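(* The following decision problem (the decision version of bilevel linear optimization in the pessimistic scenario) belongs to the complexity class NP. Input: rational data $c\in\mathbb{Q}^n$, $d,q\in\mathbb{Q}^m$, $A\in\mathbb{Q}^{k\times n}$, $B\in\mathbb{Q}^{k\times m}$, $a\in\mathbb{Q}^k$, $T\in\mathbb{Q}^{r\times n}$, $W\in\mathbb{Q}^{r\times m}$, $h\in\mathbb{Q}^r$, and a number $\alpha\in\mathbb{Q}$. Question: does there exist $\bar x\in\mathbb{R}^n$ with $\bar x\ge 0$ such that the lower level linear program $$\min\{\, q^\top y \mid T\bar x+Wy=h,\ y\ge 0\,\}$$ has an optimal solution, and such that every optimal solution $\bar y$ of this lower level program satisfies $A\bar x+B\bar y=a$ and $c^\top\bar x+d^\top\bar y\le\alpha$?
   Context: The input size is the binary encoding length of all the rational input data. *)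

theory Defs
  imports Complex_Main
begin

text \<open>Tape symbols are natural numbers: 0 is the blank, 1 encodes the bit False,
  2 encodes the bit True, 3 is a separator between input and certificate.\<close>

datatype move = MLeft | MRight | MStay

record tm =
  tm_states  :: nat
  tm_symbols :: nat
  tm_delta   :: "nat \<Rightarrow> nat \<Rightarrow> nat \<times> nat \<times> move"
  tm_start   :: nat
  tm_accept  :: nat

definition tm_wf :: "tm \<Rightarrow> bool" where
  "tm_wf M \<longleftrightarrow> 4 \<le> tm_symbols M \<and> tm_start M < tm_states M \<and> tm_accept M < tm_states M \<and>
     (\<forall>q < tm_states M. \<forall>s < tm_symbols M.
        (case tm_delta M q s of (q', s', _) \<Rightarrow> q' < tm_states M \<and> s' < tm_symbols M))"

type_synonym config = "nat \<times> int \<times> (int \<Rightarrow> nat)"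

definition move_shift :: "move \<Rightarrow> int" where
  "move_shift mv = (case mv of MLeft \<Rightarrow> -1 | MRight \<Rightarrow> 1 | MStay \<Rightarrow> 0)"

definition tm_step :: "tm \<Rightarrow> config \<Rightarrow> config" where
  "tm_step M cfg = (case cfg of (q, pos, tape) \<Rightarrow>
     (case tm_delta M q (tape pos) of (q', s', mv) \<Rightarrow> (q', pos + move_shift mv, tape(pos := s'))))"

definition tm_init :: "tm \<Rightarrow> nat list \<Rightarrow> config" where
  "tm_init M w = (tm_start M, 0, (\<lambda>i. if 0 \<le> i \<and> i < int (length w) then w ! nat i else 0))"

definition tm_accepts_within :: "tm \<Rightarrow> nat \<Rightarrow> nat list \<Rightarrow> bool" where
  "tm_accepts_within M t w \<longleftrightarrow> (\<exists>i \<le> t. fst ((tm_step M ^^ i) (tm_init M w)) = tm_accept M)"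

definition bit_sym :: "bool \<Rightarrow> nat" where
  "bit_sym b = (if b then 2 else 1)"

definition in_NP :: "bool list set \<Rightarrow> bool" where
  "in_NP L \<longleftrightarrow> (\<exists>M c k. tm_wf M \<and>
     (\<forall>w. w \<in> L \<longleftrightarrow> (\<exists>u. length u \<le> c * (length w + 1) ^ k \<and>
         tm_accepts_within M (c * (length w + length u + 1) ^ k)
            (map bit_sym w @ [3] @ map bit_sym u))))"

fun nat_bits :: "nat \<Rightarrow> bool list" where
  "nat_bits n = (if n = 0 then [] else odd n # nat_bits (n div 2))"

text \<open>Self-delimiting: each bit b becomes [False, b]; terminated by [True, True].\<close>
definition enc_nat :: "nat \<Rightarrow> bool list" where
  "enc_nat n = concat (map (\<lambda>b. [False, b]) (nat_bits n)) @ [True, True]"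

definition enc_int :: "int \<Rightarrow> bool list" where
  "enc_int i = (i < 0) # enc_nat (nat \<bar>i\<bar>)"

definition enc_rat :: "rat \<Rightarrow> bool list" where
  "enc_rat x = (case quotient_of x of (p, q) \<Rightarrow> enc_int p @ enc_nat (nat q))"

definition enc_vec :: "rat list \<Rightarrow> bool list" where
  "enc_vec v = concat (map enc_rat v)"

definition enc_mat :: "rat list list \<Rightarrow> bool list" where
  "enc_mat A = concat (map enc_vec A)"

record blp_inst =
  dim_n :: nat
  dim_m :: nat
  dim_k :: nat
  dim_r :: nat
  vec_c :: "rat list"
  vec_d :: "rat list"
  vec_q :: "rat list"
  mat_A :: "rat list list"
  mat_B :: "rat list list"
  vec_a :: "rat list"
  mat_T :: "rat list list"
  mat_W :: "rat list list"
  vec_h :: "rat list"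
  val_alpha :: rat

definition blp_wf :: "blp_inst \<Rightarrow> bool" where
  "blp_wf I \<longleftrightarrow>
     length (vec_c I) = dim_n I \<and> length (vec_d I) = dim_m I \<and> length (vec_q I) = dim_m I \<and>
     length (mat_A I) = dim_k I \<and> (\<forall>row \<in> set (mat_A I). length row = dim_n I) \<and>
     length (mat_B I) = dim_k I \<and> (\<forall>row \<in> set (mat_B I). length row = dim_m I) \<and>
     length (vec_a I) = dim_k I \<and>
     length (mat_T I) = dim_r I \<and> (\<forall>row \<in> set (mat_T I). length row = dim_n I) \<and>
     length (mat_W I) = dim_r I \<and> (\<forall>row \<in> set (mat_W I). length row = dim_m I) \<and>
     length (vec_h I) = dim_r I"

definition enc_blp :: "blp_inst \<Rightarrow> bool list" where
  "enc_blp I = enc_nat (dim_n I) @ enc_nat (dim_m I) @ enc_nat (dim_k I) @ enc_nat (dim_r I) @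
     enc_vec (vec_c I) @ enc_vec (vec_d I) @ enc_vec (vec_q I) @
     enc_mat (mat_A I) @ enc_mat (mat_B I) @ enc_vec (vec_a I) @
     enc_mat (mat_T I) @ enc_mat (mat_W I) @ enc_vec (vec_h I) @ enc_rat (val_alpha I)"

text \<open>Real vectors are functions nat \<Rightarrow> real; only indices below the dimension matter.\<close>

definition rdot :: "rat list \<Rightarrow> (nat \<Rightarrow> real) \<Rightarrow> real" where
  "rdot v x = (\<Sum>j < length v. real_of_rat (v ! j) * x j)"

definition ll_feasible :: "blp_inst \<Rightarrow> (nat \<Rightarrow> real) \<Rightarrow> (nat \<Rightarrow> real) \<Rightarrow> bool" where
  "ll_feasible I x y \<longleftrightarrow> (\<forall>j < dim_m I. y j \<ge> 0) \<and>
     (\<forall>i < dim_r I. rdot (mat_T I ! i) x + rdot (mat_W I ! i) y = real_of_rat (vec_h I ! i))"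

definition ll_optimal :: "blp_inst \<Rightarrow> (nat \<Rightarrow> real) \<Rightarrow> (nat \<Rightarrow> real) \<Rightarrow> bool" where
  "ll_optimal I x y \<longleftrightarrow> ll_feasible I x y \<and>
     (\<forall>y'. ll_feasible I x y' \<longrightarrow> rdot (vec_q I) y \<le> rdot (vec_q I) y')"

definition blp_yes :: "blp_inst \<Rightarrow> bool" where
  "blp_yes I \<longleftrightarrow> (\<exists>x :: nat \<Rightarrow> real. (\<forall>j < dim_n I. x j \<ge> 0) \<and>
     (\<exists>y. ll_optimal I x y) \<and>
     (\<forall>y. ll_optimal I x y \<longrightarrow>
        (\<forall>i < dim_k I. rdot (mat_A I ! i) x + rdot (mat_B I ! i) y = real_of_rat (vec_a I ! i)) \<and>
        rdot (vec_c I) x + rdot (vec_d I) y \<le> real_of_rat (val_alpha I)))"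

definition BLP_pess :: "bool list set" where
  "BLP_pess = {enc_blp I | I. blp_wf I \<and> blp_yes I}"

end

theory Submission
  imports Defs "HOL-Library.FuncSet" "HOL-Library.Countable"
begin

text \<open>Take a strictly complementary optimal dual solution u of the lower level program. The optimal lower
  level points are then the feasible points supported in the tight set of u, so by linear programming
  duality the pessimistic condition at x holds iff some optimal y satisfies the upper level constraints,
  some combination of the rows of W dominates d on the tight set with equality on the support of y, and
  every row of B agrees on the tight set with a combination of the rows of W. For a fixed tight set and
  support these conditions are linear; a solution of minimal support is the kernel of an integral matrix up to
  scaling, and the pigeonhole principle gives an integral kernel vector with polynomially many digits.

  Checking such a certificate is expressed by a fixed finite set of Horn rules on bit strings. A derivation of
  polynomial length with words of polynomial length is guessed and checked by a multi-stack machine: the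
  certificate lists the rules and the values of their variables.\<close>

section \<open>Multi-stack machines on a one-tape Turing machine\<close>

text \<open>The obstacle is the universal quantifier over the optimal points of the lower level,
  which even for fixed x suggests no short witness. Duality removes it. A bound on the upper
  objective over the optimal face has a dual witness. An upper level equation that holds on the
  whole face gives at first only a one-sided dual inequality; an optimal point that is positive on
  the whole tight set turns it into an equality, and this is what strict complementarity, rather
  than mere optimality of u, is used for.

  Since x and y range over the reals, short rational points have to be produced. The pigeonhole
  estimate replaces Cramer's rule and determinant bounds and still yields polynomially many digits.

  Membership in NP refers to a concrete one-tape machine and to exact encodings, so malformed words
  must be rejected too. Horn rules keep this manageable: quotients, Bezout coefficients and all
  intermediate values are guessed, each rule only has to be sound, and efficiency reduces to the
  existence of one short derivation.\<close>

definition run :: "('q \<times> 's \<Rightarrow> 'q \<times> 's) \<Rightarrow> 'q \<Rightarrow> nat \<Rightarrow> 'q \<times> 's \<Rightarrow> 'q \<times> 's \<Rightarrow> bool" where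
  "run f A n c c' \<longleftrightarrow> (f ^^ n) c = c' \<and> (\<forall>i<n. fst ((f ^^ i) c) \<noteq> A)"

definition hits :: "('q \<times> 's \<Rightarrow> 'q \<times> 's) \<Rightarrow> 'q \<Rightarrow> nat \<Rightarrow> 'q \<times> 's \<Rightarrow> bool" where
  "hits f A t c \<longleftrightarrow> (\<exists>i\<le>t. fst ((f ^^ i) c) = A)"

lemma run_0 [simp]: "run f A 0 c c' \<longleftrightarrow> c' = c"
  by (auto simp: run_def)

lemma run_Suc: "run f A (Suc n) c c' \<longleftrightarrow> fst c \<noteq> A \<and> run f A n (f c) c'"
proof -
  have "(\<forall>i<Suc n. fst ((f ^^ i) c) \<noteq> A) \<longleftrightarrow> fst c \<noteq> A \<and> (\<forall>i<n. fst ((f ^^ i) (f c)) \<noteq> A)"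
    unfolding All_less_Suc2 by (simp add: funpow_swap1)
  then show ?thesis
    by (auto simp: run_def funpow_swap1)
qed

lemma run_trans: "run f A m c c' \<Longrightarrow> run f A n c' c'' \<Longrightarrow> run f A (m + n) c c''"
  by (induction m arbitrary: c) (auto simp: run_Suc)

lemma hits_0: "hits f A 0 c \<longleftrightarrow> fst c = A"
  by (simp add: hits_def)

lemma hits_Suc: "hits f A (Suc t) c \<longleftrightarrow> fst c = A \<or> hits f A t (f c)"
proof -
  have "hits f A (Suc t) c \<longleftrightarrow> (\<exists>i<Suc (Suc t). fst ((f ^^ i) c) = A)"
    by (auto simp: hits_def less_Suc_eq_le)
  also have "\<dots> \<longleftrightarrow> fst c = A \<or> (\<exists>i<Suc t. fst ((f ^^ i) (f c)) = A)"
    unfolding Ex_less_Suc2 by (simp add: funpow_swap1)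
  finally show ?thesis
    by (auto simp: hits_def less_Suc_eq_le)
qed

lemma hits_mono: "hits f A t c \<Longrightarrow> t \<le> t' \<Longrightarrow> hits f A t' c"
  by (auto simp: hits_def intro: le_trans)

lemma run_hits: "run f A n c c' \<Longrightarrow> hits f A t c' \<Longrightarrow> hits f A (n + t) c"
  by (induction n arbitrary: c) (auto simp: run_Suc hits_Suc)

text \<open>The accepting state is forbidden during a \<open>run\<close> for the sake of this
  converse of \<open>run_hits\<close>: as acceptance has not happened before step n, it can only
  happen from there on.\<close>

lemma run_hitsD: "run f A n c c' \<Longrightarrow> hits f A t c \<Longrightarrow> n \<le> t \<and> hits f A (t - n) c'"
proof (induction n arbitrary: c t)
  case (Suc n)
  then obtain t' where "t = Suc t'" "hits f A t' (f c)"
    by (cases t) (auto simp: run_Suc hits_Suc hits_0)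
  then show ?case
    using Suc.IH[of "f c" t'] Suc.prems(1) by (simp add: run_Suc)
qed auto

section \<open>Stack machines and their packing onto one tape\<close>

datatype 'q instr = Pop nat "nat \<Rightarrow> 'q" | Push nat nat 'q

type_synonym 'q sconf = "'q \<times> (nat \<Rightarrow> nat list)"

text \<open>An empty stack answers a pop with 0. The machines considered below push only the symbols
  1 to 3, so the continuation can tell an empty stack from a symbol.\<close>

definition sstep :: "('q \<Rightarrow> 'q instr) \<Rightarrow> 'q sconf \<Rightarrow> 'q sconf" where
  "sstep ins c = (case ins (fst c) of
     Pop j f \<Rightarrow> (case snd c j of [] \<Rightarrow> (f 0, snd c) | x # xs \<Rightarrow> (f x, (snd c)(j := xs)))
   | Push j v q \<Rightarrow> (q, (snd c)(j := v # snd c j)))"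

text \<open>A tape symbol packs the symbols that the K stacks hold at one position as base 4 digits; the symbol
  4 ^ K marks the bottom of the stacks.\<close>
definition digit :: "nat \<Rightarrow> nat \<Rightarrow> nat" where
  "digit j s = s div 4 ^ j mod 4"

definition upd :: "nat \<Rightarrow> nat \<Rightarrow> nat \<Rightarrow> nat" where
  "upd j v s = (s div 4 ^ Suc j * 4 + v) * 4 ^ j + s mod 4 ^ j"

lemma digit_less [simp]: "digit j s < 4"
  by (simp add: digit_def)

lemma digit_mod: "i < j \<Longrightarrow> digit i (s mod 4 ^ j) = digit i s"
proof -
  assume "i < j"
  then obtain k where j: "j = i + Suc k" using less_natE by auto
  have "s mod (4 ^ i * 4 ^ Suc k) = 4 ^ i * (s div 4 ^ i mod 4 ^ Suc k) + s mod 4 ^ i"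
    by (rule mod_mult2_eq)
  then have "s mod 4 ^ j = 4 ^ i * (s div 4 ^ i mod 4 ^ Suc k) + s mod 4 ^ i"
    by (simp only: j power_add)
  then have "s mod 4 ^ j div 4 ^ i = s div 4 ^ i mod 4 ^ Suc k"
    by simp
  then show ?thesis
    unfolding digit_def by (simp add: mod_mod_cancel)
qed

lemma digit_div: "j < i \<Longrightarrow> digit (i - Suc j) (s div 4 ^ Suc j) = digit i s"
proof -
  assume "j < i"
  then have "(4::nat) ^ i = 4 ^ Suc j * 4 ^ (i - Suc j)" by (simp flip: power_add power_Suc)
  then show ?thesis
    by (simp add: digit_def div_mult2_eq)
qed

lemma digit_upd [simp]:
  assumes "v < 4"
  shows "digit i (upd j v s) = (if i = j then v else digit i s)"
proof -
  have lo: "upd j v s mod 4 ^ j = s mod 4 ^ j"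
    by (simp add: upd_def)
  have mid: "upd j v s div 4 ^ j = s div 4 ^ Suc j * 4 + v"
    by (simp add: upd_def)
  have hi: "upd j v s div 4 ^ Suc j = s div 4 ^ Suc j"
    using mid assms by (simp add: div_mult2_eq mult.commute[of 4])
  consider "i < j" | "i = j" | "i > j" by linarith
  then show ?thesis
  proof cases
    case 1 then show ?thesis using digit_mod[of i j "upd j v s"] digit_mod[of i j s] lo by simp
  next
    case 2 then show ?thesis using assms by (simp add: digit_def mid)
  next
    case 3 then show ?thesis using digit_div[of j i "upd j v s"] digit_div[of j i s] hi by simp
  qed
qed

lemma upd_less:
  assumes "s < 4 ^ K" "j < K" "v < 4"
  shows "upd j v s < 4 ^ K"
proof -
  have K: "(4::nat) ^ K = 4 ^ (K - Suc j) * 4 ^ Suc j" using assms(2) by (simp flip: power_add power_Suc)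
  have "s div 4 ^ Suc j < 4 ^ (K - Suc j)"
    using assms(1) K by (simp add: less_mult_imp_div_less)
  then have h: "s div 4 ^ Suc j + 1 \<le> 4 ^ (K - Suc j)" by linarith
  have "upd j v s < (s div 4 ^ Suc j * 4 + v + 1) * 4 ^ j"
    by (simp add: upd_def)
  also have "\<dots> \<le> (s div 4 ^ Suc j * 4 + 4) * 4 ^ j"
    using assms(3) by (intro mult_le_mono) auto
  also have "\<dots> = (s div 4 ^ Suc j + 1) * 4 ^ Suc j" by (simp add: algebra_simps)
  also have "\<dots> \<le> 4 ^ K" unfolding K using h by (intro mult_le_mono) auto
  finally show ?thesis .
qed

locale stack_machine =
  fixes K :: nat and Q :: "'q set" and ins :: "'q \<Rightarrow> 'q instr" and q0 qa :: 'q
    and h :: "'q \<Rightarrow> nat"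
  assumes K_pos: "0 < K"
    and finite_Q: "finite Q"
    and q0: "q0 \<in> Q"
    and qa: "qa \<in> Q"
    and Pop_ok: "\<And>q j f. q \<in> Q \<Longrightarrow> ins q = Pop j f \<Longrightarrow> j < K \<and> (\<forall>v<4. f v \<in> Q)"
    and Push_ok: "\<And>q j v q'. q \<in> Q \<Longrightarrow> ins q = Push j v q' \<Longrightarrow> j < K \<and> 0 < v \<and> v < 4 \<and> q' \<in> Q"
    and h_bij: "bij_betw h Q {..<card Q}"
begin

abbreviation N where "N \<equiv> card Q"
definition g :: "nat \<Rightarrow> 'q" where "g = inv_into Q h"

lemma g_h [simp]: "q \<in> Q \<Longrightarrow> g (h q) = q"
  using h_bij by (simp add: g_def bij_betw_def)

lemma h_less: "q \<in> Q \<Longrightarrow> h q < N"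
  using h_bij by (auto simp: bij_betw_def)

lemma g_in: "n < N \<Longrightarrow> g n \<in> Q"
  using h_bij by (metis bij_betw_def g_def inv_into_into lessThan_iff)

lemma h_eq: "q \<in> Q \<Longrightarrow> q' \<in> Q \<Longrightarrow> h q = h q' \<longleftrightarrow> q = q'"
  by (metis g_h)

definition mark :: nat where "mark = 4 ^ K"

text \<open>For a control state with number n, the machine state 3n seeks the top of the stack to the
  right, 3n+1 pops the symbol it stands on, and 3n+2 returns to the cell right of the mark.\<close>
definition delta :: "nat \<Rightarrow> nat \<Rightarrow> nat \<times> nat \<times> move" where
  "delta s a =
     (if s = 3 * N then (3 * N + 1, a, MLeft)
      else if s = 3 * N + 1 then (3 * h q0, mark, MRight)
      else if s mod 3 = 2 then (if a = mark then (s - 2, a, MRight) else (s, a, MLeft))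
      else case ins (g (s div 3)) of
        Push j v q \<Rightarrow>
          if s mod 3 = 0 then
            if a < mark \<and> digit j a = 0 then (3 * h q + 2, upd j v a, MLeft) else (s, a, MRight)
          else (s, a, MStay)
      | Pop j f \<Rightarrow>
          if s mod 3 = 0 then
            if digit j a = 0 then (s + 1, a, MLeft) else (s, a, MRight)
          else if a < mark then (3 * h (f (digit j a)) + 2, upd j 0 a, MLeft)
          else (3 * h (f 0), a, MRight))"

definition mach :: tm where
  "mach = \<lparr>tm_states = 3 * N + 2, tm_symbols = mark + 1, tm_delta = delta,
           tm_start = 3 * N, tm_accept = 3 * h qa\<rparr>"

lemma mach_simps [simp]:
  "tm_states mach = 3 * N + 2" "tm_symbols mach = mark + 1" "tm_delta mach = delta"
  "tm_start mach = 3 * N" "tm_accept mach = 3 * h qa"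
  by (simp_all add: mach_def)

lemma mark_ge: "4 \<le> mark"
  using K_pos power_increasing[of 1 K "4::nat"] by (simp add: mark_def)

lemma delta_wf:
  assumes "s < 3 * N + 2" "a < mark + 1"
  shows "case delta s a of (s', a', _) \<Rightarrow> s' < 3 * N + 2 \<and> a' < mark + 1"
proof -
  have up: "upd j v a < mark" if "a < mark" "j < K" "v < 4" for j v
    using upd_less that by (simp add: mark_def)
  have hq: "3 * h q + 2 < 3 * N + 2" if "q \<in> Q" for q using h_less[OF that] by simp
  show ?thesis
  proof (cases "s = 3 * N \<or> s = 3 * N + 1 \<or> s mod 3 = 2")
    case True
    then show ?thesis using assms hq[OF q0] by (auto simp: delta_def)
  next
    case False
    then have "s div 3 < N" using assms by auto
    then have gs: "g (s div 3) \<in> Q" by (rule g_in)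
    show ?thesis
    proof (cases "ins (g (s div 3))")
      case (Pop j f)
      note p = Pop_ok[OF gs Pop]
      have fQ: "f 0 \<in> Q" "f (digit j a) \<in> Q" using p by auto
      have s1: "s + 1 < 3 * N + 2" using False assms by presburger
      show ?thesis using False assms p hq[OF fQ(1)] hq[OF fQ(2)] up[of j 0] s1
        by (auto simp: delta_def Pop less_Suc_eq)
    next
      case (Push j v q)
      note p = Push_ok[OF gs Push]
      then have "q \<in> Q" by simp
      then show ?thesis using False assms p hq[of q] up[of j v]
        by (auto simp: delta_def Push less_Suc_eq)
    qed
  qed
qed

lemma mach_wf: "tm_wf mach"
  using mark_ge h_less[OF qa] delta_wf by (auto simp: tm_wf_def)

section \<open>Simulation of a stack instruction by the tape machine\<close>

abbreviation tstep where "tstep \<equiv> tm_step mach"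
abbreviation "accst \<equiv> 3 * h qa"

text \<open>The head of a list is the top of its stack, while position 0 of the tape holds the
  bottom; hence the reversal. The digit 0 above the top is what a seeking head looks for.\<close>

definition cell :: "nat list \<Rightarrow> nat \<Rightarrow> nat" where
  "cell xs i = (if i < length xs then rev xs ! i else 0)"

lemma cell_Nil [simp]: "cell [] i = 0"
  by (simp add: cell_def)

lemma cell_Cons: "cell (x # xs) i = (if i = length xs then x else cell xs i)"
  by (auto simp: cell_def nth_append)

definition tape_ok :: "(nat \<Rightarrow> nat list) \<Rightarrow> (int \<Rightarrow> nat) \<Rightarrow> bool" where
  "tape_ok st tp \<longleftrightarrow> tp (-1) = mark \<and>
     (\<forall>i. tp (int i) < mark \<and> (\<forall>j<K. digit j (tp (int i)) = cell (st j) i)) \<and>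
     (\<forall>j<K. set (st j) \<subseteq> {1,2,3})"

lemma cell_pos: "tape_ok st tp \<Longrightarrow> j < K \<Longrightarrow> cell (st j) i = 0 \<longleftrightarrow> length (st j) \<le> i"
proof -
  assume a: "tape_ok st tp" "j < K"
  have "rev (st j) ! i \<in> set (st j)" if "i < length (st j)" using that by (metis length_rev nth_mem set_rev)
  moreover have "0 \<notin> set (st j)" using a by (force simp: tape_ok_def)
  ultimately show ?thesis by (auto simp: cell_def not_less intro!: gr0I)
qed

lemma hmod [simp]: "3 * h q \<noteq> 3 * h q' + 2" "3 * h q + 2 \<noteq> 3 * h q'" "3 * h q + 1 \<noteq> 3 * h q'"
  "Suc (3 * h q) \<noteq> 3 * h q'"
  by presburger+

lemma hN: "q \<in> Q \<Longrightarrow> h q \<noteq> N" using h_less[of q] by auto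

lemma delta_seek:
  assumes "q \<in> Q"
  shows "delta (3 * h q) a = (case ins q of
        Push j v q' \<Rightarrow>
            if a < mark \<and> digit j a = 0 then (3 * h q' + 2, upd j v a, MLeft) else (3 * h q, a, MRight)
      | Pop j f \<Rightarrow>
            if digit j a = 0 then (3 * h q + 1, a, MLeft) else (3 * h q, a, MRight))"
proof -
  have "3 * h q \<noteq> 3 * N + 1" by presburger
  moreover have "3 * h q \<noteq> 3 * N" using hN[OF assms] by simp
  ultimately show ?thesis
    using assms unfolding delta_def by (simp split: instr.split)
qed

lemma delta_pop:
  assumes "q \<in> Q" "ins q = Pop j f"
  shows "delta (3 * h q + 1) a =
    (if a < mark then (3 * h (f (digit j a)) + 2, upd j 0 a, MLeft) else (3 * h (f 0), a, MRight))"
proof -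
  have "3 * h q + 1 \<noteq> 3 * N" by presburger
  moreover have "3 * h q + 1 \<noteq> 3 * N + 1" using hN[OF assms(1)] by simp
  moreover have "(3 * h q + 1) mod 3 = 1" "(3 * h q + 1) div 3 = h q" by presburger+
  ultimately show ?thesis
    using assms unfolding delta_def by simp
qed

lemma delta_return: "delta (3 * n + 2) a = (if a = mark then (3 * n, a, MRight) else (3 * n + 2, a, MLeft))"
proof -
  have "3 * n + 2 \<noteq> 3 * N" "3 * n + 2 \<noteq> 3 * N + 1" "(3 * n + 2) mod 3 = 2" by presburger+
  then show ?thesis
    unfolding delta_def by simp
qed

lemma run_return:
  assumes "tape_ok st tp"
  shows "run tstep accst (Suc i) (3 * n + 2, int i - 1, tp) (3 * n, 0, tp)"
proof (induction i)
  case 0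
  have "(3::nat) * n + 2 \<noteq> accst" by presburger
  then show ?case
    using assms by (simp add: run_Suc tm_step_def delta_return move_shift_def tape_ok_def fun_upd_idem del: One_nat_def add_2_eq_Suc')
next
  case (Suc i)
  have "tp (int i) < mark" using assms by (simp add: tape_ok_def)
  then have "tstep (3 * n + 2, int (Suc i) - 1, tp) = (3 * n + 2, int i - 1, tp)"
    by (simp add: tm_step_def delta_return move_shift_def del: add_2_eq_Suc')
  moreover have "(3::nat) * n + 2 \<noteq> accst" by presburger
  ultimately show ?case
    using Suc by (subst run_Suc) simp
qed

definition acts :: "'q \<Rightarrow> nat" where
  "acts q = (case ins q of Pop j f \<Rightarrow> j | Push j v q' \<Rightarrow> j)"

lemma acts_less: "q \<in> Q \<Longrightarrow> acts q < K"
  using Pop_ok Push_ok by (cases "ins q") (force simp: acts_def)+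

text \<open>Induction on the distance n to the first free cell of the stack. Taking n to be the
  height gives the walk that starts at position 0.\<close>

lemma run_seek:
  assumes "tape_ok st tp" "q \<in> Q" "q \<noteq> qa"
  shows "n \<le> length (st (acts q)) \<Longrightarrow>
    run tstep accst n (3 * h q, int (length (st (acts q)) - n), tp) (3 * h q, int (length (st (acts q))), tp)"
proof (induction n)
  case (Suc n)
  let ?j = "acts q" and ?i = "length (st (acts q)) - Suc n"
  have "cell (st ?j) ?i \<noteq> 0"
    using cell_pos[OF assms(1) acts_less[OF assms(2)]] Suc.prems by simp
  moreover have "digit ?j (tp (int ?i)) = cell (st ?j) ?i"
    using assms(1) acts_less[OF assms(2)] by (simp add: tape_ok_def)
  ultimately have "tstep (3 * h q, int ?i, tp) = (3 * h q, int ?i + 1, tp)"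
    by (cases "ins q") (simp_all add: tm_step_def delta_seek[OF assms(2)] move_shift_def acts_def)
  moreover have "int ?i + 1 = int (length (st ?j) - n)" using Suc.prems by simp
  moreover have "3 * h q \<noteq> accst" using h_eq[OF assms(2) qa] assms(3) by simp
  ultimately show ?case
    using Suc by (subst run_Suc) simp
qed simp

lemma tape_ok_push:
  assumes "tape_ok st tp" "0 < v" "v < 4" "j < K"
  shows "tape_ok (st(j := v # st j)) (tp(int (length (st j)) := upd j v (tp (int (length (st j))))))"
proof -
  have "upd j v (tp (int i)) < mark" for i
    using assms upd_less by (simp add: tape_ok_def mark_def)
  moreover have "v = 1 \<or> v = 2 \<or> v = 3" using assms by linarith
  ultimately show ?thesis
    using assms by (auto simp: tape_ok_def cell_Cons)
qed

lemma tape_ok_pop: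
  assumes "tape_ok st tp" "j < K" "st j = x # xs"
  shows "tape_ok (st(j := xs)) (tp(int (length xs) := upd j 0 (tp (int (length xs)))))"
proof -
  have "upd j 0 (tp (int i)) < mark" for i
    using assms upd_less by (simp add: tape_ok_def mark_def)
  moreover have "cell (st j) i = (if i = length xs then x else cell xs i)" for i
    by (simp add: assms(3) cell_Cons)
  moreover have "cell xs (length xs) = 0" by (simp add: cell_def)
  moreover have "set (st j) \<subseteq> {1,2,3}" using assms(1,2) by (simp add: tape_ok_def)
  then have "set xs \<subseteq> {1,2,3}" by (simp add: assms(3))
  ultimately show ?thesis
    using assms(1,2) by (auto simp: tape_ok_def) 
qed

definition rel :: "'q sconf \<Rightarrow> config \<Rightarrow> bool" where
  "rel c d \<longleftrightarrow> fst c \<in> Q \<and> (\<exists>tp. d = (3 * h (fst c), 0, tp) \<and> tape_ok (snd c) tp)"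

text \<open>The head walks up to the first free cell, acts, and walks back to the mark, which costs
  at most twice the height plus two. The lower bound 1 on the number of steps is what makes the
  induction on time in \<open>sound\<close> terminate.\<close>

lemma simulate:
  assumes "rel (q, st) d" "q \<noteq> qa"
  shows "\<exists>n d'. 1 \<le> n \<and> n \<le> 2 * length (st (acts q)) + 2 \<and> run tstep accst n d d' \<and> rel (sstep ins (q, st)) d'"
proof -
  obtain tp where d: "d = (3 * h q, 0, tp)" and ok: "tape_ok st tp" and q: "q \<in> Q"
    using assms(1) by (auto simp: rel_def)
  have nacc: "3 * h q \<noteq> accst" using h_eq[OF q qa] assms(2) by simp
  have nacc1: "3 * h q + 1 \<noteq> accst" by presburger
  define l where "l = length (st (acts q))"
  have seek: "run tstep accst l d (3 * h q, int l, tp)"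
    using run_seek[OF ok q assms(2), of l] by (simp add: d l_def)
  have dig: "digit (acts q) (tp (int i)) = cell (st (acts q)) i" "tp (int i) < mark" for i
    using ok acts_less[OF q] by (auto simp: tape_ok_def)
  show ?thesis
  proof (cases "ins q")
    case (Push j v q')
    note p = Push_ok[OF q Push]
    have j: "acts q = j" by (simp add: acts_def Push)
    let ?tp = "tp(int l := upd j v (tp (int l)))"
    have "tstep (3 * h q, int l, tp) = (3 * h q' + 2, int l - 1, ?tp)"
      using dig[of l] by (simp add: tm_step_def delta_seek[OF q] Push move_shift_def j cell_def l_def)
    then have s1: "run tstep accst (Suc 0) (3 * h q, int l, tp) (3 * h q' + 2, int l - 1, ?tp)"
      using nacc by (simp add: run_Suc)
    have ok': "tape_ok (st(j := v # st j)) ?tp"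
      using tape_ok_push[OF ok] p by (simp add: l_def j)
    have "run tstep accst (l + (Suc 0 + Suc l)) d (3 * h q', 0, ?tp)"
      by (rule run_trans[OF seek run_trans[OF s1 run_return[OF ok']]])
    moreover have "rel (sstep ins (q, st)) (3 * h q', 0, ?tp)"
      using ok' p by (simp add: rel_def sstep_def Push)
    ultimately show ?thesis
      by (intro exI[of _ "l + (Suc 0 + Suc l)"] exI) (auto simp: l_def)
  next
    case (Pop j f)
    note p = Pop_ok[OF q Pop]
    have j: "acts q = j" by (simp add: acts_def Pop)
    have "tstep (3 * h q, int l, tp) = (3 * h q + 1, int l - 1, tp)"
      using dig[of l] by (simp add: tm_step_def delta_seek[OF q] Pop move_shift_def j cell_def l_def)
    then have "run tstep accst (Suc 0) (3 * h q, int l, tp) (3 * h q + 1, int l - 1, tp)"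
      using nacc by (simp add: run_Suc)
    then have s1: "run tstep accst (l + Suc 0) d (3 * h q + 1, int l - 1, tp)"
      by (rule run_trans[OF seek])
    show ?thesis
    proof (cases "st j")
      case Nil
      then have "l = 0" by (simp add: l_def j)
      moreover have "tp (-1) = mark" using ok by (simp add: tape_ok_def)
      ultimately have "tstep (3 * h q + 1, int l - 1, tp) = (3 * h (f 0), 0, tp)"
        by (simp add: tm_step_def delta_pop[OF q Pop] move_shift_def fun_upd_idem del: One_nat_def)
      then have "run tstep accst (l + Suc 0 + Suc 0) d (3 * h (f 0), 0, tp)"
        using nacc1 by (intro run_trans[OF s1]) (simp add: run_Suc)
      moreover have "rel (sstep ins (q, st)) (3 * h (f 0), 0, tp)"
        using ok p by (simp add: rel_def sstep_def Pop Nil)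
      ultimately show ?thesis
        by (intro exI[of _ "l + Suc 0 + Suc 0"] exI) (auto simp: l_def)
    next
      case (Cons x xs)
      then have l: "l = Suc (length xs)" by (simp add: l_def j)
      let ?tp = "tp(int (length xs) := upd j 0 (tp (int (length xs))))"
      have "set (st j) \<subseteq> {1,2,3}" using ok p by (simp add: tape_ok_def)
      then have x: "x < 4" by (auto simp: Cons)
      have "digit j (tp (int (length xs))) = x"
        using dig[of "length xs"] by (simp add: j Cons cell_Cons)
      then have "tstep (3 * h q + 1, int l - 1, tp) = (3 * h (f x) + 2, int (length xs) - 1, ?tp)"
        using dig(2)[of "length xs"]
        by (simp add: tm_step_def delta_pop[OF q Pop] move_shift_def l del: One_nat_def)
      then have s2: "run tstep accst (Suc 0) (3 * h q + 1, int l - 1, tp) (3 * h (f x) + 2, int (length xs) - 1, ?tp)"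
        using nacc1 by (simp add: run_Suc)
      have ok': "tape_ok (st(j := xs)) ?tp"
        using tape_ok_pop[OF ok _ Cons] p by simp
      have "run tstep accst (l + Suc 0 + (Suc 0 + Suc (length xs))) d (3 * h (f x), 0, ?tp)"
        by (rule run_trans[OF s1 run_trans[OF s2 run_return[OF ok']]])
      moreover have "rel (sstep ins (q, st)) (3 * h (f x), 0, ?tp)"
        using ok' p x by (simp add: rel_def sstep_def Pop Cons)
      ultimately show ?thesis
        by (intro exI[of _ "l + Suc 0 + (Suc 0 + Suc (length xs))"] exI) (auto simp: l_def[symmetric] l)
    qed
  qed
qed

lemma rel_accept: "rel c d \<Longrightarrow> fst d = accst \<longleftrightarrow> fst c = qa"
  using h_eq qa by (auto simp: rel_def)

lemma sstep_length: "length (snd (sstep ins c) j) \<le> Suc (length (snd c j))"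
  by (auto simp: sstep_def split: instr.split list.split)

text \<open>The heights grow by at most one per instruction, so they stay below H + t throughout,
  and each of the t instructions costs at most twice that plus two.\<close>

lemma complete:
  "rel c d \<Longrightarrow> hits (sstep ins) qa t c \<Longrightarrow> (\<And>j. length (snd c j) \<le> H) \<Longrightarrow>
   hits tstep accst (t * (2 * (H + t) + 2)) d"
proof (induction t arbitrary: c d H)
  case 0
  then show ?case using rel_accept[of c d] by (simp add: hits_0)
next
  case (Suc t)
  show ?case
  proof (cases "fst c = qa")
    case True
    then have "fst d = accst" using rel_accept[OF Suc.prems(1)] by simp
    then show ?thesis by (auto simp: hits_def)
  next
    case False
    obtain n d' where n: "n \<le> 2 * length (snd c (acts (fst c))) + 2" "run tstep accst n d d'"
      "rel (sstep ins c) d'"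
      using simulate[of "fst c" "snd c" d] False Suc.prems(1) by auto
    have "hits (sstep ins) qa t (sstep ins c)" using Suc.prems(2) False by (simp add: hits_Suc)
    then have "hits tstep accst (t * (2 * (Suc H + t) + 2)) d'"
      using Suc.IH[OF n(3), of "Suc H"] sstep_length Suc.prems(3) le_trans by (metis Suc_le_mono)
    then have "hits tstep accst (n + t * (2 * (Suc H + t) + 2)) d"
      by (rule run_hits[OF n(2)])
    moreover have "n \<le> 2 * H + 2" using n(1) Suc.prems(3)[of "acts (fst c)"] by linarith
    then have "n + t * (2 * (Suc H + t) + 2) \<le> Suc t * (2 * (H + Suc t) + 2)" by (simp add: algebra_simps)
    ultimately show ?thesis by (rule hits_mono)
  qed
qed

lemma sound: "rel c d \<Longrightarrow> hits tstep accst t d \<Longrightarrow> \<exists>t'. hits (sstep ins) qa t' c"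
proof (induction t arbitrary: c d rule: less_induct)
  case (less t)
  show ?case
  proof (cases "fst c = qa")
    case True
    then have "hits (sstep ins) qa 0 c" by (simp add: hits_0)
    then show ?thesis by blast
  next
    case False
    obtain n d' where n: "1 \<le> n" "run tstep accst n d d'" "rel (sstep ins c) d'"
      using simulate[of "fst c" "snd c" d] False less.prems(1) by auto
    have "n \<le> t" "hits tstep accst (t - n) d'" using run_hitsD[OF n(2) less.prems(2)] by auto
    then obtain t' where "hits (sstep ins) qa t' (sstep ins c)"
      using less.IH[of "t - n" "sstep ins c" d'] n by auto
    then show ?thesis by (intro exI[of _ "Suc t'"]) (simp add: hits_Suc)
  qed
qed

text \<open>An input symbol is below 4, so as a packed symbol it has itself as digit 0 and zeros in
  the other digits: the input already is stack 0, with its last symbol on top. Only the mark at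
  position -1 has to be written, which takes two steps.\<close>

lemma run_init:
  assumes "set w \<subseteq> {1,2,3}"
  shows "\<exists>d. run tstep accst 2 (tm_init mach w) d \<and> rel (q0, (\<lambda>_. [])(0 := rev w)) d"
proof -
  define tp :: "int \<Rightarrow> nat" where "tp = (\<lambda>i. if 0 \<le> i \<and> i < int (length w) then w ! nat i else 0)"
  have ne: "3 * N \<noteq> accst" "3 * N + 1 \<noteq> accst" using hN[OF qa] by presburger+
  have "tstep (3 * N, 0, tp) = (3 * N + 1, -1, tp)"
    by (simp add: tm_step_def delta_def move_shift_def)
  moreover have "tstep (3 * N + 1, -1, tp) = (3 * h q0, 0, tp(-1 := mark))"
    by (simp add: tm_step_def delta_def move_shift_def)
  ultimately have "run tstep accst (Suc (Suc 0)) (tm_init mach w) (3 * h q0, 0, tp(-1 := mark))"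
    using ne by (simp add: run_Suc tm_init_def tp_def[symmetric])
  moreover have "tape_ok ((\<lambda>_. [])(0 := rev w)) (tp(-1 := mark))"
  proof -
    have small: "x < mark \<and> digit 0 x = x \<and> (\<forall>j>0. digit j x = 0)" if "x \<in> {0,1,2,3}" for x
    proof -
      have "x div 4 ^ j = 0" if "j > 0" for j
      proof -
        have "(4::nat) ^ 1 \<le> 4 ^ j" using that by (intro power_increasing) auto
        then show ?thesis using \<open>x \<in> _\<close> by (intro div_less) auto
      qed
      then show ?thesis using that mark_ge by (auto simp: digit_def)
    qed
    have mem: "tp (int i) \<in> {0,1,2,3}" for i
    proof (cases "i < length w")
      case True
      then have "w ! i \<in> {1,2,3}" using assms nth_mem by blast
      then show ?thesis by (auto simp: tp_def)
    qed (simp add: tp_def)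
    have "cell (rev w) i = tp (int i)" for i
      by (simp add: cell_def tp_def)
    then show ?thesis
      using small[OF mem] assms by (auto simp: tape_ok_def)
  qed
  ultimately show ?thesis using q0 by (auto simp: rel_def numeral_2_eq_2)
qed

end

text \<open>Time is controlled in one direction only. A fast stack computation must give a fast tape
  computation, whereas for soundness it is enough that an accepting tape computation comes from some
  accepting stack computation.\<close>

theorem stack_machine_to_tm:
  fixes ins :: "'q \<Rightarrow> 'q instr"
  assumes "0 < K" "finite Q" "q0 \<in> Q" "qa \<in> Q"
    and "\<And>q j f. q \<in> Q \<Longrightarrow> ins q = Pop j f \<Longrightarrow> j < K \<and> (\<forall>v<4. f v \<in> Q)"
    and "\<And>q j v q'. q \<in> Q \<Longrightarrow> ins q = Push j v q' \<Longrightarrow> j < K \<and> 0 < v \<and> v < 4 \<and> q' \<in> Q"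
  shows "\<exists>M. tm_wf M \<and> (\<forall>w. set w \<subseteq> {1,2,3} \<longrightarrow>
    (\<forall>t. hits (sstep ins) qa t (q0, (\<lambda>_. [])(0 := rev w)) \<longrightarrow>
          tm_accepts_within M (2 + t * (2 * (length w + t) + 2)) w) \<and>
    (\<forall>t. tm_accepts_within M t w \<longrightarrow>
          (\<exists>t'. hits (sstep ins) qa t' (q0, (\<lambda>_. [])(0 := rev w)))))"
proof -
  obtain h where "bij_betw h Q {..<card Q}"
    using ex_bij_betw_finite_nat[OF assms(2)] by (auto simp: atLeast0LessThan)
  then interpret stack_machine K Q ins q0 qa h
    using assms by unfold_locales
  have acc: "tm_accepts_within mach t w \<longleftrightarrow> hits tstep accst t (tm_init mach w)" for t w
    by (simp add: tm_accepts_within_def hits_def)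
  show ?thesis
  proof (intro exI[of _ mach] conjI mach_wf allI impI)
    fix w :: "nat list" and t
    assume w: "set w \<subseteq> {1,2,3}"
    obtain d where d: "run tstep accst 2 (tm_init mach w) d" "rel (q0, (\<lambda>_. [])(0 := rev w)) d"
      using run_init[OF w] by blast
    { assume "hits (sstep ins) qa t (q0, (\<lambda>_. [])(0 := rev w))"
      then have "hits tstep accst (t * (2 * (length w + t) + 2)) d"
        by (rule complete[OF d(2)]) simp
      then show "tm_accepts_within mach (2 + t * (2 * (length w + t) + 2)) w"
        unfolding acc by (rule run_hits[OF d(1)]) }
    { assume "tm_accepts_within mach t w"
      then have "hits tstep accst (t - 2) d"
        using run_hitsD[OF d(1)] acc by blast
      then show "\<exists>t'. hits (sstep ins) qa t' (q0, (\<lambda>_. [])(0 := rev w))"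
        by (rule sound[OF d(2)]) }
  qed
qed

section \<open>Searching for derivations nondeterministically\<close>

type_synonym word = "bool list"
datatype sym = Bit bool | Var nat
type_synonym pat = "sym list"

definition subst :: "(nat \<Rightarrow> word) \<Rightarrow> pat \<Rightarrow> word" where
  "subst \<sigma> p = concat (map (\<lambda>s. case s of Bit b \<Rightarrow> [b] | Var v \<Rightarrow> \<sigma> v) p)"

lemma subst_simps [simp]:
  "subst \<sigma> [] = []" "subst \<sigma> (Bit b # p) = b # subst \<sigma> p" "subst \<sigma> (Var v # p) = \<sigma> v @ subst \<sigma> p"
  by (simp_all add: subst_def)

text \<open>The list of words is a stack of pending goals: a rule consumes an instance of its heads
  at the front and puts the instances of its bodies there. \<open>S\<close> bounds the values of the
  variables because these values are what a certificate has to spell out.\<close>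

inductive rws :: "(pat list \<times> pat list) list \<Rightarrow> nat \<Rightarrow> nat \<Rightarrow> word list \<Rightarrow> bool" for P S where
  rws_Nil: "rws P S 0 []"
| rws_Step: "(hs, bs) \<in> set P \<Longrightarrow> (\<And>v. length (\<sigma> v) \<le> S) \<Longrightarrow> rws P S n (map (subst \<sigma>) bs @ ws) \<Longrightarrow>
    rws P S (Suc n) (map (subst \<sigma>) hs @ ws)"

lemma rws_mono: "rws P S n ws \<Longrightarrow> S \<le> S' \<Longrightarrow> rws P S' n ws"
  by (induction rule: rws.induct) (auto intro: rws.intros order_trans)

text \<open>Stacks can be read only destructively, so using the value of a variable takes two
  operations: \<open>Cmp\<close> and \<open>Dump\<close> move it to the scratch stack,
  \<open>Restore\<close> and \<open>Out\<close> bring it back, \<open>Out\<close> with a copy for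
  the goals.\<close>

datatype mop = Load nat | Exp nat | Put nat | Cmp nat | Restore nat | Dump nat | Out nat | Clr nat
  | MvC | MvG | Choose nat | Halt | Accept

type_synonym ctl = "nat \<times> nat \<times> mop list"

text \<open>Phase 0 carries no symbol. The placeholder is 1 because the carried symbol must always
  be one that may be pushed.\<close>

abbreviation (input) goto :: "mop list \<Rightarrow> ctl" where "goto k \<equiv> (0, Suc 0, k)"
abbreviation (input) dead :: ctl where "dead \<equiv> goto [Halt]"

text \<open>Stack 0 is scratch space, stack 1 holds the goals, stack 2 the certificate and stack v+3 the
  value of variable v. The first two components of a control state are the phase of the current
  operation and the symbol it carries.\<close>
fun minstr :: "mop list list \<Rightarrow> ctl \<Rightarrow> ctl instr" where
  "minstr cs (ph, x, []) = Pop 0 (\<lambda>_. dead)"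
| "minstr cs (ph, x, Load v # k) =
    (if ph = 0 then Pop 2 (\<lambda>y. if y = 1 then (1, 1, Load v # k) else if y = 2 then goto k else dead)
     else if ph = 1 then Pop 2 (\<lambda>y. if y = 1 \<or> y = 2 then (2, y, Load v # k) else dead)
     else Push (v + 3) x (goto (Load v # k)))"
| "minstr cs (ph, x, Exp s # k) = Pop 1 (\<lambda>y. if y = s then goto k else dead)"
| "minstr cs (ph, x, Put s # k) = Push 1 s (goto k)"
| "minstr cs (ph, x, Cmp v # k) =
    (if ph = 0 then Pop (v + 3) (\<lambda>y. if y = 0 then goto k else (1, y, Cmp v # k))
     else if ph = 1 then Pop 1 (\<lambda>y. if y = x then (2, x, Cmp v # k) else dead)
     else Push 0 x (goto (Cmp v # k)))"
| "minstr cs (ph, x, Restore v # k) =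
    (if ph = 0 then Pop 0 (\<lambda>y. if y = 0 then goto k else (1, y, Restore v # k))
     else Push (v + 3) x (goto (Restore v # k)))"
| "minstr cs (ph, x, Dump v # k) =
    (if ph = 0 then Pop (v + 3) (\<lambda>y. if y = 0 then goto k else (1, y, Dump v # k))
     else Push 0 x (goto (Dump v # k)))"
| "minstr cs (ph, x, Out v # k) =
    (if ph = 0 then Pop 0 (\<lambda>y. if y = 0 then goto k else (1, y, Out v # k))
     else if ph = 1 then Push (v + 3) x (2, x, Out v # k)
     else Push 1 x (goto (Out v # k)))"
| "minstr cs (ph, x, Clr v # k) =
    Pop (v + 3) (\<lambda>y. if y = 0 then goto k else goto (Clr v # k))"
| "minstr cs (ph, x, MvC # k) =
    (if ph = 0 then Pop 0 (\<lambda>y. if y = 3 then goto k else if y = 0 then dead else (1, y, MvC # k))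
     else Push 2 x (goto (MvC # k)))"
| "minstr cs (ph, x, MvG # k) =
    (if ph = 0 then Pop 0 (\<lambda>y. if y = 0 then goto k else (1, y, MvG # k))
     else Push 1 x (goto (MvG # k)))"
| "minstr cs (ph, x, Choose i # k) =
    (if i < length cs
     then Pop 2 (\<lambda>y. if y = 1 then goto (cs ! i) else if y = 2 then goto [Choose (Suc i)] else dead)
     else Pop 1 (\<lambda>y. if y = 0 then goto [Accept] else dead))"
| "minstr cs (ph, x, Halt # k) = Pop 0 (\<lambda>_. dead)"
| "minstr cs (ph, x, Accept # k) = Pop 0 (\<lambda>_. dead)"

fun mop_ok :: "nat \<Rightarrow> mop \<Rightarrow> bool" where
  "mop_ok V (Load v) = (v < V)" | "mop_ok V (Cmp v) = (v < V)" | "mop_ok V (Restore v) = (v < V)"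
| "mop_ok V (Dump v) = (v < V)" | "mop_ok V (Out v) = (v < V)" | "mop_ok V (Clr v) = (v < V)"
| "mop_ok V (Put s) = (0 < s \<and> s < 4)"
| "mop_ok V _ = True"

definition suffixes_of :: "'a list set \<Rightarrow> 'a list set" where
  "suffixes_of A = (\<Union>l\<in>A. (\<lambda>i. drop i l) ` {..length l})"

lemma suffixes_of_self: "l \<in> A \<Longrightarrow> l \<in> suffixes_of A"
  by (force simp: suffixes_of_def intro!: bexI[of _ 0])

lemma suffixes_of_Cons: "x # k \<in> suffixes_of A \<Longrightarrow> k \<in> suffixes_of A"
proof -
  assume "x # k \<in> suffixes_of A"
  then obtain l i where l: "l \<in> A" "x # k = drop i l" "i \<le> length l" by (auto simp: suffixes_of_def)
  then have "i < length l" by (metis drop_all list.distinct(1) not_le)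
  moreover have "k = drop (Suc i) l" using l(2) by (metis drop_Suc drop_tl list.sel(3))
  ultimately show ?thesis using l by (auto simp: suffixes_of_def intro!: bexI[of _ l] image_eqI[of _ _ "Suc i"])
qed

lemma suffixes_of_ok: "x # k \<in> suffixes_of A \<Longrightarrow> (\<And>l. l \<in> A \<Longrightarrow> \<forall>y\<in>set l. P y) \<Longrightarrow> P x"
  unfolding suffixes_of_def by (smt (verit) UN_E image_iff in_set_dropD list.set_intros(1))

lemma finite_suffixes_of: "finite A \<Longrightarrow> finite (suffixes_of A)"
  by (simp add: suffixes_of_def)

text \<open>A control state stores the code that remains to be executed. Finiteness of the state set
  therefore means that only suffixes of finitely many codes occur.\<close>

definition codes :: "mop list list \<Rightarrow> mop list \<Rightarrow> mop list set" where
  "codes cs c0 = suffixes_of (set cs \<union> {c0, [Halt], [Accept]} \<union> (\<lambda>i. [Choose i]) ` {..length cs})"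

definition ctls :: "mop list list \<Rightarrow> mop list \<Rightarrow> ctl set" where
  "ctls cs c0 = {..2} \<times> {1..3} \<times> codes cs c0"

lemma codes_intros:
  "i < length cs \<Longrightarrow> cs ! i \<in> codes cs c0" "c0 \<in> codes cs c0" "[Halt] \<in> codes cs c0"
  "[Accept] \<in> codes cs c0" "i \<le> length cs \<Longrightarrow> [Choose i] \<in> codes cs c0"
  by (auto simp: codes_def intro!: suffixes_of_self)

lemma codes_Cons: "x # k \<in> codes cs c0 \<Longrightarrow> k \<in> codes cs c0"
  unfolding codes_def by (rule suffixes_of_Cons)

lemma minstr_ok:
  assumes ok: "\<And>l. l \<in> insert c0 (set cs) \<Longrightarrow> \<forall>y\<in>set l. mop_ok V y" and q: "q \<in> ctls cs c0"
  shows "case minstr cs q of Pop j f \<Rightarrow> j < V + 3 \<and> (\<forall>v<4. f v \<in> ctls cs c0)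
    | Push j v q' \<Rightarrow> j < V + 3 \<and> 0 < v \<and> v < 4 \<and> q' \<in> ctls cs c0"
proof -
  obtain ph x c where q': "q = (ph, x, c)" "ph \<le> 2" "x \<in> {1..3}" "c \<in> codes cs c0"
    using q by (auto simp: ctls_def)
  have x: "0 < x" "x < 4" using q' by auto
  have d: "[Halt] \<in> codes cs c0" by (rule codes_intros)
  show ?thesis
  proof (cases c)
    case Nil
    then show ?thesis using d by (simp add: q' ctls_def)
  next
    case (Cons op k)
    have k: "k \<in> codes cs c0" "op # k \<in> codes cs c0" using codes_Cons q' Cons by auto
    have op: "mop_ok V op"
      using k(2) unfolding codes_def by (rule suffixes_of_ok) (use ok in auto)
    show ?thesis
      using op q'(2,3) k d x codes_intros[where cs = cs and ?c0.0 = c0]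
      by (cases op) (simp_all add: q' Cons ctls_def)
  qed
qed

definition stk :: "nat list \<Rightarrow> nat list \<Rightarrow> nat list \<Rightarrow> (nat \<Rightarrow> nat list) \<Rightarrow> nat \<Rightarrow> nat list" where
  "stk T G C R = (\<lambda>j. if j = 0 then T else if j = 1 then G else if j = 2 then C else R (j - 3))"

lemma stk_app [simp]: "stk T G C R 0 = T" "stk T G C R (Suc 0) = G" "stk T G C R 2 = C" "stk T G C R (v + 3) = R v"
  by (simp_all add: stk_def)

lemma stk_upd [simp]:
  "(stk T G C R)(0 := x) = stk x G C R" "(stk T G C R)(Suc 0 := x) = stk T x C R"
  "(stk T G C R)(2 := x) = stk T G x R" "(stk T G C R)(v + 3 := x) = stk T G C (R(v := x))"
  by (auto simp: stk_def fun_eq_iff)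

lemma bit_sym_simps [simp]: "bit_sym b \<noteq> 0" "bit_sym b \<noteq> 3" "bit_sym a = bit_sym b \<longleftrightarrow> a = b"
  "bit_sym b = Suc 0 \<or> bit_sym b = 2" "0 < bit_sym b" "3 \<noteq> bit_sym b" "0 \<noteq> bit_sym b"
  by (simp_all add: bit_sym_def)

abbreviation bits :: "word \<Rightarrow> nat list" where "bits \<equiv> map bit_sym"

text \<open>The certificate may contain only the symbols 1 and 2. Announcing each bit by 1 and the
  end of the word by 2 makes words self-delimiting without a separator.\<close>

definition encw :: "word \<Rightarrow> nat list" where
  "encw w = concat (map (\<lambda>b. [1, bit_sym b]) w) @ [2]"

lemma encw_simps [simp]: "encw [] = [2]" "encw (b # w) = Suc 0 # bit_sym b # encw w"
  by (simp_all add: encw_def)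

lemma length_encw [simp]: "length (encw w) = 2 * length w + 1"
  by (induction w) auto

section \<open>Effect of the single operations\<close>

locale checker =
  fixes cs :: "mop list list"
begin

abbreviation "step \<equiv> sstep (minstr cs)"
abbreviation "A \<equiv> goto [Accept]"

definition runb :: "nat \<Rightarrow> ctl sconf \<Rightarrow> ctl sconf \<Rightarrow> bool" where
  "runb b c c' \<longleftrightarrow> (\<exists>n\<le>b. run step A n c c')"

definition acc :: "ctl sconf \<Rightarrow> bool" where
  "acc c \<longleftrightarrow> (\<exists>t. hits step A t c)"

lemma runb_refl [simp]: "runb b c c"
  by (auto simp: runb_def)

lemma runb_trans: "runb a c c' \<Longrightarrow> runb b c' c'' \<Longrightarrow> runb (a + b) c c''"
  unfolding runb_def by (meson add_mono run_trans)

lemma runb_Suc: "fst c \<noteq> A \<Longrightarrow> runb b (step c) c' \<Longrightarrow> runb (Suc b) c c'"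
proof -
  assume a: "fst c \<noteq> A" and "runb b (step c) c'"
  then obtain n where "n \<le> b" "run step A n (step c) c'" by (auto simp: runb_def)
  then have "Suc n \<le> Suc b" "run step A (Suc n) c c'" using a by (simp_all add: run_Suc)
  then show ?thesis unfolding runb_def by blast
qed

lemma runb_mono: "runb a c c' \<Longrightarrow> a \<le> b \<Longrightarrow> runb b c c'"
  unfolding runb_def using le_trans by blast

text \<open>The machine is deterministic and a run does not pass the accepting state before its end,
  so acceptance is invariant along it. In the soundness arguments this pushes acceptance forward
  through whole code blocks.\<close>

lemma runb_acc: "runb b c c' \<Longrightarrow> acc c \<longleftrightarrow> acc c'"
proof -
  assume "runb b c c'"
  then obtain n where n: "run step A n c c'" by (auto simp: runb_def)
  show ?thesis
    unfolding acc_def using run_hits[OF n] run_hitsD[OF n] by blast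
qed

lemma runb_hits: "runb b c c' \<Longrightarrow> hits step A t c' \<Longrightarrow> hits step A (b + t) c"
proof -
  assume "runb b c c'" and t: "hits step A t c'"
  then obtain n where n: "n \<le> b" "run step A n c c'" by (auto simp: runb_def)
  show ?thesis
    using run_hits[OF n(2) t] by (rule hits_mono) (use n in simp)
qed

lemma acc_step: "fst c \<noteq> A \<Longrightarrow> fst c \<noteq> dead \<Longrightarrow> acc c \<longleftrightarrow> acc (step c)"
  by (rule runb_acc[of 1]) (simp add: runb_Suc)

lemma dead_stays: "fst ((step ^^ n) (dead, s)) = dead"
  by (induction n arbitrary: s) (auto simp: sstep_def split: list.split)

lemma not_acc_dead [simp]: "\<not> acc (dead, s)"
  by (auto simp: acc_def hits_def dead_stays)

lemma run_Load:
  "runb (3 * length w + 1) (goto (Load v # k), stk T G (encw w @ C) R)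
     (goto k, stk T G C (R(v := rev (bits w) @ R v)))"
proof (induction w arbitrary: R)
  case Nil
  then show ?case
    by (auto intro!: runb_Suc simp: sstep_def)
next
  case (Cons b w)
  have "runb (Suc (Suc (Suc (3 * length w + 1)))) (goto (Load v # k), stk T G (encw (b # w) @ C) R)
     (goto k, stk T G C (R(v := rev (bits (b # w)) @ R v)))"
    using Cons[of "R(v := bit_sym b # R v)"] by (intro runb_Suc) (simp_all add: sstep_def fun_upd_same del: fun_upd_apply)
  then show ?case by (rule runb_mono) simp
qed

lemma acc_Load:
  "acc (goto (Load v # k), stk T G C R) \<Longrightarrow>
     \<exists>w C'. C = encw w @ C' \<and> acc (goto k, stk T G C' (R(v := rev (bits w) @ R v)))"
proof (induction "length C" arbitrary: C R rule: less_induct)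
  case less
  obtain y C1 where C: "C = y # C1" "y = 1 \<or> y = 2"
    using less.prems by (cases C) (auto simp: acc_step sstep_def split: if_splits)
  show ?case
  proof (cases "y = 2")
    case True
    then show ?thesis
      using less.prems by (intro exI[of _ "[]"] exI[of _ C1]) (simp add: C acc_step sstep_def)
  next
    case False
    then have a: "acc ((1, 1, Load v # k), stk T G C1 R)"
      using less.prems C by (simp add: acc_step sstep_def)
    then obtain z C2 where C1: "C1 = z # C2" "z = 1 \<or> z = 2"
      by (cases C1) (auto simp: acc_step sstep_def split: if_splits)
    define b where "b = (z = 2)"
    have z: "z = bit_sym b" using C1 by (auto simp: b_def bit_sym_def)
    have a2: "acc (goto (Load v # k), stk T G C2 (R(v := bit_sym b # R v)))"
      using a C1 by (simp add: acc_step sstep_def z)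
    obtain w C' where "C2 = encw w @ C'" "acc (goto k, stk T G C' (R(v := rev (bits w) @ bit_sym b # R v)))"
      using less.hyps[OF _ a2] by (auto simp: C C1)
    then show ?thesis
      using False C C1 z by (intro exI[of _ "b # w"] exI[of _ C']) auto
  qed
qed

lemma run_Exp: "runb 1 (goto (Exp s # k), stk T (s # G) C R) (goto k, stk T G C R)"
  by (auto intro!: runb_Suc simp: sstep_def)

lemma acc_Exp:
  "acc (goto (Exp s # k), stk T G C R) \<Longrightarrow> s \<noteq> 0 \<Longrightarrow> \<exists>G'. G = s # G' \<and> acc (goto k, stk T G' C R)"
  by (cases G) (auto simp: acc_step sstep_def split: if_splits)

lemma run_Put: "runb 1 (goto (Put s # k), stk T G C R) (goto k, stk T (s # G) C R)"
  by (auto intro!: runb_Suc simp: sstep_def)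

lemma run_Cmp:
  "R v = bits w \<Longrightarrow> runb (3 * length w + 1) (goto (Cmp v # k), stk T (bits w @ G) C R)
     (goto k, stk (rev (bits w) @ T) G C (R(v := [])))"
proof (induction w arbitrary: R T)
  case Nil
  then have "R(v := []) = R" by auto
  then show ?case using Nil
    by (auto intro!: runb_Suc simp: sstep_def)
next
  case (Cons b w)
  have "runb (Suc (Suc (Suc (3 * length w + 1)))) (goto (Cmp v # k), stk T (bits (b # w) @ G) C R)
     (goto k, stk (rev (bits (b # w)) @ T) G C (R(v := [])))"
    using Cons.IH[of "R(v := bits w)" "bit_sym b # T"] Cons.prems by (intro runb_Suc) (simp_all add: sstep_def fun_upd_same del: fun_upd_apply)
  then show ?case by (rule runb_mono) simp
qed

text \<open>Only the shape of the goal stack is extracted here. Once it is known,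
  \<open>run_Cmp\<close> describes the computation exactly and carries acceptance further.\<close>

lemma acc_Cmp:
  "acc (goto (Cmp v # k), stk T G C R) \<Longrightarrow> R v = bits w \<Longrightarrow> \<exists>G'. G = bits w @ G'"
proof (induction w arbitrary: R T G)
  case (Cons b w)
  then have a: "acc ((1, bit_sym b, Cmp v # k), stk T G C (R(v := bits w)))"
    by (simp add: acc_step sstep_def)
  then obtain G1 where G: "G = bit_sym b # G1"
    by (cases G) (auto simp: acc_step sstep_def split: if_splits)
  then have "acc (goto (Cmp v # k), stk (bit_sym b # T) G1 C (R(v := bits w)))"
    using a by (simp add: acc_step sstep_def)
  from Cons.IH[OF this] show ?case by (auto simp: G)
qed auto

lemma run_Restore:
  "runb (2 * length w + 1) (goto (Restore v # k), stk (bits w) G C R)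
     (goto k, stk [] G C (R(v := rev (bits w) @ R v)))"
proof (induction w arbitrary: R)
  case Nil
  then show ?case
    by (auto intro!: runb_Suc simp: sstep_def)
next
  case (Cons b w)
  have "runb (Suc (Suc (2 * length w + 1))) (goto (Restore v # k), stk (bits (b # w)) G C R)
     (goto k, stk [] G C (R(v := rev (bits (b # w)) @ R v)))"
    using Cons.IH[of "R(v := bit_sym b # R v)"] by (intro runb_Suc) (simp_all add: sstep_def fun_upd_same del: fun_upd_apply)
  then show ?case by (rule runb_mono) simp
qed

lemma run_Dump:
  "R v = bits w \<Longrightarrow> runb (2 * length w + 1) (goto (Dump v # k), stk T G C R)
     (goto k, stk (rev (bits w) @ T) G C (R(v := [])))"
proof (induction w arbitrary: R T)
  case Nil
  then have "R(v := []) = R" by auto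
  then show ?case using Nil
    by (auto intro!: runb_Suc simp: sstep_def)
next
  case (Cons b w)
  have "runb (Suc (Suc (2 * length w + 1))) (goto (Dump v # k), stk T G C R)
     (goto k, stk (rev (bits (b # w)) @ T) G C (R(v := [])))"
    using Cons.IH[of "R(v := bits w)" "bit_sym b # T"] Cons.prems by (intro runb_Suc) (simp_all add: sstep_def fun_upd_same del: fun_upd_apply)
  then show ?case by (rule runb_mono) simp
qed

lemma run_Out:
  "runb (3 * length w + 1) (goto (Out v # k), stk (bits w) G C R)
     (goto k, stk [] (rev (bits w) @ G) C (R(v := rev (bits w) @ R v)))"
proof (induction w arbitrary: R G)
  case Nil
  then show ?case
    by (auto intro!: runb_Suc simp: sstep_def)
next
  case (Cons b w)
  have "runb (Suc (Suc (Suc (3 * length w + 1)))) (goto (Out v # k), stk (bits (b # w)) G C R)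
     (goto k, stk [] (rev (bits (b # w)) @ G) C (R(v := rev (bits (b # w)) @ R v)))"
    using Cons.IH[of "bit_sym b # G" "R(v := bit_sym b # R v)"] by (intro runb_Suc) (simp_all add: sstep_def fun_upd_same del: fun_upd_apply)
  then show ?case by (rule runb_mono) simp
qed

lemma run_Clr:
  "R v = bits w \<Longrightarrow> runb (length w + 1) (goto (Clr v # k), stk T G C R) (goto k, stk T G C (R(v := [])))"
proof (induction w arbitrary: R)
  case Nil
  then have "R(v := []) = R" by auto
  then show ?case using Nil
    by (auto intro!: runb_Suc simp: sstep_def)
next
  case (Cons b w)
  have "runb (Suc (length w + 1)) (goto (Clr v # k), stk T G C R) (goto k, stk T G C (R(v := [])))"
    using Cons.IH[of "R(v := bits w)"] Cons.prems by (intro runb_Suc) (simp_all add: sstep_def fun_upd_same del: fun_upd_apply)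
  then show ?case by (rule runb_mono) simp
qed

lemma run_MvC:
  "runb (2 * length w + 1) (goto (MvC # k), stk (bits w @ 3 # T) G C R)
     (goto k, stk T G (rev (bits w) @ C) R)"
proof (induction w arbitrary: C)
  case Nil
  then show ?case
    by (auto intro!: runb_Suc simp: sstep_def)
next
  case (Cons b w)
  have "runb (Suc (Suc (2 * length w + 1))) (goto (MvC # k), stk (bits (b # w) @ 3 # T) G C R)
     (goto k, stk T G (rev (bits (b # w)) @ C) R)"
    using Cons.IH[of "bit_sym b # C"] by (intro runb_Suc) (simp_all add: sstep_def fun_upd_same del: fun_upd_apply)
  then show ?case by (rule runb_mono) simp
qed

lemma run_MvG:
  "runb (2 * length w + 1) (goto (MvG # k), stk (bits w) G C R)
     (goto k, stk [] (rev (bits w) @ G) C R)"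
proof (induction w arbitrary: G)
  case Nil
  then show ?case
    by (auto intro!: runb_Suc simp: sstep_def)
next
  case (Cons b w)
  have "runb (Suc (Suc (2 * length w + 1))) (goto (MvG # k), stk (bits (b # w)) G C R)
     (goto k, stk [] (rev (bits (b # w)) @ G) C R)"
    using Cons.IH[of "bit_sym b # G"] by (intro runb_Suc) (simp_all add: sstep_def fun_upd_same del: fun_upd_apply)
  then show ?case by (rule runb_mono) simp
qed

lemma run_Choose: "i < length cs \<Longrightarrow> runb 1 (goto [Choose i], stk T G (Suc 0 # C) R) (goto (cs ! i), stk T G C R)"
  by (auto intro!: runb_Suc simp: sstep_def)

lemma run_Choose_Suc: "i < length cs \<Longrightarrow> runb 1 (goto [Choose i], stk T G (2 # C) R) (goto [Choose (Suc i)], stk T G C R)"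
  by (auto intro!: runb_Suc simp: sstep_def)

lemma run_Choose_skip:
  "i + j < length cs \<Longrightarrow>
   runb (Suc j) (goto [Choose i], stk T G (replicate j 2 @ Suc 0 # C) R) (goto (cs ! (i + j)), stk T G C R)"
proof (induction j arbitrary: i)
  case 0
  then show ?case using run_Choose by simp
next
  case (Suc j)
  have "runb 1 (goto [Choose i], stk T G (2 # replicate j 2 @ Suc 0 # C) R)
      (goto [Choose (Suc i)], stk T G (replicate j 2 @ Suc 0 # C) R)"
    using Suc.prems by (intro run_Choose_Suc) simp
  from runb_trans[OF this Suc.IH[of "Suc i"]] show ?case using Suc.prems by simp
qed

text \<open>A symbol 2 skips a rule. Skipping all of them announces the end of the derivation, which
  is accepted if no goal is left.\<close>

lemma hits_Choose:
  "i \<le> length cs \<Longrightarrow>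
   hits step A (Suc (length cs - i)) (goto [Choose i], stk T [] (replicate (length cs - i) 2) R)"
proof (induction "length cs - i" arbitrary: i)
  case 0
  then show ?case
    by (simp add: hits_Suc hits_0 sstep_def)
next
  case (Suc n)
  then have "hits step A (Suc (length cs - Suc i)) (goto [Choose (Suc i)], stk T [] (replicate (length cs - Suc i) 2) R)"
    by simp
  moreover have "length cs - i = Suc (length cs - Suc i)" "i < length cs" using Suc by auto
  ultimately show ?case
    using runb_hits[OF run_Choose_Suc[where C = "replicate (length cs - Suc i) 2"]] by simp
qed

text \<open>The certificate gets strictly shorter with every choice, which is the measure for the
  induction in \<open>acc_sound\<close>. The goals must avoid 0 because popping a 0 would be taken
  for an empty goal stack.\<close>

lemma acc_Choose:
  "acc (goto [Choose i], stk T G C R) \<Longrightarrow> 0 \<notin> set G \<Longrightarrow>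
   G = [] \<or> (\<exists>j C'. j < length cs \<and> length C' < length C \<and> acc (goto (cs ! j), stk T G C' R))"
proof (induction C arbitrary: i)
  case Nil
  then show ?case
    by (cases "i < length cs"; cases G) (auto simp: acc_step sstep_def split: if_splits)
next
  case (Cons y C)
  show ?case
  proof (cases "i < length cs")
    case False
    then show ?thesis using Cons.prems
      by (cases G) (auto simp: acc_step sstep_def split: if_splits)
  next
    case True
    then have "y = 1 \<and> acc (goto (cs ! i), stk T G C R) \<or> y = 2 \<and> acc (goto [Choose (Suc i)], stk T G C R)"
      using Cons.prems by (subst (asm) acc_step) (auto simp: sstep_def split: if_splits)
    then show ?thesis
      using True Cons.IH[of "Suc i"] Cons.prems by (auto simp: less_Suc_eq)
  qed
qed

end

section \<open>Compiling a rule into operations\<close>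

definition cmatch :: "pat \<Rightarrow> mop list" where
  "cmatch p = concat (map (\<lambda>s. case s of Bit b \<Rightarrow> [Exp (bit_sym b)] | Var v \<Rightarrow> [Cmp v, Restore v]) p) @ [Exp 3]"

text \<open>The symbols are pushed from last to first, after the separator, so that the word ends up
  with its first symbol on top.\<close>

definition cpush :: "pat \<Rightarrow> mop list" where
  "cpush p = Put 3 # concat (map (\<lambda>s. case s of Bit b \<Rightarrow> [Put (bit_sym b)] | Var v \<Rightarrow> [Dump v, Out v]) (rev p))"

definition rcode :: "nat \<Rightarrow> pat list \<times> pat list \<Rightarrow> mop list" where
  "rcode V r = map Load [0..<V] @ concat (map cmatch (fst r)) @ concat (map cpush (rev (snd r)))
     @ map Clr [0..<V] @ [Choose 0]"

definition pat_ok :: "nat \<Rightarrow> pat \<Rightarrow> bool" where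
  "pat_ok V p \<longleftrightarrow> (\<forall>v. Var v \<in> set p \<longrightarrow> v < V)"

lemma pat_ok_simps [simp]: "pat_ok V []" "pat_ok V (Bit b # p) = pat_ok V p"
  "pat_ok V (Var v # p) \<longleftrightarrow> v < V \<and> pat_ok V p"
  by (auto simp: pat_ok_def)

definition encws :: "word list \<Rightarrow> nat list" where
  "encws ws = concat (map (\<lambda>w. bits w @ [3]) ws)"

lemma encws_simps [simp]: "encws [] = []" "encws (w # ws) = bits w @ 3 # encws ws"
  "encws (ws @ ws') = encws ws @ encws ws'"
  by (simp_all add: encws_def)

lemma bits_sep_eq: "bits w @ 3 # X = bits u @ 3 # Y \<longleftrightarrow> w = u \<and> X = Y"
proof (induction w arbitrary: u)
  case Nil
  then show ?case by (cases u) auto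
next
  case (Cons b w)
  then show ?case by (cases u) auto
qed

lemma encws_eqD: "encws ws = bits u @ 3 # G \<Longrightarrow> \<exists>ws'. ws = u # ws' \<and> G = encws ws'"
  by (cases ws) (auto simp: bits_sep_eq)

definition regs :: "nat \<Rightarrow> (nat \<Rightarrow> word) \<Rightarrow> nat \<Rightarrow> nat list" where
  "regs V \<sigma> = (\<lambda>v. if v < V then bits (\<sigma> v) else [])"

lemma regs_upd: "v < V \<Longrightarrow> (regs V \<sigma>)(v := bits (\<sigma> v)) = regs V \<sigma>"
  by (auto simp: regs_def)

context checker
begin

lemma run_Cmp_Restore:
  assumes "v < V"
  shows "runb (5 * length (\<sigma> v) + 2) (goto (Cmp v # Restore v # k), stk [] (bits (\<sigma> v) @ G) C (regs V \<sigma>))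
     (goto k, stk [] G C (regs V \<sigma>))"
proof -
  have "regs V \<sigma> v = bits (\<sigma> v)" using assms by (simp add: regs_def)
  from runb_trans[OF run_Cmp[where R = "regs V \<sigma>" and v = v and T = "[]", OF this, unfolded rev_map append_Nil2] run_Restore[of "rev (\<sigma> v)" v k G C "(regs V \<sigma>)(v := [])", unfolded rev_map rev_rev_ident]]
  show ?thesis using assms by (simp add: rev_map regs_upd fun_upd_same del: fun_upd_apply)
qed

lemma run_Dump_Out:
  assumes "v < V"
  shows "runb (5 * length (\<sigma> v) + 2) (goto (Dump v # Out v # k), stk [] G C (regs V \<sigma>))
     (goto k, stk [] (bits (\<sigma> v) @ G) C (regs V \<sigma>))"
proof -
  have "regs V \<sigma> v = bits (\<sigma> v)" using assms by (simp add: regs_def)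
  from runb_trans[OF run_Dump[where R = "regs V \<sigma>" and v = v and T = "[]", OF this, unfolded rev_map append_Nil2] run_Out[of "rev (\<sigma> v)" v k G C "(regs V \<sigma>)(v := [])", unfolded rev_map rev_rev_ident]]
  show ?thesis using assms by (simp add: rev_map regs_upd fun_upd_same del: fun_upd_apply)
qed

lemma run_match:
  assumes S: "\<And>v. length (\<sigma> v) \<le> S" and "pat_ok V p"
  shows "runb (Suc (length p) * (5 * S + 2)) (goto (cmatch p @ k), stk [] (bits (subst \<sigma> p) @ 3 # G) C (regs V \<sigma>))
    (goto k, stk [] G C (regs V \<sigma>))"
  using assms(2)
proof (induction p)
  case Nil
  show ?case using runb_mono[OF run_Exp] by (simp add: cmatch_def)
next
  case (Cons s p)
  show ?case
  proof (cases s)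
    case (Bit b)
    have "runb (1 + Suc (length p) * (5 * S + 2)) (goto (cmatch (s # p) @ k), stk [] (bits (subst \<sigma> (s # p)) @ 3 # G) C (regs V \<sigma>))
      (goto k, stk [] G C (regs V \<sigma>))"
      by (rule runb_trans[OF _ Cons.IH])
        (use Cons.prems run_Exp[of "bit_sym b" "cmatch p @ k" "[]" "bits (subst \<sigma> p) @ 3 # G" C "regs V \<sigma>"] in \<open>auto simp: Bit cmatch_def\<close>)
    then show ?thesis by (rule runb_mono) simp
  next
    case (Var v)
    have "runb (5 * length (\<sigma> v) + 2 + Suc (length p) * (5 * S + 2)) (goto (cmatch (s # p) @ k), stk [] (bits (subst \<sigma> (s # p)) @ 3 # G) C (regs V \<sigma>))
      (goto k, stk [] G C (regs V \<sigma>))"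
      by (rule runb_trans[OF _ Cons.IH])
        (use Cons.prems run_Cmp_Restore[of v V \<sigma> "cmatch p @ k" "bits (subst \<sigma> p) @ 3 # G" C] in \<open>auto simp: Var cmatch_def\<close>)
    then show ?thesis by (rule runb_mono) (use S[of v] in simp)
  qed
qed

lemma acc_match:
  assumes "acc (goto (cmatch p @ k), stk [] G C (regs V \<sigma>))" "pat_ok V p"
  shows "\<exists>G'. G = bits (subst \<sigma> p) @ 3 # G' \<and> acc (goto k, stk [] G' C (regs V \<sigma>))"
  using assms
proof (induction p arbitrary: G)
  case Nil
  then show ?case using acc_Exp[of 3] by (simp add: cmatch_def)
next
  case (Cons s p)
  show ?case
  proof (cases s)
    case (Bit b)
    then have "acc (goto (Exp (bit_sym b) # cmatch p @ k), stk [] G C (regs V \<sigma>))"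
      using Cons.prems by (simp add: cmatch_def)
    from acc_Exp[OF this] obtain G' where G': "G = bit_sym b # G'" "acc (goto (cmatch p @ k), stk [] G' C (regs V \<sigma>))"
      by auto
    from Cons.IH[OF G'(2)] show ?thesis using Cons.prems by (auto simp: Bit G')
  next
    case (Var v)
    then have a: "acc (goto (Cmp v # Restore v # cmatch p @ k), stk [] G C (regs V \<sigma>))"
      using Cons.prems by (simp add: cmatch_def)
    have v: "v < V" using Cons.prems by (simp add: Var)
    then obtain G' where G': "G = bits (\<sigma> v) @ G'"
      using acc_Cmp[OF a, of "\<sigma> v"] by (auto simp: regs_def)
    then have "acc (goto (cmatch p @ k), stk [] G' C (regs V \<sigma>))"
      using a runb_acc[OF run_Cmp_Restore[OF v, of \<sigma> "cmatch p @ k" G' C]] by simp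
    from Cons.IH[OF this] show ?thesis using Cons.prems by (auto simp: Var G')
  qed
qed

lemma run_push_syms:
  assumes S: "\<And>v. length (\<sigma> v) \<le> S" and "pat_ok V p"
  shows "runb (length p * (5 * S + 2))
    (goto (concat (map (\<lambda>s. case s of Bit b \<Rightarrow> [Put (bit_sym b)] | Var v \<Rightarrow> [Dump v, Out v]) (rev p)) @ k), stk [] G C (regs V \<sigma>))
    (goto k, stk [] (bits (subst \<sigma> p) @ G) C (regs V \<sigma>))"
  using assms(2)
proof (induction p arbitrary: k)
  case (Cons s p)
  show ?case
  proof (cases s)
    case (Bit b)
    have "runb (length p * (5 * S + 2) + 1)
      (goto (concat (map (\<lambda>s. case s of Bit b \<Rightarrow> [Put (bit_sym b)] | Var v \<Rightarrow> [Dump v, Out v]) (rev (s # p))) @ k), stk [] G C (regs V \<sigma>))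
      (goto k, stk [] (bits (subst \<sigma> (s # p)) @ G) C (regs V \<sigma>))"
      by (rule runb_trans[of _ _ "(goto (Put (bit_sym b) # k), stk [] (bits (subst \<sigma> p) @ G) C (regs V \<sigma>))"]) (use Cons.prems Cons.IH[of "Put (bit_sym b) # k"] run_Put[of "bit_sym b" k "[]" "bits (subst \<sigma> p) @ G" C "regs V \<sigma>"] in \<open>auto simp: Bit\<close>)
    then show ?thesis by (rule runb_mono) simp
  next
    case (Var v)
    have "runb (length p * (5 * S + 2) + (5 * length (\<sigma> v) + 2))
      (goto (concat (map (\<lambda>s. case s of Bit b \<Rightarrow> [Put (bit_sym b)] | Var v \<Rightarrow> [Dump v, Out v]) (rev (s # p))) @ k), stk [] G C (regs V \<sigma>))
      (goto k, stk [] (bits (subst \<sigma> (s # p)) @ G) C (regs V \<sigma>))"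
      by (rule runb_trans[of _ _ "(goto (Dump v # Out v # k), stk [] (bits (subst \<sigma> p) @ G) C (regs V \<sigma>))"]) (use Cons.prems Cons.IH[of "Dump v # Out v # k"] run_Dump_Out[of v V \<sigma> k "bits (subst \<sigma> p) @ G" C] in \<open>auto simp: Var\<close>)
    then show ?thesis by (rule runb_mono) (use S[of v] in simp)
  qed
qed simp

lemma run_push:
  assumes S: "\<And>v. length (\<sigma> v) \<le> S" and "pat_ok V p"
  shows "runb (Suc (length p) * (5 * S + 2)) (goto (cpush p @ k), stk [] G C (regs V \<sigma>))
    (goto k, stk [] (bits (subst \<sigma> p) @ 3 # G) C (regs V \<sigma>))"
proof -
  have "runb (1 + length p * (5 * S + 2)) (goto (cpush p @ k), stk [] G C (regs V \<sigma>))
    (goto k, stk [] (bits (subst \<sigma> p) @ 3 # G) C (regs V \<sigma>))"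
    unfolding cpush_def append_Cons by (rule runb_trans[OF run_Put run_push_syms]) (use assms in auto)
  then show ?thesis by (rule runb_mono) simp
qed

abbreviation weight :: "pat list \<Rightarrow> nat" where
  "weight ps \<equiv> sum_list (map (\<lambda>p. Suc (length p)) ps)"

lemma run_matches:
  assumes S: "\<And>v. length (\<sigma> v) \<le> S"
  shows "\<forall>p\<in>set ps. pat_ok V p \<Longrightarrow>
    runb (weight ps * (5 * S + 2)) (goto (concat (map cmatch ps) @ k), stk [] (encws (map (subst \<sigma>) ps) @ G) C (regs V \<sigma>))
    (goto k, stk [] G C (regs V \<sigma>))"
proof (induction ps)
  case (Cons p ps)
  have "runb (Suc (length p) * (5 * S + 2) + weight ps * (5 * S + 2)) (goto (concat (map cmatch (p # ps)) @ k), stk [] (encws (map (subst \<sigma>) (p # ps)) @ G) C (regs V \<sigma>))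
    (goto k, stk [] G C (regs V \<sigma>))"
    by (rule runb_trans[OF _ Cons.IH])
      (use Cons.prems run_match[where \<sigma> = \<sigma>, OF S, where V = V and p = p and k = "concat (map cmatch ps) @ k" and G = "encws (map (subst \<sigma>) ps) @ G" and C = C] in auto)
  then show ?case by (rule runb_mono) (simp add: algebra_simps)
qed simp

lemma acc_matches:
  "acc (goto (concat (map cmatch ps) @ k), stk [] (encws ws) C (regs V \<sigma>)) \<Longrightarrow> \<forall>p\<in>set ps. pat_ok V p \<Longrightarrow>
   \<exists>ws'. ws = map (subst \<sigma>) ps @ ws' \<and> acc (goto k, stk [] (encws ws') C (regs V \<sigma>))"
proof (induction ps arbitrary: ws)
  case (Cons p ps)
  then obtain G where G: "encws ws = bits (subst \<sigma> p) @ 3 # G"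
    "acc (goto (concat (map cmatch ps) @ k), stk [] G C (regs V \<sigma>))"
    using acc_match[where p = p and k = "concat (map cmatch ps) @ k" and G = "encws ws" and C = C and V = V and \<sigma> = \<sigma>] by auto
  then obtain ws1 where "ws = subst \<sigma> p # ws1" "G = encws ws1"
    using encws_eqD by blast
  then show ?case using Cons.IH[of ws1] Cons.prems G by auto
qed simp

lemma run_pushes:
  assumes S: "\<And>v. length (\<sigma> v) \<le> S"
  shows "\<forall>p\<in>set ps. pat_ok V p \<Longrightarrow>
    runb (weight ps * (5 * S + 2)) (goto (concat (map cpush (rev ps)) @ k), stk [] G C (regs V \<sigma>))
    (goto k, stk [] (encws (map (subst \<sigma>) ps) @ G) C (regs V \<sigma>))"
proof (induction ps arbitrary: k)
  case (Cons p ps)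
  have "runb (weight ps * (5 * S + 2) + Suc (length p) * (5 * S + 2)) (goto (concat (map cpush (rev (p # ps))) @ k), stk [] G C (regs V \<sigma>))
    (goto k, stk [] (encws (map (subst \<sigma>) (p # ps)) @ G) C (regs V \<sigma>))"
    by (rule runb_trans[of _ _ "(goto (cpush p @ k), stk [] (encws (map (subst \<sigma>) ps) @ G) C (regs V \<sigma>))"]) (use Cons.prems Cons.IH[of "cpush p @ k"] run_push[where \<sigma> = \<sigma>, OF S, where V = V and p = p and k = k and G = "encws (map (subst \<sigma>) ps) @ G" and C = C] in \<open>auto\<close>)
  then show ?case by (rule runb_mono) (simp add: algebra_simps)
qed simp

text \<open>Loading pushes a word symbol by symbol and thereby reverses it; the certificate
  therefore lists the reversed values.\<close>

lemma run_Loads: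
  assumes S: "\<And>v. length (\<sigma> v) \<le> S"
  shows "a \<le> V \<Longrightarrow>
    runb ((V - a) * (5 * S + 2)) (goto (map Load [a..<V] @ k), stk [] G (concat (map (\<lambda>v. encw (rev (\<sigma> v))) [a..<V]) @ C) (regs a \<sigma>))
    (goto k, stk [] G C (regs V \<sigma>))"
proof (induction "V - a" arbitrary: a)
  case (Suc n)
  then have a: "a < V" "[a..<V] = a # [Suc a..<V]" by (auto simp: upt_conv_Cons)
  have "(regs a \<sigma>)(a := rev (bits (rev (\<sigma> a))) @ regs a \<sigma> a) = regs (Suc a) \<sigma>"
    by (auto simp: regs_def rev_map)
  note 1 = run_Load[of "rev (\<sigma> a)" a "map Load [Suc a..<V] @ k" "[]" G
      "concat (map (\<lambda>v. encw (rev (\<sigma> v))) [Suc a..<V]) @ C" "regs a \<sigma>", unfolded this]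
  have 2: "runb ((V - Suc a) * (5 * S + 2)) (goto (map Load [Suc a..<V] @ k), stk [] G (concat (map (\<lambda>v. encw (rev (\<sigma> v))) [Suc a..<V]) @ C) (regs (Suc a) \<sigma>))
    (goto k, stk [] G C (regs V \<sigma>))"
    using Suc by (intro Suc.hyps) auto
  have "3 * length (rev (\<sigma> a)) + 1 + (V - Suc a) * (5 * S + 2) \<le> Suc (V - Suc a) * (5 * S + 2)"
    using S[of a] by simp
  also have "Suc (V - Suc a) = V - a" using a by simp
  finally show ?case
    using runb_mono[OF runb_trans[OF 1 2]] by (simp add: a(2))
qed simp

lemma acc_Loads:
  "acc (goto (map Load [a..<V] @ k), stk [] G C (regs a \<sigma>)) \<Longrightarrow> a \<le> V \<Longrightarrow>
   \<exists>\<tau> C'. length C' \<le> length C \<and> acc (goto k, stk [] G C' (regs V \<tau>))"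
proof (induction "V - a" arbitrary: a C \<sigma>)
  case 0
  then show ?case by auto
next
  case (Suc n)
  then have a: "a < V" "[a..<V] = a # [Suc a..<V]" by (auto simp: upt_conv_Cons)
  from Suc.prems have "acc (goto (Load a # map Load [Suc a..<V] @ k), stk [] G C (regs a \<sigma>))"
    by (simp add: a)
  from acc_Load[OF this] obtain w C' where C: "C = encw w @ C'"
    and *: "acc (goto (map Load [Suc a..<V] @ k), stk [] G C' ((regs a \<sigma>)(a := rev (bits w) @ regs a \<sigma> a)))" by blast
  have "(regs a \<sigma>)(a := rev (bits w) @ regs a \<sigma> a) = regs (Suc a) (\<sigma>(a := rev w))"
    by (auto simp: regs_def rev_map)
  then have "\<exists>\<tau> C''. length C'' \<le> length C' \<and> acc (goto k, stk [] G C'' (regs V \<tau>))"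
    using Suc a * by (intro Suc.hyps(1)[of "Suc a"]) auto
  then obtain \<tau> C'' where "length C'' \<le> length C'" "acc (goto k, stk [] G C'' (regs V \<tau>))" by blast
  then show ?case using C by (intro exI[of _ \<tau>] exI[of _ C'']) auto
qed

lemma run_Clrs:
  assumes S: "\<And>v. length (\<sigma> v) \<le> S"
  shows "a \<le> V \<Longrightarrow>
    runb ((V - a) * (5 * S + 2)) (goto (map Clr [a..<V] @ k), stk T G C (\<lambda>v. if v < a then [] else regs V \<sigma> v))
    (goto k, stk T G C (\<lambda>_. []))"
proof (induction "V - a" arbitrary: a)
  case 0
  then have "(\<lambda>v. if v < a then [] else regs V \<sigma> v) = (\<lambda>_. [])" by (auto simp: regs_def)
  then show ?case using 0 by simp
next
  case (Suc n)
  then have a: "a < V" "[a..<V] = a # [Suc a..<V]" by (auto simp: upt_conv_Cons)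
  let ?R = "\<lambda>a v. if v < a then [] else regs V \<sigma> v"
  have "?R a a = bits (\<sigma> a)" using a by (simp add: regs_def)
  note 1 = run_Clr[where R = "?R a" and v = a, OF this]
  have eq: "(?R a)(a := []) = ?R (Suc a)" by (auto simp: regs_def)
  have 2: "runb ((V - Suc a) * (5 * S + 2)) (goto (map Clr [Suc a..<V] @ k), stk T G C (?R (Suc a)))
    (goto k, stk T G C (\<lambda>_. []))"
    using Suc by (intro Suc.hyps) auto
  have "length (\<sigma> a) + 1 + (V - Suc a) * (5 * S + 2) \<le> Suc (V - Suc a) * (5 * S + 2)"
    using S[of a] by simp
  also have "Suc (V - Suc a) = V - a" using a by simp
  finally show ?case
    using runb_mono[OF runb_trans[OF 1[unfolded eq] 2]] unfolding a(2) list.map append_Cons by blast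
qed

end

section \<open>Accepted certificates are derivations\<close>

locale rewrite_system =
  fixes P :: "(pat list \<times> pat list) list" and V :: nat
  assumes ok: "(hs, bs) \<in> set P \<Longrightarrow> \<forall>p\<in>set hs \<union> set bs. pat_ok V p"
begin

sublocale checker "map (rcode V) P" .

abbreviation "start ws C \<equiv> (goto [Choose 0], stk [] (encws ws) C (\<lambda>_. []))"

lemma regs_0: "regs 0 \<sigma> = (\<lambda>_. [])" by (simp add: regs_def)

text \<open>Induction on the length of the certificate, of which each application of a rule consumes
  a part. The bounds S and n of the derivation obtained are left open, because soundness does not
  depend on size.\<close>

lemma acc_sound: "acc (start ws C) \<Longrightarrow> \<exists>S n. rws P S n ws"
proof (induction "length C" arbitrary: C ws rule: less_induct)
  case less
  show ?case
  proof (cases "ws = []")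
    case True
    then show ?thesis by (auto intro: rws_Nil)
  next
    case False
    then have "encws ws \<noteq> []" by (cases ws) auto
    moreover have "0 \<notin> set (encws ws)" by (auto simp: encws_def)
    ultimately obtain i C1 where i: "i < length P" "length C1 < length C"
      "acc (goto (rcode V (P ! i)), stk [] (encws ws) C1 (\<lambda>_. []))"
      using acc_Choose[OF less.prems] by auto
    obtain hs bs where P: "P ! i = (hs, bs)" by fastforce
    then have mem: "(hs, bs) \<in> set P" using i nth_mem by metis
    let ?k1 = "concat (map cpush (rev bs)) @ map Clr [0..<V] @ [Choose 0]"
    have "acc (goto (map Load [0..<V] @ concat (map cmatch hs) @ ?k1), stk [] (encws ws) C1 (regs 0 (\<lambda>_. [])))"
      using i by (simp add: P rcode_def regs_0)
    from acc_Loads[OF this] obtain \<tau> C2 where C2: "length C2 \<le> length C1"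
      "acc (goto (concat (map cmatch hs) @ ?k1), stk [] (encws ws) C2 (regs V \<tau>))" by auto
    \<comment> \<open>Cut off at V, the assignment has only finitely many nonempty values, so a
      common bound S on their lengths exists.\<close>
    define \<sigma> where "\<sigma> = (\<lambda>v. if v < V then \<tau> v else [])"
    define S where "S = Max (insert 0 ((\<lambda>v. length (\<tau> v)) ` {..<V}))"
    have S: "length (\<sigma> v) \<le> S" for v
      by (auto simp: S_def \<sigma>_def intro!: Max_ge)
    have "regs V \<tau> = regs V \<sigma>" by (auto simp: regs_def \<sigma>_def)
    then obtain ws' where ws': "ws = map (subst \<sigma>) hs @ ws'" "acc (goto ?k1, stk [] (encws ws') C2 (regs V \<sigma>))"
      using acc_matches[of hs ?k1 ws C2 V \<sigma>] C2 ok[OF mem] by auto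
    have "acc (goto (map Clr [0..<V] @ [Choose 0]), stk [] (encws (map (subst \<sigma>) bs @ ws')) C2 (regs V \<sigma>))"
      using ws'(2) runb_acc[OF run_pushes[where \<sigma> = \<sigma>, OF S, where ps = bs and V = V and k = "map Clr [0..<V] @ [Choose 0]" and G = "encws ws'" and C = C2]] ok[OF mem] by simp
    then have "acc (start (map (subst \<sigma>) bs @ ws') C2)"
      using runb_acc[OF run_Clrs[where \<sigma> = \<sigma>, OF S, where a = 0 and V = V and k = "[Choose 0]"]] by simp
    then have "\<exists>S n. rws P S n (map (subst \<sigma>) bs @ ws')"
      by (rule less.hyps[rotated]) (use i C2 in simp)
    then obtain S' n where "rws P S' n (map (subst \<sigma>) bs @ ws')" by blast
    then have "rws P (max S S') n (map (subst \<sigma>) bs @ ws')"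
      by (rule rws_mono) simp
    then have "rws P (max S S') (Suc n) ws"
      unfolding ws' by (intro rws_Step[OF mem]) (use S in \<open>auto simp: le_max_iff_disj\<close>)
    then show ?thesis by blast
  qed
qed

text \<open>Bounds the number of pieces in one application of a rule: choosing it, loading and
  clearing V variables, and matching and pushing the symbols and separators. A piece takes at most 5
  * S + 2 steps, the price of \<open>Cmp\<close> with \<open>Restore\<close> or of
  \<open>Dump\<close> with \<open>Out\<close> on a word of length S.\<close>

definition cost :: nat where
  "cost = 2 * V + (\<Sum>(hs, bs)\<leftarrow>P. weight hs + weight bs) + length P + 1"

lemma run_rule:
  assumes S: "\<And>v. length (\<sigma> v) \<le> S" and i: "i < length P" "P ! i = (hs, bs)"
  shows "runb (cost * (5 * S + 2))
    (start (map (subst \<sigma>) hs @ ws)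
       (bits (replicate i True @ [False]) @ concat (map (\<lambda>v. encw (rev (\<sigma> v))) [0..<V]) @ C))
    (start (map (subst \<sigma>) bs @ ws) C)"
proof -
  have mem: "(hs, bs) \<in> set P" using i nth_mem by metis
  note ok = ok[OF mem]
  let ?k2 = "map Clr [0..<V] @ [Choose 0]"
  let ?k1 = "concat (map cpush (rev bs)) @ ?k2"
  let ?C = "concat (map (\<lambda>v. encw (rev (\<sigma> v))) [0..<V]) @ C"
  have b: "bits (replicate i True @ [False]) @ ?C = replicate i 2 @ Suc 0 # ?C"
    by (simp add: bit_sym_def)
  have 1: "runb (Suc i) (start (map (subst \<sigma>) hs @ ws) (bits (replicate i True @ [False]) @ ?C))
    (goto (map Load [0..<V] @ concat (map cmatch hs) @ ?k1),
     stk [] (encws (map (subst \<sigma>) hs) @ encws ws) ?C (regs 0 \<sigma>))"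
    using run_Choose_skip[of 0 i "[]" "encws (map (subst \<sigma>) hs @ ws)" ?C "\<lambda>_. []"] i
    unfolding b by (simp add: rcode_def regs_0)
  have 2: "runb ((V - 0) * (5 * S + 2)) \<dots> (goto (concat (map cmatch hs) @ ?k1),
     stk [] (encws (map (subst \<sigma>) hs) @ encws ws) C (regs V \<sigma>))"
    by (rule run_Loads[OF S]) simp
  have 3: "runb (weight hs * (5 * S + 2)) \<dots> (goto ?k1, stk [] (encws ws) C (regs V \<sigma>))"
    by (rule run_matches[OF S]) (use ok in simp)
  have 4: "runb (weight bs * (5 * S + 2)) \<dots> (goto ?k2, stk [] (encws (map (subst \<sigma>) bs) @ encws ws) C (regs V \<sigma>))"
    by (rule run_pushes[OF S]) (use ok in simp)
  have 5: "runb ((V - 0) * (5 * S + 2)) \<dots> (start (map (subst \<sigma>) bs @ ws) C)"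
    using run_Clrs[where \<sigma> = \<sigma>, OF S, where a = 0 and V = V and k = "[Choose 0]"] by simp
  have "weight hs + weight bs \<le> (\<Sum>(hs, bs)\<leftarrow>P. weight hs + weight bs)"
  proof -
    obtain xs ys where "P = xs @ (hs, bs) # ys" using mem by (auto simp: in_set_conv_decomp)
    then show ?thesis by simp
  qed
  then have "Suc i + 2 * V + weight hs + weight bs \<le> cost"
    using i by (simp add: cost_def)
  then have "(Suc i + 2 * V + weight hs + weight bs) * (5 * S + 2) \<le> cost * (5 * S + 2)"
    by (rule mult_le_mono1)
  then show ?thesis
    using i by (intro runb_mono[OF runb_trans[OF 1 runb_trans[OF 2 runb_trans[OF 3 runb_trans[OF 4 5]]]]])
      (simp add: algebra_simps)
qed

text \<open>The certificate of one step is the index of the rule in unary, closed by False, followed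
  by the values of the variables; a value of length l takes 2 * l + 1 bits. A final block of
  \<open>length P\<close> bits True skips all rules and ends the derivation.\<close>

lemma hits_complete:
  "rws P S n ws \<Longrightarrow> \<exists>u. length u \<le> n * (cost * (2 * S + 2)) + length P \<and>
     hits step A (n * (cost * (5 * S + 2)) + length P + 1) (start ws (bits u))"
proof (induction rule: rws.induct)
  case rws_Nil
  have "hits step A (Suc (length P)) (start [] (bits (replicate (length P) True)))"
    using hits_Choose[of 0 "[]"] by (simp add: bit_sym_def)
  then show ?case by (intro exI[of _ "replicate (length P) True"]) simp
next
  case (rws_Step hs bs \<sigma> n ws)
  then obtain u where u: "length u \<le> n * (cost * (2 * S + 2)) + length P"
     "hits step A (n * (cost * (5 * S + 2)) + length P + 1) (start (map (subst \<sigma>) bs @ ws) (bits u))" by blast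
  obtain i where i: "i < length P" "P ! i = (hs, bs)"
    using rws_Step by (metis in_set_conv_nth)
  define ew :: "word \<Rightarrow> word" where "ew = (\<lambda>w. concat (map (\<lambda>b. [False, b]) w) @ [True])"
  have ew: "bits (ew w) = encw w" "length (ew w) = 2 * length w + 1" for w
    by (induction w) (auto simp: ew_def bit_sym_def)
  define c where "c = (replicate i True @ [False]) @ concat (map (\<lambda>v. ew (rev (\<sigma> v))) [0..<V])"
  have "bits c = bits (replicate i True @ [False]) @ concat (map (\<lambda>v. encw (rev (\<sigma> v))) [0..<V])"
    by (simp add: c_def map_concat ew o_def)
  then have "runb (cost * (5 * S + 2)) (start (map (subst \<sigma>) hs @ ws) (bits (c @ u))) (start (map (subst \<sigma>) bs @ ws) (bits u))"
    using run_rule[where \<sigma> = \<sigma>, OF rws_Step(2) i, where ws = ws and C = "bits u"] by simp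
  from runb_hits[OF this u(2)]
  have "hits step A (Suc n * (cost * (5 * S + 2)) + length P + 1) (start (map (subst \<sigma>) hs @ ws) (bits (c @ u)))"
    by (simp add: algebra_simps)
  moreover have "length c \<le> cost * (2 * S + 2)"
  proof -
    have "length (concat (map (\<lambda>v. ew (rev (\<sigma> v))) [0..<V])) \<le> V * (2 * S + 1)" for V
    proof (induction V)
      case (Suc V)
      then show ?case using rws_Step(2)[of V] by (simp add: ew)
    qed simp
    from this[of V] have "length c \<le> length P + V * (2 * S + 1)"
      using i(1) unfolding c_def length_append by simp
    also have "\<dots> \<le> (length P + V) * (2 * S + 2)" by (simp add: algebra_simps)
    also have "\<dots> \<le> cost * (2 * S + 2)" by (intro mult_le_mono1) (simp add: cost_def)
    finally show ?thesis .
  qed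
  then have "length (c @ u) \<le> Suc n * (cost * (2 * S + 2)) + length P" using u(1) by simp
  ultimately show ?case by blast
qed

text \<open>The top of stack 0 is the end of the certificate. Moving symbols from stack to stack
  reverses their order, so certificate and input arrive with their first symbols on top; the
  separator 3 tells where one ends and the other begins.\<close>

lemma run_init:
  "runb (2 * length u + 2 * length w + length pw + 4)
     (goto ([MvC, Put 3, MvG, Put 3] @ map (Put \<circ> bit_sym) (rev pw) @ [Choose 0]),
      stk (rev (bits w @ [3] @ bits u)) [] [] (\<lambda>_. []))
     (start [pw, w] (bits u))"
proof -
  let ?k1 = "map (Put \<circ> bit_sym) (rev pw) @ [Choose 0]"
  have puts: "runb (length p) (goto (map (Put \<circ> bit_sym) (rev p) @ k), stk T G C R) (goto k, stk T (bits p @ G) C R)"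
    for p k T G C R
  proof (induction p arbitrary: k)
    case (Cons b p)
    from runb_trans[OF Cons.IH[of "Put (bit_sym b) # k"] run_Put] show ?case by simp
  qed simp
  have "runb (2 * length (rev u) + 1) (goto (MvC # Put 3 # MvG # Put 3 # ?k1), stk (bits (rev u) @ 3 # bits (rev w)) [] [] (\<lambda>_. []))
    (goto (Put 3 # MvG # Put 3 # ?k1), stk (bits (rev w)) [] (bits u) (\<lambda>_. []))"
    using run_MvC[of "rev u" "Put 3 # MvG # Put 3 # ?k1" "bits (rev w)" "[]" "[]" "\<lambda>_. []"] by (simp add: rev_map)
  note runb_trans[OF this run_Put]
  note runb_trans[OF this run_MvG, unfolded rev_map rev_rev_ident]
  note runb_trans[OF this run_Put]
  note runb_trans[OF this puts]
  from runb_mono[OF this, of "2 * length u + 2 * length w + length pw + 4"]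
  show ?thesis by (simp add: rev_map)
qed

end

section \<open>Polynomial bounds and membership in NP\<close>

definition poly_bounded :: "(nat \<Rightarrow> nat) \<Rightarrow> bool" where
  "poly_bounded f \<longleftrightarrow> (\<exists>c k. \<forall>n. f n \<le> c * (n + 1) ^ k)"

lemma poly_bounded_const [intro, simp]: "poly_bounded (\<lambda>_. c)"
  unfolding poly_bounded_def by (intro exI[of _ c] exI[of _ 0]) simp

lemma poly_bounded_id [intro, simp]: "poly_bounded (\<lambda>n. n)"
  unfolding poly_bounded_def by (intro exI[of _ 1]) simp

lemma poly_bounded_add [intro, simp]: "poly_bounded f \<Longrightarrow> poly_bounded g \<Longrightarrow> poly_bounded (\<lambda>n. f n + g n)"
proof -
  assume "poly_bounded f" "poly_bounded g"
  then obtain c k d l where f: "\<And>n. f n \<le> c * (n + 1) ^ k" and g: "\<And>n. g n \<le> d * (n + 1) ^ l"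
    unfolding poly_bounded_def by blast
  have "f n + g n \<le> (c + d) * (n + 1) ^ (k + l)" for n
  proof -
    have "(n + 1) ^ k \<le> (n + 1) ^ (k + l)" "(n + 1) ^ l \<le> (n + 1) ^ (k + l)"
      by (intro power_increasing; simp)+
    then have "c * (n + 1) ^ k + d * (n + 1) ^ l \<le> c * (n + 1) ^ (k + l) + d * (n + 1) ^ (k + l)"
      by (intro add_mono mult_le_mono2)
    then show ?thesis using f[of n] g[of n] unfolding add_mult_distrib by linarith
  qed
  then show ?thesis unfolding poly_bounded_def by blast
qed

lemma poly_bounded_mult [intro, simp]: "poly_bounded f \<Longrightarrow> poly_bounded g \<Longrightarrow> poly_bounded (\<lambda>n. f n * g n)"
proof -
  assume "poly_bounded f" "poly_bounded g"
  then obtain c k d l where f: "\<And>n. f n \<le> c * (n + 1) ^ k" and g: "\<And>n. g n \<le> d * (n + 1) ^ l"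
    unfolding poly_bounded_def by blast
  have "f n * g n \<le> (c * d) * (n + 1) ^ (k + l)" for n
    using mult_le_mono[OF f[of n] g[of n]] by (simp add: power_add ac_simps)
  then show ?thesis unfolding poly_bounded_def by blast
qed

text \<open>The fixed word \<open>pw\<close> names the predicate that is claimed of the input.
  Soundness is required of derivations of any size, while members of the language must have
  derivations that are polynomial both in the number of steps and in the length of the
  words.\<close>

theorem rewriting_in_NP:
  fixes P :: "(pat list \<times> pat list) list"
  assumes ok: "\<And>hs bs. (hs, bs) \<in> set P \<Longrightarrow> \<forall>p\<in>set hs \<union> set bs. pat_ok V p"
    and sound: "\<And>w S n. rws P S n [pw, w] \<Longrightarrow> w \<in> L"
    and complete: "\<And>w. w \<in> L \<Longrightarrow> \<exists>n\<le>N (length w). rws P (S (length w)) n [pw, w]"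
    and poly: "poly_bounded N" "poly_bounded S"
  shows "in_NP L"
proof -
  interpret rewrite_system P V by unfold_locales (rule ok)
  define c0 where "c0 = [MvC, Put 3, MvG, Put 3] @ map (Put \<circ> bit_sym) (rev pw) @ [Choose 0]"
  let ?cs = "map (rcode V) P"
  let ?init = "\<lambda>w u. (goto c0, stk (rev (bits w @ [3] @ bits u)) [] [] (\<lambda>_. []))"
  have "\<forall>y\<in>set l. mop_ok V y" if "l \<in> insert c0 (set ?cs)" for l
  proof -
    have b: "0 < bit_sym b \<and> bit_sym b < 4" for b by (simp add: bit_sym_def)
    have m: "\<forall>y\<in>set (cmatch p). mop_ok V y" "\<forall>y\<in>set (cpush p). mop_ok V y" if "pat_ok V p" for p
      using that b by (auto simp: cmatch_def cpush_def pat_ok_def split: sym.splits)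
    have "\<forall>y\<in>set (rcode V (hs, bs)). mop_ok V y" if "(hs, bs) \<in> set P" for hs bs
      using m ok[OF that] by (auto simp: rcode_def)
    then show ?thesis using that b by (auto simp: c0_def)
  qed
  note mok = minstr_ok[of c0 ?cs V, OF this]
  have "\<exists>M. tm_wf M \<and> (\<forall>w. set w \<subseteq> {1,2,3} \<longrightarrow>
    (\<forall>t. hits (sstep (minstr ?cs)) A t (goto c0, (\<lambda>_. [])(0 := rev w)) \<longrightarrow>
          tm_accepts_within M (2 + t * (2 * (length w + t) + 2)) w) \<and>
    (\<forall>t. tm_accepts_within M t w \<longrightarrow>
          (\<exists>t'. hits (sstep (minstr ?cs)) A t' (goto c0, (\<lambda>_. [])(0 := rev w)))))"
  proof (rule stack_machine_to_tm[where Q = "ctls ?cs c0" and K = "V + 3"])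
    show "finite (ctls ?cs c0)"
      by (simp add: ctls_def codes_def finite_suffixes_of)
    show "goto c0 \<in> ctls ?cs c0" "A \<in> ctls ?cs c0"
      using codes_intros[where cs = ?cs and ?c0.0 = c0] by (auto simp: ctls_def)
  next
    fix q j f assume "q \<in> ctls ?cs c0" "minstr ?cs q = Pop j f"
    then show "j < V + 3 \<and> (\<forall>v<4. f v \<in> ctls ?cs c0)" using mok[of q] by simp
  next
    fix q j v q' assume "q \<in> ctls ?cs c0" "minstr ?cs q = Push j v q'"
    then show "j < V + 3 \<and> 0 < v \<and> v < 4 \<and> q' \<in> ctls ?cs c0" using mok[of q] by simp
  qed simp
  then obtain M where M: "tm_wf M"
    and M1: "\<And>w t. set w \<subseteq> {1,2,3} \<Longrightarrow> hits step A t (goto c0, (\<lambda>_. [])(0 := rev w)) \<Longrightarrow>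
          tm_accepts_within M (2 + t * (2 * (length w + t) + 2)) w"
    and M2: "\<And>w t. set w \<subseteq> {1,2,3} \<Longrightarrow> tm_accepts_within M t w \<Longrightarrow>
          (\<exists>t'. hits step A t' (goto c0, (\<lambda>_. [])(0 := rev w)))"
    by blast
  have stk0: "(\<lambda>_. [])(0 := T) = stk T [] [] (\<lambda>_. [])" for T :: "nat list"
    by (auto simp: stk_def)
  have alpha: "set (bits w @ [3] @ bits u) \<subseteq> {1,2,3}" for w u
    by (auto simp: bit_sym_def)
  \<comment> \<open>\<open>U\<close> bounds the certificate, \<open>t0\<close> the time of the stack
    machine including the initial rearrangement of the stacks, and \<open>T\<close> the time of the
    tape machine after the quadratic overhead.\<close>
  define U where "U = (\<lambda>n. N n * (cost * (2 * S n + 2)) + length P)"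
  define t0 where "t0 = (\<lambda>n. (2 * U n + 2 * n + length pw + 4) + (N n * (cost * (5 * S n + 2)) + length P + 1))"
  define T where "T = (\<lambda>n. 2 + t0 n * (2 * ((n + 1 + U n) + t0 n) + 2))"
  \<comment> \<open>Bounding the sum yields one pair c, k that serves both for the certificate and
    for the time, as \<open>in_NP\<close> demands.\<close>
  have "poly_bounded (\<lambda>n. U n + T n)"
    unfolding T_def t0_def U_def using poly by (intro poly_bounded_add poly_bounded_mult poly_bounded_const poly_bounded_id)
  then obtain c k where ck: "\<And>n. U n + T n \<le> c * (n + 1) ^ k" unfolding poly_bounded_def by blast
  have "w \<in> L \<longleftrightarrow> (\<exists>u. length u \<le> c * (length w + 1) ^ k \<and>
         tm_accepts_within M (c * (length w + length u + 1) ^ k) (bits w @ [3] @ bits u))" for w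
  proof
    assume "w \<in> L"
    then obtain n where n: "n \<le> N (length w)" "rws P (S (length w)) n [pw, w]" using complete by blast
    from hits_complete[OF n(2)] obtain u where u: "length u \<le> n * (cost * (2 * S (length w) + 2)) + length P"
      "hits step A (n * (cost * (5 * S (length w) + 2)) + length P + 1) (start [pw, w] (bits u))" by blast
    have "n * (cost * (2 * S (length w) + 2)) \<le> N (length w) * (cost * (2 * S (length w) + 2))"
      using n(1) by (rule mult_le_mono1)
    then have uU: "length u \<le> U (length w)" using u(1) unfolding U_def by linarith
    have "n * (cost * (5 * S (length w) + 2)) \<le> N (length w) * (cost * (5 * S (length w) + 2))"
      using n(1) by (rule mult_le_mono1)
    then have t0: "2 * length u + 2 * length w + length pw + 4 + (n * (cost * (5 * S (length w) + 2)) + length P + 1) \<le> t0 (length w)"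
      using uU unfolding t0_def by linarith
    have "hits step A (t0 (length w)) (?init w u)"
      using hits_mono[OF runb_hits[OF run_init[of u w pw] u(2)] t0] by (simp add: c0_def)
    then have "tm_accepts_within M (2 + t0 (length w) * (2 * (length (bits w @ [3] @ bits u) + t0 (length w)) + 2)) (bits w @ [3] @ bits u)"
      by (intro M1[OF alpha]) (simp only: stk0)
    moreover have "2 + t0 (length w) * (2 * (length (bits w @ [3] @ bits u) + t0 (length w)) + 2) \<le> T (length w)"
      using uU unfolding T_def by (intro add_mono mult_le_mono) auto
    moreover have "T (length w) \<le> c * (length w + length u + 1) ^ k"
    proof -
      have "c * (length w + 1) ^ k \<le> c * (length w + length u + 1) ^ k"
        by (intro mult_le_mono2 power_mono) auto
      then show ?thesis using ck[of "length w"] by linarith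
    qed
    ultimately have "tm_accepts_within M (c * (length w + length u + 1) ^ k) (bits w @ [3] @ bits u)"
      unfolding tm_accepts_within_def by (meson le_trans)
    moreover have "length u \<le> c * (length w + 1) ^ k" using uU ck[of "length w"] by linarith
    ultimately show "\<exists>u. length u \<le> c * (length w + 1) ^ k \<and>
         tm_accepts_within M (c * (length w + length u + 1) ^ k) (bits w @ [3] @ bits u)" by blast
  next
    assume "\<exists>u. length u \<le> c * (length w + 1) ^ k \<and>
         tm_accepts_within M (c * (length w + length u + 1) ^ k) (bits w @ [3] @ bits u)"
    then obtain u where "tm_accepts_within M (c * (length w + length u + 1) ^ k) (bits w @ [3] @ bits u)" by blast
    from M2[OF alpha this] have "acc (?init w u)"
      unfolding acc_def stk0 .
    then have "acc (start [pw, w] (bits u))"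
      using runb_acc[OF run_init[of u w pw]] by (simp add: c0_def)
    then show "w \<in> L" using acc_sound sound by blast
  qed
  then show ?thesis unfolding in_NP_def using M by blast
qed

section \<open>Logic programs and the verification of certificates\<close>

type_synonym 'p patom = "'p \<times> pat list"
type_synonym 'p rule = "'p patom \<times> 'p patom list"
type_synonym 'p gatom = "'p \<times> word list"

definition inst :: "(nat \<Rightarrow> word) \<Rightarrow> 'p patom \<Rightarrow> 'p gatom" where
  "inst \<sigma> a = (fst a, map (subst \<sigma>) (snd a))"

inductive ders :: "'p rule list \<Rightarrow> nat \<Rightarrow> nat \<Rightarrow> 'p gatom list \<Rightarrow> bool" for P S where
  ders_Nil: "ders P S 0 []"
| ders_Step: "(h, bs) \<in> set P \<Longrightarrow> (\<And>v. length (\<sigma> v) \<le> S) \<Longrightarrow> ders P S n (map (inst \<sigma>) bs @ gs) \<Longrightarrow>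
    ders P S (Suc n) (inst \<sigma> h # gs)"

lemma ders_append: "ders P S n gs \<Longrightarrow> ders P S n' gs' \<Longrightarrow> ders P S (n + n') (gs @ gs')"
  by (induction rule: ders.induct) (auto intro: ders.intros)

text \<open>The arity is part of the code of a predicate, so a flattened goal list determines its atoms.\<close>
definition pword :: "'p::countable \<Rightarrow> nat \<Rightarrow> word" where
  "pword p n = replicate (to_nat (p, n)) True"

lemma pword_inject: "pword p n = pword p' n' \<longleftrightarrow> p = p' \<and> n = n'"
  by (auto simp: pword_def)

definition flat :: "'p::countable patom \<Rightarrow> pat list" where
  "flat a = map Bit (pword (fst a) (length (snd a))) # snd a"

definition gflat :: "'p::countable gatom \<Rightarrow> word list" where
  "gflat a = pword (fst a) (length (snd a)) # snd a"

definition flat_rule :: "'p::countable rule \<Rightarrow> pat list \<times> pat list" where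
  "flat_rule r = (flat (fst r), concat (map flat (snd r)))"

lemma subst_Bits [simp]: "subst \<sigma> (map Bit bs) = bs"
  by (induction bs) auto

lemma subst_flat [simp]: "map (subst \<sigma>) (flat a) = gflat (inst \<sigma> a)"
  by (simp add: flat_def gflat_def inst_def)

lemma subst_flats [simp]: "map (subst \<sigma>) (concat (map flat as)) = concat (map gflat (map (inst \<sigma>) as))"
  by (induction as) auto

lemma ders_rws: "ders P S n gs \<Longrightarrow> rws (map flat_rule P) S n (concat (map gflat gs))"
proof (induction rule: ders.induct)
  case (ders_Step h bs \<sigma> n gs)
  have "(flat h, concat (map flat bs)) \<in> set (map flat_rule P)"
    using ders_Step(1) by (force simp: flat_rule_def)
  from rws_Step[OF this, of \<sigma> S n "concat (map gflat gs)"] ders_Step show ?case by simp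
qed (simp add: rws_Nil)

definition valid :: "('p \<Rightarrow> word list \<Rightarrow> bool) \<Rightarrow> 'p rule \<Rightarrow> bool" where
  "valid sem r \<longleftrightarrow> (\<forall>\<sigma>. (\<forall>(p, ws)\<in>set (map (inst \<sigma>) (snd r)). sem p ws) \<longrightarrow>
     sem (fst (fst r)) (map (subst \<sigma>) (snd (fst r))))"

lemma rws_sound:
  assumes "rws (map flat_rule P) S n (concat (map gflat gs))" "\<And>r. r \<in> set P \<Longrightarrow> valid sem r"
  shows "\<forall>(p, ws)\<in>set gs. sem p ws"
  using assms(1)
proof (induction "concat (map gflat gs)" arbitrary: gs rule: rws.induct)
  case rws_Nil
  then show ?case by (cases gs) (auto simp: gflat_def)
next
  case (rws_Step hs bs \<sigma> n ws)
  obtain h as where r: "(h, as) \<in> set P" "hs = flat h" "bs = concat (map flat as)"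
    using rws_Step(1) by (auto simp: flat_rule_def)
  have eq: "gflat (inst \<sigma> h) @ ws = concat (map gflat gs)" using rws_Step(5) r by simp
  then obtain g gs' where gs: "gs = g # gs'" by (cases gs) (auto simp: gflat_def)
  have "pword (fst (inst \<sigma> h)) (length (snd (inst \<sigma> h))) = pword (fst g) (length (snd g))"
    "snd (inst \<sigma> h) @ ws = snd g @ concat (map gflat gs')"
    using eq by (auto simp: gs gflat_def)
  then have g: "g = inst \<sigma> h" "ws = concat (map gflat gs')"
    by (auto simp: pword_inject prod_eq_iff)
  have "map (subst \<sigma>) bs @ ws = concat (map gflat (map (inst \<sigma>) as @ gs'))"
    using r g by simp
  from rws_Step(4)[OF this] have *: "\<forall>(p, ws)\<in>set (map (inst \<sigma>) as @ gs'). sem p ws" .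
  have "sem (fst h) (map (subst \<sigma>) (snd h))"
    using assms(2)[OF r(1)] * unfolding valid_def by auto
  then show ?case using * by (auto simp: gs g inst_def)
qed

lemma pat_ok_Bits [simp]: "pat_ok V (map Bit bs)"
  by (auto simp: pat_ok_def)

definition rule_ok :: "nat \<Rightarrow> 'p rule \<Rightarrow> bool" where
  "rule_ok V r \<longleftrightarrow> (\<forall>a\<in>set (fst r # snd r). \<forall>p\<in>set (snd a). pat_ok V p)"

lemma flat_rule_ok: "rule_ok V r \<Longrightarrow> flat_rule r = (hs, bs) \<Longrightarrow> \<forall>p\<in>set hs \<union> set bs. pat_ok V p"
  by (auto simp: rule_ok_def flat_rule_def flat_def)

text \<open>Integers are written least significant bit first in two's complement: each bit b as the pair
  (False, b), terminated by (True, True) for 0 and (True, False) for -1. On nonnegative numbers this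
  agrees with enc_nat.\<close>
inductive num :: "word \<Rightarrow> int \<Rightarrow> bool" where
  num_0: "num [True, True] 0"
| num_m1: "num [True, False] (-1)"
| num_bit: "num X x \<Longrightarrow> num (False # b # X) (of_bool b + 2 * x)"

lemma num_det: "num X x \<Longrightarrow> num Y y \<Longrightarrow> X @ U = Y @ V \<Longrightarrow> X = Y \<and> x = y \<and> U = V"
proof (induction arbitrary: Y y rule: num.induct)
  case num_0
  then show ?case by (auto elim: num.cases)
next
  case num_m1
  then show ?case by (auto elim: num.cases)
next
  case (num_bit X x b)
  from num_bit.prems(1) show ?case
  proof cases
    case (num_bit Y' y' b')
    then show ?thesis using num_bit.IH[of Y' y'] num_bit.prems by auto
  qed (use num_bit.prems in auto)
qed

lemma num_unique: "num X x \<Longrightarrow> num X y \<Longrightarrow> x = y"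
  using num_det[of X x X y "[]" "[]"] by simp

inductive vec :: "word \<Rightarrow> int list \<Rightarrow> bool" where
  vec_Nil: "vec [] []"
| vec_Cons: "num X x \<Longrightarrow> vec V vs \<Longrightarrow> vec (X @ V) (x # vs)"

lemma num_nonempty: "num X x \<Longrightarrow> X \<noteq> []"
  by (auto elim: num.cases)

lemma vec_unique: "vec V vs \<Longrightarrow> vec V us \<Longrightarrow> vs = us"
proof (induction arbitrary: us rule: vec.induct)
  case vec_Nil
  then show ?case by cases (auto dest: num_nonempty)
next
  case (vec_Cons X x V vs)
  obtain Y y V' us' where "X @ V = Y @ V'" "us = y # us'" "num Y y" "vec V' us'"
    using vec_Cons.prems num_nonempty[OF vec_Cons.hyps(1)] by (cases rule: vec.cases) auto
  then show ?case using num_det[OF vec_Cons.hyps(1), of Y y V V'] vec_Cons.IH by auto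
qed

lemma vec_append: "vec U us \<Longrightarrow> vec V vs \<Longrightarrow> vec (U @ V) (us @ vs)"
  by (induction rule: vec.induct) (auto intro: vec.intros)

definition idot :: "int list \<Rightarrow> int list \<Rightarrow> int" where
  "idot vs us = sum_list (map2 (*) vs us)"

lemma idot_simps [simp]: "idot [] us = 0" "idot (v # vs) (u # us) = v * u + idot vs us"
  by (simp_all add: idot_def)

definition axpy :: "int \<Rightarrow> int list \<Rightarrow> int list \<Rightarrow> int list" where
  "axpy a vs us = map2 (\<lambda>v u. a * v + u) vs us"

lemma axpy_simps [simp]: "axpy a [] us = []" "axpy a (v # vs) (u # us) = (a * v + u) # axpy a vs us"
  "length (axpy a vs us) = min (length vs) (length us)"
  by (simp_all add: axpy_def)

text \<open>The number m of columns is an argument because it cannot be read off an empty list of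
  rows.\<close>

fun icomb :: "nat \<Rightarrow> int list \<Rightarrow> int list list \<Rightarrow> int list" where
  "icomb m (u # us) (r # rows) = axpy u r (icomb m us rows)"
| "icomb m _ _ = replicate m 0"

lemma length_icomb: "\<forall>r\<in>set rows. length r = m \<Longrightarrow> length (icomb m us rows) = m"
  by (induction m us rows rule: icomb.induct) auto

section \<open>Intended meaning of the predicates\<close>

definition sNum where "sNum X \<longleftrightarrow> (\<exists>x. num X x)"
definition sCons where "sCons B X Y \<longleftrightarrow> (\<exists>b x. B = [b] \<and> num X x \<and> num Y (of_bool b + 2 * x))"
definition sAdd where "sAdd C X Y Z \<longleftrightarrow> (\<exists>c x y. C = [c] \<and> num X x \<and> num Y y \<and> num Z (x + y + of_bool c))"
definition sMul where "sMul X Y Z \<longleftrightarrow> (\<exists>x y. num X x \<and> num Y y \<and> num Z (x * y))"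
definition sNeg where "sNeg X \<longleftrightarrow> (\<exists>x<0. num X x)"
definition sNn where "sNn X \<longleftrightarrow> (\<exists>x\<ge>0. num X x)"
definition sNnv where "sNnv V \<longleftrightarrow> (\<exists>vs. vec V vs \<and> (\<forall>x\<in>set vs. 0 \<le> x))"
definition sDot where "sDot V U Z \<longleftrightarrow> (\<exists>vs us. vec V vs \<and> vec U us \<and> length vs = length us \<and> num Z (idot vs us))"
definition sZv where "sZv Z \<longleftrightarrow> (\<exists>n. vec Z (replicate n 0))"
definition sAx where "sAx A V U Z \<longleftrightarrow> (\<exists>a vs us. num A a \<and> vec V vs \<and> vec U us \<and> length vs = length us \<and> vec Z (axpy a vs us))"
definition sComb where "sComb U M G \<longleftrightarrow> (\<exists>us rows m. vec U us \<and> vec M (concat rows) \<and> length rows = length us \<and>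
  (\<forall>r\<in>set rows. length r = m) \<and> vec G (icomb m us rows))"
text \<open>Fractions are stored as integer numerators over a negative common denominator (e here, E in sVer),
  so that linear conditions are sums equal to zero and need no subtraction.\<close>
definition sLin where "sLin B W H \<longleftrightarrow> (\<exists>e us bs rows. e < 0 \<and> vec B bs \<and> vec W (concat rows) \<and> length rows = length us \<and>
  (\<forall>r\<in>set rows. length r = length bs) \<and> vec H (axpy e bs (icomb (length bs) us rows)))"
text \<open>The values of X, Y and E are quantified universally so that the clause for matrices
  without rows is sound without inspecting these words. The multiplier L in \<open>sCv\<close> and
  \<open>sCm\<close> is treated in the same way.\<close>

definition sMv where "sMv T W H X Y E \<longleftrightarrow> (\<exists>Ts Ws hs. vec T (concat Ts) \<and> vec W (concat Ws) \<and> vec H hs \<and>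
  length Ts = length hs \<and> length Ws = length hs \<and>
  (\<forall>xs ys e. vec X xs \<longrightarrow> vec Y ys \<longrightarrow> num E e \<longrightarrow> (\<forall>i<length hs. length (Ts ! i) = length xs \<and> length (Ws ! i) = length ys \<and>
     idot (Ts ! i) xs + idot (Ws ! i) ys + hs ! i * e = 0)))"
text \<open>Here G stands for a positive multiple of u W - q and F for one of l W - d. The signs
  then say that u is dual feasible, that y is complementary to u, and that on the tight set l W
  dominates d with equality on the support of y.\<close>

definition sChk where "sChk G F Y \<longleftrightarrow> (\<exists>gs fs ys. vec G gs \<and> vec F fs \<and> vec Y ys \<and> length gs = length ys \<and> length fs = length ys \<and>
  (\<forall>i<length ys. 0 \<le> ys ! i \<and> gs ! i \<le> 0 \<and> (gs ! i < 0 \<longrightarrow> ys ! i = 0) \<and>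
     (gs ! i = 0 \<longrightarrow> 0 \<le> fs ! i \<and> (ys ! i = 0 \<or> fs ! i = 0))))"
definition sEqj where "sEqj G H \<longleftrightarrow> (\<exists>gs hs. vec G gs \<and> vec H hs \<and> length gs = length hs \<and>
  (\<forall>i<length gs. gs ! i = 0 \<longrightarrow> hs ! i = 0))"
definition sEqs where "sEqs W B G \<longleftrightarrow> (\<exists>Bs. vec B (concat Bs) \<and> (\<forall>bs\<in>set Bs. \<exists>b H. vec b bs \<and> sLin b W H \<and> sEqj G H))"
text \<open>In contrast to \<open>num\<close>, which tolerates redundant leading digits, this asks
  for the exact encoding, because the language contains exact encodings only.\<close>

definition sNat where "sNat X \<longleftrightarrow> (\<exists>n. X = enc_nat n)"
text \<open>A dimension in unary drives the recursion over entries or rows. It is no longer than the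
  input, as each dimension is the length of a vector contained in the input.\<close>

definition sUn where "sUn X U \<longleftrightarrow> (\<exists>n. num X (int n) \<and> U = replicate n True)"
definition sCop where "sCop P Q \<longleftrightarrow> (\<exists>p q. P = enc_nat p \<and> Q = enc_nat q \<and> 0 < q \<and> coprime p q)"
definition sCrat where "sCrat L R Z \<longleftrightarrow> (\<exists>\<rho> l z. R = enc_rat \<rho> \<and> num L l \<and> num Z z \<and> of_int z = of_int l * \<rho>)"
definition sCv where "sCv L U V Z \<longleftrightarrow> (\<exists>vs zs. length vs = length U \<and> V = enc_vec vs \<and> vec Z zs \<and> length zs = length vs \<and>
  (\<forall>l. num L l \<longrightarrow> (\<forall>i<length vs. of_int (zs ! i) = of_int l * vs ! i)))"
definition sCm where "sCm L K U V Z \<longleftrightarrow> (\<exists>M Zs. length M = length K \<and> (\<forall>row\<in>set M. length row = length U) \<and> V = enc_mat M \<and>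
  vec Z (concat Zs) \<and> length Zs = length M \<and> (\<forall>row\<in>set Zs. length row = length U) \<and>
  (\<forall>l. num L l \<longrightarrow> (\<forall>i<length M. \<forall>j<length U. of_int (Zs ! i ! j) = of_int l * M ! i ! j)))"
text \<open>The only inequality between x and y becomes an equation with the nonnegative slack t6.
  Nonnegativity of Y is enforced by \<open>sChk\<close>.\<close>

definition sVer where "sVer c d q A B a T W h al \<longleftrightarrow> (\<exists>X Y E t1 t2 t3 t4 t5 t6 G F.
  sNnv X \<and> sNeg E \<and> sMv T W h X Y E \<and> sMv A B a X Y E \<and>
  sDot c X t1 \<and> sDot d Y t2 \<and> sAdd [False] t1 t2 t3 \<and> sMul al E t4 \<and> sAdd [False] t3 t4 t5 \<and>
  sAdd [False] t5 t6 [True, True] \<and> sNn t6 \<and> sLin q W G \<and> sLin d W F \<and> sChk G F Y \<and> sEqs W B G)"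
text \<open>L is a guessed number that clears all denominators at once. Its positivity is expressed
  through the negative number L' with L + L' = 0, as there is a predicate for negative numbers but
  none for positive ones.\<close>

definition sMain where "sMain w \<longleftrightarrow> (\<exists>en em ek er uN uM uK uR Vc Vd Vq VA VB Va VT VW Vh Val c d q A B a T W h al L L'.
  w = en @ em @ ek @ er @ Vc @ Vd @ Vq @ VA @ VB @ Va @ VT @ VW @ Vh @ Val \<and>
  sNat en \<and> sNat em \<and> sNat ek \<and> sNat er \<and> sUn en uN \<and> sUn em uM \<and> sUn ek uK \<and> sUn er uR \<and>
  sNeg L' \<and> sAdd [False] L L' [True, True] \<and>
  sCv L uN Vc c \<and> sCv L uM Vd d \<and> sCv L uM Vq q \<and> sCm L uK uN VA A \<and> sCm L uK uM VB B \<and> sCv L uK Va a \<and>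
  sCm L uR uN VT T \<and> sCm L uR uM VW W \<and> sCv L uR Vh h \<and> sCrat L Val al \<and> sVer c d q A B a T W h al)"

section \<open>The logic program\<close>

datatype pr = Num | Shift | Add | Mul | Neg | Nn | Nnv | Dot | Zv | Ax | Comb | Lin | Mv | Chk | Eqj | Eqs
  | Nat | Unary | Cop | Crat | Cv | Cm | Ver | Main

instance pr :: countable by countable_datatype

primrec sem :: "pr \<Rightarrow> word list \<Rightarrow> bool" where
  "sem Num = (\<lambda>w. sNum (w ! 0))"
| "sem Shift = (\<lambda>w. sCons (w ! 0) (w ! 1) (w ! 2))"
| "sem Add = (\<lambda>w. sAdd (w ! 0) (w ! 1) (w ! 2) (w ! 3))"
| "sem Mul = (\<lambda>w. sMul (w ! 0) (w ! 1) (w ! 2))"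
| "sem Neg = (\<lambda>w. sNeg (w ! 0))"
| "sem Nn = (\<lambda>w. sNn (w ! 0))"
| "sem Nnv = (\<lambda>w. sNnv (w ! 0))"
| "sem Dot = (\<lambda>w. sDot (w ! 0) (w ! 1) (w ! 2))"
| "sem Zv = (\<lambda>w. sZv (w ! 0))"
| "sem Ax = (\<lambda>w. sAx (w ! 0) (w ! 1) (w ! 2) (w ! 3))"
| "sem Comb = (\<lambda>w. sComb (w ! 0) (w ! 1) (w ! 2))"
| "sem Lin = (\<lambda>w. sLin (w ! 0) (w ! 1) (w ! 2))"
| "sem Mv = (\<lambda>w. sMv (w ! 0) (w ! 1) (w ! 2) (w ! 3) (w ! 4) (w ! 5))"
| "sem Chk = (\<lambda>w. sChk (w ! 0) (w ! 1) (w ! 2))"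
| "sem Eqj = (\<lambda>w. sEqj (w ! 0) (w ! 1))"
| "sem Eqs = (\<lambda>w. sEqs (w ! 0) (w ! 1) (w ! 2))"
| "sem Nat = (\<lambda>w. sNat (w ! 0))"
| "sem Unary = (\<lambda>w. sUn (w ! 0) (w ! 1))"
| "sem Cop = (\<lambda>w. sCop (w ! 0) (w ! 1))"
| "sem Crat = (\<lambda>w. sCrat (w ! 0) (w ! 1) (w ! 2))"
| "sem Cv = (\<lambda>w. sCv (w ! 0) (w ! 1) (w ! 2) (w ! 3))"
| "sem Cm = (\<lambda>w. sCm (w ! 0) (w ! 1) (w ! 2) (w ! 3) (w ! 4))"
| "sem Ver = (\<lambda>w. sVer (w ! 0) (w ! 1) (w ! 2) (w ! 3) (w ! 4) (w ! 5) (w ! 6) (w ! 7) (w ! 8) (w ! 9))"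
| "sem Main = (\<lambda>w. sMain (w ! 0))"

abbreviation Vr :: "nat \<Rightarrow> pat" where "Vr n \<equiv> [Var n]"
abbreviation TT :: pat where "TT \<equiv> [Bit True, Bit True]"
abbreviation TF :: pat where "TF \<equiv> [Bit True, Bit False]"
abbreviation FB :: "bool \<Rightarrow> pat \<Rightarrow> pat" where "FB b p \<equiv> Bit False # Bit b # p"
abbreviation Fb :: pat where "Fb \<equiv> [Bit False]"
abbreviation Tb :: pat where "Tb \<equiv> [Bit True]"

text \<open>A full adder on the last bits a and b with incoming carry c.\<close>
definition add_rule :: "bool \<Rightarrow> bool \<Rightarrow> bool \<Rightarrow> pr rule" where
  "add_rule a b c =
    ((Add, [[Bit c], Vr 0, Vr 1, Vr 2]),
     [(Shift, [[Bit a], Vr 3, Vr 0]), (Shift, [[Bit b], Vr 4, Vr 1]), (Shift, [[Bit ((a \<noteq> b) \<noteq> c)], Vr 5, Vr 2]),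
      (Add, [[Bit ((a \<and> b) \<or> (c \<and> (a \<or> b)))], Vr 3, Vr 4, Vr 5])])"

text \<open>\<open>Shift\<close> may also extend 0 by the bit 0 and -1 by the bit 1 without
  lengthening the word; this sign extension lets operands of different length be added. Addition
  stops when one operand is 0 without carry or -1 with carry, since the other one is then the sum,
  and at 0 + 0 + 1 and (-1) + (-1). Multiplication follows the digits of the first factor down to 0
  or -1.\<close>

definition rules_num :: "pr rule list" where
  "rules_num =
   [((Num, [TT]), []), ((Num, [TF]), []),
    ((Num, [FB False (Vr 0)]), [(Num, [Vr 0])]), ((Num, [FB True (Vr 0)]), [(Num, [Vr 0])]),
    ((Shift, [Fb, TT, TT]), []), ((Shift, [Tb, TF, TF]), []),
    ((Shift, [Fb, Vr 0, FB False (Vr 0)]), [(Num, [Vr 0])]), ((Shift, [Tb, Vr 0, FB True (Vr 0)]), [(Num, [Vr 0])]),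
    ((Add, [Fb, TT, Vr 0, Vr 0]), [(Num, [Vr 0])]), ((Add, [Fb, Vr 0, TT, Vr 0]), [(Num, [Vr 0])]),
    ((Add, [Tb, TF, Vr 0, Vr 0]), [(Num, [Vr 0])]), ((Add, [Tb, Vr 0, TF, Vr 0]), [(Num, [Vr 0])]),
    ((Add, [Tb, TT, TT, FB True TT]), []), ((Add, [Fb, TF, TF, FB False TF]), []),
    add_rule False False False, add_rule False False True, add_rule False True False, add_rule False True True,
    add_rule True False False, add_rule True False True, add_rule True True False, add_rule True True True,
    ((Mul, [TT, Vr 0, TT]), [(Num, [Vr 0])]),
    ((Mul, [TF, Vr 0, Vr 1]), [(Add, [Fb, Vr 0, Vr 1, TT])]),
    ((Mul, [FB False (Vr 0), Vr 1, Vr 2]), [(Mul, [Vr 0, Vr 1, Vr 3]), (Shift, [Fb, Vr 3, Vr 2])]),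
    ((Mul, [FB True (Vr 0), Vr 1, Vr 2]), [(Mul, [Vr 0, Vr 1, Vr 3]), (Shift, [Fb, Vr 3, Vr 4]), (Add, [Fb, Vr 1, Vr 4, Vr 2])]),
    ((Neg, [TF]), []), ((Neg, [FB False (Vr 0)]), [(Neg, [Vr 0])]), ((Neg, [FB True (Vr 0)]), [(Neg, [Vr 0])]),
    ((Nn, [TT]), []), ((Nn, [FB False (Vr 0)]), [(Nn, [Vr 0])]), ((Nn, [FB True (Vr 0)]), [(Nn, [Vr 0])])]"

text \<open>A pattern such as \<open>Vr 0 @ Vr 1\<close> leaves the cut to the choice of the values.
  The premises give it a meaning: an entry must be a numeral, and a row of a flattened matrix must
  have the length of the vector that it is combined with.\<close>

definition rules_vec :: "pr rule list" where
  "rules_vec =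
   [((Nnv, [[]]), []),
    ((Nnv, [Vr 0 @ Vr 1]), [(Nn, [Vr 0]), (Nnv, [Vr 1])]),
    ((Dot, [[], [], TT]), []),
    ((Dot, [Vr 0 @ Vr 1, Vr 2 @ Vr 3, Vr 4]), [(Mul, [Vr 0, Vr 2, Vr 5]), (Dot, [Vr 1, Vr 3, Vr 6]), (Add, [Fb, Vr 5, Vr 6, Vr 4])]),
    ((Zv, [[]]), []),
    ((Zv, [TT @ Vr 0]), [(Zv, [Vr 0])]),
    ((Ax, [Vr 0, [], [], []]), [(Num, [Vr 0])]),
    ((Ax, [Vr 0, Vr 1 @ Vr 2, Vr 3 @ Vr 4, Vr 5 @ Vr 6]),
     [(Mul, [Vr 0, Vr 1, Vr 7]), (Add, [Fb, Vr 7, Vr 3, Vr 5]), (Ax, [Vr 0, Vr 2, Vr 4, Vr 6])]),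
    ((Comb, [[], [], Vr 0]), [(Zv, [Vr 0])]),
    ((Comb, [Vr 0 @ Vr 1, Vr 2 @ Vr 3, Vr 4]), [(Comb, [Vr 1, Vr 3, Vr 5]), (Ax, [Vr 0, Vr 2, Vr 5, Vr 4])]),
    ((Lin, [Vr 0, Vr 1, Vr 2]), [(Neg, [Vr 3]), (Comb, [Vr 4, Vr 1, Vr 5]), (Ax, [Vr 3, Vr 0, Vr 5, Vr 2])]),
    ((Mv, [[], [], [], Vr 0, Vr 1, Vr 2]), []),
    ((Mv, [Vr 0 @ Vr 1, Vr 2 @ Vr 3, Vr 4 @ Vr 5, Vr 6, Vr 7, Vr 8]),
     [(Dot, [Vr 0, Vr 6, Vr 9]), (Dot, [Vr 2, Vr 7, Vr 10]), (Add, [Fb, Vr 9, Vr 10, Vr 11]), (Mul, [Vr 4, Vr 8, Vr 12]),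
      (Add, [Fb, Vr 11, Vr 12, TT]), (Mv, [Vr 1, Vr 3, Vr 5, Vr 6, Vr 7, Vr 8])]),
    ((Chk, [[], [], []]), []),
    ((Chk, [TT @ Vr 0, TT @ Vr 1, Vr 2 @ Vr 3]), [(Nn, [Vr 2]), (Chk, [Vr 0, Vr 1, Vr 3])]),
    ((Chk, [TT @ Vr 0, Vr 1 @ Vr 2, TT @ Vr 3]), [(Nn, [Vr 1]), (Chk, [Vr 0, Vr 2, Vr 3])]),
    ((Chk, [Vr 0 @ Vr 1, Vr 2 @ Vr 3, TT @ Vr 4]), [(Neg, [Vr 0]), (Num, [Vr 2]), (Chk, [Vr 1, Vr 3, Vr 4])]),
    ((Eqj, [[], []]), []),
    ((Eqj, [TT @ Vr 0, TT @ Vr 1]), [(Eqj, [Vr 0, Vr 1])]),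
    ((Eqj, [Vr 0 @ Vr 1, Vr 2 @ Vr 3]), [(Neg, [Vr 0]), (Num, [Vr 2]), (Eqj, [Vr 1, Vr 3])]),
    ((Eqs, [Vr 0, [], Vr 1]), []),
    ((Eqs, [Vr 0, Vr 1 @ Vr 2, Vr 3]), [(Lin, [Vr 1, Vr 0, Vr 4]), (Eqj, [Vr 3, Vr 4]), (Eqs, [Vr 0, Vr 2, Vr 3])])]"

text \<open>These clauses reject all but exact encodings. \<open>Nat\<close> starts from 0 or 1, so
  the leading digit of a positive number is 1. Guessed Bezout coefficients certify lowest terms. A
  leading False excludes zero, as denominator and as numerator after a minus sign. Fractions are
  never divided: multiplied equations express that z is l times p / q.\<close>

definition rules_parse :: "pr rule list" where
  "rules_parse =
   [((Nat, [TT]), []), ((Nat, [FB True TT]), []),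
    ((Nat, [FB False (Bit False # Vr 0)]), [(Nat, [Bit False # Vr 0])]),
    ((Nat, [FB True (Bit False # Vr 0)]), [(Nat, [Bit False # Vr 0])]),
    ((Unary, [TT, []]), []),
    ((Unary, [FB False (Vr 0), Vr 1 @ Vr 1]), [(Unary, [Vr 0, Vr 1])]),
    ((Unary, [FB True (Vr 0), Tb @ Vr 1 @ Vr 1]), [(Unary, [Vr 0, Vr 1])]),
    ((Cop, [Vr 0, Fb @ Vr 1]),
     [(Nat, [Vr 0]), (Nat, [Fb @ Vr 1]), (Mul, [Vr 0, Vr 2, Vr 3]), (Mul, [Fb @ Vr 1, Vr 4, Vr 5]), (Add, [Fb, Vr 3, Vr 5, FB True TT])]),
    ((Crat, [Vr 0, Fb @ Vr 1 @ Vr 2, Vr 3]), [(Cop, [Vr 1, Vr 2]), (Mul, [Vr 1, Vr 0, Vr 4]), (Mul, [Vr 3, Vr 2, Vr 4])]),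
    ((Crat, [Vr 0, Tb @ Fb @ Vr 1 @ Vr 2, Vr 3]),
     [(Cop, [Fb @ Vr 1, Vr 2]), (Mul, [Fb @ Vr 1, Vr 0, Vr 4]), (Mul, [Vr 3, Vr 2, Vr 5]), (Add, [Fb, Vr 4, Vr 5, TT])]),
    ((Cv, [Vr 0, [], [], []]), []),
    ((Cv, [Vr 0, Tb @ Vr 1, Vr 2 @ Vr 3, Vr 4 @ Vr 5]), [(Crat, [Vr 0, Vr 2, Vr 4]), (Cv, [Vr 0, Vr 1, Vr 3, Vr 5])]),
    ((Cm, [Vr 0, [], Vr 1, [], []]), []),
    ((Cm, [Vr 0, Tb @ Vr 1, Vr 2, Vr 3 @ Vr 4, Vr 5 @ Vr 6]), [(Cv, [Vr 0, Vr 2, Vr 3, Vr 5]), (Cm, [Vr 0, Vr 1, Vr 2, Vr 4, Vr 6])])]"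

definition rules_main :: "pr rule list" where
  "rules_main =
   [((Ver, [Vr 0, Vr 1, Vr 2, Vr 3, Vr 4, Vr 5, Vr 6, Vr 7, Vr 8, Vr 9]),
     [(Nnv, [Vr 10]), (Neg, [Vr 12]), (Mv, [Vr 6, Vr 7, Vr 8, Vr 10, Vr 11, Vr 12]), (Mv, [Vr 3, Vr 4, Vr 5, Vr 10, Vr 11, Vr 12]),
      (Dot, [Vr 0, Vr 10, Vr 13]), (Dot, [Vr 1, Vr 11, Vr 14]), (Add, [Fb, Vr 13, Vr 14, Vr 15]), (Mul, [Vr 9, Vr 12, Vr 16]),
      (Add, [Fb, Vr 15, Vr 16, Vr 17]), (Add, [Fb, Vr 17, Vr 18, TT]), (Nn, [Vr 18]),
      (Lin, [Vr 2, Vr 7, Vr 19]), (Lin, [Vr 1, Vr 7, Vr 20]), (Chk, [Vr 19, Vr 20, Vr 11]), (Eqs, [Vr 7, Vr 4, Vr 19])]),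
    ((Main, [Vr 0 @ Vr 1 @ Vr 2 @ Vr 3 @ Vr 8 @ Vr 9 @ Vr 10 @ Vr 11 @ Vr 12 @ Vr 13 @ Vr 14 @ Vr 15 @ Vr 16 @ Vr 17]),
     [(Nat, [Vr 0]), (Nat, [Vr 1]), (Nat, [Vr 2]), (Nat, [Vr 3]),
      (Unary, [Vr 0, Vr 4]), (Unary, [Vr 1, Vr 5]), (Unary, [Vr 2, Vr 6]), (Unary, [Vr 3, Vr 7]),
      (Neg, [Vr 29]), (Add, [Fb, Vr 28, Vr 29, TT]),
      (Cv, [Vr 28, Vr 4, Vr 8, Vr 18]), (Cv, [Vr 28, Vr 5, Vr 9, Vr 19]), (Cv, [Vr 28, Vr 5, Vr 10, Vr 20]),
      (Cm, [Vr 28, Vr 6, Vr 4, Vr 11, Vr 21]), (Cm, [Vr 28, Vr 6, Vr 5, Vr 12, Vr 22]), (Cv, [Vr 28, Vr 6, Vr 13, Vr 23]),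
      (Cm, [Vr 28, Vr 7, Vr 4, Vr 14, Vr 24]), (Cm, [Vr 28, Vr 7, Vr 5, Vr 15, Vr 25]), (Cv, [Vr 28, Vr 7, Vr 16, Vr 26]),
      (Crat, [Vr 28, Vr 17, Vr 27]),
      (Ver, [Vr 18, Vr 19, Vr 20, Vr 21, Vr 22, Vr 23, Vr 24, Vr 25, Vr 26, Vr 27])])]"

definition prog :: "pr rule list" where
  "prog = rules_num @ rules_vec @ rules_parse @ rules_main"

text \<open>30 is the number of variables of the largest rule, the one for
  \<open>Main\<close>.\<close>

lemma prog_ok: "r \<in> set prog \<Longrightarrow> rule_ok 30 r"
proof -
  have "list_all (rule_ok 30) prog"
    by (simp add: prog_def rules_num_def rules_vec_def rules_parse_def rules_main_def add_rule_def rule_ok_def)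
  then show "r \<in> set prog \<Longrightarrow> rule_ok 30 r" by (simp add: list_all_iff)
qed

section \<open>Soundness of the rules\<close>

lemma num_simps [simp]:
  "num [True, True] x \<longleftrightarrow> x = 0" "num [True, False] x \<longleftrightarrow> x = -1"
  "num (False # b # X) y \<longleftrightarrow> (\<exists>x. num X x \<and> y = of_bool b + 2 * x)"
proof -
  show "num [True, True] x \<longleftrightarrow> x = 0" "num [True, False] x \<longleftrightarrow> x = -1"
    by (auto elim: num.cases intro: num.intros)
  show "num (False # b # X) y \<longleftrightarrow> (\<exists>x. num X x \<and> y = of_bool b + 2 * x)"
    using num_bit by (blast elim: num.cases)
qed

lemma vec_Nil_iff [simp]: "vec [] vs \<longleftrightarrow> vs = []"
  using vec_unique vec_Nil by blast

lemma sMulE: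
  assumes "sMul X Y Z"
  obtains x y where "num X x" "num Y y" "num Z (x * y)"
  using assms unfolding sMul_def by blast

lemma sAdd_det: "sAdd [c] X Y Z \<Longrightarrow> num X x \<Longrightarrow> num Y y \<Longrightarrow> num Z (x + y + of_bool c)"
  unfolding sAdd_def using num_unique by blast

lemma sAdd_sum: "sAdd [c] X Y Z \<Longrightarrow> num X x \<Longrightarrow> \<exists>y. num Y y \<and> num Z (x + y + of_bool c)"
  unfolding sAdd_def using num_unique by blast

lemma sAdd_value: "sAdd [c] X Y Z \<Longrightarrow> num X x \<Longrightarrow> num Y y \<Longrightarrow> num Z z \<Longrightarrow> z = x + y + of_bool c"
  using sAdd_det num_unique by blast

lemma sShift_det: "sCons [b] X Y \<Longrightarrow> num X x \<Longrightarrow> num Y (of_bool b + 2 * x)"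
  unfolding sCons_def using num_unique by blast

lemma sAdd_step:
  assumes "sCons [a] X' X" "sCons [b] Y' Y" "sCons [(a \<noteq> b) \<noteq> c] Z' Z" "sAdd [(a \<and> b) \<or> (c \<and> (a \<or> b))] X' Y' Z'"
  shows "sAdd [c] X Y Z"
proof -
  obtain x y where xy: "num X' x" "num Y' y" "num Z' (x + y + of_bool ((a \<and> b) \<or> (c \<and> (a \<or> b))))"
    using assms(4) by (auto simp: sAdd_def)
  have "num X (of_bool a + 2 * x)" "num Y (of_bool b + 2 * y)"
    "num Z (of_bool ((a \<noteq> b) \<noteq> c) + 2 * (x + y + of_bool ((a \<and> b) \<or> (c \<and> (a \<or> b)))))"
    using assms(1-3)[THEN sShift_det] xy by blast+
  moreover have "of_bool ((a \<noteq> b) \<noteq> c) + 2 * (x + y + of_bool ((a \<and> b) \<or> (c \<and> (a \<or> b))))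
    = (of_bool a + 2 * x) + (of_bool b + 2 * y) + of_bool c"
    by (cases a; cases b; cases c) simp_all
  ultimately show ?thesis unfolding sAdd_def by metis
qed

lemma sMul_m1: "sAdd [False] Y Z [True, True] \<Longrightarrow> sMul [True, False] Y Z"
proof -
  assume "sAdd [False] Y Z [True, True]"
  then obtain y z where "num Y y" "num Z z" "y + z = 0" by (auto simp: sAdd_def)
  then show ?thesis unfolding sMul_def by (intro exI[of _ "-1"] exI[of _ y]) (auto simp: add_eq_0_iff)
qed

lemma sMul_0: "sMul X Y M \<Longrightarrow> sCons [False] M Z \<Longrightarrow> sMul (False # False # X) Y Z"
proof (erule sMulE)
  fix x y assume "sCons [False] M Z" and n: "num X x" "num Y y" "num M (x * y)"
  then have "num Z ((2 * x) * y)" using sShift_det[of False M Z "x * y"] by (simp add: mult.assoc)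
  then show ?thesis unfolding sMul_def using n by (intro exI[of _ "2 * x"] exI[of _ y]) simp
qed

lemma sMul_1:
  assumes "sMul X Y M" "sCons [False] M M2" "sAdd [False] Y M2 Z"
  shows "sMul (False # True # X) Y Z"
proof -
  obtain x y where xy: "num X x" "num Y y" "num M (x * y)" using assms by (auto simp: sMul_def)
  have m2: "num M2 (2 * (x * y))" using sShift_det[OF assms(2) xy(3)] by simp
  have "num Z (y + 2 * (x * y))" using sAdd_det[OF assms(3) xy(2) m2] by simp
  then show ?thesis unfolding sMul_def using xy
    by (intro exI[of _ "1 + 2 * x"] exI[of _ y]) (auto simp: algebra_simps)
qed

lemma valid_iff [simp]: "valid sem ((p, ps), bs) \<longleftrightarrow>
   (\<forall>\<sigma>. (\<forall>(p, ws)\<in>set (map (inst \<sigma>) bs). sem p ws) \<longrightarrow> sem p (map (subst \<sigma>) ps))"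
  by (simp add: valid_def)

lemma valid_num: "\<forall>r\<in>set rules_num. valid sem r"
proof -
  have add: "valid sem (add_rule a b c)" for a b c
    unfolding valid_def add_rule_def
    by (cases a; cases b; cases c; simp add: inst_def)
      (blast intro: sAdd_step[of True _ _ True _ _ True, simplified]
        sAdd_step[of True _ _ True _ _ False, simplified]
        sAdd_step[of True _ _ False _ _ True, simplified]
        sAdd_step[of True _ _ False _ _ False, simplified]
        sAdd_step[of False _ _ True _ _ True, simplified]
        sAdd_step[of False _ _ True _ _ False, simplified]
        sAdd_step[of False _ _ False _ _ True, simplified]
        sAdd_step[of False _ _ False _ _ False, simplified])+
  have num: "sNum [True, True]" "sNum [True, False]" "sNum X \<Longrightarrow> sNum (False # b # X)" for X b
    by (auto simp: sNum_def)
  have shift: "sCons [False] [True, True] [True, True]" "sCons [True] [True, False] [True, False]"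
    "sNum X \<Longrightarrow> sCons [b] X (False # b # X)" for X b
    by (auto simp: sNum_def sCons_def)
  have adds: "sNum Y \<Longrightarrow> sAdd [False] [True, True] Y Y" "sNum Y \<Longrightarrow> sAdd [False] Y [True, True] Y"
    "sNum Y \<Longrightarrow> sAdd [True] [True, False] Y Y" "sNum Y \<Longrightarrow> sAdd [True] Y [True, False] Y"
    "sAdd [True] [True, True] [True, True] [False, True, True, True]"
    "sAdd [False] [True, False] [True, False] [False, False, True, False]" for Y
    by (auto simp: sNum_def sAdd_def)
  have mul: "sNum Y \<Longrightarrow> sMul [True, True] Y [True, True]" for Y
    by (auto simp: sNum_def sMul_def)
  have sgn: "sNeg [True, False]" "sNn [True, True]"
    by (simp_all add: sNeg_def sNn_def)
  have neg: "sNeg (False # b # X)" if X: "sNeg X" for X b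
  proof -
    obtain x where "x < 0" "num X x" using X by (auto simp: sNeg_def)
    then show ?thesis unfolding sNeg_def by (intro exI[of _ "of_bool b + 2 * x"]) (auto intro: num_bit)
  qed
  have nn: "sNn (False # b # X)" if X: "sNn X" for X b
  proof -
    obtain x where "x \<ge> 0" "num X x" using X by (auto simp: sNn_def)
    then show ?thesis unfolding sNn_def by (intro exI[of _ "of_bool b + 2 * x"]) (auto intro: num_bit)
  qed
  show ?thesis
    unfolding rules_num_def
    by (simp add: add num shift adds mul sgn neg nn inst_def sMul_m1) (blast intro: sMul_0 sMul_1)
qed

lemma sNnv_Cons: "sNn X \<Longrightarrow> sNnv V \<Longrightarrow> sNnv (X @ V)"
  unfolding sNn_def sNnv_def by (metis vec_Cons set_ConsD)

lemma sDot_Cons: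
  assumes "sMul X Y M" "sDot V U N" "sAdd [False] M N Z"
  shows "sDot (X @ V) (Y @ U) Z"
proof -
  obtain x y where xy: "num X x" "num Y y" "num M (x * y)" using assms by (auto simp: sMul_def)
  obtain vs us where vu: "vec V vs" "vec U us" "length vs = length us" "num N (idot vs us)"
    using assms by (auto simp: sDot_def)
  have "num Z (x * y + idot vs us)" using sAdd_det[OF assms(3) xy(3) vu(4)] by simp
  then show ?thesis unfolding sDot_def using xy vu
    by (intro exI[of _ "x # vs"] exI[of _ "y # us"]) (auto intro: vec_Cons)
qed

lemma sZv_Cons: "sZv V \<Longrightarrow> sZv (True # True # V)"
  unfolding sZv_def using vec_Cons[OF num_0] by (metis append_Cons append_Nil replicate_Suc)

lemma sAx_Nil: "sNum A \<Longrightarrow> sAx A [] [] []"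
  by (auto simp: sNum_def sAx_def)

lemma sAx_Cons:
  assumes "sMul A X M" "sAdd [False] M Y Z" "sAx A V U W"
  shows "sAx A (X @ V) (Y @ U) (Z @ W)"
proof -
  obtain a x where ax: "num A a" "num X x" "num M (a * x)" using assms by (auto simp: sMul_def)
  obtain y where y: "num Y y" "num Z (a * x + y)"
    using sAdd_sum[OF assms(2) ax(3)] by auto
  obtain vs us where vu: "vec V vs" "vec U us" "length vs = length us" "vec W (axpy a vs us)"
    using assms(3) num_unique[OF ax(1)] unfolding sAx_def by blast
  show ?thesis unfolding sAx_def using ax y vu
    by (intro exI[of _ a] exI[of _ "x # vs"] exI[of _ "y # us"]) (auto intro: vec_Cons)
qed

lemma sComb_Nil: "sZv G \<Longrightarrow> sComb [] [] G"
  unfolding sZv_def sComb_def by (elim exE, rename_tac n, intro exI[of _ "[]"], rule_tac x = n in exI) simp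

lemma sComb_Cons:
  assumes "sComb U M H" "sAx A R H G"
  shows "sComb (A @ U) (R @ M) G"
proof -
  obtain us rows m where c: "vec U us" "vec M (concat rows)" "length rows = length us"
    "\<forall>r\<in>set rows. length r = m" "vec H (icomb m us rows)" using assms by (auto simp: sComb_def)
  obtain a vs where a: "num A a" "vec R vs" "length vs = m" "vec G (axpy a vs (icomb m us rows))"
  proof -
    obtain a vs hs where "num A a" "vec R vs" "vec H hs" "length vs = length hs" "vec G (axpy a vs hs)"
      using assms(2) unfolding sAx_def by blast
    moreover from this have "hs = icomb m us rows" using vec_unique c(5) by blast
    ultimately show ?thesis using that length_icomb[OF c(4)] by simp
  qed
  show ?thesis unfolding sComb_def using c a
    by (intro exI[of _ "a # us"] exI[of _ "vs # rows"] exI[of _ m]) (auto intro: vec_Cons vec_append)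
qed

lemma sLinI:
  assumes "sNeg E" "sComb U W H" "sAx E B H G"
  shows "sLin B W G"
proof -
  obtain us rows m where c: "vec U us" "vec W (concat rows)" "length rows = length us"
    "\<forall>r\<in>set rows. length r = m" "vec H (icomb m us rows)" using assms by (auto simp: sComb_def)
  obtain e vs where a: "num E e" "vec B vs" "length vs = m" "vec G (axpy e vs (icomb m us rows))"
  proof -
    obtain e vs hs where "num E e" "vec B vs" "vec H hs" "length vs = length hs" "vec G (axpy e vs hs)"
      using assms(3) unfolding sAx_def by blast
    moreover from this have "hs = icomb m us rows" using vec_unique c(5) by blast
    ultimately show ?thesis using that length_icomb[OF c(4)] by simp
  qed
  have "e < 0" using assms(1) num_unique[OF a(1)] by (auto simp: sNeg_def)
  then show ?thesis unfolding sLin_def using c a by blast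
qed

lemma sMv_Nil: "sMv [] [] [] X Y E"
  by (auto simp: sMv_def intro!: exI[of _ "[]"])

lemma sMv_Cons:
  assumes "sDot T1 X A" "sDot W1 Y B" "sAdd [False] A B C" "sMul H1 E D" "sAdd [False] C D [True, True]"
    "sMv T W H X Y E"
  shows "sMv (T1 @ T) (W1 @ W) (H1 @ H) X Y E"
proof -
  obtain ts xs where t: "vec T1 ts" "vec X xs" "length ts = length xs" "num A (idot ts xs)"
    using assms by (auto simp: sDot_def)
  obtain ws ys where w: "vec W1 ws" "vec Y ys" "length ws = length ys" "num B (idot ws ys)"
    using assms by (auto simp: sDot_def)
  obtain h e where h: "num H1 h" "num E e" "num D (h * e)" using assms by (auto simp: sMul_def)
  have C: "num C (idot ts xs + idot ws ys)" using sAdd_det[OF assms(3) t(4) w(4)] by simp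
  have 0: "idot ts xs + idot ws ys + h * e = 0" using sAdd_value[OF assms(5) C h(3) num_0] by simp
  obtain Ts Ws hs where m: "vec T (concat Ts)" "vec W (concat Ws)" "vec H hs"
    "length Ts = length hs" "length Ws = length hs"
    "\<forall>i<length hs. length (Ts ! i) = length xs \<and> length (Ws ! i) = length ys \<and>
     idot (Ts ! i) xs + idot (Ws ! i) ys + hs ! i * e = 0"
    using assms(6) t w h by (auto simp: sMv_def)
  have *: "\<forall>i<length (h # hs). length ((ts # Ts) ! i) = length xs \<and> length ((ws # Ws) ! i) = length ys \<and>
     idot ((ts # Ts) ! i) xs + idot ((ws # Ws) ! i) ys + (h # hs) ! i * e = 0"
    using m(6) t w 0 by (auto simp: less_Suc_eq_0_disj)
  have "vec (T1 @ T) (concat (ts # Ts))" "vec (W1 @ W) (concat (ws # Ws))" "vec (H1 @ H) (h # hs)"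
    using t w h m by (auto intro: vec_Cons vec_append)
  moreover have "xs' = xs" "ys' = ys" "e' = e" if "vec X xs'" "vec Y ys'" "num E e'" for xs' ys' e'
    using that t w h vec_unique num_unique by auto
  ultimately show ?thesis unfolding sMv_def using * m(4,5)
    by (intro exI[of _ "ts # Ts"] exI[of _ "ws # Ws"] exI[of _ "h # hs"]) (auto simp del: nth_Cons_Suc)
qed

lemma sChk_Cons:
  assumes "num G1 g" "num F1 f" "num Y1 y" "sChk G F Y"
    "0 \<le> y \<and> g \<le> 0 \<and> (g < 0 \<longrightarrow> y = 0) \<and> (g = 0 \<longrightarrow> 0 \<le> f \<and> (y = 0 \<or> f = 0))"
  shows "sChk (G1 @ G) (F1 @ F) (Y1 @ Y)"
proof -
  obtain gs fs ys where c: "vec G gs" "vec F fs" "vec Y ys" "length gs = length ys" "length fs = length ys"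
    "\<forall>i<length ys. 0 \<le> ys ! i \<and> gs ! i \<le> 0 \<and> (gs ! i < 0 \<longrightarrow> ys ! i = 0) \<and>
     (gs ! i = 0 \<longrightarrow> 0 \<le> fs ! i \<and> (ys ! i = 0 \<or> fs ! i = 0))"
    using assms(4) by (auto simp: sChk_def)
  show ?thesis unfolding sChk_def using assms c
    by (intro exI[of _ "g # gs"] exI[of _ "f # fs"] exI[of _ "y # ys"])
      (simp add: vec_Cons All_less_Suc2)
qed

lemma sEqj_Cons:
  assumes "num G1 g" "num H1 h" "sEqj G H" "g = 0 \<longrightarrow> h = 0"
  shows "sEqj (G1 @ G) (H1 @ H)"
proof -
  obtain gs hs where c: "vec G gs" "vec H hs" "length gs = length hs"
    "\<forall>i<length gs. gs ! i = 0 \<longrightarrow> hs ! i = 0"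
    using assms(3) by (auto simp: sEqj_def)
  show ?thesis unfolding sEqj_def using assms c
    by (intro exI[of _ "g # gs"] exI[of _ "h # hs"]) (simp add: vec_Cons All_less_Suc2)
qed

lemma sEqs_Cons:
  assumes "sLin B1 W H" "sEqj G H" "sEqs W B G"
  shows "sEqs W (B1 @ B) G"
proof -
  obtain bs where bs: "vec B1 bs" using assms(1) by (auto simp: sLin_def)
  obtain Bs where Bs: "vec B (concat Bs)" "\<forall>bs\<in>set Bs. \<exists>b H. vec b bs \<and> sLin b W H \<and> sEqj G H"
    using assms(3) by (auto simp: sEqs_def)
  show ?thesis unfolding sEqs_def
    using assms(1,2) bs Bs by (intro exI[of _ "bs # Bs"]) (auto intro: vec_append)
qed

lemma valid_vec: "\<forall>r\<in>set rules_vec. valid sem r"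
proof -
  note T = num_0[unfolded append_Nil]
  have c1: "sChk (True # True # G) (True # True # F) (Y1 @ Y)" if "sNn Y1" "sChk G F Y" for G F Y Y1
    using that sChk_Cons[OF num_0 num_0, of Y1 _ G F Y] by (auto simp: sNn_def)
  have c2: "sChk (True # True # G) (F1 @ F) (True # True # Y)" if "sNn F1" "sChk G F Y" for G F Y F1
    using that sChk_Cons[OF num_0 _ num_0, of F1 _ G F Y] by (auto simp: sNn_def)
  have c3: "sChk (G1 @ G) (F1 @ F) (True # True # Y)" if "sNeg G1" "sNum F1" "sChk G F Y" for G F Y F1 G1
    using that sChk_Cons[OF _ _ num_0, of G1 _ F1 _ G F Y] by (auto simp: sNeg_def sNum_def)
  have e1: "sEqj (True # True # G) (True # True # H)" if "sEqj G H" for G H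
    using that sEqj_Cons[OF num_0 num_0, of G H] by simp
  have e2: "sEqj (G1 @ G) (H1 @ H)" if "sNeg G1" "sNum H1" "sEqj G H" for G H G1 H1
    using that sEqj_Cons[of G1 _ H1 _ G H] by (auto simp: sNeg_def sNum_def)
  have n: "sNnv []" "sDot [] [] [True, True]" "sZv []" "sChk [] [] []" "sEqj [] []" "sEqs X [] Y" for X Y
    by (auto simp: sNnv_def sDot_def sZv_def sChk_def sEqj_def sEqs_def intro!: exI[of _ 0] exI[of _ "[]"])
  show ?thesis
    unfolding rules_vec_def valid_def
    by (simp add: inst_def n c1 c2 c3 e1 e2 sNnv_Cons sZv_Cons sAx_Nil sAx_Cons sComb_Nil sMv_Nil)
      (auto intro: sDot_Cons sAx_Cons sComb_Cons sLinI sMv_Cons sEqs_Cons)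
qed

declare nat_bits.simps [simp del]

lemma enc_nat_0: "enc_nat 0 = [True, True]"
  by (simp add: enc_nat_def nat_bits.simps)

lemma enc_nat_pos: "0 < n \<Longrightarrow> enc_nat n = False # odd n # enc_nat (n div 2)"
  by (simp add: enc_nat_def nat_bits.simps[of n])

lemma num_enc_nat: "num (enc_nat n) (int n)"
proof (induction n rule: less_induct)
  case (less n)
  show ?case
  proof (cases "n = 0")
    case False
    then have "num (enc_nat (n div 2)) (int (n div 2))" using less by simp
    from num_bit[OF this, of "odd n"]
    have "num (enc_nat n) (of_bool (odd n) + 2 * int (n div 2))" using False by (simp add: enc_nat_pos)
    moreover have "of_bool (odd n) + 2 * int (n div 2) = int n"
      by (cases "even n") (auto elim!: evenE oddE)
    ultimately show ?thesis by simp
  qed (simp add: enc_nat_0)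
qed

text \<open>A canonical word that starts with False encodes a positive number, so a further low bit,
  even a zero, does not create a redundant leading digit.\<close>

lemma sNat_bit: "sNat (False # X) \<Longrightarrow> sNat (False # b # False # X)"
proof -
  assume "sNat (False # X)"
  then obtain n where n: "False # X = enc_nat n" by (auto simp: sNat_def)
  then have "n > 0" by (cases "n = 0") (auto simp: enc_nat_0)
  then have "enc_nat (2 * n + of_bool b) = False # b # False # X"
    by (subst enc_nat_pos) (auto simp: n)
  then show ?thesis unfolding sNat_def by metis
qed

lemma sUn_bit: "sUn X U \<Longrightarrow> sUn (False # b # X) ((if b then [True] else []) @ U @ U)"
proof -
  assume "sUn X U"
  then obtain n where n: "num X (int n)" "U = replicate n True" unfolding sUn_def by blast
  have "num (False # b # X) (int (of_bool b + 2 * n))" using num_bit[OF n(1), of b] by simp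
  moreover have "(if b then [True] else []) @ U @ U = replicate (of_bool b + 2 * n) True"
    unfolding n(2) replicate_add mult_2 by simp
  ultimately show ?thesis unfolding sUn_def by blast
qed

lemma sCopI:
  assumes "sNat P" "sNat (False # Q)" "sMul P A X" "sMul (False # Q) B Y" "sAdd [False] X Y [False, True, True, True]"
  shows "sCop P (False # Q)"
proof -
  obtain p where p: "P = enc_nat p" using assms by (auto simp: sNat_def)
  obtain q where q: "False # Q = enc_nat q" using assms by (auto simp: sNat_def)
  then have "q > 0" by (cases "q = 0") (auto simp: enc_nat_0)
  have np: "num P (int p)" and nq: "num (False # Q) (int q)" unfolding p q by (rule num_enc_nat)+
  obtain a where a: "num X (int p * a)" using assms(3) num_unique[OF np] by (auto simp: sMul_def)
  obtain b where b: "num Y (int q * b)" using assms(4) num_unique[OF nq] by (auto simp del: num_simps simp: sMul_def)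
  have "int p * a + int q * b = 1"
    using sAdd_value[OF assms(5) a b, of 1] by auto
  then have "coprime (int p) (int q)"
    by (metis coprime_def dvd_add dvd_mult2)
  then show ?thesis unfolding sCop_def using p q \<open>q > 0\<close> by auto
qed

lemma enc_rat_coprime:
  assumes "0 < q" "coprime p q"
  shows "enc_rat (rat_of_int (int p) / rat_of_int (int q)) = False # enc_nat p @ enc_nat q"
    "0 < p \<Longrightarrow> enc_rat (- rat_of_int (int p) / rat_of_int (int q)) = True # enc_nat p @ enc_nat q"
proof -
  have "quotient_of (Fract (int p) (int q)) = (int p, int q)" "quotient_of (Fract (- int p) (int q)) = (- int p, int q)"
    using assms by (simp_all add: quotient_of_Fract normalize_stable)
  then show "enc_rat (rat_of_int (int p) / rat_of_int (int q)) = False # enc_nat p @ enc_nat q"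
    "0 < p \<Longrightarrow> enc_rat (- rat_of_int (int p) / rat_of_int (int q)) = True # enc_nat p @ enc_nat q"
    by (simp_all add: enc_rat_def Fract_of_int_quotient enc_int_def)
qed

lemma sCrat_pos:
  assumes "sCop P Q" "sMul P L M" "sMul Z Q M"
  shows "sCrat L (False # P @ Q) Z"
proof -
  obtain p q where pq: "P = enc_nat p" "Q = enc_nat q" "0 < q" "coprime p q" using assms by (auto simp: sCop_def)
  have np: "num P (int p)" and nq: "num Q (int q)" unfolding pq by (rule num_enc_nat)+
  obtain l where l: "num L l" "num M (int p * l)" using assms(2) num_unique[OF np] by (auto simp: sMul_def)
  obtain z where z: "num Z z" "num M (z * int q)" using assms(3) num_unique[OF nq] by (auto simp: sMul_def)
  have "z * int q = int p * l" using num_unique l z by blast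
  then have "rat_of_int z * rat_of_int (int q) = rat_of_int (int p) * rat_of_int l" by (metis of_int_mult)
  then have "rat_of_int z = rat_of_int l * (rat_of_int (int p) / rat_of_int (int q))"
    using pq(3) by (simp add: field_simps)
  then show ?thesis unfolding sCrat_def
    using l z pq enc_rat_coprime(1)[OF pq(3,4)] by metis
qed

lemma sCrat_neg:
  assumes "sCop (False # P) Q" "sMul (False # P) L M" "sMul Z Q M'" "sAdd [False] M M' [True, True]"
  shows "sCrat L (True # False # P @ Q) Z"
proof -
  obtain p q where pq: "False # P = enc_nat p" "Q = enc_nat q" "0 < q" "coprime p q" using assms by (auto simp: sCop_def)
  have "p > 0" using pq(1) by (cases "p = 0") (auto simp: enc_nat_0)
  have np: "num (False # P) (int p)" and nq: "num Q (int q)" unfolding pq by (rule num_enc_nat)+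
  obtain l where l: "num L l" "num M (int p * l)" using assms(2) num_unique[OF np] by (auto simp del: num_simps simp: sMul_def)
  obtain z where z: "num Z z" "num M' (z * int q)" using assms(3) num_unique[OF nq] by (auto simp: sMul_def)
  have "int p * l + z * int q = 0" using sAdd_value[OF assms(4) l(2) z(2) num_0] by simp
  then have "z * int q = - int p * l" by simp
  then have "rat_of_int z * rat_of_int (int q) = - rat_of_int (int p) * rat_of_int l" by (metis of_int_mult of_int_minus)
  then have "rat_of_int z = rat_of_int l * (- rat_of_int (int p) / rat_of_int (int q))"
    using pq(3) by (simp add: field_simps)
  moreover have "enc_rat (- rat_of_int (int p) / rat_of_int (int q)) = True # False # P @ Q"
    using enc_rat_coprime(2)[OF pq(3,4) \<open>p > 0\<close>] by (simp flip: pq(1,2))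
  ultimately show ?thesis unfolding sCrat_def using l z by metis
qed

lemma enc_vec_simps [simp]: "enc_vec [] = []" "enc_vec (x # xs) = enc_rat x @ enc_vec xs"
  by (simp_all add: enc_vec_def)

lemma enc_mat_simps [simp]: "enc_mat [] = []" "enc_mat (x # xs) = enc_vec x @ enc_mat xs"
  by (simp_all add: enc_mat_def)

lemma sCv_Cons:
  assumes "sCrat L R X" "sCv L U V Z"
  shows "sCv L (True # U) (R @ V) (X @ Z)"
proof -
  obtain \<rho> l x where r: "R = enc_rat \<rho>" "num L l" "num X x" "of_int x = of_int l * \<rho>"
    using assms by (auto simp: sCrat_def)
  obtain vs zs where v: "length vs = length U" "V = enc_vec vs" "vec Z zs" "length zs = length vs"
    "\<forall>i<length vs. of_int (zs ! i) = of_int l * vs ! i"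
    using assms(2) r(2) by (auto simp: sCv_def)
  have "\<forall>i<length (\<rho> # vs). of_int ((x # zs) ! i) = of_int l * (\<rho> # vs) ! i"
    using r v(5) by (auto simp: less_Suc_eq_0_disj)
  then show ?thesis unfolding sCv_def using r v num_unique
    by (intro exI[of _ "\<rho> # vs"] exI[of _ "x # zs"]) (auto intro: vec_Cons)
qed

lemma sCm_Cons:
  assumes "sCv L U R X" "sCm L K U V Z"
  shows "sCm L (True # K) U (R @ V) (X @ Z)"
proof -
  obtain vs zs where v: "length vs = length U" "R = enc_vec vs" "vec X zs" "length zs = length vs"
    "\<And>l i. num L l \<Longrightarrow> i<length vs \<Longrightarrow> of_int (zs ! i) = of_int l * vs ! i"
    using assms(1) by (auto simp: sCv_def)
  obtain M Zs where m: "length M = length K" "\<forall>row\<in>set M. length row = length U" "V = enc_mat M"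
    "vec Z (concat Zs)" "length Zs = length M" "\<forall>row\<in>set Zs. length row = length U"
    "\<And>l i j. num L l \<Longrightarrow> i<length M \<Longrightarrow> j<length U \<Longrightarrow> of_int (Zs ! i ! j) = of_int l * M ! i ! j"
    using assms(2) by (auto simp: sCm_def)
  have "of_int ((zs # Zs) ! i ! j) = of_int l * (vs # M) ! i ! j" if "num L l" "i < Suc (length M)" "j < length U" for l i j
    using v(1,5) m(7) that by (cases i) auto
  then show ?thesis unfolding sCm_def using v(1-4) m(1-6)
    by (intro exI[of _ "vs # M"] exI[of _ "zs # Zs"]) (auto intro: vec_append)
qed

lemma valid_parse: "\<forall>r\<in>set rules_parse. valid sem r"
proof -
  have n: "sNat [True, True]" "sNat [False, True, True, True]"
  proof -
    have "enc_nat 1 = [False, True, True, True]" by (simp add: enc_nat_pos enc_nat_0)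
    then show "sNat [True, True]" "sNat [False, True, True, True]" unfolding sNat_def using enc_nat_0 by metis+
  qed
  have u: "sUn [True, True] []" by (auto simp: sUn_def)
  have u0: "sUn (False # False # X) (U @ U)" "sUn (False # True # X) (True # U @ U)" if "sUn X U" for X U
    using sUn_bit[OF that, of False] sUn_bit[OF that, of True] by simp_all
  have c: "sCv L [] [] []" "sCm L [] U [] []" for L U
    by (auto simp: sCv_def sCm_def intro!: exI[of _ "[]"])
  show ?thesis
    unfolding rules_parse_def valid_def
    by (simp add: inst_def n u u0 c sNat_bit sCv_Cons sCm_Cons)
      (auto intro: sCopI sCrat_pos sCrat_neg)
qed

lemma sVerI:
  "\<lbrakk>sNnv X; sNeg E; sMv T W h X Y E; sMv A B a X Y E; sDot c X t1; sDot d Y t2; sAdd [False] t1 t2 t3;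
    sMul al E t4; sAdd [False] t3 t4 t5; sAdd [False] t5 t6 [True, True]; sNn t6; sLin q W G; sLin d W F;
    sChk G F Y; sEqs W B G\<rbrakk> \<Longrightarrow> sVer c d q A B a T W h al"
  unfolding sVer_def by (intro exI conjI)

lemma sMainI:
  "\<lbrakk>sNat en; sNat em; sNat ek; sNat er; sUn en uN; sUn em uM; sUn ek uK; sUn er uR; sNeg L'; sAdd [False] L L' [True, True];
    sCv L uN Vc c; sCv L uM Vd d; sCv L uM Vq q; sCm L uK uN VA A; sCm L uK uM VB B; sCv L uK Va a;
    sCm L uR uN VT T; sCm L uR uM VW W; sCv L uR Vh h; sCrat L Val al; sVer c d q A B a T W h al\<rbrakk> \<Longrightarrow>
   sMain (en @ em @ ek @ er @ Vc @ Vd @ Vq @ VA @ VB @ Va @ VT @ VW @ Vh @ Val)"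
  unfolding sMain_def by (intro exI conjI) (rule refl | assumption)+

lemma valid_main: "\<forall>r\<in>set rules_main. valid sem r"
  unfolding rules_main_def
  by (simp add: inst_def; intro conjI allI impI; elim conjE; (rule sVerI | rule sMainI); assumption)

lemma prog_valid: "r \<in> set prog \<Longrightarrow> valid sem r"
  using valid_num valid_vec valid_parse valid_main by (auto simp: prog_def)

section \<open>Short solutions and linear programming duality\<close>

text \<open>Siegel's lemma. Among the integer vectors with entries from 0 to H there are more than
  values of the linear map given by E, so two of them have the same image, and their difference is
  the desired kernel vector. H is the smallest convenient number for which the count works.\<close>

lemma siegel:
  fixes E :: "('a \<Rightarrow> int) set" and M :: nat
  assumes A: "finite A" and E: "finite E" "card E < card A"
    and M: "\<And>f a. f \<in> E \<Longrightarrow> a \<in> A \<Longrightarrow> \<bar>f a\<bar> \<le> int M"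
  defines "H \<equiv> (2 * card A * M + 1) ^ card E"
  shows "\<exists>c. (\<exists>a\<in>A. c a \<noteq> 0) \<and> (\<forall>a\<in>A. \<bar>c a\<bar> \<le> int H) \<and> (\<forall>f\<in>E. (\<Sum>a\<in>A. c a * f a) = 0)"
proof -
  define K where "K = card A * M * H"
  define B where "B = PiE A (\<lambda>_. {0..int H})"
  define D where "D = PiE E (\<lambda>_. {- int K..int K})"
  define F where "F = (\<lambda>c. \<lambda>f\<in>E. \<Sum>a\<in>A. c a * f a)"
  have "F c \<in> D" if "c \<in> B" for c
  proof -
    have *: "\<bar>\<Sum>a\<in>A. c a * f a\<bar> \<le> int K" if "f \<in> E" for f
    proof -
      have "\<bar>\<Sum>a\<in>A. c a * f a\<bar> \<le> (\<Sum>a\<in>A. \<bar>c a * f a\<bar>)" by (rule sum_abs)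
      also have "\<dots> \<le> (\<Sum>a\<in>A. int H * int M)"
      proof (rule sum_mono)
        fix a assume a: "a \<in> A"
        then have "c a \<in> {0..int H}" using \<open>c \<in> B\<close> unfolding B_def by (rule PiE_mem[rotated])
        then have "\<bar>c a\<bar> \<le> int H" by simp
        then show "\<bar>c a * f a\<bar> \<le> int H * int M"
          unfolding abs_mult by (rule mult_mono) (use M[OF \<open>f \<in> E\<close> a] in auto)
      qed
      finally show ?thesis by (simp add: K_def ac_simps)
    qed
    have "(\<Sum>a\<in>A. c a * f a) \<in> {- int K..int K}" if "f \<in> E" for f
      using *[OF that] unfolding atLeastAtMost_iff by linarith
    then show ?thesis unfolding D_def F_def by auto
  qed
  then have "F ` B \<subseteq> D" by auto
  have "nat (2 * int K + 1) = 2 * K + 1" by linarith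
  then have cD: "finite D" "card D = (2 * K + 1) ^ card E"
    using E by (auto simp: D_def card_PiE intro!: finite_PiE)
  have "nat (int H + 1) = H + 1" by linarith
  then have cB: "card B = (H + 1) ^ card A"
    using A by (simp add: B_def card_PiE)
  have "2 * K + 1 \<le> (2 * card A * M + 1) * (H + 1)" by (simp add: K_def algebra_simps)
  then have "(2 * K + 1) ^ card E \<le> ((2 * card A * M + 1) * (H + 1)) ^ card E"
    by (rule power_mono) simp
  \<comment> \<open>H was defined as the first factor raised to the power \<open>card E\<close>;
    replacing it by H + 1 gains the strict inequality.\<close>
  also have "\<dots> = H * (H + 1) ^ card E" by (simp only: power_mult_distrib H_def)
  also have "\<dots> < (H + 1) ^ Suc (card E)" by simp
  also have "\<dots> \<le> (H + 1) ^ card A" using E by (intro power_increasing) auto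
  finally have "card (F ` B) < card B"
    using card_mono[OF cD(1) \<open>F ` B \<subseteq> D\<close>] cD cB by simp
  then have "\<not> inj_on F B" by (rule pigeonhole)
  then obtain c1 c2 where c: "c1 \<in> B" "c2 \<in> B" "c1 \<noteq> c2" "F c1 = F c2" by (auto simp: inj_on_def)
  obtain a where "a \<in> A" "c1 a \<noteq> c2 a" using c by (metis B_def PiE_ext)
  moreover have "\<bar>c1 a - c2 a\<bar> \<le> int H" if "a \<in> A" for a
    using c that by (auto simp: B_def PiE_iff abs_le_iff) (smt (verit, best))+
  moreover have "(\<Sum>a\<in>A. (c1 a - c2 a) * f a) = 0" if "f \<in> E" for f
    using fun_cong[OF c(4), of f] that by (simp add: F_def algebra_simps sum_subtractf)
  ultimately show ?thesis by (intro exI[of _ "\<lambda>a. c1 a - c2 a"]) auto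
qed

text \<open>Index N is the homogenising coordinate. Choosing the support C of a solution minimal forces
  every kernel vector on C that vanishes at N to be zero, so the short kernel vector provided by
  the pigeonhole principle is nonzero at N.\<close>
lemma small_homogeneous_solution:
  fixes R :: "(nat \<Rightarrow> int) set" and z :: "nat \<Rightarrow> real"
  assumes R: "finite R" and M: "\<And>f j. f \<in> R \<Longrightarrow> j \<le> N \<Longrightarrow> \<bar>f j\<bar> \<le> int M"
    and z: "z N = 1" "\<And>f. f \<in> R \<Longrightarrow> (\<Sum>j\<le>N. real_of_int (f j) * z j) = 0"
  shows "\<exists>p :: nat \<Rightarrow> int. p N > 0 \<and> (\<forall>j\<le>N. \<bar>p j\<bar> \<le> int ((2 * (N + 1) * M + 1) ^ N)) \<and>
    (\<forall>f\<in>R. (\<Sum>j\<le>N. f j * p j) = 0)"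
proof -
  define good where "good = (\<lambda>C. C \<subseteq> {..<N} \<and> (\<exists>z :: nat \<Rightarrow> real. z N = 1 \<and>
    (\<forall>j\<in>{..<N} - C. z j = 0) \<and> (\<forall>f\<in>R. (\<Sum>j\<le>N. real_of_int (f j) * z j) = 0)))"
  have "good {..<N}" using z by (auto simp: good_def)
  then obtain C where C: "good C" "\<And>C'. good C' \<Longrightarrow> card C \<le> card C'"
    using ex_has_least_nat[of good _ card] by metis
  obtain z :: "nat \<Rightarrow> real" where z: "z N = 1" "\<And>j. j < N \<Longrightarrow> j \<notin> C \<Longrightarrow> z j = 0"
    "\<And>f. f \<in> R \<Longrightarrow> (\<Sum>j\<le>N. real_of_int (f j) * z j) = 0"
    using C(1) by (auto simp: good_def)
  have CN: "C \<subseteq> {..<N}" "finite C" using C(1) finite_subset by (auto simp: good_def)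
  define D where "D = insert N C"
  have D: "finite D" "D \<subseteq> {..N}" "card D = Suc (card C)" "N \<in> D"
    using CN by (auto simp: D_def card_insert_if)
  have sumD: "(\<Sum>j\<le>N. g j) = (\<Sum>j\<in>D. g j)" if "\<And>j. j < N \<Longrightarrow> j \<notin> C \<Longrightarrow> g j = 0" for g :: "nat \<Rightarrow> 'b::comm_monoid_add"
    using D that by (intro sum.mono_neutral_right) (auto simp: D_def nat_less_le)
  have cardC: "card C \<le> N" using card_mono[of "{..<N}" C] CN by simp
  define ker :: "(nat \<Rightarrow> int) set \<Rightarrow> (nat \<Rightarrow> real) \<Rightarrow> bool" where
    "ker = (\<lambda>R v. \<forall>f\<in>R. (\<Sum>j\<in>D. real_of_int (f j) * v j) = 0)"
  have kz: "(\<Sum>j\<in>D. real_of_int (f j) * z j) = 0" if "f \<in> R" for f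
    using z(3)[OF that] sumD[of "\<lambda>j. real_of_int (f j) * z j"] z(2) by simp
  have inj: "v j = 0" if v: "ker R v" "v N = 0" and j: "j \<in> C" for v j
  proof (rule ccontr)
    assume "v j \<noteq> 0"
    \<comment> \<open>The multiple of v is chosen to cancel coordinate j. Coordinate N keeps the
      value 1 because v vanishes there, so z' is a solution with smaller support.\<close>
    define z' where "z' = (\<lambda>i. if i \<in> D then z i - z j / v j * v i else 0)"
    have "(\<Sum>i\<le>N. real_of_int (f i) * z' i) = 0" if "f \<in> R" for f
    proof -
      have "(\<Sum>i\<le>N. real_of_int (f i) * z' i) = (\<Sum>i\<in>D. real_of_int (f i) * z' i)"
        by (rule sumD) (auto simp: z'_def D_def)
      also have "\<dots> = (\<Sum>i\<in>D. real_of_int (f i) * z i) - z j / v j * (\<Sum>i\<in>D. real_of_int (f i) * v i)"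
        unfolding sum_distrib_left sum_subtractf[symmetric]
        by (rule sum.cong) (simp_all add: z'_def algebra_simps)
      also have "\<dots> = 0" using kz that v by (simp add: ker_def)
      finally show ?thesis .
    qed
    then have "good (C - {j})"
      using CN D v j \<open>v j \<noteq> 0\<close> z(1,2) unfolding good_def
      by (intro conjI exI[of _ z']) (auto simp: z'_def D_def)
    then have "card C \<le> card (C - {j})" by (rule C(2))
    then show False using card_Diff1_less[OF CN(2) j] by simp
  qed
  \<comment> \<open>A smallest set of equations with the same kernel stands in for a basis of the
    row space; its size plays the part of the rank.\<close>
  define gen where "gen = (\<lambda>R'. R' \<subseteq> R \<and> (\<forall>v. ker R' v \<longrightarrow> ker R v))"
  have "gen R" by (simp add: gen_def)
  then obtain R' where R': "gen R'" "\<And>R''. gen R'' \<Longrightarrow> card R' \<le> card R''"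
    using ex_has_least_nat[of gen _ card] by metis
  have finR': "finite R'" "R' \<subseteq> R" using R' R finite_subset by (auto simp: gen_def)
  have "card R' \<le> card C"
  proof (rule ccontr)
    assume "\<not> card R' \<le> card C"
    \<comment> \<open>The transposed system: the unknowns are coefficients of the rows, with one
      equation for each column in C. More rows than columns would give a nontrivial relation between
      the rows, and only its existence is used.\<close>
    define E :: "((nat \<Rightarrow> int) \<Rightarrow> int) set" where "E = (\<lambda>j f. f j) ` C"
    have E: "finite E" "card E < card R'"
      using CN card_image_le[OF CN(2), of "\<lambda>j (f :: nat \<Rightarrow> int). f j"] \<open>\<not> card R' \<le> card C\<close> by (auto simp: E_def)
    have bnd: "\<bar>e f\<bar> \<le> int M" if "e \<in> E" "f \<in> R'" for e f
      using that M finR' CN by (force simp: E_def)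
    have "\<exists>c. (\<exists>f\<in>R'. c f \<noteq> 0) \<and> (\<forall>f\<in>R'. \<bar>c f\<bar> \<le> int ((2 * card R' * M + 1) ^ card E)) \<and>
      (\<forall>e\<in>E. (\<Sum>f\<in>R'. c f * e f) = 0)"
      by (rule siegel[OF finR'(1) E]) (rule bnd)
    then obtain c where c: "\<exists>f\<in>R'. c f \<noteq> 0" "\<And>e. e \<in> E \<Longrightarrow> (\<Sum>f\<in>R'. c f * e f) = 0"
      by blast
    have cC: "(\<Sum>f\<in>R'. c f * f j) = 0" if "j \<in> C" for j
      using c(2)[of "\<lambda>f. f j"] that by (auto simp: E_def)
    have cC': "(\<Sum>f\<in>R'. real_of_int (c f) * real_of_int (f j)) = 0" if "j \<in> C" for j
      using arg_cong[OF cC[OF that], of real_of_int] by simp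
    \<comment> \<open>As z is a solution with z N = 1, column N is a combination of the columns in
      C, so the relation between the rows extends to it.\<close>
    have "(\<Sum>f\<in>R'. real_of_int (c f) * real_of_int (f N)) = 0"
    proof -
      have fN: "real_of_int (f N) = - (\<Sum>j\<in>C. real_of_int (f j) * z j)" if "f \<in> R'" for f
      proof -
        have "N \<notin> C" using CN by auto
        then show ?thesis using kz[of f] that finR' CN z(1) by (auto simp: D_def)
      qed
      have "(\<Sum>f\<in>R'. real_of_int (c f) * real_of_int (f N)) =
        - (\<Sum>f\<in>R'. \<Sum>j\<in>C. (real_of_int (c f) * real_of_int (f j)) * z j)"
        unfolding sum_negf[symmetric] by (rule sum.cong) (simp_all add: fN sum_distrib_left mult.assoc sum_negf)
      also have "\<dots> = - (\<Sum>j\<in>C. (\<Sum>f\<in>R'. real_of_int (c f) * real_of_int (f j)) * z j)"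
        by (subst sum.swap) (simp add: sum_distrib_right)
      finally show ?thesis using cC' by simp
    qed
    then have cD: "(\<Sum>f\<in>R'. real_of_int (c f) * real_of_int (f j)) = 0" if "j \<in> D" for j
      using that cC' by (auto simp: D_def)
    obtain f0 where f0: "f0 \<in> R'" "c f0 \<noteq> 0" using c(1) by blast
    have "ker R v" if v: "ker (R' - {f0}) v" for v
    proof -
      let ?d = "\<lambda>f. \<Sum>j\<in>D. real_of_int (f j) * v j"
      have "(\<Sum>f\<in>R'. real_of_int (c f) * ?d f) = (\<Sum>j\<in>D. (\<Sum>f\<in>R'. real_of_int (c f) * real_of_int (f j)) * v j)"
        unfolding sum_distrib_left sum_distrib_right by (subst sum.swap) (simp add: mult.assoc)
      also have "\<dots> = 0" using cD by simp
      also have "(\<Sum>f\<in>R'. real_of_int (c f) * ?d f) = real_of_int (c f0) * ?d f0 + (\<Sum>f\<in>R' - {f0}. real_of_int (c f) * ?d f)"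
        using finR' f0 by (simp add: sum.remove)
      also have "(\<Sum>f\<in>R' - {f0}. real_of_int (c f) * ?d f) = 0"
        using v by (intro sum.neutral) (simp add: ker_def)
      finally have "?d f0 = 0" using f0 by simp
      then have "ker R' v" using v by (auto simp: ker_def)
      then show ?thesis using R'(1) by (simp add: gen_def)
    qed
    then have "gen (R' - {f0})" using finR' by (auto simp: gen_def)
    then have "card R' \<le> card (R' - {f0})" by (rule R'(2))
    then show False using card_Diff1_less[OF finR'(1) f0(1)] by simp
  qed
  then have "card R' < card D" using D by simp
  moreover have "\<bar>f j\<bar> \<le> int M" if "f \<in> R'" "j \<in> D" for f j
    using that M finR' D by blast
  ultimately obtain c where c: "\<exists>j\<in>D. c j \<noteq> 0" "\<And>j. j \<in> D \<Longrightarrow> \<bar>c j\<bar> \<le> int ((2 * card D * M + 1) ^ card R')"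
    "\<And>f. f \<in> R' \<Longrightarrow> (\<Sum>j\<in>D. c j * f j) = 0"
    using siegel[OF D(1) finR'(1), of M] by blast
  have "ker R' (\<lambda>j. real_of_int (c j))"
  proof -
    have "(\<Sum>j\<in>D. real_of_int (f j) * real_of_int (c j)) = 0" if "f \<in> R'" for f
      using arg_cong[OF c(3)[OF that], of real_of_int] by (simp add: mult.commute)
    then show ?thesis by (simp add: ker_def)
  qed
  then have kc: "ker R (\<lambda>j. real_of_int (c j))" using R'(1) by (simp add: gen_def)
  have kc': "(\<Sum>j\<in>D. f j * c j) = 0" if "f \<in> R" for f
  proof -
    have "real_of_int (\<Sum>j\<in>D. f j * c j) = 0" using kc that by (simp add: ker_def)
    then show ?thesis by linarith
  qed
  have cN: "c N \<noteq> 0"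
  proof
    assume "c N = 0"
    then have "c j = 0" if "j \<in> C" for j using inj[OF kc _ that] by simp
    then show False using c(1) \<open>c N = 0\<close> by (auto simp: D_def)
  qed
  define p where "p = (\<lambda>j. if j \<in> D then sgn (c N) * c j else 0)"
  have "p N > 0" using cN D by (auto simp: p_def sgn_if)
  moreover have "\<bar>p j\<bar> \<le> int ((2 * (N + 1) * M + 1) ^ N)" if "j \<le> N" for j
  proof -
    have "(2 * card D * M + 1) ^ card R' \<le> (2 * (N + 1) * M + 1) ^ card R'"
      using D cardC by (intro power_mono add_mono mult_le_mono) auto
    also have "\<dots> \<le> (2 * (N + 1) * M + 1) ^ N"
      using cardC \<open>card R' \<le> card C\<close> by (intro power_increasing) auto
    finally have le: "int ((2 * card D * M + 1) ^ card R') \<le> int ((2 * (N + 1) * M + 1) ^ N)"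
      by (simp only: of_nat_le_iff)
    show ?thesis
    proof (cases "j \<in> D")
      case True
      then have "\<bar>p j\<bar> = \<bar>c j\<bar>" using cN by (simp add: p_def abs_mult)
      then show ?thesis using order_trans[OF c(2)[OF True] le] by simp
    qed (simp add: p_def)
  qed
  moreover have "(\<Sum>j\<le>N. f j * p j) = 0" if "f \<in> R" for f
  proof -
    have "(\<Sum>j\<le>N. f j * p j) = (\<Sum>j\<in>D. f j * p j)" by (rule sumD) (auto simp: p_def D_def)
    also have "\<dots> = sgn (c N) * (\<Sum>j\<in>D. f j * c j)"
      unfolding sum_distrib_left by (rule sum.cong) (simp_all add: p_def algebra_simps)
    finally show ?thesis using kc'[OF that] by simp
  qed
  ultimately show ?thesis by blast
qed

section \<open>Short solutions of systems of inequalities\<close>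

definition dotp :: "nat \<Rightarrow> (nat \<Rightarrow> int) \<Rightarrow> (nat \<Rightarrow> real) \<Rightarrow> real" where
  "dotp N f z = (\<Sum>j<N. real_of_int (f j) * z j)"

lemma dotp_line: "dotp N f (\<lambda>j. z j + t * (w j - z j)) = dotp N f z + t * (dotp N f w - dotp N f z)"
  unfolding dotp_def sum_subtractf[symmetric] sum_distrib_left sum.distrib[symmetric]
  by (rule sum.cong) (simp_all add: algebra_simps)

lemma dotp_scale: "dotp N f (\<lambda>j. t * z j) = t * dotp N f z"
  unfolding dotp_def sum_distrib_left by (rule sum.cong) simp_all

text \<open>After scaling, strict constraints read 1 <= f. Take a solution z with as many tight
  constraints as possible. Any w that satisfies these as equations is again a solution: otherwise
  the way from z to w reaches some further constraint with equality before any is violated,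
  contradicting the choice of z. So it suffices to solve linear equations, and a short homogeneous
  solution provides numerators over the common denominator p N, which is dropped because the
  original constraints are homogeneous.\<close>

theorem small_solution:
  fixes Ge Gt :: "(nat \<Rightarrow> int) set" and z :: "nat \<Rightarrow> real"
  assumes fin: "finite Ge" "finite Gt" and M: "1 \<le> M" "\<And>f j. f \<in> Ge \<union> Gt \<Longrightarrow> j < N \<Longrightarrow> \<bar>f j\<bar> \<le> int M"
    and z: "\<And>f. f \<in> Ge \<Longrightarrow> 0 \<le> dotp N f z" "\<And>f. f \<in> Gt \<Longrightarrow> 0 < dotp N f z"
  shows "\<exists>p :: nat \<Rightarrow> int. (\<forall>j<N. \<bar>p j\<bar> \<le> int ((2 * (N + 1) * M + 1) ^ N)) \<and>
    (\<forall>f\<in>Ge. 0 \<le> (\<Sum>j<N. f j * p j)) \<and> (\<forall>f\<in>Gt. 0 < (\<Sum>j<N. f j * p j))"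
proof -
  define G where "G = Ge \<union> Gt"
  have finG: "finite G" using fin by (simp add: G_def)
  define b :: "(nat \<Rightarrow> int) \<Rightarrow> int" where "b = (\<lambda>f. if f \<in> Gt then 1 else 0)"
  define sol where "sol = (\<lambda>z. \<forall>f\<in>G. of_int (b f) \<le> dotp N f z)"
  define tight where "tight = (\<lambda>z. {f\<in>G. dotp N f z = of_int (b f)})"
  have "\<exists>z. sol z"
  proof -
    \<comment> \<open>Dividing by the smallest value of a strict constraint makes all these values
      at least 1; the inserted 1 covers the case without strict constraints.\<close>
    define \<epsilon> where "\<epsilon> = Min (insert 1 ((\<lambda>f. dotp N f z) ` Gt))"
    have "\<epsilon> > 0" using z(2) fin by (auto simp: \<epsilon>_def)
    have "\<epsilon> \<le> dotp N f z" if "f \<in> Gt" for f using that fin by (auto simp: \<epsilon>_def)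
    then have "sol (\<lambda>j. (1 / \<epsilon>) * z j)"
      using \<open>\<epsilon> > 0\<close> z unfolding sol_def dotp_scale by (auto simp: b_def G_def field_simps)
    then show ?thesis by blast
  qed
  moreover have "\<forall>z. sol z \<longrightarrow> card (tight z) < Suc (card G)"
    using finG by (auto simp: tight_def less_Suc_eq_le intro: card_mono)
  ultimately obtain z where z: "sol z" "\<And>z'. sol z' \<Longrightarrow> card (tight z') \<le> card (tight z)"
    using ex_has_greatest_nat[of sol _ "\<lambda>z. card (tight z)" "Suc (card G)"] by (metis)
  have key: "sol w" if w: "\<And>f. f \<in> tight z \<Longrightarrow> dotp N f w = of_int (b f)" for w
  proof (rule ccontr)
    assume "\<not> sol w"
    define Vi where "Vi = {f\<in>G. dotp N f w < of_int (b f)}"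
    have Vi: "finite Vi" "Vi \<noteq> {}" using finG \<open>\<not> sol w\<close> by (auto simp: Vi_def sol_def not_le)
    \<comment> \<open>The parameter at which f becomes tight on the segment from z to w. The
      minimiser f0 is the first violated constraint that is met.\<close>
    define \<tau> where "\<tau> = (\<lambda>f. (dotp N f z - of_int (b f)) / (dotp N f z - dotp N f w))"
    obtain f0 where f0: "f0 \<in> Vi" "\<And>f. f \<in> Vi \<Longrightarrow> \<tau> f0 \<le> \<tau> f"
      using Vi by (metis arg_min_if_finite(1) arg_min_least)
    define z' where "z' = (\<lambda>j. z j + \<tau> f0 * (w j - z j))"
    have zG: "of_int (b f) \<le> dotp N f z" if "f \<in> G" for f using z(1) that by (simp add: sol_def)
    have dz': "dotp N f z' = dotp N f z + \<tau> f0 * (dotp N f w - dotp N f z)" for f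
      unfolding z'_def by (rule dotp_line)
    have Vi_less: "dotp N f w < dotp N f z" "of_int (b f) < dotp N f z" if "f \<in> Vi" for f
    proof -
      have "f \<notin> tight z" using w that by (auto simp: Vi_def)
      then show "of_int (b f) < dotp N f z" using that zG[of f] by (auto simp: Vi_def tight_def)
      then show "dotp N f w < dotp N f z" using that by (auto simp: Vi_def)
    qed
    have t0: "0 \<le> \<tau> f0" using Vi_less[OF f0(1)] by (simp add: \<tau>_def)
    have t1: "\<tau> f0 \<le> 1" using Vi_less[OF f0(1)] f0(1) by (simp add: \<tau>_def Vi_def)
    have "sol z'" unfolding sol_def
    proof
      fix f assume f: "f \<in> G"
      show "of_int (b f) \<le> dotp N f z'"
      proof (cases "f \<in> Vi")
        case True
        have "\<tau> f0 * (dotp N f z - dotp N f w) \<le> \<tau> f * (dotp N f z - dotp N f w)"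
          using f0(2)[OF True] Vi_less[OF True] by (intro mult_right_mono) auto
        also have "\<dots> = dotp N f z - of_int (b f)" using Vi_less[OF True] by (simp add: \<tau>_def)
        finally show ?thesis unfolding dz' by (simp add: algebra_simps)
      next
        case False
        then have "of_int (b f) \<le> dotp N f w" using f by (auto simp: Vi_def)
        then have "(1 - \<tau> f0) * of_int (b f) + \<tau> f0 * of_int (b f) \<le> (1 - \<tau> f0) * dotp N f z + \<tau> f0 * dotp N f w"
          using zG[OF f] t0 t1 by (intro add_mono mult_left_mono) auto
        then show ?thesis unfolding dz' by (simp add: algebra_simps)
      qed
    qed
    moreover have "insert f0 (tight z) \<subseteq> tight z'"
    proof -
      have "dotp N f0 z' = of_int (b f0)"
        using Vi_less[OF f0(1)] unfolding dz' \<tau>_def by (simp add: field_simps)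
      then show ?thesis using w f0(1) by (auto simp: tight_def dz' Vi_def)
    qed
    moreover have "f0 \<notin> tight z" using Vi_less[OF f0(1)] by (auto simp: tight_def)
    moreover have "finite (tight z')" "finite (tight z)" using finG by (auto simp: tight_def)
    ultimately show False
      using z(2)[of z'] card_mono[of "tight z'" "insert f0 (tight z)"] by simp
  qed
  \<comment> \<open>Moves the right-hand side into the coefficient of coordinate N, which turns
    tightness into a homogeneous equation.\<close>
  define ext where "ext = (\<lambda>f j. if j < N then f j else if j = N then - b f else 0)"
  have "\<exists>p :: nat \<Rightarrow> int. p N > 0 \<and> (\<forall>j\<le>N. \<bar>p j\<bar> \<le> int ((2 * (N + 1) * M + 1) ^ N)) \<and>
    (\<forall>f\<in>ext ` tight z. (\<Sum>j\<le>N. f j * p j) = 0)"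
  proof (rule small_homogeneous_solution[where z = "\<lambda>j. if j = N then 1 else z j"])
    show "finite (ext ` tight z)" using finG by (simp add: tight_def)
    show "\<bar>f j\<bar> \<le> int M" if "f \<in> ext ` tight z" "j \<le> N" for f j
      using that M by (auto simp: ext_def tight_def G_def b_def)
    show "(\<Sum>j\<le>N. real_of_int (f j) * (if j = N then 1 else z j)) = 0" if f: "f \<in> ext ` tight z" for f
    proof -
      obtain g where g: "g \<in> tight z" "f = ext g" using f by auto
      have "(\<Sum>j<N. real_of_int (f j) * (if j = N then 1 else z j)) = dotp N g z"
        unfolding dotp_def by (rule sum.cong) (simp_all add: g(2) ext_def)
      then show ?thesis using g by (simp add: lessThan_Suc_atMost[symmetric] ext_def tight_def)
    qed
  qed simp
  then obtain p where p: "p N > 0" "\<And>j. j \<le> N \<Longrightarrow> \<bar>p j\<bar> \<le> int ((2 * (N + 1) * M + 1) ^ N)"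
    "\<And>f. f \<in> tight z \<Longrightarrow> (\<Sum>j\<le>N. ext f j * p j) = 0" by auto
  have dp: "real_of_int (\<Sum>j<N. f j * p j) = of_int (p N) * dotp N f (\<lambda>j. of_int (p j) / of_int (p N))" for f
    unfolding dotp_def of_int_sum sum_distrib_left
    by (rule sum.cong) (use p(1) in simp_all)
  have "sol (\<lambda>j. of_int (p j) / of_int (p N))"
  proof (rule key)
    fix f assume f: "f \<in> tight z"
    have "(\<Sum>j\<le>N. ext f j * p j) = (\<Sum>j<N. f j * p j) - b f * p N"
      by (simp add: lessThan_Suc_atMost[symmetric] ext_def)
    then have "(\<Sum>j<N. f j * p j) = b f * p N" using p(3)[OF f] by simp
    then have "of_int (p N) * dotp N f (\<lambda>j. of_int (p j) / of_int (p N)) = of_int (p N) * real_of_int (b f)"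
      unfolding dp[symmetric] by simp
    then show "dotp N f (\<lambda>j. of_int (p j) / of_int (p N)) = of_int (b f)" using p(1) by simp
  qed
  then have *: "of_int (p N * b f) \<le> real_of_int (\<Sum>j<N. f j * p j)" if "f \<in> G" for f
    unfolding dp using that p(1) by (simp add: sol_def)
  have **: "p N * b f \<le> (\<Sum>j<N. f j * p j)" if "f \<in> G" for f using *[OF that] by linarith
  have "0 < (\<Sum>j<N. f j * p j)" if "f \<in> Gt" for f using **[of f] that p(1) by (simp add: G_def b_def)
  moreover have "0 \<le> (\<Sum>j<N. f j * p j)" if "f \<in> Ge" for f
    using **[of f] that p(1) by (auto simp: G_def b_def split: if_splits)
  ultimately show ?thesis using p(2) by (intro exI[of _ p]) auto
qed

section \<open>Farkas' lemma\<close>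

inductive_set cone :: "(('v \<Rightarrow> real) \<times> real) set \<Rightarrow> (('v \<Rightarrow> real) \<times> real) set" for S where
  cone_zero: "((\<lambda>_. 0), 0) \<in> cone S"
| cone_add: "(a, b) \<in> cone S \<Longrightarrow> (a', b') \<in> S \<Longrightarrow> 0 \<le> c \<Longrightarrow> ((\<lambda>v. a v + c * a' v), b + c * b') \<in> cone S"

text \<open>Read (a, b) as the inequality a z <= b; the cone then consists of nonnegative
  combinations, built one generator at a time. Adding a whole element of the cone makes the
  construction transitive, so inequalities obtained by elimination can be traced back to the
  original ones.\<close>

lemma cone_add_cone:
  assumes "(a', b') \<in> cone S" "(a, b) \<in> cone S" "0 \<le> c"
  shows "((\<lambda>v. a v + c * a' v), b + c * b') \<in> cone S"
  using assms(1)
proof induction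
  case cone_zero
  then show ?case using assms by simp
next
  case (cone_add a1 b1 a2 b2 k)
  have "((\<lambda>v. (a v + c * a1 v) + (c * k) * a2 v), (b + c * b1) + (c * k) * b2) \<in> cone S"
    by (rule cone.cone_add) (use cone_add assms in auto)
  then show ?case by (simp add: algebra_simps)
qed

lemma cone_subset: "S \<subseteq> cone T \<Longrightarrow> cone S \<subseteq> cone T"
proof (rule subrelI)
  fix a b assume S: "S \<subseteq> cone T" and "(a, b) \<in> cone S"
  from this(2) show "(a, b) \<in> cone T"
  proof induction
    case (cone_add a b a' b' c)
    then show ?case using S by (intro cone_add_cone) auto
  qed (rule cone.cone_zero)
qed

lemma cone_gen: "(a, b) \<in> S \<Longrightarrow> 0 \<le> c \<Longrightarrow> ((\<lambda>v. c * a v), c * b) \<in> cone S"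
  using cone_add[OF cone_zero] by fastforce

lemma between_finite:
  fixes L U :: "real set"
  assumes "finite L" "finite U" "\<And>l u. l \<in> L \<Longrightarrow> u \<in> U \<Longrightarrow> l \<le> u"
  shows "\<exists>m. (\<forall>l\<in>L. l \<le> m) \<and> (\<forall>u\<in>U. m \<le> u)"
proof (cases "L = {}")
  case True
  then show ?thesis
    by (cases "U = {}") (auto intro: exI[of _ "Min U"] simp: assms)
next
  case False
  then show ?thesis using assms by (intro exI[of _ "Max L"]) auto
qed

text \<open>Farkas' lemma by Fourier-Motzkin elimination of one variable at a time.\<close>
lemma farkas_cone:
  "finite V \<Longrightarrow> finite S \<Longrightarrow> \<not> (\<exists>z. \<forall>(a, b)\<in>S. (\<Sum>v\<in>V. a v * z v) \<le> b) \<Longrightarrow>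
   \<exists>a b. (a, b) \<in> cone S \<and> (\<forall>v\<in>V. a v = 0) \<and> b < 0"
proof (induction V arbitrary: S rule: finite_induct)
  case empty
  then obtain a b where "(a, b) \<in> S" "b < 0" by force
  then show ?case using cone_gen[of a b S 1] by force
next
  case (insert x V)
  \<comment> \<open>Scaled so that x has coefficient 1 in the first inequality and -1 in the second;
    in the sum x cancels.\<close>
  define comb :: "('a \<Rightarrow> real) \<times> real \<Rightarrow> ('a \<Rightarrow> real) \<times> real \<Rightarrow> ('a \<Rightarrow> real) \<times> real" where
    "comb = (\<lambda>s t. ((\<lambda>v. (1 / fst s x) * fst s v + (1 / - fst t x) * fst t v),
                    (1 / fst s x) * snd s + (1 / - fst t x) * snd t))"
  define S0 where "S0 = {s\<in>S. fst s x = 0}"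
  define Sp where "Sp = {s\<in>S. fst s x > 0}"
  define Sn where "Sn = {s\<in>S. fst s x < 0}"
  define S' where "S' = S0 \<union> (\<lambda>(s, t). comb s t) ` (Sp \<times> Sn)"
  have fin: "finite Sp" "finite Sn" "finite S'"
    using insert.prems by (auto simp: S'_def S0_def Sp_def Sn_def)
  have "\<not> (\<exists>z. \<forall>(a, b)\<in>S'. (\<Sum>v\<in>V. a v * z v) \<le> b)"
  proof
    assume "\<exists>z. \<forall>(a, b)\<in>S'. (\<Sum>v\<in>V. a v * z v) \<le> b"
    then obtain z where z: "\<And>s. s \<in> S' \<Longrightarrow> (\<Sum>v\<in>V. fst s v * z v) \<le> snd s" by fastforce
    \<comment> \<open>The bound that an inequality puts on x once the other variables are fixed: an
      upper bound for positive coefficient, a lower bound for negative coefficient. The combined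
      inequalities say that no lower bound exceeds an upper one.\<close>
    define bd where "bd = (\<lambda>s :: ('a \<Rightarrow> real) \<times> real. (snd s - (\<Sum>v\<in>V. fst s v * z v)) / fst s x)"
    have bd_le: "bd t \<le> bd s" if s: "s \<in> Sp" and t: "t \<in> Sn" for s t
    proof -
      have "comb s t \<in> S'" using s t by (auto simp: S'_def)
      from z[OF this] have "(1 / fst s x) * (\<Sum>v\<in>V. fst s v * z v) + (1 / - fst t x) * (\<Sum>v\<in>V. fst t v * z v)
        \<le> (1 / fst s x) * snd s + (1 / - fst t x) * snd t"
        unfolding sum_distrib_left by (simp add: comb_def sum.distrib[symmetric] algebra_simps)
      then show ?thesis by (simp add: bd_def diff_divide_distrib)
    qed
    have "\<exists>m. (\<forall>l\<in>bd ` Sn. l \<le> m) \<and> (\<forall>u\<in>bd ` Sp. m \<le> u)"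
    proof (rule between_finite)
      fix l w assume "l \<in> bd ` Sn" "w \<in> bd ` Sp"
      then obtain t s where "t \<in> Sn" "s \<in> Sp" "l = bd t" "w = bd s" by (elim imageE)
      then show "l \<le> w" by (simp only: bd_le)
    qed (use fin in auto)
    then obtain m where m: "\<And>t. t \<in> Sn \<Longrightarrow> bd t \<le> m" "\<And>s. s \<in> Sp \<Longrightarrow> m \<le> bd s"
      by (metis image_eqI)
    define z' where "z' = z(x := m)"
    have zs: "(\<Sum>v\<in>insert x V. fst s v * z' v) = fst s x * m + (\<Sum>v\<in>V. fst s v * z v)" for s :: "('a \<Rightarrow> real) \<times> real"
    proof -
      have "(\<Sum>v\<in>V. fst s v * z' v) = (\<Sum>v\<in>V. fst s v * z v)"
        using insert.hyps by (intro sum.cong) (auto simp: z'_def)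
      then show ?thesis using insert.hyps by (simp add: z'_def)
    qed
    have "(\<Sum>v\<in>insert x V. fst s v * z' v) \<le> snd s" if s: "s \<in> S" for s
    proof -
      consider "s \<in> S0" | "s \<in> Sp" | "s \<in> Sn" using s by (force simp: S0_def Sp_def Sn_def)
      then show ?thesis
      proof cases
        case 1
        then show ?thesis using z[of s] unfolding zs by (simp add: S'_def S0_def)
      next
        case 2
        then show ?thesis using m(2)[OF 2] unfolding zs by (simp add: Sp_def bd_def field_simps)
      next
        case 3
        then show ?thesis using m(1)[OF 3] unfolding zs by (simp add: Sn_def bd_def field_simps)
      qed
    qed
    then show False using insert.prems(2) by fastforce
  qed
  then obtain a b where ab: "(a, b) \<in> cone S'" "\<forall>v\<in>V. a v = 0" "b < 0"
    using insert.IH[OF fin(3)] by blast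
  have "a x = 0"
    using ab(1)
  proof induction
    case (cone_add a b a' b' c)
    then show ?case by (auto simp: S'_def S0_def comb_def Sp_def Sn_def)
  qed simp
  moreover have "S' \<subseteq> cone S"
  proof
    fix u assume "u \<in> S'"
    then consider "u \<in> S" | s t where "s \<in> Sp" "t \<in> Sn" "u = comb s t" by (auto simp: S'_def S0_def)
    then show "u \<in> cone S"
    proof cases
      case 1
      then show ?thesis using cone_gen[of "fst u" "snd u" S 1] by simp
    next
      case 2
      have "((\<lambda>v. (1 / fst s x) * fst s v), (1 / fst s x) * snd s) \<in> cone S"
        using 2 by (intro cone_gen) (auto simp: Sp_def)
      then have "((\<lambda>v. (1 / fst s x) * fst s v + (1 / - fst t x) * fst t v),
                    (1 / fst s x) * snd s + (1 / - fst t x) * snd t) \<in> cone S"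
        using 2 by (intro cone_add) (auto simp: Sn_def)
      then show ?thesis by (simp add: 2 comb_def)
    qed
  qed
  ultimately show ?case using ab cone_subset by blast
qed

section \<open>Linear programming duality\<close>

definition feasible :: "'i set \<Rightarrow> 'j set \<Rightarrow> ('i \<Rightarrow> 'j \<Rightarrow> real) \<Rightarrow> ('i \<Rightarrow> real) \<Rightarrow> ('j \<Rightarrow> real) \<Rightarrow> bool" where
  "feasible I J W b y \<longleftrightarrow> (\<forall>j\<in>J. 0 \<le> y j) \<and> (\<forall>i\<in>I. (\<Sum>j\<in>J. W i j * y j) = b i)"

lemma feasible_swap:
  assumes "feasible I J W b y"
  shows "(\<Sum>j\<in>J. y j * (\<Sum>i\<in>I. p i * W i j)) = (\<Sum>i\<in>I. p i * b i)"
proof -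
  have "(\<Sum>j\<in>J. y j * (\<Sum>i\<in>I. p i * W i j)) = (\<Sum>i\<in>I. p i * (\<Sum>j\<in>J. W i j * y j))"
    unfolding sum_distrib_left by (subst sum.swap) (simp add: ac_simps)
  also have "\<dots> = (\<Sum>i\<in>I. p i * b i)"
    using assms by (intro sum.cong) (auto simp: feasible_def)
  finally show ?thesis .
qed

lemma sum_fun_upd_add:
  "finite I \<Longrightarrow> i \<in> I \<Longrightarrow> (\<Sum>k\<in>I. (p(i := p i + c)) k * g k) = (\<Sum>k\<in>I. p k * g k) + c * (g i :: real)"
  by (simp add: sum.remove[of I i] algebra_simps)

lemma sum_nonneg_zeroD:
  "sum f A = 0 \<Longrightarrow> finite A \<Longrightarrow> (\<And>x. x \<in> A \<Longrightarrow> 0 \<le> f x) \<Longrightarrow> x \<in> A \<Longrightarrow> f x = (0 :: real)"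
  by (simp add: sum_nonneg_eq_0_iff)

text \<open>The primal and dual feasibility constraints together with weak duality reversed form one system;
  a Farkas certificate of its infeasibility would contradict feasibility or boundedness.\<close>
theorem lp_duality:
  fixes W :: "'i \<Rightarrow> 'j \<Rightarrow> real"
  assumes fin: "finite I" "finite J" and feas: "feasible I J W b y0"
    and bdd: "\<And>y. feasible I J W b y \<Longrightarrow> (\<Sum>j\<in>J. y j * d j) \<le> \<beta>"
  shows "\<exists>y p. feasible I J W b y \<and> (\<forall>j\<in>J. d j \<le> (\<Sum>i\<in>I. p i * W i j)) \<and>
    (\<forall>j\<in>J. y j = 0 \<or> (\<Sum>i\<in>I. p i * W i j) = d j)"
proof -
  define V where "V = Inl ` J \<union> Inr ` I"
  \<comment> \<open>With y on the left and p on the right summand: W y <= b, W y >= b, y >= 0, p W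
    >= d, and p b <= y d, all in the form a z <= b.\<close>
  define S where "S =
     (\<lambda>i. (case_sum (\<lambda>j. W i j) (\<lambda>_. 0), b i)) ` I \<union>
     (\<lambda>i. (case_sum (\<lambda>j. - W i j) (\<lambda>_. 0), - b i)) ` I \<union>
     (\<lambda>j. (case_sum (\<lambda>j'. if j' = j then -1 else 0) (\<lambda>_. 0), 0)) ` J \<union>
     (\<lambda>j. (case_sum (\<lambda>_. 0) (\<lambda>i. - W i j), - d j)) ` J \<union>
     {(case_sum (\<lambda>j. - d j) (\<lambda>i. b i), 0)}"
  have finV: "finite V" and finS: "finite S" using fin by (auto simp: V_def S_def)
  have sumV: "(\<Sum>v\<in>V. g v) = (\<Sum>j\<in>J. g (Inl j)) + (\<Sum>i\<in>I. g (Inr i))" for g :: "'j + 'i \<Rightarrow> real"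
    unfolding V_def using fin by (subst sum.union_disjoint) (auto simp: sum.reindex)
  have "\<exists>z. \<forall>(a, \<gamma>)\<in>S. (\<Sum>v\<in>V. a v * z v) \<le> \<gamma>"
  proof (rule ccontr)
    assume "\<not> ?thesis"
    from farkas_cone[OF finV finS this] obtain a \<gamma> where
      a: "(a, \<gamma>) \<in> cone S" "\<forall>v\<in>V. a v = 0" "\<gamma> < 0" by blast
    \<comment> \<open>Induction over the cone collects the multipliers of the five kinds of
      inequalities: p for the equations, of any sign since both directions are present, s for the
      sign constraints, v for the dual constraints, and \<tau> for the comparison of the
      objectives.\<close>
    from a(1) have "\<exists>p v s \<tau>. (\<forall>j. 0 \<le> v j) \<and> (\<forall>j. 0 \<le> s j) \<and> 0 \<le> \<tau> \<and>
      (\<forall>j\<in>J. a (Inl j) = (\<Sum>i\<in>I. p i * W i j) - s j - \<tau> * d j) \<and>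
      (\<forall>i\<in>I. a (Inr i) = \<tau> * b i - (\<Sum>j\<in>J. v j * W i j)) \<and>
      \<gamma> = (\<Sum>i\<in>I. p i * b i) - (\<Sum>j\<in>J. v j * d j)"
    proof induction
      case cone_zero
      show ?case by (intro exI[of _ "\<lambda>_. 0"] exI[of _ 0]) simp
    next
      case (cone_add a \<gamma> a' \<gamma>' c)
      then obtain p v s \<tau> where h: "\<forall>j. 0 \<le> v j" "\<forall>j. 0 \<le> s j" "0 \<le> \<tau>"
        "\<forall>j\<in>J. a (Inl j) = (\<Sum>i\<in>I. p i * W i j) - s j - \<tau> * d j"
        "\<forall>i\<in>I. a (Inr i) = \<tau> * b i - (\<Sum>j\<in>J. v j * W i j)"
        "\<gamma> = (\<Sum>i\<in>I. p i * b i) - (\<Sum>j\<in>J. v j * d j)" by blast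
      consider i where "i \<in> I" "a' = case_sum (\<lambda>j. W i j) (\<lambda>_. 0)" "\<gamma>' = b i"
        | i where "i \<in> I" "a' = case_sum (\<lambda>j. - W i j) (\<lambda>_. 0)" "\<gamma>' = - b i"
        | j where "j \<in> J" "a' = case_sum (\<lambda>j'. if j' = j then -1 else 0) (\<lambda>_. 0)" "\<gamma>' = 0"
        | j where "j \<in> J" "a' = case_sum (\<lambda>_. 0) (\<lambda>i. - W i j)" "\<gamma>' = - d j"
        | "a' = case_sum (\<lambda>j. - d j) (\<lambda>i. b i)" "\<gamma>' = 0"
        using cone_add.hyps(2) unfolding S_def by blast
      then show ?case
      proof cases
        case (1 i)
        have upd: "(\<Sum>k\<in>I. (p(i := p i + c)) k * W k j) = (\<Sum>k\<in>I. p k * W k j) + c * W i j"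
          "(\<Sum>k\<in>I. (p(i := p i + c)) k * b k) = (\<Sum>k\<in>I. p k * b k) + c * b i" for j
          by (rule sum_fun_upd_add[OF fin(1) 1(1)])+
        show ?thesis
          by (rule exI[of _ "p(i := p i + c)"], rule exI[of _ v], rule exI[of _ s], rule exI[of _ \<tau>])
            (use h 1 fin in \<open>simp add: upd del: fun_upd_apply\<close>)
      next
        case (2 i)
        define c' where "c' = - c"
        have c: "c = - c'" by (simp add: c'_def)
        have upd: "(\<Sum>k\<in>I. (p(i := p i + c')) k * W k j) = (\<Sum>k\<in>I. p k * W k j) + c' * W i j"
          "(\<Sum>k\<in>I. (p(i := p i + c')) k * b k) = (\<Sum>k\<in>I. p k * b k) + c' * b i" for j
          by (rule sum_fun_upd_add[OF fin(1) 2(1)])+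
        show ?thesis
          by (rule exI[of _ "p(i := p i + c')"], rule exI[of _ v], rule exI[of _ s], rule exI[of _ \<tau>])
            (use h 2 fin in \<open>simp add: upd c del: fun_upd_apply\<close>)
      next
        case (3 j)
        show ?thesis
          by (rule exI[of _ p], rule exI[of _ v], rule exI[of _ "s(j := s j + c)"], rule exI[of _ \<tau>])
            (use h 3 fin cone_add.hyps in \<open>simp\<close>)
      next
        case (4 j)
        have upd: "(\<Sum>k\<in>J. (v(j := v j + c)) k * W i k) = (\<Sum>k\<in>J. v k * W i k) + c * W i j"
          "(\<Sum>k\<in>J. (v(j := v j + c)) k * d k) = (\<Sum>k\<in>J. v k * d k) + c * d j" for i
          by (rule sum_fun_upd_add[OF fin(2) 4(1)])+
        have nn: "\<forall>k. 0 \<le> (v(j := v j + c)) k" using h(1) cone_add.hyps by simp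
        show ?thesis
          by (rule exI[of _ p], rule exI[of _ "v(j := v j + c)"], rule exI[of _ s], rule exI[of _ \<tau>])
            (use h 4 fin cone_add.hyps nn in \<open>simp add: upd del: fun_upd_apply\<close>)
      next
        case 5
        show ?thesis
          by (rule exI[of _ p], rule exI[of _ v], rule exI[of _ s], rule exI[of _ "\<tau> + c"])
            (use h 5 fin cone_add.hyps in \<open>simp add: algebra_simps\<close>)
      qed
    qed
    then obtain p v s \<tau> where h0: "\<forall>j. 0 \<le> v j" "\<forall>j. 0 \<le> s j" "0 \<le> \<tau>"
        "\<forall>j\<in>J. a (Inl j) = (\<Sum>i\<in>I. p i * W i j) - s j - \<tau> * d j"
        "\<forall>i\<in>I. a (Inr i) = \<tau> * b i - (\<Sum>j\<in>J. v j * W i j)"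
        "\<gamma> = (\<Sum>i\<in>I. p i * b i) - (\<Sum>j\<in>J. v j * d j)" by blast
    have "(\<Sum>i\<in>I. p i * W i j) = s j + \<tau> * d j" if "j \<in> J" for j
      using h0(4) a(2) that by (auto simp: V_def)
    moreover have "(\<Sum>j\<in>J. W i j * v j) = \<tau> * b i" if "i \<in> I" for i
      using h0(5) a(2) that by (auto simp: V_def mult.commute)
    moreover have "(\<Sum>i\<in>I. p i * b i) < (\<Sum>j\<in>J. v j * d j)"
      using h0(6) a(3) by simp
    ultimately have h: "\<forall>j. 0 \<le> v j" "\<forall>j. 0 \<le> s j" "0 \<le> \<tau>"
        "\<forall>j\<in>J. (\<Sum>i\<in>I. p i * W i j) = s j + \<tau> * d j"
        "\<forall>i\<in>I. (\<Sum>j\<in>J. W i j * v j) = \<tau> * b i"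
        "(\<Sum>i\<in>I. p i * b i) < (\<Sum>j\<in>J. v j * d j)"
      using h0 by auto
    show False
    \<comment> \<open>If \<tau> is positive, v / \<tau> is primal feasible and weak duality
      contradicts the last inequality of \<open>h\<close>. If \<tau> = 0, v is a direction of
      recession along which the objective grows without bound.\<close>
    proof (cases "\<tau> = 0")
      case False
      then have "\<tau> > 0" using h by simp
      have "(\<Sum>j\<in>J. W i j * (v j / \<tau>)) = (\<Sum>j\<in>J. W i j * v j) / \<tau>" for i
        by (simp add: sum_divide_distrib)
      then have "feasible I J W b (\<lambda>j. v j / \<tau>)"
        using h \<open>\<tau> > 0\<close> by (simp add: feasible_def)
      from feasible_swap[OF this, of p]
      have "(\<Sum>i\<in>I. p i * b i) = (\<Sum>j\<in>J. v j / \<tau> * (s j + \<tau> * d j))" using h by simp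
      also have "\<dots> \<ge> (\<Sum>j\<in>J. v j * d j)"
        using h \<open>\<tau> > 0\<close> by (intro sum_mono) (simp add: field_simps)
      finally show False using h by simp
    next
      case True
      have pb: "(\<Sum>i\<in>I. p i * b i) \<ge> 0"
        unfolding feasible_swap[OF feas, of p, symmetric]
        using h feas True by (intro sum_nonneg) (auto simp: feasible_def)
      define D where "D = (\<Sum>j\<in>J. v j * d j)"
      have "D > 0" using pb h by (simp add: D_def)
      \<comment> \<open>Far enough along v for the objective at y0 + k v to exceed \<beta>.\<close>
      define k where "k = (\<bar>\<beta> - (\<Sum>j\<in>J. y0 j * d j)\<bar> + 1) / D"
      have "k \<ge> 0" using \<open>D > 0\<close> by (simp add: k_def)
      have "(\<Sum>j\<in>J. W i j * (y0 j + k * v j)) = (\<Sum>j\<in>J. W i j * y0 j) + k * (\<Sum>j\<in>J. W i j * v j)" for i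
        by (simp add: sum_distrib_left sum.distrib algebra_simps)
      then have "feasible I J W b (\<lambda>j. y0 j + k * v j)"
        using feas h True \<open>k \<ge> 0\<close> by (simp add: feasible_def)
      from bdd[OF this] have "(\<Sum>j\<in>J. y0 j * d j) + k * D \<le> \<beta>"
        by (simp add: D_def sum_distrib_left sum.distrib algebra_simps)
      moreover have "k * D = \<bar>\<beta> - (\<Sum>j\<in>J. y0 j * d j)\<bar> + 1" using \<open>D > 0\<close> by (simp add: k_def)
      ultimately show False by linarith
    qed
  qed
  then obtain z where z: "\<And>a \<gamma>. (a, \<gamma>) \<in> S \<Longrightarrow> (\<Sum>v\<in>V. a v * z v) \<le> \<gamma>" by fast
  define y where "y = (\<lambda>j. z (Inl j))"
  define p where "p = (\<lambda>i. z (Inr i))"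
  have le: "(\<Sum>j\<in>J. W i j * y j) \<le> b i" if "i \<in> I" for i
    using z[of "case_sum (\<lambda>j. W i j) (\<lambda>_. 0)" "b i"] that unfolding sumV by (auto simp: S_def y_def)
  have ge: "(\<Sum>j\<in>J. W i j * y j) \<ge> b i" if "i \<in> I" for i
    using z[of "case_sum (\<lambda>j. - W i j) (\<lambda>_. 0)" "- b i"] that unfolding sumV by (auto simp: S_def y_def sum_negf)
  have pos: "0 \<le> y j" if "j \<in> J" for j
  proof -
    have "(\<Sum>j'\<in>J. (if j' = j then -1 else 0) * z (Inl j')) = - z (Inl j)"
      using that fin by (simp add: if_distrib[of "\<lambda>x. x * _"] cong: if_cong)
    then show ?thesis
      using z[of "case_sum (\<lambda>j'. if j' = j then -1 else 0) (\<lambda>_. 0)" 0] that unfolding sumV by (auto simp: S_def y_def)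
  qed
  have dual: "d j \<le> (\<Sum>i\<in>I. p i * W i j)" if "j \<in> J" for j
    using z[of "case_sum (\<lambda>_. 0) (\<lambda>i. - W i j)" "- d j"] that unfolding sumV
    by (auto simp: S_def p_def sum_negf mult.commute)
  have opt: "(\<Sum>i\<in>I. p i * b i) \<le> (\<Sum>j\<in>J. y j * d j)"
    using z[of "case_sum (\<lambda>j. - d j) (\<lambda>i. b i)" 0] unfolding sumV
    by (auto simp: S_def y_def p_def sum_negf mult.commute)
  have feas': "feasible I J W b y" using le ge pos by (auto simp: feasible_def intro: antisym)
  have "(\<Sum>j\<in>J. y j * ((\<Sum>i\<in>I. p i * W i j) - d j)) \<le> 0"
    using opt feasible_swap[OF feas', of p] by (simp add: right_diff_distrib sum_subtractf)
  moreover have nn: "0 \<le> y j * ((\<Sum>i\<in>I. p i * W i j) - d j)" if "j \<in> J" for j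
    using pos[OF that] dual[OF that] by simp
  ultimately have "(\<Sum>j\<in>J. y j * ((\<Sum>i\<in>I. p i * W i j) - d j)) = 0"
    by (intro antisym sum_nonneg) auto
  then have "y j * ((\<Sum>i\<in>I. p i * W i j) - d j) = 0" if "j \<in> J" for j
    using that by (intro sum_nonneg_zeroD[OF _ fin(2) nn])
  then have "y j = 0 \<or> (\<Sum>i\<in>I. p i * W i j) = d j" if "j \<in> J" for j
    using that by force
  then show ?thesis using feas' dual by blast
qed

section \<open>Strict complementarity and the pessimistic condition\<close>

lemma feasible_combine:
  assumes "feasible I J W b y" "feasible I J W b y'"
  shows "feasible I J W b (\<lambda>j. (y j + y' j) / 2)"
proof -
  have eq: "(\<Sum>j\<in>J. W i j * ((y j + y' j) / 2)) = ((\<Sum>j\<in>J. W i j * y j) + (\<Sum>j\<in>J. W i j * y' j)) / 2" for i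
    by (simp add: sum.distrib sum_divide_distrib add_divide_distrib ring_distribs)
  show ?thesis using assms unfolding feasible_def eq by simp
qed

lemma dual_optimum:
  fixes W :: "nat \<Rightarrow> nat \<Rightarrow> real"
  assumes y0: "feasible {..<r} {..<m} W b y0"
    and opt: "\<And>y. feasible {..<r} {..<m} W b y \<Longrightarrow> (\<Sum>j<m. q j * y0 j) \<le> (\<Sum>j<m. q j * y j)"
  shows "\<exists>u. (\<forall>j<m. (\<Sum>i<r. u i * W i j) \<le> q j) \<and> (\<Sum>i<r. u i * b i) = (\<Sum>j<m. q j * y0 j)"
proof -
  have "(\<Sum>j<m. y j * - q j) \<le> - (\<Sum>j<m. q j * y0 j)" if "feasible {..<r} {..<m} W b y" for y
    using opt[OF that] by (simp add: sum_negf mult.commute)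
  from lp_duality[OF _ _ y0 this] obtain y p where yp: "feasible {..<r} {..<m} W b y"
    "\<And>j. j < m \<Longrightarrow> - q j \<le> (\<Sum>i<r. p i * W i j)" "\<And>j. j < m \<Longrightarrow> y j = 0 \<or> (\<Sum>i<r. p i * W i j) = - q j"
    by auto
  define u where "u = (\<lambda>i. - p i)"
  have u: "(\<Sum>i<r. u i * c i) = - (\<Sum>i<r. p i * c i)" for c by (simp add: u_def sum_negf)
  have dual: "(\<Sum>i<r. u i * W i j) \<le> q j" if "j < m" for j using yp(2)[OF that] by (simp add: u)
  have "(\<Sum>i<r. u i * b i) = (\<Sum>j<m. y j * (\<Sum>i<r. u i * W i j))"
    by (rule feasible_swap[OF yp(1), symmetric])
  also have "\<dots> = (\<Sum>j<m. q j * y j)"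
    using yp(3) by (intro sum.cong) (force simp: u)+
  finally have "(\<Sum>i<r. u i * b i) \<ge> (\<Sum>j<m. q j * y0 j)" using opt[OF yp(1)] by simp
  moreover have "(\<Sum>i<r. u i * b i) = (\<Sum>j<m. y0 j * (\<Sum>i<r. u i * W i j))"
    by (rule feasible_swap[OF y0, symmetric])
  moreover have "\<dots> \<le> (\<Sum>j<m. q j * y0 j)"
  proof (rule sum_mono)
    fix j assume "j \<in> {..<m}"
    then have "y0 j * (\<Sum>i<r. u i * W i j) \<le> y0 j * q j"
      using y0 dual by (intro mult_left_mono) (auto simp: feasible_def)
    then show "y0 j * (\<Sum>i<r. u i * W i j) \<le> q j * y0 j" by (simp add: mult.commute)
  qed
  ultimately show ?thesis using dual by (intro exI[of _ u]) auto
qed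

text \<open>The Goldman-Tucker theorem. It is enough to be strict at one index k, as averages of
  optimal pairs remain optimal and inherit strictness from each pair. If y k vanishes on the whole
  optimal face, the maximum of y k over that face is 0, and a dual solution of this auxiliary
  program can be mixed with an optimal u to obtain slack at k.\<close>

lemma strict_complementarity:
  fixes W :: "nat \<Rightarrow> nat \<Rightarrow> real"
  assumes y0: "feasible {..<r} {..<m} W b y0"
    and opt: "\<And>y. feasible {..<r} {..<m} W b y \<Longrightarrow> (\<Sum>j<m. q j * y0 j) \<le> (\<Sum>j<m. q j * y j)"
  defines "\<phi> \<equiv> (\<Sum>j<m. q j * y0 j)"
  shows "\<exists>u y. (\<forall>j<m. (\<Sum>i<r. u i * W i j) \<le> q j) \<and> (\<Sum>i<r. u i * b i) = \<phi> \<and>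
    feasible {..<r} {..<m} W b y \<and> (\<Sum>j<m. q j * y j) = \<phi> \<and>
    (\<forall>j<m. 0 < y j \<or> (\<Sum>i<r. u i * W i j) < q j)"
proof -
  define D where "D = (\<lambda>u. (\<forall>j<m. (\<Sum>i<r. u i * W i j) \<le> q j) \<and> (\<Sum>i<r. u i * b i) = \<phi>)"
  define F where "F = (\<lambda>y. feasible {..<r} {..<m} W b y \<and> (\<Sum>j<m. q j * y j) = \<phi>)"
  obtain u0 where u0: "D u0" using dual_optimum[OF y0 opt] by (auto simp: D_def \<phi>_def)
  have Fy0: "F y0" using y0 by (simp add: F_def \<phi>_def)
  have one: "\<exists>u y. D u \<and> F y \<and> (0 < y k \<or> (\<Sum>i<r. u i * W i k) < q k)" if k: "k < m" for k
  proof (cases "\<exists>y. F y \<and> 0 < y k")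
    case True
    then show ?thesis using u0 by blast
  next
    case False
    \<comment> \<open>The additional row r states that the objective equals \<phi>, so the feasible
      set becomes the optimal face.\<close>
    define W' where "W' = (\<lambda>i j. if i < r then W i j else q j)"
    define b' where "b' = (\<lambda>i. if i < r then b i else \<phi>)"
    define d where "d = (\<lambda>j. if j = k then 1 else 0 :: real)"
    have feas': "feasible {..<Suc r} {..<m} W' b' y \<longleftrightarrow> F y" for y
      unfolding feasible_def F_def by (auto simp: W'_def b'_def less_Suc_eq)
    have dk: "(\<Sum>j<m. y j * d j) = y k" for y :: "nat \<Rightarrow> real"
      using k by (simp add: d_def if_distrib[of "\<lambda>x. _ * x"] cong: if_cong)
    have "\<exists>y p. feasible {..<Suc r} {..<m} W' b' y \<and> (\<forall>j\<in>{..<m}. d j \<le> (\<Sum>i\<in>{..<Suc r}. p i * W' i j)) \<and>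
      (\<forall>j\<in>{..<m}. y j = 0 \<or> (\<Sum>i\<in>{..<Suc r}. p i * W' i j) = d j)"
      by (rule lp_duality[where \<beta> = 0]) (use False Fy0 in \<open>auto simp: feas' dk not_less\<close>)
    then obtain y p where y: "F y" and p: "\<And>j. j < m \<Longrightarrow> d j \<le> (\<Sum>i<Suc r. p i * W' i j)"
      and c: "\<And>j. j < m \<Longrightarrow> y j = 0 \<or> (\<Sum>i<Suc r. p i * W' i j) = d j"
      by (auto simp: feas')
    have "(\<Sum>i<Suc r. p i * b' i) = (\<Sum>j<m. y j * (\<Sum>i<Suc r. p i * W' i j))"
      by (rule feasible_swap[symmetric]) (simp add: feas' y)
    also have "\<dots> = (\<Sum>j<m. y j * d j)"
      using c by (intro sum.cong) force+
    also have "\<dots> = 0" using y False k by (auto simp: dk F_def feasible_def not_less intro: antisym)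
    finally have pb: "(\<Sum>i<r. p i * b i) + p r * \<phi> = 0" by (simp add: b'_def)
    have pW: "(\<Sum>i<Suc r. p i * W' i j) = (\<Sum>i<r. p i * W i j) + p r * q j" for j
      by (simp add: W'_def)
    \<comment> \<open>The multiplier p r of the objective row may be negative. With K copies of u0
      the total weight \<tau> of q becomes positive; division by it gives a dual feasible point with
      slack at least d j / \<tau>.\<close>
    define K where "K = \<bar>p r\<bar> + 1"
    define \<tau> where "\<tau> = K + p r"
    have K: "K \<ge> 0" "\<tau> > 0" by (simp_all add: K_def \<tau>_def)
    define u where "u = (\<lambda>i. (K * u0 i - p i) / \<tau>)"
    have us: "(\<Sum>i<r. u i * c i) = (K * (\<Sum>i<r. u0 i * c i) - (\<Sum>i<r. p i * c i)) / \<tau>" for c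
      unfolding sum_distrib_left sum_subtractf[symmetric] sum_divide_distrib
      by (rule sum.cong) (simp_all add: u_def algebra_simps diff_divide_distrib)
    have uW: "(\<Sum>i<r. u i * W i j) \<le> q j - d j / \<tau>" if "j < m" for j
    proof -
      have "(\<Sum>i<r. u0 i * W i j) \<le> q j" using u0 that by (simp add: D_def)
      then have "K * (\<Sum>i<r. u0 i * W i j) \<le> K * q j" using K by (intro mult_left_mono)
      then have "K * (\<Sum>i<r. u0 i * W i j) - (\<Sum>i<r. p i * W i j) \<le> \<tau> * q j - d j"
        using p[OF that, unfolded pW] by (simp add: \<tau>_def algebra_simps)
      then have "(K * (\<Sum>i<r. u0 i * W i j) - (\<Sum>i<r. p i * W i j)) / \<tau> \<le> (\<tau> * q j - d j) / \<tau>"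
        using K by (intro divide_right_mono) auto
      then show ?thesis using K unfolding us by (simp add: diff_divide_distrib)
    qed
    have "(\<Sum>i<r. u i * b i) = \<phi>"
    proof -
      have "(\<Sum>i<r. u0 i * b i) = \<phi>" using u0 by (simp add: D_def)
      then show ?thesis using pb K unfolding us by (simp add: \<tau>_def field_simps)
    qed
    moreover have "(\<Sum>i<r. u i * W i j) \<le> q j" if "j < m" for j
    proof -
      have "d j / \<tau> \<ge> 0" using K by (simp add: d_def)
      then show ?thesis using uW[OF that] by linarith
    qed
    ultimately have "D u" by (simp add: D_def)
    moreover have "(\<Sum>i<r. u i * W i k) < q k"
    proof -
      have "d k / \<tau> > 0" using K by (simp add: d_def)
      then show ?thesis using uW[OF k] by linarith
    qed
    ultimately show ?thesis using y by blast
  qed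
  \<comment> \<open>Averaging with the pair that is strict at n keeps strictness at the earlier
    indices, because the other summand has the weak inequality there.\<close>
  have "n \<le> m \<Longrightarrow> \<exists>u y. D u \<and> F y \<and> (\<forall>j<n. 0 < y j \<or> (\<Sum>i<r. u i * W i j) < q j)" for n
  proof (induction n)
    case 0
    then show ?case using u0 Fy0 by blast
  next
    case (Suc n)
    then obtain u y where uy: "D u" "F y" "\<And>j. j < n \<Longrightarrow> 0 < y j \<or> (\<Sum>i<r. u i * W i j) < q j" by auto
    obtain u' y' where uy': "D u'" "F y'" "0 < y' n \<or> (\<Sum>i<r. u' i * W i n) < q n"
      using one[of n] Suc.prems by auto
    define v where "v = (\<lambda>i. (u i + u' i) / 2)"
    define z where "z = (\<lambda>j. (y j + y' j) / 2)"
    have vs: "(\<Sum>i<r. v i * c i) = ((\<Sum>i<r. u i * c i) + (\<Sum>i<r. u' i * c i)) / 2" for c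
      unfolding v_def by (simp add: sum.distrib sum_divide_distrib add_divide_distrib ring_distribs)
    have zs: "(\<Sum>i<m. c i * z i) = ((\<Sum>i<m. c i * y i) + (\<Sum>i<m. c i * y' i)) / 2" for c
      unfolding z_def by (simp add: sum.distrib sum_divide_distrib add_divide_distrib ring_distribs)
    have Dj: "(\<Sum>i<r. u i * W i j) \<le> q j" "(\<Sum>i<r. u' i * W i j) \<le> q j" if "j < m" for j
      using uy(1) uy'(1) that by (auto simp: D_def)
    have Fj: "0 \<le> y j" "0 \<le> y' j" if "j < m" for j
      using uy(2) uy'(2) that by (auto simp: F_def feasible_def)
    have "((\<Sum>i<r. u i * W i j) + (\<Sum>i<r. u' i * W i j)) / 2 \<le> q j" if "j < m" for j
      using Dj[OF that] by simp
    then have "D v" using uy(1) uy'(1) unfolding D_def vs by simp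
    moreover have "feasible {..<r} {..<m} W b z"
      unfolding z_def using uy(2) uy'(2) by (intro feasible_combine) (auto simp: F_def)
    then have "F z" using uy(2) uy'(2) by (simp add: F_def zs)
    moreover have "0 < z j \<or> (\<Sum>i<r. v i * W i j) < q j" if j: "j < Suc n" for j
    proof -
      have jm: "j < m" using that Suc.prems by simp
      have "0 < y j \<or> 0 < y' j \<or> (\<Sum>i<r. u i * W i j) < q j \<or> (\<Sum>i<r. u' i * W i j) < q j"
        using uy(3)[of j] uy'(3) j by (auto simp: less_Suc_eq)
      then show ?thesis using Dj[OF jm] Fj[OF jm] unfolding vs z_def by (auto simp: field_simps)
    qed
    ultimately show ?case by blast
  qed
  from this[of m] show ?thesis by (auto simp: D_def F_def)
qed

text \<open>The tight set J of a strictly complementary dual solution u describes the whole optimal face, so the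
  pessimistic condition becomes a statement about the polyhedron of feasible points supported in J:
  l bounds the upper level objective there, and each \<mu> i writes a row of B as a combination of rows of W.\<close>
theorem pessimistic_certificate:
  fixes W B :: "nat \<Rightarrow> nat \<Rightarrow> real"
  assumes y0: "feasible {..<r} {..<m} W b y0"
    and opt: "\<And>y. feasible {..<r} {..<m} W b y \<Longrightarrow> (\<Sum>j<m. q j * y0 j) \<le> (\<Sum>j<m. q j * y j)"
    and all: "\<And>y. feasible {..<r} {..<m} W b y \<Longrightarrow>
      (\<And>y'. feasible {..<r} {..<m} W b y' \<Longrightarrow> (\<Sum>j<m. q j * y j) \<le> (\<Sum>j<m. q j * y' j)) \<Longrightarrow>
      (\<forall>i<k. (\<Sum>j<m. B i j * y j) = e i) \<and> (\<Sum>j<m. d j * y j) \<le> \<beta>"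
  shows "\<exists>u y l \<mu>. (\<forall>j<m. (\<Sum>i<r. u i * W i j) \<le> q j) \<and> feasible {..<r} {..<m} W b y \<and>
    (\<forall>j<m. (\<Sum>i<r. u i * W i j) < q j \<longrightarrow> y j = 0) \<and>
    (\<forall>j<m. (\<Sum>i<r. u i * W i j) = q j \<longrightarrow> d j \<le> (\<Sum>i<r. l i * W i j) \<and> (y j = 0 \<or> (\<Sum>i<r. l i * W i j) = d j)) \<and>
    (\<forall>i'<k. \<forall>j<m. (\<Sum>i<r. u i * W i j) = q j \<longrightarrow> (\<Sum>i<r. \<mu> i' i * W i j) = B i' j) \<and>
    (\<forall>i<k. (\<Sum>j<m. B i j * y j) = e i) \<and> (\<Sum>j<m. d j * y j) \<le> \<beta>"
proof -
  define \<phi> where "\<phi> = (\<Sum>j<m. q j * y0 j)"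
  from strict_complementarity[OF y0 opt] obtain u ys where u: "\<And>j. j < m \<Longrightarrow> (\<Sum>i<r. u i * W i j) \<le> q j"
    "(\<Sum>i<r. u i * b i) = \<phi>" and ys: "feasible {..<r} {..<m} W b ys" "(\<Sum>j<m. q j * ys j) = \<phi>"
    and sc: "\<And>j. j < m \<Longrightarrow> 0 < ys j \<or> (\<Sum>i<r. u i * W i j) < q j" by (auto simp: \<phi>_def)
  define J where "J = {j. j < m \<and> (\<Sum>i<r. u i * W i j) = q j}"
  have J: "finite J" "J \<subseteq> {..<m}" by (auto simp: J_def)
  have sumJ: "(\<Sum>j<m. f j) = (\<Sum>j\<in>J. f j)" if "\<And>j. j < m \<Longrightarrow> j \<notin> J \<Longrightarrow> f j = 0" for f :: "nat \<Rightarrow> real"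
    using J that by (intro sum.mono_neutral_right) auto
  have off: "ys j = 0" if "j < m" "j \<notin> J" for j
  proof -
    have nn: "0 \<le> ys i * (q i - (\<Sum>i'<r. u i' * W i' i))" if "i \<in> {..<m}" for i
      using ys u(1)[of i] that by (simp add: feasible_def)
    have "(\<Sum>j<m. ys j * (q j - (\<Sum>i<r. u i * W i j))) = 0"
      using feasible_swap[OF ys(1), of u] ys(2) u(2)
      by (simp add: right_diff_distrib sum_subtractf mult.commute)
    then have "ys j * (q j - (\<Sum>i<r. u i * W i j)) = 0"
      by (rule sum_nonneg_zeroD) (use nn that in auto)
    then show ?thesis using that by (auto simp: J_def)
  qed
  have ysJ: "feasible {..<r} J W b ys"
    using ys(1) J sumJ[of "\<lambda>j. W _ j * ys j"] off by (auto simp: feasible_def)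
  define ex where "ex = (\<lambda>y j. if j \<in> J then y j else (0::real))"
  have exs: "(\<Sum>j<m. c j * ex y j) = (\<Sum>j\<in>J. c j * y j)" for c y
  proof -
    have "(\<Sum>j<m. c j * ex y j) = (\<Sum>j\<in>J. c j * ex y j)" by (rule sumJ) (simp add: ex_def)
    also have "\<dots> = (\<Sum>j\<in>J. c j * y j)" by (rule sum.cong) (simp_all add: ex_def)
    finally show ?thesis .
  qed
  have exf: "feasible {..<r} {..<m} W b (ex y)" if "feasible {..<r} J W b y" for y
    using that unfolding feasible_def exs by (auto simp: ex_def)
  \<comment> \<open>On J the vector q agrees with u W, so every feasible point supported there has
    the objective value u b, which is optimal.\<close>
  have exq: "(\<Sum>j<m. q j * ex y j) = \<phi>" if "feasible {..<r} J W b y" for y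
  proof -
    have "(\<Sum>j\<in>J. q j * y j) = (\<Sum>j\<in>J. y j * (\<Sum>i<r. u i * W i j))"
      by (rule sum.cong) (simp_all add: J_def)
    then show ?thesis using feasible_swap[OF that, of u] u(2) by (simp add: exs)
  qed
  have allJ: "(\<forall>i<k. (\<Sum>j\<in>J. B i j * y j) = e i) \<and> (\<Sum>j\<in>J. d j * y j) \<le> \<beta>" if "feasible {..<r} J W b y" for y
    using all[OF exf[OF that]] opt unfolding exq[OF that] \<phi>_def exs by blast
  have "\<exists>y p. feasible {..<r} J W b y \<and> (\<forall>j\<in>J. d j \<le> (\<Sum>i<r. p i * W i j)) \<and>
    (\<forall>j\<in>J. y j = 0 \<or> (\<Sum>i<r. p i * W i j) = d j)"
    by (rule lp_duality[OF _ J(1) ysJ, where \<beta> = \<beta>]) (use allJ in \<open>auto simp: mult.commute\<close>)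
  then obtain y l where yl: "feasible {..<r} J W b y" "\<And>j. j \<in> J \<Longrightarrow> d j \<le> (\<Sum>i<r. l i * W i j)"
    "\<And>j. j \<in> J \<Longrightarrow> y j = 0 \<or> (\<Sum>i<r. l i * W i j) = d j" by blast
  have "\<exists>p. \<forall>j\<in>J. (\<Sum>i<r. p i * W i j) = B i' j" if i': "i' < k" for i'
  proof -
    have "\<exists>y p. feasible {..<r} J W b y \<and> (\<forall>j\<in>J. B i' j \<le> (\<Sum>i<r. p i * W i j)) \<and>
      (\<forall>j\<in>J. y j = 0 \<or> (\<Sum>i<r. p i * W i j) = B i' j)"
      by (rule lp_duality[OF _ J(1) ysJ, where \<beta> = "e i'"]) (use allJ i' in \<open>auto simp: mult.commute\<close>)
    then obtain y p where yp: "feasible {..<r} J W b y" "\<And>j. j \<in> J \<Longrightarrow> B i' j \<le> (\<Sum>i<r. p i * W i j)"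
      "\<And>j. j \<in> J \<Longrightarrow> y j = 0 \<or> (\<Sum>i<r. p i * W i j) = B i' j" by blast
    \<comment> \<open>The values of row i' at y and at \<open>ys\<close> are both e i', so the gaps
      between p W and the row, weighted by \<open>ys\<close>, sum to zero. Since \<open>ys\<close>
      is positive on J, every gap vanishes and the inequality becomes an equality.\<close>
    have "(\<Sum>i<r. p i * b i) = (\<Sum>j\<in>J. y j * (\<Sum>i<r. p i * W i j))"
      by (rule feasible_swap[OF yp(1), symmetric])
    also have "\<dots> = (\<Sum>j\<in>J. B i' j * y j)" using yp(3) by (intro sum.cong) force+
    also have "\<dots> = e i'" using allJ[OF yp(1)] i' by blast
    finally have "(\<Sum>j\<in>J. ys j * ((\<Sum>i<r. p i * W i j) - B i' j)) = 0"
      using feasible_swap[OF ysJ, of p] allJ[OF ysJ] i'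
      by (simp add: right_diff_distrib sum_subtractf mult.commute)
    moreover have nn: "0 \<le> ys j * ((\<Sum>i<r. p i * W i j) - B i' j)" if "j \<in> J" for j
      using ysJ yp(2)[OF that] that by (simp add: feasible_def)
    ultimately have "ys j * ((\<Sum>i<r. p i * W i j) - B i' j) = 0" if "j \<in> J" for j
      using that by (intro sum_nonneg_zeroD[OF _ J(1) nn])
    moreover have "ys j > 0" if "j \<in> J" for j using sc[of j] that by (auto simp: J_def)
    ultimately have "(\<Sum>i<r. p i * W i j) = B i' j" if "j \<in> J" for j using that by force
    then show ?thesis by blast
  qed
  then obtain \<mu> where \<mu>: "\<And>i' j. i' < k \<Longrightarrow> j \<in> J \<Longrightarrow> (\<Sum>i<r. \<mu> i' i * W i j) = B i' j" by metis
  show ?thesis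
  proof (rule exI[of _ u], rule exI[of _ "ex y"], rule exI[of _ l], rule exI[of _ \<mu>], intro conjI)
    show "\<forall>j<m. (\<Sum>i<r. u i * W i j) < q j \<longrightarrow> ex y j = 0" by (auto simp: ex_def J_def)
    show "\<forall>j<m. (\<Sum>i<r. u i * W i j) = q j \<longrightarrow> d j \<le> (\<Sum>i<r. l i * W i j) \<and> (ex y j = 0 \<or> (\<Sum>i<r. l i * W i j) = d j)"
      using yl(2,3) by (auto simp: ex_def J_def)
    show "\<forall>i'<k. \<forall>j<m. (\<Sum>i<r. u i * W i j) = q j \<longrightarrow> (\<Sum>i<r. \<mu> i' i * W i j) = B i' j"
      using \<mu> by (auto simp: J_def)
    show "\<forall>i<k. (\<Sum>j<m. B i j * ex y j) = e i" "(\<Sum>j<m. d j * ex y j) \<le> \<beta>"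
      unfolding exs using allJ[OF yl(1)] by auto
  qed (use u(1) exf[OF yl(1)] in auto)
qed

text \<open>Complementarity with u makes y optimal. Every other optimal y' then vanishes off the
  tight set too, where the rows of B are combinations of rows of W; so B y' and B y are both
  determined by the right-hand side b. In the same way d y' <= l b = d y.\<close>

theorem pessimistic_certificate_sound:
  fixes W B :: "nat \<Rightarrow> nat \<Rightarrow> real"
  assumes u: "\<And>j. j < m \<Longrightarrow> (\<Sum>i<r. u i * W i j) \<le> q j" and y: "feasible {..<r} {..<m} W b y"
    and y0: "\<And>j. j < m \<Longrightarrow> (\<Sum>i<r. u i * W i j) < q j \<Longrightarrow> y j = 0"
    and l: "\<And>j. j < m \<Longrightarrow> (\<Sum>i<r. u i * W i j) = q j \<Longrightarrow>
      d j \<le> (\<Sum>i<r. l i * W i j) \<and> (y j = 0 \<or> (\<Sum>i<r. l i * W i j) = d j)"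
    and \<mu>: "\<And>i'. i' < k \<Longrightarrow> \<exists>\<mu>. \<forall>j<m. (\<Sum>i<r. u i * W i j) = q j \<longrightarrow> (\<Sum>i<r. \<mu> i * W i j) = B i' j"
    and e: "\<And>i. i < k \<Longrightarrow> (\<Sum>j<m. B i j * y j) = e i" and \<beta>: "(\<Sum>j<m. d j * y j) \<le> \<beta>"
  shows "\<And>y'. feasible {..<r} {..<m} W b y' \<Longrightarrow> (\<Sum>j<m. q j * y j) \<le> (\<Sum>j<m. q j * y' j)"
    and "\<And>y'. feasible {..<r} {..<m} W b y' \<Longrightarrow> (\<Sum>j<m. q j * y' j) \<le> (\<Sum>j<m. q j * y j) \<Longrightarrow>
      (\<forall>i<k. (\<Sum>j<m. B i j * y' j) = e i) \<and> (\<Sum>j<m. d j * y' j) \<le> \<beta>"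
proof -
  have "(\<Sum>j<m. q j * y j) = (\<Sum>j<m. y j * (\<Sum>i<r. u i * W i j))"
  proof (rule sum.cong)
    fix j assume "j \<in> {..<m}"
    then show "q j * y j = y j * (\<Sum>i<r. u i * W i j)"
      using u[of j] y0[of j] by (cases "(\<Sum>i<r. u i * W i j) < q j") auto
  qed simp
  then have qy: "(\<Sum>j<m. q j * y j) = (\<Sum>i<r. u i * b i)" using feasible_swap[OF y, of u] by simp
  have nn: "0 \<le> y' j * (q j - (\<Sum>i<r. u i * W i j))" if "feasible {..<r} {..<m} W b y'" "j \<in> {..<m}" for y' j
    using that u[of j] by (simp add: feasible_def)
  have gap: "(\<Sum>j<m. y' j * (q j - (\<Sum>i<r. u i * W i j))) = (\<Sum>j<m. q j * y' j) - (\<Sum>j<m. q j * y j)"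
    if "feasible {..<r} {..<m} W b y'" for y'
    using feasible_swap[OF that, of u] qy by (simp add: right_diff_distrib sum_subtractf mult.commute)
  show opt: "(\<Sum>j<m. q j * y j) \<le> (\<Sum>j<m. q j * y' j)" if "feasible {..<r} {..<m} W b y'" for y'
  proof -
    have "0 \<le> (\<Sum>j<m. y' j * (q j - (\<Sum>i<r. u i * W i j)))" by (rule sum_nonneg) (rule nn[OF that])
    then show ?thesis using gap[OF that] by simp
  qed
  fix y' assume y': "feasible {..<r} {..<m} W b y'" and le: "(\<Sum>j<m. q j * y' j) \<le> (\<Sum>j<m. q j * y j)"
  have "(\<Sum>j<m. y' j * (q j - (\<Sum>i<r. u i * W i j))) = 0"
    using gap[OF y'] opt[OF y'] le by simp
  then have z: "y' j * (q j - (\<Sum>i<r. u i * W i j)) = 0" if "j < m" for j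
    by (rule sum_nonneg_zeroD) (use nn[OF y'] that in auto)
  have off: "y' j = 0" if "j < m" "(\<Sum>i<r. u i * W i j) \<noteq> q j" for j
    using z[OF that(1)] that(2) by auto
  have off0: "y j = 0" if "j < m" "(\<Sum>i<r. u i * W i j) \<noteq> q j" for j
    using u[OF that(1)] y0[OF that(1)] that(2) by auto
  show "(\<forall>i<k. (\<Sum>j<m. B i j * y' j) = e i) \<and> (\<Sum>j<m. d j * y' j) \<le> \<beta>"
  proof (intro conjI allI impI)
    fix i' assume i': "i' < k"
    obtain p where p: "\<And>j. j < m \<Longrightarrow> (\<Sum>i<r. u i * W i j) = q j \<Longrightarrow> (\<Sum>i<r. p i * W i j) = B i' j"
      using \<mu>[OF i'] by blast
    have *: "(\<Sum>j<m. B i' j * z j) = (\<Sum>j<m. z j * (\<Sum>i<r. p i * W i j))"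
      if "\<And>j. j < m \<Longrightarrow> (\<Sum>i<r. u i * W i j) \<noteq> q j \<Longrightarrow> z j = 0" for z
    proof (rule sum.cong)
      fix j assume "j \<in> {..<m}"
      then show "B i' j * z j = z j * (\<Sum>i<r. p i * W i j)"
        using p[of j] that[of j] by (cases "(\<Sum>i<r. u i * W i j) = q j") auto
    qed simp
    show "(\<Sum>j<m. B i' j * y' j) = e i'"
      using *[of y', OF off] *[of y, OF off0] feasible_swap[OF y, of p] feasible_swap[OF y', of p] e[OF i'] by simp
  next
    have "(\<Sum>j<m. d j * y' j) \<le> (\<Sum>j<m. y' j * (\<Sum>i<r. l i * W i j))"
    proof (rule sum_mono)
      fix j assume j: "j \<in> {..<m}"
      show "d j * y' j \<le> y' j * (\<Sum>i<r. l i * W i j)"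
      proof (cases "(\<Sum>i<r. u i * W i j) = q j")
        case True
        have "y' j * d j \<le> y' j * (\<Sum>i<r. l i * W i j)"
          using True l[of j] j y' by (intro mult_left_mono) (auto simp: feasible_def)
        then show ?thesis by (simp add: mult.commute)
      qed (use off[of j] j in simp)
    qed
    also have "\<dots> = (\<Sum>j<m. y j * (\<Sum>i<r. l i * W i j))"
      by (simp add: feasible_swap[OF y] feasible_swap[OF y'])
    also have "\<dots> = (\<Sum>j<m. d j * y j)"
    proof (rule sum.cong)
      fix j assume j: "j \<in> {..<m}"
      then show "y j * (\<Sum>i<r. l i * W i j) = d j * y j"
        using l[of j] off0[of j] by (cases "(\<Sum>i<r. u i * W i j) = q j") auto
    qed simp
    finally show "(\<Sum>j<m. d j * y' j) \<le> \<beta>" using \<beta> by linarith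
  qed
qed

section \<open>Certificates for bilevel programs\<close>

definition rcert :: "nat \<Rightarrow> nat \<Rightarrow> nat \<Rightarrow> nat \<Rightarrow> (nat \<Rightarrow> real) \<Rightarrow> (nat \<Rightarrow> real) \<Rightarrow> (nat \<Rightarrow> real) \<Rightarrow>
    (nat \<Rightarrow> nat \<Rightarrow> real) \<Rightarrow> (nat \<Rightarrow> nat \<Rightarrow> real) \<Rightarrow> (nat \<Rightarrow> real) \<Rightarrow>
    (nat \<Rightarrow> nat \<Rightarrow> real) \<Rightarrow> (nat \<Rightarrow> nat \<Rightarrow> real) \<Rightarrow> (nat \<Rightarrow> real) \<Rightarrow> real \<Rightarrow> bool" where
  "rcert n m k r c d q A B a T W h \<alpha> \<longleftrightarrow> (\<exists>x y u l \<mu>.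
     (\<forall>j<n. 0 \<le> x j) \<and> (\<forall>j<m. 0 \<le> y j) \<and>
     (\<forall>i<r. (\<Sum>j<n. x j * T i j) + (\<Sum>j<m. y j * W i j) = h i) \<and>
     (\<forall>i<k. (\<Sum>j<n. x j * A i j) + (\<Sum>j<m. y j * B i j) = a i) \<and>
     (\<Sum>j<n. x j * c j) + (\<Sum>j<m. y j * d j) \<le> \<alpha> \<and>
     (\<forall>j<m. (\<Sum>i<r. u i * W i j) \<le> q j) \<and>
     (\<forall>j<m. (\<Sum>i<r. u i * W i j) < q j \<longrightarrow> y j = 0) \<and>
     (\<forall>j<m. (\<Sum>i<r. u i * W i j) = q j \<longrightarrow> d j \<le> (\<Sum>i<r. l i * W i j) \<and> (y j = 0 \<or> (\<Sum>i<r. l i * W i j) = d j)) \<and>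
     (\<forall>i'<k. \<forall>j<m. (\<Sum>i<r. u i * W i j) = q j \<longrightarrow> (\<Sum>i<r. \<mu> i' i * W i j) = B i' j))"

text \<open>Every condition compares two expressions that are linear in the data, so a common
  positive factor cancels and the same x, y, u, l, \<mu> serve. This is how rational data are
  replaced by integers.\<close>

lemma rcert_scale:
  assumes "0 < L" "rcert n m k r c d q A B a T W h \<alpha>"
  shows "rcert n m k r (\<lambda>j. L * c j) (\<lambda>j. L * d j) (\<lambda>j. L * q j) (\<lambda>i j. L * A i j) (\<lambda>i j. L * B i j) (\<lambda>j. L * a j)
    (\<lambda>i j. L * T i j) (\<lambda>i j. L * W i j) (\<lambda>i. L * h i) (L * \<alpha>)"
proof -
  have s: "(\<Sum>i\<in>I. u i * (L * v i)) = L * (\<Sum>i\<in>I. u i * v i)" for I :: "nat set" and u v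
    by (simp add: sum_distrib_left mult.left_commute)
  show ?thesis
    using assms unfolding rcert_def s distrib_left[symmetric] by simp
qed

lemma rcert_cong:
  assumes "rcert n m k r c d q A B a T W h \<alpha>"
    "\<And>j. j < n \<Longrightarrow> c j = c' j" "\<And>j. j < m \<Longrightarrow> d j = d' j" "\<And>j. j < m \<Longrightarrow> q j = q' j"
    "\<And>i j. i < k \<Longrightarrow> j < n \<Longrightarrow> A i j = A' i j" "\<And>i j. i < k \<Longrightarrow> j < m \<Longrightarrow> B i j = B' i j" "\<And>i. i < k \<Longrightarrow> a i = a' i"
    "\<And>i j. i < r \<Longrightarrow> j < n \<Longrightarrow> T i j = T' i j" "\<And>i j. i < r \<Longrightarrow> j < m \<Longrightarrow> W i j = W' i j" "\<And>i. i < r \<Longrightarrow> h i = h' i"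
    "\<alpha> = \<alpha>'"
  shows "rcert n m k r c' d' q' A' B' a' T' W' h' \<alpha>'"
proof -
  have 1: "(\<Sum>j<n. x j * T i j) = (\<Sum>j<n. x j * T' i j)" "(\<Sum>j<m. y j * W i j) = (\<Sum>j<m. y j * W' i j)" if "i < r" for i x y
    using assms that by auto
  have 2: "(\<Sum>j<n. x j * A i j) = (\<Sum>j<n. x j * A' i j)" "(\<Sum>j<m. y j * B i j) = (\<Sum>j<m. y j * B' i j)" if "i < k" for i x y
    using assms that by auto
  have 3: "(\<Sum>i<r. u i * W i j) = (\<Sum>i<r. u i * W' i j)" if "j < m" for u j
    using assms that by auto
  have 4: "(\<Sum>j<n. x j * c j) = (\<Sum>j<n. x j * c' j)" "(\<Sum>j<m. y j * d j) = (\<Sum>j<m. y j * d' j)" for x y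
    using assms by auto
  from assms(1) obtain x y u l \<mu> where h:
     "\<forall>j<n. 0 \<le> x j" "\<forall>j<m. 0 \<le> y j"
     "\<forall>i<r. (\<Sum>j<n. x j * T i j) + (\<Sum>j<m. y j * W i j) = h i"
     "\<forall>i<k. (\<Sum>j<n. x j * A i j) + (\<Sum>j<m. y j * B i j) = a i"
     "(\<Sum>j<n. x j * c j) + (\<Sum>j<m. y j * d j) \<le> \<alpha>"
     "\<forall>j<m. (\<Sum>i<r. u i * W i j) \<le> q j"
     "\<forall>j<m. (\<Sum>i<r. u i * W i j) < q j \<longrightarrow> y j = 0"
     "\<forall>j<m. (\<Sum>i<r. u i * W i j) = q j \<longrightarrow> d j \<le> (\<Sum>i<r. l i * W i j) \<and> (y j = 0 \<or> (\<Sum>i<r. l i * W i j) = d j)"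
     "\<forall>i'<k. \<forall>j<m. (\<Sum>i<r. u i * W i j) = q j \<longrightarrow> (\<Sum>i<r. \<mu> i' i * W i j) = B i' j"
    unfolding rcert_def by (elim exE conjE)
  show ?thesis unfolding rcert_def
  proof (rule exI[of _ x], rule exI[of _ y], rule exI[of _ u], rule exI[of _ l], rule exI[of _ \<mu>], intro conjI)
    show "\<forall>i<r. (\<Sum>j<n. x j * T' i j) + (\<Sum>j<m. y j * W' i j) = h' i"
      using h(3) 1 assms(10) by simp
    show "\<forall>i<k. (\<Sum>j<n. x j * A' i j) + (\<Sum>j<m. y j * B' i j) = a' i"
      using h(4) 2 assms(7) by simp
    show "(\<Sum>j<n. x j * c' j) + (\<Sum>j<m. y j * d' j) \<le> \<alpha>'"
      using h(5) 4 assms(11) by simp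
    show "\<forall>j<m. (\<Sum>i<r. u i * W' i j) \<le> q' j" "\<forall>j<m. (\<Sum>i<r. u i * W' i j) < q' j \<longrightarrow> y j = 0"
      using h(6,7) 3 assms(4) by simp_all
    show "\<forall>j<m. (\<Sum>i<r. u i * W' i j) = q' j \<longrightarrow> d' j \<le> (\<Sum>i<r. l i * W' i j) \<and> (y j = 0 \<or> (\<Sum>i<r. l i * W' i j) = d' j)"
      using h(8) 3 assms(3,4) by simp
    show "\<forall>i'<k. \<forall>j<m. (\<Sum>i<r. u i * W' i j) = q' j \<longrightarrow> (\<Sum>i<r. \<mu> i' i * W' i j) = B' i' j"
      using h(9) 3 assms(4,6) by simp
  qed (rule h)+
qed

lemma rdot_sum: "length v = n \<Longrightarrow> rdot v x = (\<Sum>j<n. x j * real_of_rat (v ! j))"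
  by (simp add: rdot_def mult.commute)

lemma blp_yes_rcert:
  assumes "blp_wf I"
  shows "blp_yes I \<longleftrightarrow> rcert (dim_n I) (dim_m I) (dim_k I) (dim_r I)
    (\<lambda>j. real_of_rat (vec_c I ! j)) (\<lambda>j. real_of_rat (vec_d I ! j)) (\<lambda>j. real_of_rat (vec_q I ! j))
    (\<lambda>i j. real_of_rat (mat_A I ! i ! j)) (\<lambda>i j. real_of_rat (mat_B I ! i ! j)) (\<lambda>i. real_of_rat (vec_a I ! i))
    (\<lambda>i j. real_of_rat (mat_T I ! i ! j)) (\<lambda>i j. real_of_rat (mat_W I ! i ! j)) (\<lambda>i. real_of_rat (vec_h I ! i))
    (real_of_rat (val_alpha I))"
    (is "_ \<longleftrightarrow> rcert ?n ?m ?k ?r ?c ?d ?q ?A ?B ?a ?T ?W ?h ?\<alpha>")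
proof -
  have len: "length (vec_c I) = ?n" "length (vec_d I) = ?m" "length (vec_q I) = ?m"
    "i < ?k \<Longrightarrow> length (mat_A I ! i) = ?n" "i < ?k \<Longrightarrow> length (mat_B I ! i) = ?m"
    "i < ?r \<Longrightarrow> length (mat_T I ! i) = ?n" "i < ?r \<Longrightarrow> length (mat_W I ! i) = ?m" for i
    using assms by (auto simp: blp_wf_def)
  \<comment> \<open>For fixed x both levels become constraints on y alone, with right-hand sides b
    x, e x and the bound \<beta> x.\<close>
  define b where "b = (\<lambda>x i. ?h i - (\<Sum>j<?n. x j * ?T i j))"
  define e where "e = (\<lambda>x i. ?a i - (\<Sum>j<?n. x j * ?A i j))"
  define \<beta> where "\<beta> = (\<lambda>x. ?\<alpha> - (\<Sum>j<?n. x j * ?c j))"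
  have feas: "ll_feasible I x y \<longleftrightarrow> feasible {..<?r} {..<?m} ?W (b x) y" for x y
    by (auto simp: ll_feasible_def feasible_def rdot_sum len b_def mult.commute algebra_simps)
  have obj: "rdot (vec_q I) y = (\<Sum>j<?m. ?q j * y j)" for y
    by (simp add: rdot_sum len mult.commute)
  have opt: "ll_optimal I x y \<longleftrightarrow> feasible {..<?r} {..<?m} ?W (b x) y \<and>
    (\<forall>y'. feasible {..<?r} {..<?m} ?W (b x) y' \<longrightarrow> (\<Sum>j<?m. ?q j * y j) \<le> (\<Sum>j<?m. ?q j * y' j))" for x y
    by (simp add: ll_optimal_def feas obj)
  have up: "((\<forall>i<?k. rdot (mat_A I ! i) x + rdot (mat_B I ! i) y = ?a i) \<and> rdot (vec_c I) x + rdot (vec_d I) y \<le> ?\<alpha>)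
     \<longleftrightarrow> (\<forall>i<?k. (\<Sum>j<?m. ?B i j * y j) = e x i) \<and> (\<Sum>j<?m. ?d j * y j) \<le> \<beta> x" for x y
    by (auto simp: rdot_sum len e_def \<beta>_def mult.commute algebra_simps)
  show ?thesis
  proof
    assume "blp_yes I"
    then obtain x y0 where x: "\<forall>j<?n. 0 \<le> x j" and y0: "ll_optimal I x y0"
      and all: "\<And>y. ll_optimal I x y \<Longrightarrow> (\<forall>i<?k. (\<Sum>j<?m. ?B i j * y j) = e x i) \<and> (\<Sum>j<?m. ?d j * y j) \<le> \<beta> x"
      unfolding blp_yes_def up by blast
    have "\<exists>u y l \<mu>. (\<forall>j<?m. (\<Sum>i<?r. u i * ?W i j) \<le> ?q j) \<and> feasible {..<?r} {..<?m} ?W (b x) y \<and>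
      (\<forall>j<?m. (\<Sum>i<?r. u i * ?W i j) < ?q j \<longrightarrow> y j = 0) \<and>
      (\<forall>j<?m. (\<Sum>i<?r. u i * ?W i j) = ?q j \<longrightarrow> ?d j \<le> (\<Sum>i<?r. l i * ?W i j) \<and> (y j = 0 \<or> (\<Sum>i<?r. l i * ?W i j) = ?d j)) \<and>
      (\<forall>i'<?k. \<forall>j<?m. (\<Sum>i<?r. u i * ?W i j) = ?q j \<longrightarrow> (\<Sum>i<?r. \<mu> i' i * ?W i j) = ?B i' j) \<and>
      (\<forall>i<?k. (\<Sum>j<?m. ?B i j * y j) = e x i) \<and> (\<Sum>j<?m. ?d j * y j) \<le> \<beta> x"
      by (rule pessimistic_certificate[where ?y0.0 = y0]) (use y0 all in \<open>unfold opt, blast+\<close>)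
    then obtain u y l \<mu> where *: "\<forall>j<?m. (\<Sum>i<?r. u i * ?W i j) \<le> ?q j" "feasible {..<?r} {..<?m} ?W (b x) y"
      "\<forall>j<?m. (\<Sum>i<?r. u i * ?W i j) < ?q j \<longrightarrow> y j = 0"
      "\<forall>j<?m. (\<Sum>i<?r. u i * ?W i j) = ?q j \<longrightarrow> ?d j \<le> (\<Sum>i<?r. l i * ?W i j) \<and> (y j = 0 \<or> (\<Sum>i<?r. l i * ?W i j) = ?d j)"
      "\<forall>i'<?k. \<forall>j<?m. (\<Sum>i<?r. u i * ?W i j) = ?q j \<longrightarrow> (\<Sum>i<?r. \<mu> i' i * ?W i j) = ?B i' j"
      "\<forall>i<?k. (\<Sum>j<?m. ?B i j * y j) = e x i" "(\<Sum>j<?m. ?d j * y j) \<le> \<beta> x" by blast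
    have y: "\<forall>j<?m. 0 \<le> y j" "\<forall>i<?r. (\<Sum>j<?n. x j * ?T i j) + (\<Sum>j<?m. y j * ?W i j) = ?h i"
      using *(2) by (auto simp: feasible_def b_def mult.commute)
    have up: "\<forall>i<?k. (\<Sum>j<?n. x j * ?A i j) + (\<Sum>j<?m. y j * ?B i j) = ?a i"
      "(\<Sum>j<?n. x j * ?c j) + (\<Sum>j<?m. y j * ?d j) \<le> ?\<alpha>"
      using *(6,7) by (auto simp: e_def \<beta>_def mult.commute)
    show "rcert ?n ?m ?k ?r ?c ?d ?q ?A ?B ?a ?T ?W ?h ?\<alpha>"
      unfolding rcert_def
      by (rule exI[of _ x], rule exI[of _ y], rule exI[of _ u], rule exI[of _ l], rule exI[of _ \<mu>], intro conjI)
        (fact x y up *)+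
  next
    assume "rcert ?n ?m ?k ?r ?c ?d ?q ?A ?B ?a ?T ?W ?h ?\<alpha>"
    then obtain x y u l \<mu> where x: "\<forall>j<?n. 0 \<le> x j" and y: "\<forall>j<?m. 0 \<le> y j"
     "\<forall>i<?r. (\<Sum>j<?n. x j * ?T i j) + (\<Sum>j<?m. y j * ?W i j) = ?h i"
     "\<forall>i<?k. (\<Sum>j<?n. x j * ?A i j) + (\<Sum>j<?m. y j * ?B i j) = ?a i"
     "(\<Sum>j<?n. x j * ?c j) + (\<Sum>j<?m. y j * ?d j) \<le> ?\<alpha>" and u:
     "\<forall>j<?m. (\<Sum>i<?r. u i * ?W i j) \<le> ?q j"
     "\<forall>j<?m. (\<Sum>i<?r. u i * ?W i j) < ?q j \<longrightarrow> y j = 0"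
     "\<forall>j<?m. (\<Sum>i<?r. u i * ?W i j) = ?q j \<longrightarrow> ?d j \<le> (\<Sum>i<?r. l i * ?W i j) \<and> (y j = 0 \<or> (\<Sum>i<?r. l i * ?W i j) = ?d j)"
     "\<forall>i'<?k. \<forall>j<?m. (\<Sum>i<?r. u i * ?W i j) = ?q j \<longrightarrow> (\<Sum>i<?r. \<mu> i' i * ?W i j) = ?B i' j"
      unfolding rcert_def by (elim exE conjE)
    have fy: "feasible {..<?r} {..<?m} ?W (b x) y"
      using y(1,2) by (auto simp: feasible_def b_def mult.commute algebra_simps)
    have e: "(\<Sum>j<?m. ?B i j * y j) = e x i" if "i < ?k" for i
      using y(3) that by (auto simp: e_def mult.commute algebra_simps)
    have \<beta>: "(\<Sum>j<?m. ?d j * y j) \<le> \<beta> x"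
      using y(4) by (auto simp: \<beta>_def mult.commute algebra_simps)
    have mu: "\<exists>\<mu>. \<forall>j<?m. (\<Sum>i<?r. u i * ?W i j) = ?q j \<longrightarrow> (\<Sum>i<?r. \<mu> i * ?W i j) = ?B i' j" if "i' < ?k" for i'
      using u(4) that by blast
    note s = pessimistic_certificate_sound[where m = ?m and r = ?r and u = u and W = ?W and q = ?q and b = "b x" and y = y
        and d = ?d and l = l and k = ?k and B = ?B and e = "e x" and \<beta> = "\<beta> x", OF u(1)[rule_format] fy u(2)[rule_format] u(3)[rule_format] mu e \<beta>]
    have "ll_optimal I x y" unfolding opt using fy s(1) by blast
    moreover have "(\<forall>i<?k. (\<Sum>j<?m. ?B i j * y' j) = e x i) \<and> (\<Sum>j<?m. ?d j * y' j) \<le> \<beta> x"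
      if "ll_optimal I x y'" for y'
      using that unfolding opt by (intro s(2)) (use fy in blast)+
    ultimately show "blp_yes I" unfolding blp_yes_def up using x by blast
  qed
qed

text \<open>Numerators over common denominators. x and y occur in the same equations and share D; u,
  l and each \<mu> i' come from separate systems and bring their own denominators.\<close>

definition icert :: "nat \<Rightarrow> nat \<Rightarrow> nat \<Rightarrow> nat \<Rightarrow> (nat \<Rightarrow> int) \<Rightarrow> (nat \<Rightarrow> int) \<Rightarrow> (nat \<Rightarrow> int) \<Rightarrow>
    (nat \<Rightarrow> nat \<Rightarrow> int) \<Rightarrow> (nat \<Rightarrow> nat \<Rightarrow> int) \<Rightarrow> (nat \<Rightarrow> int) \<Rightarrow>
    (nat \<Rightarrow> nat \<Rightarrow> int) \<Rightarrow> (nat \<Rightarrow> nat \<Rightarrow> int) \<Rightarrow> (nat \<Rightarrow> int) \<Rightarrow> int \<Rightarrow>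
    (nat \<Rightarrow> int) \<Rightarrow> (nat \<Rightarrow> int) \<Rightarrow> int \<Rightarrow> (nat \<Rightarrow> int) \<Rightarrow> int \<Rightarrow> (nat \<Rightarrow> int) \<Rightarrow> int \<Rightarrow> (nat \<Rightarrow> nat \<Rightarrow> int) \<Rightarrow> (nat \<Rightarrow> int) \<Rightarrow> bool" where
  "icert n m k r c d q A B a T W h \<alpha> x y D u Du l Dl \<mu> D\<mu> \<longleftrightarrow>
     (\<forall>j<n. 0 \<le> x j) \<and> (\<forall>j<m. 0 \<le> y j) \<and> 0 < D \<and> 0 < Du \<and> 0 < Dl \<and> (\<forall>i'<k. 0 < D\<mu> i') \<and>
     (\<forall>i<r. (\<Sum>j<n. x j * T i j) + (\<Sum>j<m. y j * W i j) = D * h i) \<and>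
     (\<forall>i<k. (\<Sum>j<n. x j * A i j) + (\<Sum>j<m. y j * B i j) = D * a i) \<and>
     (\<Sum>j<n. x j * c j) + (\<Sum>j<m. y j * d j) \<le> D * \<alpha> \<and>
     (\<forall>j<m. (\<Sum>i<r. u i * W i j) \<le> Du * q j) \<and>
     (\<forall>j<m. (\<Sum>i<r. u i * W i j) < Du * q j \<longrightarrow> y j = 0) \<and>
     (\<forall>j<m. (\<Sum>i<r. u i * W i j) = Du * q j \<longrightarrow> Dl * d j \<le> (\<Sum>i<r. l i * W i j) \<and> (y j = 0 \<or> (\<Sum>i<r. l i * W i j) = Dl * d j)) \<and>
     (\<forall>i'<k. \<forall>j<m. (\<Sum>i<r. u i * W i j) = Du * q j \<longrightarrow> (\<Sum>i<r. \<mu> i' i * W i j) = D\<mu> i' * B i' j)"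

lemma icert_rcert:
  assumes "icert n m k r c d q A B a T W h \<alpha> x y D u Du l Dl \<mu> D\<mu>"
  shows "rcert n m k r (\<lambda>j. of_int (c j)) (\<lambda>j. of_int (d j)) (\<lambda>j. of_int (q j)) (\<lambda>i j. of_int (A i j)) (\<lambda>i j. of_int (B i j))
    (\<lambda>j. of_int (a j)) (\<lambda>i j. of_int (T i j)) (\<lambda>i j. of_int (W i j)) (\<lambda>i. of_int (h i)) (of_int \<alpha>)"
proof -
  note ic = assms[unfolded icert_def]
  have pos: "0 < D" "0 < Du" "0 < Dl" "i' < k \<Longrightarrow> 0 < D\<mu> i'" for i' using ic by auto
  have s: "(\<Sum>j\<in>J. of_int (v j) / of_int e * of_int (w j)) = real_of_int (\<Sum>j\<in>J. v j * w j) / of_int e"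
    for J :: "nat set" and v w e by (simp add: sum_divide_distrib)
  have eqs: "real_of_int p / of_int e + real_of_int p' / of_int e = of_int w \<longleftrightarrow> p + p' = e * w" if "0 < e" for p p' e w
  proof -
    have "real_of_int p / of_int e + real_of_int p' / of_int e = of_int w \<longleftrightarrow> real_of_int (p + p') = of_int (e * w)"
      using that by (simp add: field_simps)
    then show ?thesis by (simp only: of_int_eq_iff)
  qed
  have le: "real_of_int p / of_int e + real_of_int p' / of_int e \<le> of_int w \<longleftrightarrow> p + p' \<le> e * w" if "0 < e" for p p' e w
  proof -
    have "real_of_int p / of_int e + real_of_int p' / of_int e \<le> of_int w \<longleftrightarrow> real_of_int (p + p') \<le> of_int (e * w)"
      using that by (simp add: field_simps)
    then show ?thesis by (simp only: of_int_le_iff)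
  qed
  have le1: "real_of_int p / of_int e \<le> of_int w \<longleftrightarrow> p \<le> e * w" if "0 < e" for p e w
    using le[OF that, of p 0 w] by simp
  have eq1: "real_of_int p / of_int e = of_int w \<longleftrightarrow> p = e * w" if "0 < e" for p e w
    using eqs[OF that, of p 0 w] by simp
  have ge1: "of_int w \<le> real_of_int p / of_int e \<longleftrightarrow> e * w \<le> p" if "0 < e" for p e w
  proof -
    have "of_int w \<le> real_of_int p / of_int e \<longleftrightarrow> real_of_int (e * w) \<le> of_int p"
      using that by (simp add: field_simps)
    then show ?thesis by (simp only: of_int_le_iff)
  qed
  have lt1: "real_of_int p / of_int e < of_int w \<longleftrightarrow> p < e * w" if "0 < e" for p e w
    using ge1[OF that, of w p] by linarith
  show ?thesis unfolding rcert_def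
  proof (rule exI[of _ "\<lambda>j. of_int (x j) / of_int D"], rule exI[of _ "\<lambda>j. of_int (y j) / of_int D"],
      rule exI[of _ "\<lambda>j. of_int (u j) / of_int Du"], rule exI[of _ "\<lambda>j. of_int (l j) / of_int Dl"],
      rule exI[of _ "\<lambda>i j. of_int (\<mu> i j) / of_int (D\<mu> i)"],
      unfold s eqs[OF pos(1)] le[OF pos(1)] le1[OF pos(2)] lt1[OF pos(2)] eq1[OF pos(2)] ge1[OF pos(3)] eq1[OF pos(3)], intro conjI)
    show "\<forall>j<n. 0 \<le> real_of_int (x j) / real_of_int D" "\<forall>j<m. 0 \<le> real_of_int (y j) / real_of_int D"
      using ic by auto
    show "\<forall>j<m. (\<Sum>i<r. u i * W i j) < Du * q j \<longrightarrow> real_of_int (y j) / real_of_int D = 0"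
      using ic by auto
    show "\<forall>j<m. (\<Sum>i<r. u i * W i j) = Du * q j \<longrightarrow> Dl * d j \<le> (\<Sum>i<r. l i * W i j) \<and>
      (real_of_int (y j) / real_of_int D = 0 \<or> (\<Sum>i<r. l i * W i j) = Dl * d j)"
      using ic by auto
    show "\<forall>i'<k. \<forall>j<m. (\<Sum>i<r. u i * W i j) = Du * q j \<longrightarrow>
      real_of_int (\<Sum>i<r. \<mu> i' i * W i j) / real_of_int (D\<mu> i') = real_of_int (B i' j)"
      using ic eq1[OF pos(4)] by auto
  qed (insert ic, elim conjE, assumption)+
qed

section \<open>From real to short integral certificates\<close>

lemma sum_lessThan_add:
  fixes n m :: nat and f :: "nat \<Rightarrow> 'a::comm_monoid_add"
  shows "(\<Sum>j<n + m. f j) = (\<Sum>j<n. f j) + (\<Sum>j<m. f (n + j))"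
  by (induction m) (simp_all add: ac_simps)

definition bound :: "nat \<Rightarrow> nat \<Rightarrow> nat" where
  "bound N M = (2 * (N + 1) * M + 1) ^ N"

lemma bound_mono: "N \<le> N' \<Longrightarrow> bound N M \<le> bound N' M"
proof -
  assume le: "N \<le> N'"
  have "bound N M \<le> (2 * (N' + 1) * M + 1) ^ N"
    unfolding bound_def using le by (intro power_mono add_mono mult_le_mono) auto
  also have "\<dots> \<le> bound N' M"
    unfolding bound_def using le by (intro power_increasing) auto
  finally show ?thesis .
qed

lemma small_solution':
  fixes Eq Ge Gt :: "(nat \<Rightarrow> int) set" and z :: "nat \<Rightarrow> real"
  assumes fin: "finite Eq" "finite Ge" "finite Gt"
    and M: "1 \<le> M" "\<And>f j. f \<in> Eq \<union> Ge \<union> Gt \<Longrightarrow> j < N \<Longrightarrow> \<bar>f j\<bar> \<le> int M"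
    and z: "\<And>f. f \<in> Eq \<Longrightarrow> dotp N f z = 0" "\<And>f. f \<in> Ge \<Longrightarrow> 0 \<le> dotp N f z" "\<And>f. f \<in> Gt \<Longrightarrow> 0 < dotp N f z"
    and N: "N \<le> N'"
  obtains p :: "nat \<Rightarrow> int" where "\<And>j. j < N \<Longrightarrow> \<bar>p j\<bar> \<le> int (bound N' M)"
    "\<And>f. f \<in> Eq \<Longrightarrow> (\<Sum>j<N. f j * p j) = 0" "\<And>f. f \<in> Ge \<Longrightarrow> 0 \<le> (\<Sum>j<N. f j * p j)"
    "\<And>f. f \<in> Gt \<Longrightarrow> 0 < (\<Sum>j<N. f j * p j)"
proof -
  define ng :: "(nat \<Rightarrow> int) \<Rightarrow> nat \<Rightarrow> int" where "ng = (\<lambda>f j. - f j)"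
  have ng: "dotp N (ng f) z = - dotp N f z" "(\<Sum>j<N. ng f j * p j) = - (\<Sum>j<N. f j * p j)" for f z p
    by (simp_all add: dotp_def ng_def sum_negf)
  have "\<exists>p :: nat \<Rightarrow> int. (\<forall>j<N. \<bar>p j\<bar> \<le> int ((2 * (N + 1) * M + 1) ^ N)) \<and>
    (\<forall>f\<in>Eq \<union> ng ` Eq \<union> Ge. 0 \<le> (\<Sum>j<N. f j * p j)) \<and> (\<forall>f\<in>Gt. 0 < (\<Sum>j<N. f j * p j))"
  proof (rule small_solution[where z = z])
    show "\<bar>f j\<bar> \<le> int M" if "f \<in> Eq \<union> ng ` Eq \<union> Ge \<union> Gt" "j < N" for f j
      using that M(2) by (auto simp: ng_def)
    show "0 \<le> dotp N f z" if "f \<in> Eq \<union> ng ` Eq \<union> Ge" for f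
      using that z by (auto simp: ng)
  qed (use fin M z in auto)
  then obtain p :: "nat \<Rightarrow> int" where p0: "\<forall>j<N. \<bar>p j\<bar> \<le> int (bound N M)"
    "\<forall>f\<in>Eq \<union> ng ` Eq \<union> Ge. 0 \<le> (\<Sum>j<N. f j * p j)" "\<forall>f\<in>Gt. 0 < (\<Sum>j<N. f j * p j)"
    unfolding bound_def[symmetric] by (elim exE conjE)
  note p = p0(1)[rule_format] p0(2)[THEN bspec] p0(3)[THEN bspec]
  have "(\<Sum>j<N. f j * p j) = 0" if "f \<in> Eq" for f
    using p(2)[of f] p(2)[of "ng f"] that by (simp add: ng)
  moreover have "\<bar>p j\<bar> \<le> int (bound N' M)" if "j < N" for j
    using p(1)[OF that] bound_mono[OF N, of M] by linarith
  ultimately show ?thesis using p by (intro that[of p]) auto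
qed

text \<open>Only the signs of u W - b in the m columns matter for a certificate, since they
  determine the tight set and the slack columns. Prescribing these signs is a homogeneous system in
  r + 1 unknowns, the last of which is the denominator, and u itself shows that it is
  solvable.\<close>

lemma dual_integral:
  fixes W :: "nat \<Rightarrow> nat \<Rightarrow> int" and b :: "nat \<Rightarrow> int" and u :: "nat \<Rightarrow> real"
  assumes M: "1 \<le> M" "\<forall>i<r. \<forall>j<m. \<bar>W i j\<bar> \<le> int M" "\<forall>j<m. \<bar>b j\<bar> \<le> int M"
    and N: "r + 1 \<le> N"
  shows "\<exists>p D. (\<forall>i<r. \<bar>p i\<bar> \<le> int (bound N M)) \<and> 0 < D \<and> D \<le> int (bound N M) \<and>
    (\<forall>j<m. ((\<Sum>i<r. u i * of_int (W i j)) = of_int (b j) \<longrightarrow> (\<Sum>i<r. p i * W i j) = D * b j) \<and>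
      ((\<Sum>i<r. u i * of_int (W i j)) < of_int (b j) \<longrightarrow> (\<Sum>i<r. p i * W i j) < D * b j) \<and>
      (of_int (b j) < (\<Sum>i<r. u i * of_int (W i j)) \<longrightarrow> D * b j < (\<Sum>i<r. p i * W i j)))"
proof -
  define col where "col = (\<lambda>j i. if i < r then W i j else - b j)"
  define ncol where "ncol = (\<lambda>j i. - col j i)"
  define z where "z = (\<lambda>i. if i < r then u i else 1)"
  define s where "s = (\<lambda>j. \<Sum>i<r. u i * of_int (W i j))"
  define unit :: "nat \<Rightarrow> int" where "unit = (\<lambda>i. if i = r then 1 else 0)"
  have dc: "dotp (Suc r) (col j) z = s j - of_int (b j)" for j
  proof -
    have "(\<Sum>i<r. real_of_int (col j i) * z i) = s j"
      unfolding s_def by (rule sum.cong) (simp_all add: col_def z_def mult.commute)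
    then show ?thesis by (simp add: dotp_def) (simp add: col_def z_def)
  qed
  have dn: "dotp (Suc r) (ncol j) z = of_int (b j) - s j" for j
    using dc[of j] by (simp add: dotp_def ncol_def sum_negf)
  have du: "dotp (Suc r) unit z = 1" by (simp add: dotp_def unit_def z_def)
  have bc: "\<bar>col j i\<bar> \<le> int M" "\<bar>ncol j i\<bar> \<le> int M" if "j < m" "i < Suc r" for i j
    using M that by (auto simp: col_def ncol_def)
  define Eq where "Eq = col ` {j. j < m \<and> s j = of_int (b j)}"
  define Gt where "Gt = insert unit (ncol ` {j. j < m \<and> s j < of_int (b j)} \<union> col ` {j. j < m \<and> s j > of_int (b j)})"
  obtain p where p: "\<And>j. j < Suc r \<Longrightarrow> \<bar>p j\<bar> \<le> int (bound N M)"
    "\<And>f. f \<in> Eq \<Longrightarrow> (\<Sum>j<Suc r. f j * p j) = 0" "\<And>f. f \<in> Gt \<Longrightarrow> 0 < (\<Sum>j<Suc r. f j * p j)"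
  proof (rule small_solution'[of Eq "{}" Gt M "Suc r" z N])
    show "finite Eq" "finite Gt" by (auto simp: Eq_def Gt_def)
    show "\<bar>f j\<bar> \<le> int M" if "f \<in> Eq \<union> {} \<union> Gt" "j < Suc r" for f j
      using that bc M(1) by (auto simp: Eq_def Gt_def unit_def)
    show "dotp (Suc r) f z = 0" if "f \<in> Eq" for f using that by (auto simp: Eq_def dc)
    show "0 < dotp (Suc r) f z" if "f \<in> Gt" for f using that by (auto simp: Gt_def dc dn du)
  qed (use M N in auto)
  have sc: "(\<Sum>i<Suc r. col j i * p i) = (\<Sum>i<r. p i * W i j) - p r * b j" for j
  proof -
    have "(\<Sum>i<r. col j i * p i) = (\<Sum>i<r. p i * W i j)"
      by (rule sum.cong) (simp_all add: col_def mult.commute)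
    then show ?thesis by simp (simp add: col_def mult.commute)
  qed
  have sn: "(\<Sum>i<Suc r. ncol j i * p i) = p r * b j - (\<Sum>i<r. p i * W i j)" for j
    using sc[of j] by (simp add: ncol_def sum_negf)
  have "(\<Sum>i<Suc r. unit i * p i) = p r" by (simp add: unit_def)
  then have "0 < p r" using p(3)[of unit] by (simp add: Gt_def)
  moreover have "(\<Sum>i<r. p i * W i j) = p r * b j" if "j < m" "s j = of_int (b j)" for j
    using p(2)[of "col j"] that unfolding sc by (simp add: Eq_def)
  moreover have "(\<Sum>i<r. p i * W i j) < p r * b j" if "j < m" "s j < of_int (b j)" for j
    using p(3)[of "ncol j"] that unfolding sn by (simp add: Gt_def)
  moreover have "(\<Sum>i<r. p i * W i j) > p r * b j" if "j < m" "s j > of_int (b j)" for j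
    using p(3)[of "col j"] that unfolding sc by (simp add: Gt_def)
  ultimately show ?thesis
    using p(1) p(1)[of r] unfolding s_def by (intro exI[of _ p] exI[of _ "p r"]) auto
qed

text \<open>The tight set and the zeros of y are read off the given real certificate and then
  prescribed. With these fixed, the disjunctive conditions become linear, and the dual vectors on
  the one hand and (x, y) on the other can be made short independently.\<close>

lemma rcert_icert:
  fixes c d q a h :: "nat \<Rightarrow> int" and A B T W :: "nat \<Rightarrow> nat \<Rightarrow> int" and \<alpha> :: int
  assumes rc: "rcert n m k r (\<lambda>j. of_int (c j)) (\<lambda>j. of_int (d j)) (\<lambda>j. of_int (q j)) (\<lambda>i j. of_int (A i j)) (\<lambda>i j. of_int (B i j))
    (\<lambda>j. of_int (a j)) (\<lambda>i j. of_int (T i j)) (\<lambda>i j. of_int (W i j)) (\<lambda>i. of_int (h i)) (of_int \<alpha>)"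
  assumes M: "1 \<le> M" "\<And>j. j < n \<Longrightarrow> \<bar>c j\<bar> \<le> int M" "\<And>j. j < m \<Longrightarrow> \<bar>d j\<bar> \<le> int M" "\<And>j. j < m \<Longrightarrow> \<bar>q j\<bar> \<le> int M"
    "\<And>i j. i < k \<Longrightarrow> j < n \<Longrightarrow> \<bar>A i j\<bar> \<le> int M" "\<And>i j. i < k \<Longrightarrow> j < m \<Longrightarrow> \<bar>B i j\<bar> \<le> int M" "\<And>i. i < k \<Longrightarrow> \<bar>a i\<bar> \<le> int M"
    "\<And>i j. i < r \<Longrightarrow> j < n \<Longrightarrow> \<bar>T i j\<bar> \<le> int M" "\<And>i j. i < r \<Longrightarrow> j < m \<Longrightarrow> \<bar>W i j\<bar> \<le> int M" "\<And>i. i < r \<Longrightarrow> \<bar>h i\<bar> \<le> int M"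
    "\<bar>\<alpha>\<bar> \<le> int M"
  defines "H \<equiv> int (bound (n + m + r + 1) M)"
  shows "\<exists>x y D u Du l Dl \<mu> D\<mu>. icert n m k r c d q A B a T W h \<alpha> x y D u Du l Dl \<mu> D\<mu> \<and>
     (\<forall>j<n. x j \<le> H) \<and> (\<forall>j<m. y j \<le> H) \<and> D \<le> H \<and> (\<forall>i<r. \<bar>u i\<bar> \<le> H \<and> \<bar>l i\<bar> \<le> H) \<and> Du \<le> H \<and> Dl \<le> H \<and>
     (\<forall>i'<k. D\<mu> i' \<le> H \<and> (\<forall>i<r. \<bar>\<mu> i' i\<bar> \<le> H))"
proof -
  from rc obtain x y u l :: "nat \<Rightarrow> real" and \<mu> where rx:
     "\<forall>j<n. 0 \<le> x j" "\<forall>j<m. 0 \<le> y j"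
     "\<forall>i<r. (\<Sum>j<n. x j * of_int (T i j)) + (\<Sum>j<m. y j * of_int (W i j)) = of_int (h i)"
     "\<forall>i<k. (\<Sum>j<n. x j * of_int (A i j)) + (\<Sum>j<m. y j * of_int (B i j)) = of_int (a i)"
     "(\<Sum>j<n. x j * of_int (c j)) + (\<Sum>j<m. y j * of_int (d j)) \<le> of_int \<alpha>" and ru:
     "\<forall>j<m. (\<Sum>i<r. u i * of_int (W i j)) \<le> of_int (q j)"
     "\<forall>j<m. (\<Sum>i<r. u i * of_int (W i j)) < of_int (q j) \<longrightarrow> y j = 0"
     "\<forall>j<m. (\<Sum>i<r. u i * of_int (W i j)) = of_int (q j) \<longrightarrow> of_int (d j) \<le> (\<Sum>i<r. l i * of_int (W i j)) \<and> (y j = 0 \<or> (\<Sum>i<r. l i * of_int (W i j)) = of_int (d j))"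
     "\<forall>i'<k. \<forall>j<m. (\<Sum>i<r. u i * of_int (W i j)) = of_int (q j) \<longrightarrow> (\<Sum>i<r. \<mu> i' i * of_int (W i j)) = real_of_int (B i' j)"
    unfolding rcert_def by (elim exE conjE)
  have N: "r + 1 \<le> n + m + r + 1" by simp
  have MW: "\<forall>i<r. \<forall>j<m. \<bar>W i j\<bar> \<le> int M" and Mq: "\<forall>j<m. \<bar>q j\<bar> \<le> int M" and Md: "\<forall>j<m. \<bar>d j\<bar> \<le> int M"
    and MB: "i < k \<Longrightarrow> \<forall>j<m. \<bar>B i j\<bar> \<le> int M" for i
    using M by auto
  obtain U Du where U0: "\<forall>i<r. \<bar>U i\<bar> \<le> H" "0 < Du" "Du \<le> H"
    "\<forall>j<m. ((\<Sum>i<r. u i * of_int (W i j)) = of_int (q j) \<longrightarrow> (\<Sum>i<r. U i * W i j) = Du * q j) \<and>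
      ((\<Sum>i<r. u i * of_int (W i j)) < of_int (q j) \<longrightarrow> (\<Sum>i<r. U i * W i j) < Du * q j) \<and>
      (of_int (q j) < (\<Sum>i<r. u i * of_int (W i j)) \<longrightarrow> Du * q j < (\<Sum>i<r. U i * W i j))"
    using dual_integral[where W = W and b = q and m = m and r = r and u = u, OF M(1) MW Mq N] unfolding H_def[symmetric] by (elim exE conjE)
  have U: "\<And>i. i < r \<Longrightarrow> \<bar>U i\<bar> \<le> H" "0 < Du" "Du \<le> H"
    "\<And>j. j < m \<Longrightarrow> (\<Sum>i<r. u i * of_int (W i j)) = of_int (q j) \<Longrightarrow> (\<Sum>i<r. U i * W i j) = Du * q j"
    "\<And>j. j < m \<Longrightarrow> (\<Sum>i<r. u i * of_int (W i j)) < of_int (q j) \<Longrightarrow> (\<Sum>i<r. U i * W i j) < Du * q j"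
    using U0 by simp_all
  obtain Lm Dl where L0: "\<forall>i<r. \<bar>Lm i\<bar> \<le> H" "0 < Dl" "Dl \<le> H"
    "\<forall>j<m. ((\<Sum>i<r. l i * of_int (W i j)) = of_int (d j) \<longrightarrow> (\<Sum>i<r. Lm i * W i j) = Dl * d j) \<and>
      ((\<Sum>i<r. l i * of_int (W i j)) < of_int (d j) \<longrightarrow> (\<Sum>i<r. Lm i * W i j) < Dl * d j) \<and>
      (of_int (d j) < (\<Sum>i<r. l i * of_int (W i j)) \<longrightarrow> Dl * d j < (\<Sum>i<r. Lm i * W i j))"
    using dual_integral[where W = W and b = d and m = m and r = r and u = l, OF M(1) MW Md N] unfolding H_def[symmetric] by (elim exE conjE)
  have Lm: "\<And>i. i < r \<Longrightarrow> \<bar>Lm i\<bar> \<le> H" "0 < Dl" "Dl \<le> H"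
    "\<And>j. j < m \<Longrightarrow> (\<Sum>i<r. l i * of_int (W i j)) = of_int (d j) \<Longrightarrow> (\<Sum>i<r. Lm i * W i j) = Dl * d j"
    "\<And>j. j < m \<Longrightarrow> (\<Sum>i<r. l i * of_int (W i j)) > of_int (d j) \<Longrightarrow> (\<Sum>i<r. Lm i * W i j) > Dl * d j"
    using L0 by simp_all
  have "\<forall>i'. \<exists>p D. i' < k \<longrightarrow> (\<forall>i<r. \<bar>p i\<bar> \<le> H) \<and> 0 < D \<and> D \<le> H \<and>
    (\<forall>j<m. (\<Sum>i<r. \<mu> i' i * of_int (W i j)) = of_int (B i' j) \<longrightarrow> (\<Sum>i<r. p i * W i j) = D * B i' j)"
  proof
    fix i'
    show "\<exists>p D. i' < k \<longrightarrow> (\<forall>i<r. \<bar>p i\<bar> \<le> H) \<and> 0 < D \<and> D \<le> H \<and>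
      (\<forall>j<m. (\<Sum>i<r. \<mu> i' i * of_int (W i j)) = of_int (B i' j) \<longrightarrow> (\<Sum>i<r. p i * W i j) = D * B i' j)"
    proof (cases "i' < k")
      case True
      from dual_integral[where W = W and b = "B i'" and m = m and r = r and u = "\<mu> i'", OF M(1) MW MB[OF True] N]
      obtain p D where "\<forall>i<r. \<bar>p i\<bar> \<le> H" "0 < D" "D \<le> H"
        "\<forall>j<m. ((\<Sum>i<r. \<mu> i' i * of_int (W i j)) = of_int (B i' j) \<longrightarrow> (\<Sum>i<r. p i * W i j) = D * B i' j) \<and>
        ((\<Sum>i<r. \<mu> i' i * of_int (W i j)) < of_int (B i' j) \<longrightarrow> (\<Sum>i<r. p i * W i j) < D * B i' j) \<and>
        (of_int (B i' j) < (\<Sum>i<r. \<mu> i' i * of_int (W i j)) \<longrightarrow> D * B i' j < (\<Sum>i<r. p i * W i j))"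
        unfolding H_def[symmetric] by (elim exE conjE)
      then show ?thesis by (intro exI[of _ p] exI[of _ D]) simp
    qed simp
  qed
  from choice[OF this] obtain Mu where "\<forall>i'. \<exists>D. i' < k \<longrightarrow> (\<forall>i<r. \<bar>Mu i' i\<bar> \<le> H) \<and> 0 < D \<and> D \<le> H \<and>
    (\<forall>j<m. (\<Sum>i<r. \<mu> i' i * of_int (W i j)) = of_int (B i' j) \<longrightarrow> (\<Sum>i<r. Mu i' i * W i j) = D * B i' j)" ..
  from choice[OF this] obtain D\<mu> where Mu0: "\<forall>i'. i' < k \<longrightarrow> (\<forall>i<r. \<bar>Mu i' i\<bar> \<le> H) \<and> 0 < D\<mu> i' \<and> D\<mu> i' \<le> H \<and>
    (\<forall>j<m. (\<Sum>i<r. \<mu> i' i * of_int (W i j)) = of_int (B i' j) \<longrightarrow> (\<Sum>i<r. Mu i' i * W i j) = D\<mu> i' * B i' j)" ..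
  have Mu: "\<And>i' i. i' < k \<Longrightarrow> i < r \<Longrightarrow> \<bar>Mu i' i\<bar> \<le> H" "\<And>i'. i' < k \<Longrightarrow> 0 < D\<mu> i' \<and> D\<mu> i' \<le> H"
    "\<And>i' j. i' < k \<Longrightarrow> j < m \<Longrightarrow> (\<Sum>i<r. \<mu> i' i * of_int (W i j)) = of_int (B i' j) \<Longrightarrow> (\<Sum>i<r. Mu i' i * W i j) = D\<mu> i' * B i' j"
    using Mu0 by simp_all
  define N where "N = n + m + 1"
  \<comment> \<open>Coordinates below n belong to x, the next m to y, and coordinate n + m is the
    denominator, which carries the right-hand side with a minus sign.\<close>
  define row :: "(nat \<Rightarrow> int) \<Rightarrow> (nat \<Rightarrow> int) \<Rightarrow> int \<Rightarrow> nat \<Rightarrow> int" where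
    "row = (\<lambda>s t e j. if j < n then s j else if j < n + m then t (j - n) else - e)"
  define z where "z = (\<lambda>j. if j < n then x j else if j < n + m then y (j - n) else 1)"
  have split: "(\<Sum>j<N. f j) = (\<Sum>j<n. f j) + (\<Sum>j<m. f (n + j)) + f (n + m)" for f :: "nat \<Rightarrow> 'a::comm_monoid_add"
    by (simp add: N_def sum_lessThan_add)
  have drow: "dotp N (row s t e) z = (\<Sum>j<n. x j * of_int (s j)) + (\<Sum>j<m. y j * of_int (t j)) - of_int e" for s t e
    unfolding dotp_def split by (simp add: row_def z_def mult.commute)
  have prow: "(\<Sum>j<N. row s t e j * p j) = (\<Sum>j<n. p j * s j) + (\<Sum>j<m. p (n + j) * t j) - p (n + m) * e" for s t e p
    unfolding split by (simp add: row_def mult.commute)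
  have zv: "z (n + j) = y j" if "j < m" for j using that by (simp add: z_def)
  have zl: "z (n + m) = 1" by (simp add: z_def)
  have Nlt: "j < m \<Longrightarrow> n + j < N" "n + m < N" "i < n + m \<Longrightarrow> i < N" for i j by (simp_all add: N_def)
  define un :: "nat \<Rightarrow> nat \<Rightarrow> int" where "un = (\<lambda>i j. if j = i then 1 else 0)"
  have dun: "dotp N (un i) v = v i" if "i < N" for i v
    using that by (simp add: dotp_def un_def if_distrib[of "\<lambda>x. real_of_int x * _"] cong: if_cong)
  have pun: "(\<Sum>j<N. un i j * p j) = p i" if "i < N" for i p
    using that by (simp add: un_def if_distrib[of "\<lambda>x. x * _"] cong: if_cong)
  \<comment> \<open>The zeros of y are imposed as equations, so that complementary slackness
    survives the passage to the short solution.\<close>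
  define Eq where "Eq = (\<lambda>i. row (T i) (W i) (h i)) ` {..<r} \<union> (\<lambda>i. row (A i) (B i) (a i)) ` {..<k} \<union>
    (\<lambda>j. un (n + j)) ` {j. j < m \<and> y j = 0}"
  define Ge where "Ge = insert (\<lambda>j. - row c d \<alpha> j) (un ` {..<n + m})"
  define Gt where "Gt = {un (n + m)}"
  obtain p where p: "\<And>j. j < N \<Longrightarrow> \<bar>p j\<bar> \<le> H"
    "\<And>f. f \<in> Eq \<Longrightarrow> (\<Sum>j<N. f j * p j) = 0" "\<And>f. f \<in> Ge \<Longrightarrow> 0 \<le> (\<Sum>j<N. f j * p j)"
    "\<And>f. f \<in> Gt \<Longrightarrow> 0 < (\<Sum>j<N. f j * p j)"
    unfolding H_def
  proof (rule small_solution'[of Eq Ge Gt M N z "n + m + r + 1"])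
    show "finite Eq" "finite Ge" "finite Gt" by (auto simp: Eq_def Ge_def Gt_def)
    have br: "\<bar>row s t e j\<bar> \<le> int M" if "\<And>j. j < n \<Longrightarrow> \<bar>s j\<bar> \<le> int M" "\<And>j. j < m \<Longrightarrow> \<bar>t j\<bar> \<le> int M" "\<bar>e\<bar> \<le> int M" for s t e j
      using that by (auto simp: row_def)
    have bu: "\<bar>un i j\<bar> \<le> int M" for i j using M(1) by (simp add: un_def)
    show "\<bar>f j\<bar> \<le> int M" if "f \<in> Eq \<union> Ge \<union> Gt" "j < N" for f j
      using that M(2-) br bu by (auto simp: Eq_def Ge_def Gt_def)
    show "dotp N f z = 0" if "f \<in> Eq" for f
      using that rx by (auto simp: Eq_def drow dun Nlt zv)
    show "0 \<le> dotp N f z" if "f \<in> Ge" for f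
    proof -
      have "dotp N (\<lambda>j. - row c d \<alpha> j) z = - dotp N (row c d \<alpha>) z" by (simp add: dotp_def sum_negf)
      moreover have "0 \<le> z i" if "i < n + m" for i using that rx(1,2) by (auto simp: z_def)
      ultimately show ?thesis using that rx(5) by (auto simp: Ge_def drow dun Nlt)
    qed
    show "0 < dotp N f z" if "f \<in> Gt" for f
      using that by (auto simp: Gt_def dun Nlt zl)
  qed (use M N_def in auto)
  define D where "D = p (n + m)"
  define Y where "Y = (\<lambda>j. p (n + j))"
  have nonneg: "0 \<le> p j" if "j < n + m" for j
    using p(3)[of "un j"] pun[of j p] that by (simp add: Ge_def N_def)
  have "0 < D" using p(4)[of "un (n + m)"] pun[of "n + m" p] by (simp add: Gt_def N_def D_def)
  have bnd: "p j \<le> H" if "j < N" for j using p(1)[OF that] by linarith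
  have Y0: "Y j = 0" if "j < m" "y j = 0" for j
    using p(2)[of "un (n + j)"] pun[of "n + j" p] that by (auto simp: Eq_def N_def Y_def)
  have e1: "(\<Sum>j<n. p j * T i j) + (\<Sum>j<m. Y j * W i j) = D * h i" if "i < r" for i
    using p(2)[of "row (T i) (W i) (h i)"] that by (auto simp: Eq_def prow D_def Y_def)
  have e2: "(\<Sum>j<n. p j * A i j) + (\<Sum>j<m. Y j * B i j) = D * a i" if "i < k" for i
    using p(2)[of "row (A i) (B i) (a i)"] that by (auto simp: Eq_def prow D_def Y_def)
  have e3: "(\<Sum>j<n. p j * c j) + (\<Sum>j<m. Y j * d j) \<le> D * \<alpha>"
  proof -
    have "(\<Sum>j<N. - row c d \<alpha> j * p j) = - (\<Sum>j<N. row c d \<alpha> j * p j)" by (simp add: sum_negf)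
    then show ?thesis using p(3)[of "\<lambda>j. - row c d \<alpha> j"] by (simp add: Ge_def prow D_def Y_def)
  qed
  have cs: "(\<Sum>i<r. u i * of_int (W i j)) = of_int (q j) \<or> (\<Sum>i<r. u i * of_int (W i j)) < real_of_int (q j)" if "j < m" for j
    using ru(1) that by (auto simp: le_less)
  have tight: "(\<Sum>i<r. u i * of_int (W i j)) = of_int (q j)" if "j < m" "(\<Sum>i<r. U i * W i j) = Du * q j" for j
    using cs[OF that(1)] U(5)[OF that(1)] that(2) by auto
  have slack: "(\<Sum>i<r. u i * of_int (W i j)) < real_of_int (q j)" if "j < m" "(\<Sum>i<r. U i * W i j) < Du * q j" for j
    using cs[OF that(1)] U(4)[OF that(1)] that(2) by auto
  have "icert n m k r c d q A B a T W h \<alpha> p Y D U Du Lm Dl Mu D\<mu>"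
    unfolding icert_def
  proof (intro conjI allI impI)
    fix j assume j: "j < m" and t: "(\<Sum>i<r. U i * W i j) = Du * q j"
    note l = ru(3)[rule_format, OF j tight[OF j t]]
    show "Dl * d j \<le> (\<Sum>i<r. Lm i * W i j)"
      using l Lm(4,5)[OF j] by (cases "(\<Sum>i<r. l i * of_int (W i j)) = real_of_int (d j)") (auto simp: less_le)
    show "Y j = 0 \<or> (\<Sum>i<r. Lm i * W i j) = Dl * d j"
      using l Lm(4)[OF j] Y0[OF j] by blast
  next
    fix j assume j: "j < m" and t: "(\<Sum>i<r. U i * W i j) < Du * q j"
    show "Y j = 0" using ru(2) slack[OF j t] Y0[OF j] j by blast
  next
    fix j assume j: "j < m"
    show "(\<Sum>i<r. U i * W i j) \<le> Du * q j" using cs[OF j] U(4,5)[OF j] by auto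
  next
    fix i' j assume "i' < k" "j < m" "(\<Sum>i<r. U i * W i j) = Du * q j"
    then show "(\<Sum>i<r. Mu i' i * W i j) = D\<mu> i' * B i' j" using ru(4) tight Mu(3) by blast
  qed (use nonneg \<open>0 < D\<close> e1 e2 e3 U Lm Mu in \<open>auto simp: Y_def D_def\<close>)
  moreover have "\<forall>j<n. p j \<le> H" "\<forall>j<m. Y j \<le> H" "D \<le> H"
    using bnd Nlt by (auto simp: Y_def D_def)
  moreover have "\<forall>i<r. \<bar>U i\<bar> \<le> H \<and> \<bar>Lm i\<bar> \<le> H" "Du \<le> H" "Dl \<le> H"
    "\<forall>i'<k. D\<mu> i' \<le> H \<and> (\<forall>i<r. \<bar>Mu i' i\<bar> \<le> H)"
    using U Lm Mu by auto
  ultimately show ?thesis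
    by (intro exI[of _ p] exI[of _ Y] exI[of _ D] exI[of _ U] exI[of _ Du] exI[of _ Lm] exI[of _ Dl] exI[of _ Mu] exI[of _ D\<mu>] conjI)
qed

section \<open>Accepted words are encodings of yes-instances\<close>

lemma length_concat_rows: "\<forall>r\<in>set rows. length r = m \<Longrightarrow> length (concat rows) = length rows * m"
  by (induction rows) auto

text \<open>A flattened matrix with rows of length 0 has forgotten how many rows it had; hence the
  alternative in the last assumption.\<close>

lemma concat_rows_eq:
  assumes "concat xs = concat ys" "\<forall>r\<in>set xs. length r = m" "\<forall>r\<in>set ys. length r = m" "0 < m \<or> length xs = length ys"
  shows "xs = ys"
proof (rule concat_injective[OF assms(1)])
  show "length xs = length ys"
    using assms length_concat_rows[OF assms(2)] length_concat_rows[OF assms(3)] by auto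
  show "\<forall>(x, y)\<in>set (zip xs ys). length x = length y"
    using assms(2,3) set_zip_leftD[of _ _ xs ys] set_zip_rightD[of _ _ xs ys] by fastforce
qed

lemma idot_sum: "length vs = length us \<Longrightarrow> idot vs us = (\<Sum>j<length us. us ! j * vs ! j)"
  by (induction vs us rule: list_induct2) (simp_all add: sum.lessThan_Suc_shift mult.commute del: sum.lessThan_Suc)

lemma axpy_nth: "j < length vs \<Longrightarrow> j < length us \<Longrightarrow> axpy a vs us ! j = a * vs ! j + us ! j"
  by (simp add: axpy_def)

lemma icomb_nth:
  "length us = length rows \<Longrightarrow> \<forall>r\<in>set rows. length r = m \<Longrightarrow> j < m \<Longrightarrow>
   icomb m us rows ! j = (\<Sum>i<length rows. us ! i * rows ! i ! j)"
proof (induction us rows rule: list_induct2)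
  case (Cons u us r rows)
  then show ?case
    using length_icomb[of rows m us]
    by (simp add: axpy_nth sum.lessThan_Suc_shift del: sum.lessThan_Suc)
qed simp

lemma sLin_sum:
  assumes "sLin b W G" "vec W (concat Ws)" "\<forall>row\<in>set Ws. length row = m" "length Ws = r"
    and "vec b bs" "length bs = m"
  shows "\<exists>e u gs. e < 0 \<and> vec G gs \<and> length gs = m \<and> (\<forall>j<m. gs ! j = (\<Sum>i<r. u i * Ws ! i ! j) + e * bs ! j)"
proof -
  obtain e us bs' rows where l: "e < 0" "vec b bs'" "vec W (concat rows)" "length rows = length us"
    "\<forall>r\<in>set rows. length r = length bs'" "vec G (axpy e bs' (icomb (length bs') us rows))"
    using assms(1) unfolding sLin_def by blast
  have bs': "bs' = bs" using vec_unique l(2) assms(5) by blast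
  have len: "length (icomb m us rows) = m" using length_icomb l(5) assms(6) bs' by blast
  have "axpy e bs (icomb m us rows) ! j = (\<Sum>i<r. us ! i * Ws ! i ! j) + e * bs ! j" if "j < m" for j
  proof -
    \<comment> \<open>Here j < m excludes empty rows, so the word determines the matrix.\<close>
    have "rows = Ws"
      using concat_rows_eq[of rows Ws m] vec_unique[OF l(3) assms(2)] l(5) assms that bs' by auto
    then show ?thesis
      using icomb_nth[of us rows m j] l(4,5) bs' assms that len by (simp add: axpy_nth)
  qed
  then show ?thesis using l(1,6) bs' assms(6) len
    by (intro exI[of _ e] exI[of _ "\<lambda>i. us ! i"] exI[of _ "axpy e bs (icomb m us rows)"]) auto
qed

lemma sLin_length:
  assumes "sLin b W G" "vec b bs" "vec G gs"
  shows "length gs = length bs"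
proof -
  obtain e us bs' rows where l: "vec b bs'" "\<forall>r\<in>set rows. length r = length bs'"
    "vec G (axpy e bs' (icomb (length bs') us rows))"
    using assms(1) unfolding sLin_def by blast
  then show ?thesis using vec_unique[OF l(1) assms(2)] vec_unique[OF l(3) assms(3)] length_icomb by force
qed

lemma sMv_sum:
  assumes "sMv T W h X Y E" "vec T (concat Ts)" "vec W (concat Ws)" "vec h hs" "vec X xs" "vec Y ys" "num E e"
    and "length Ts = length hs" "length Ws = length hs" "\<forall>r\<in>set Ts. length r = length xs" "\<forall>r\<in>set Ws. length r = length ys"
  shows "\<forall>i<length hs. (\<Sum>j<length xs. xs ! j * Ts ! i ! j) + (\<Sum>j<length ys. ys ! j * Ws ! i ! j) = - e * hs ! i"
proof -
  obtain Ts' Ws' hs' where m: "vec T (concat Ts')" "vec W (concat Ws')" "vec h hs'"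
    "length Ts' = length hs'" "length Ws' = length hs'"
    "\<forall>i<length hs'. length (Ts' ! i) = length xs \<and> length (Ws' ! i) = length ys \<and>
     idot (Ts' ! i) xs + idot (Ws' ! i) ys + hs' ! i * e = 0"
    using assms(1,5-7) unfolding sMv_def by blast
  have hs: "hs' = hs" using vec_unique m(3) assms(4) by blast
  have rows: "\<forall>r\<in>set Ts'. length r = length xs" "\<forall>r\<in>set Ws'. length r = length ys"
    using m(4-6) by (metis in_set_conv_nth)+
  have "Ts' = Ts" using concat_rows_eq[OF vec_unique[OF m(1) assms(2)] rows(1) assms(10)] m(4) assms(8) hs by simp
  moreover have "Ws' = Ws" using concat_rows_eq[OF vec_unique[OF m(2) assms(3)] rows(2) assms(11)] m(5) assms(9) hs by simp
  ultimately have i: "length (Ts ! i) = length xs" "length (Ws ! i) = length ys"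
    "idot (Ts ! i) xs + idot (Ws ! i) ys + hs ! i * e = 0" if "i < length hs" for i
    using m(6) hs that by auto
  have "idot (Ts ! i) xs + idot (Ws ! i) ys = - (hs ! i * e)" if "i < length hs" for i
    using i(3)[OF that] by linarith
  then show ?thesis using i(1,2) by (simp add: idot_sum mult.commute[of e])
qed

lemma sVer_rcert:
  assumes ver: "sVer wc wd wq wA wB wa wT wW wh wal"
    and v: "vec wc cs" "vec wd ds" "vec wq qs" "vec wA (concat As)" "vec wB (concat Bs)" "vec wa as"
      "vec wT (concat Ts)" "vec wW (concat Ws)" "vec wh hs" "num wal al"
    and len: "length cs = n" "length ds = m" "length qs = m" "length As = k" "length Bs = k" "length as = k"
      "length Ts = r" "length Ws = r" "length hs = r"
    and rows: "\<forall>row\<in>set As. length row = n" "\<forall>row\<in>set Bs. length row = m"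
      "\<forall>row\<in>set Ts. length row = n" "\<forall>row\<in>set Ws. length row = m"
  shows "rcert n m k r (\<lambda>j. of_int (cs ! j)) (\<lambda>j. of_int (ds ! j)) (\<lambda>j. of_int (qs ! j)) (\<lambda>i j. of_int (As ! i ! j))
    (\<lambda>i j. of_int (Bs ! i ! j)) (\<lambda>j. of_int (as ! j)) (\<lambda>i j. of_int (Ts ! i ! j)) (\<lambda>i j. of_int (Ws ! i ! j))
    (\<lambda>i. of_int (hs ! i)) (of_int al)"
proof -
  obtain X Y E t1 t2 t3 t4 t5 t6 G F where w: "sNnv X" "sNeg E" "sMv wT wW wh X Y E" "sMv wA wB wa X Y E"
    "sDot wc X t1" "sDot wd Y t2" "sAdd [False] t1 t2 t3" "sMul wal E t4" "sAdd [False] t3 t4 t5"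
    "sAdd [False] t5 t6 [True, True]" "sNn t6" "sLin wq wW G" "sLin wd wW F" "sChk G F Y" "sEqs wW wB G"
    using ver unfolding sVer_def by (elim exE conjE)
  obtain e where e: "e < 0" "num E e" using w(2) by (auto simp: sNeg_def)
  obtain xs where xs: "vec X xs" "length xs = n" "num t1 (idot cs xs)"
    using w(5) vec_unique[OF v(1)] len(1) unfolding sDot_def by metis
  obtain ys where ys: "vec Y ys" "length ys = m" "num t2 (idot ds ys)"
    using w(6) vec_unique[OF v(2)] len(2) unfolding sDot_def by metis
  have xs0: "\<forall>x\<in>set xs. 0 \<le> x" using w(1) vec_unique[OF xs(1)] unfolding sNnv_def by blast
  have obj: "idot cs xs + idot ds ys \<le> - e * al"
  proof -
    have t3: "num t3 (idot cs xs + idot ds ys)" using sAdd_det[OF w(7) xs(3) ys(3)] by simp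
    have t4: "num t4 (al * e)" using w(8) num_unique[OF v(10)] num_unique[OF e(2)] unfolding sMul_def by blast
    have t5: "num t5 (idot cs xs + idot ds ys + al * e)" using sAdd_det[OF w(9) t3 t4] by simp
    obtain t where t: "t \<ge> 0" "num t6 t" using w(11) by (auto simp: sNn_def)
    show ?thesis using sAdd_value[OF w(10) t5 t(2) num_0] t(1) by (simp add: mult.commute)
  qed
  obtain e1 u gs where G: "e1 < 0" "vec G gs" "length gs = m" "\<forall>j<m. gs ! j = (\<Sum>i<r. u i * Ws ! i ! j) + e1 * qs ! j"
    using sLin_sum[OF w(12) v(8) rows(4) len(8) v(3) len(3)] by blast
  obtain e2 l fs where F: "e2 < 0" "vec F fs" "length fs = m" "\<forall>j<m. fs ! j = (\<Sum>i<r. l i * Ws ! i ! j) + e2 * ds ! j"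
    using sLin_sum[OF w(13) v(8) rows(4) len(8) v(2) len(2)] by blast
  have chk: "\<forall>i<m. 0 \<le> ys ! i \<and> gs ! i \<le> 0 \<and> (gs ! i < 0 \<longrightarrow> ys ! i = 0) \<and>
     (gs ! i = 0 \<longrightarrow> 0 \<le> fs ! i \<and> (ys ! i = 0 \<or> fs ! i = 0))"
    using w(14) vec_unique[OF G(2)] vec_unique[OF F(2)] vec_unique[OF ys(1)] ys(2) unfolding sChk_def by metis
  have "\<exists>\<mu> D. i' < k \<longrightarrow> 0 < D \<and> (\<forall>j<m. gs ! j = 0 \<longrightarrow> (\<Sum>i<r. \<mu> i * Ws ! i ! j) = D * Bs ! i' ! j)" for i'
  \<comment> \<open>Without columns the rows of B cannot be recovered from their word, but then the
    condition on them is void. Otherwise each row certified by \<open>sEqs\<close> has the length of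
    G, which fixes the cuts.\<close>
  proof (cases "i' < k \<and> 0 < m")
    case False
    then show ?thesis by (intro exI[of _ "\<lambda>_. 0"] exI[of _ 1]) auto
  next
    case True
    obtain Bs' where Bs': "vec wB (concat Bs')" "\<forall>bs\<in>set Bs'. \<exists>b H. vec b bs \<and> sLin b wW H \<and> sEqj G H"
      using w(15) unfolding sEqs_def by blast
    have B: "length bs = m \<and> (\<exists>b H. vec b bs \<and> sLin b wW H \<and> sEqj G H)" if bs: "bs \<in> set Bs'" for bs
    proof -
      obtain b H where b: "vec b bs" "sLin b wW H" "sEqj G H" using Bs'(2) bs by blast
      obtain gs' h' where "vec G gs'" "vec H h'" "length gs' = length h'" using b(3) unfolding sEqj_def by blast
      then show ?thesis using sLin_length[OF b(2,1)] vec_unique[OF G(2)] G(3) b by metis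
    qed
    have "Bs' = Bs"
      by (rule concat_rows_eq[OF vec_unique[OF Bs'(1) v(5)], of m]) (use B rows(2) True in auto)
    then obtain b H where b: "vec b (Bs ! i')" "sLin b wW H" "sEqj G H" and lb: "length (Bs ! i') = m"
      using B[of "Bs ! i'"] True len(5) by auto
    obtain e3 \<mu> h' where h': "e3 < 0" "vec H h'" "length h' = m" "\<forall>j<m. h' ! j = (\<Sum>i<r. \<mu> i * Ws ! i ! j) + e3 * Bs ! i' ! j"
      using sLin_sum[OF b(2) v(8) rows(4) len(8) b(1) lb] by blast
    have "\<forall>j<m. gs ! j = 0 \<longrightarrow> h' ! j = 0"
      using b(3) vec_unique[OF G(2)] vec_unique[OF h'(2)] G(3) unfolding sEqj_def by metis
    then show ?thesis using h' by (intro exI[of _ \<mu>] exI[of _ "- e3"]) auto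
  qed
  then obtain \<mu> D\<mu> where mu: "\<And>i'. i' < k \<Longrightarrow> 0 < D\<mu> i'"
    "\<And>i' j. i' < k \<Longrightarrow> j < m \<Longrightarrow> gs ! j = 0 \<Longrightarrow> (\<Sum>i<r. \<mu> i' i * Ws ! i ! j) = D\<mu> i' * Bs ! i' ! j"
    by metis
  have "icert n m k r (\<lambda>j. cs ! j) (\<lambda>j. ds ! j) (\<lambda>j. qs ! j) (\<lambda>i j. As ! i ! j)
    (\<lambda>i j. Bs ! i ! j) (\<lambda>j. as ! j) (\<lambda>i j. Ts ! i ! j) (\<lambda>i j. Ws ! i ! j)
    (\<lambda>i. hs ! i) al (\<lambda>j. xs ! j) (\<lambda>j. ys ! j) (- e) u (- e1) l (- e2) \<mu> D\<mu>"
    unfolding icert_def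
  proof (intro conjI)
    show "\<forall>i<r. (\<Sum>j<n. xs ! j * Ts ! i ! j) + (\<Sum>j<m. ys ! j * Ws ! i ! j) = - e * hs ! i"
      using sMv_sum[OF w(3) v(7-9) xs(1) ys(1) e(2)] len rows xs ys by auto
    show "\<forall>i<k. (\<Sum>j<n. xs ! j * As ! i ! j) + (\<Sum>j<m. ys ! j * Bs ! i ! j) = - e * as ! i"
      using sMv_sum[OF w(4) v(4-6) xs(1) ys(1) e(2)] len rows xs ys by auto
    show "(\<Sum>j<n. xs ! j * cs ! j) + (\<Sum>j<m. ys ! j * ds ! j) \<le> - e * al"
      using obj len xs(2) ys(2) by (simp add: idot_sum)
    show "\<forall>j<n. 0 \<le> xs ! j" using xs0 xs(2) by simp
    have g: "gs ! j = (\<Sum>i<r. u i * Ws ! i ! j) + e1 * qs ! j" if "j < m" for j using G(4) that by blast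
    have f: "fs ! j = (\<Sum>i<r. l i * Ws ! i ! j) + e2 * ds ! j" if "j < m" for j using F(4) that by blast
    show "\<forall>j<m. (\<Sum>i<r. u i * Ws ! i ! j) \<le> - e1 * qs ! j" using chk g by force
    show "\<forall>j<m. (\<Sum>i<r. u i * Ws ! i ! j) < - e1 * qs ! j \<longrightarrow> ys ! j = 0" using chk g by force
    show "\<forall>j<m. (\<Sum>i<r. u i * Ws ! i ! j) = - e1 * qs ! j \<longrightarrow> - e2 * ds ! j \<le> (\<Sum>i<r. l i * Ws ! i ! j) \<and>
      (ys ! j = 0 \<or> (\<Sum>i<r. l i * Ws ! i ! j) = - e2 * ds ! j)"
      using chk g f by force
    show "\<forall>i'<k. \<forall>j<m. (\<Sum>i<r. u i * Ws ! i ! j) = - e1 * qs ! j \<longrightarrow> (\<Sum>i<r. \<mu> i' i * Ws ! i ! j) = D\<mu> i' * Bs ! i' ! j"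
      using mu(2) g by simp
  qed (use chk e(1) G(1) F(1) mu(1) in auto)
  then show ?thesis by (rule icert_rcert)
qed

lemma real_of_rat_scaled: "rat_of_int z = rat_of_int l * \<rho> \<Longrightarrow> 0 < l \<Longrightarrow> 1 / real_of_int l * real_of_int z = real_of_rat \<rho>"
proof -
  assume a: "rat_of_int z = rat_of_int l * \<rho>" "0 < l"
  have "real_of_int z = real_of_rat (rat_of_int z)" by simp
  also have "\<dots> = real_of_int l * real_of_rat \<rho>" unfolding a(1) by (simp add: of_rat_mult)
  finally show ?thesis using a(2) by simp
qed

lemma sUn_nat: "sNat en \<Longrightarrow> sUn en u \<Longrightarrow> en = enc_nat (length u)"
  unfolding sNat_def sUn_def using num_enc_nat num_unique by fastforce

text \<open>The parsed integer vectors are l times the rational data. The certificate that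
  \<open>sVer\<close> gives for them is scaled by 1 / l to one for the instance itself.\<close>

theorem sMain_sound: "sMain w \<Longrightarrow> w \<in> BLP_pess"
proof -
  assume "sMain w"
  then obtain en em ek er uN uM uK uR Vc Vd Vq VA VB Va VT VW Vh Val wc wd wq wA wB wa wT wW wh wal L L' where
    w: "w = en @ em @ ek @ er @ Vc @ Vd @ Vq @ VA @ VB @ Va @ VT @ VW @ Vh @ Val"
    and N: "sNat en" "sNat em" "sNat ek" "sNat er" "sUn en uN" "sUn em uM" "sUn ek uK" "sUn er uR"
    and L: "sNeg L'" "sAdd [False] L L' [True, True]"
    and C: "sCv L uN Vc wc" "sCv L uM Vd wd" "sCv L uM Vq wq" "sCm L uK uN VA wA" "sCm L uK uM VB wB" "sCv L uK Va wa"
      "sCm L uR uN VT wT" "sCm L uR uM VW wW" "sCv L uR Vh wh" "sCrat L Val wal" and ver: "sVer wc wd wq wA wB wa wT wW wh wal"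
    unfolding sMain_def by (elim exE conjE)
  define n m k r where "n = length uN" and "m = length uM" and "k = length uK" and "r = length uR"
  note dims = n_def[symmetric] m_def[symmetric] k_def[symmetric] r_def[symmetric]
  have en: "en = enc_nat n" "em = enc_nat m" "ek = enc_nat k" "er = enc_nat r"
    unfolding n_def m_def k_def r_def using N sUn_nat by blast+
  obtain l' where l': "l' < 0" "num L' l'" using L(1) by (auto simp: sNeg_def)
  obtain l where l: "num L l" using L(2) by (auto simp: sAdd_def)
  have lpos: "0 < l" using sAdd_value[OF L(2) l l'(2) num_0] l'(1) by simp
  have cv: "\<exists>vs zs. length vs = length U \<and> V = enc_vec vs \<and> vec Z zs \<and> length zs = length vs \<and>
    (\<forall>i<length U. 1 / real_of_int l * real_of_int (zs ! i) = real_of_rat (vs ! i))" if "sCv L U V Z" for U V Z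
    using that l real_of_rat_scaled[OF _ lpos] unfolding sCv_def by metis
  have cm: "\<exists>M Zs. length M = length K \<and> (\<forall>row\<in>set M. length row = length U) \<and> V = enc_mat M \<and>
    vec Z (concat Zs) \<and> length Zs = length M \<and> (\<forall>row\<in>set Zs. length row = length U) \<and>
    (\<forall>i<length K. \<forall>j<length U. 1 / real_of_int l * real_of_int (Zs ! i ! j) = real_of_rat (M ! i ! j))"
    if "sCm L K U V Z" for K U V Z
    using that l real_of_rat_scaled[OF _ lpos] unfolding sCm_def by metis
  obtain c cs where c: "length c = n" "Vc = enc_vec c" "vec wc cs" "length cs = n"
    "\<forall>i<n. 1 / real_of_int l * real_of_int (cs ! i) = real_of_rat (c ! i)"
    using cv[OF C(1)] unfolding dims by metis
  obtain d ds where d: "length d = m" "Vd = enc_vec d" "vec wd ds" "length ds = m"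
    "\<forall>i<m. 1 / real_of_int l * real_of_int (ds ! i) = real_of_rat (d ! i)"
    using cv[OF C(2)] unfolding dims by metis
  obtain q qs where q: "length q = m" "Vq = enc_vec q" "vec wq qs" "length qs = m"
    "\<forall>i<m. 1 / real_of_int l * real_of_int (qs ! i) = real_of_rat (q ! i)"
    using cv[OF C(3)] unfolding dims by metis
  obtain A As where A: "length A = k" "\<forall>row\<in>set A. length row = n" "VA = enc_mat A" "vec wA (concat As)" "length As = k"
    "\<forall>row\<in>set As. length row = n" "\<forall>i<k. \<forall>j<n. 1 / real_of_int l * real_of_int (As ! i ! j) = real_of_rat (A ! i ! j)"
    using cm[OF C(4)] unfolding dims by metis
  obtain B Bs where B: "length B = k" "\<forall>row\<in>set B. length row = m" "VB = enc_mat B" "vec wB (concat Bs)" "length Bs = k"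
    "\<forall>row\<in>set Bs. length row = m" "\<forall>i<k. \<forall>j<m. 1 / real_of_int l * real_of_int (Bs ! i ! j) = real_of_rat (B ! i ! j)"
    using cm[OF C(5)] unfolding dims by metis
  obtain a as where a: "length a = k" "Va = enc_vec a" "vec wa as" "length as = k"
    "\<forall>i<k. 1 / real_of_int l * real_of_int (as ! i) = real_of_rat (a ! i)"
    using cv[OF C(6)] unfolding dims by metis
  obtain T Ts where T: "length T = r" "\<forall>row\<in>set T. length row = n" "VT = enc_mat T" "vec wT (concat Ts)" "length Ts = r"
    "\<forall>row\<in>set Ts. length row = n" "\<forall>i<r. \<forall>j<n. 1 / real_of_int l * real_of_int (Ts ! i ! j) = real_of_rat (T ! i ! j)"
    using cm[OF C(7)] unfolding dims by metis
  obtain W Ws where W: "length W = r" "\<forall>row\<in>set W. length row = m" "VW = enc_mat W" "vec wW (concat Ws)" "length Ws = r"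
    "\<forall>row\<in>set Ws. length row = m" "\<forall>i<r. \<forall>j<m. 1 / real_of_int l * real_of_int (Ws ! i ! j) = real_of_rat (W ! i ! j)"
    using cm[OF C(8)] unfolding dims by metis
  obtain h hs where h: "length h = r" "Vh = enc_vec h" "vec wh hs" "length hs = r"
    "\<forall>i<r. 1 / real_of_int l * real_of_int (hs ! i) = real_of_rat (h ! i)"
    using cv[OF C(9)] unfolding dims by metis
  obtain \<alpha> al where al: "Val = enc_rat \<alpha>" "num wal al" "1 / real_of_int l * real_of_int al = real_of_rat \<alpha>"
    using C(10) num_unique[OF l] real_of_rat_scaled[OF _ lpos] unfolding sCrat_def by metis
  define I where "I = \<lparr>dim_n = n, dim_m = m, dim_k = k, dim_r = r, vec_c = c, vec_d = d, vec_q = q, mat_A = A, mat_B = B,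
    vec_a = a, mat_T = T, mat_W = W, vec_h = h, val_alpha = \<alpha>\<rparr>"
  have wf: "blp_wf I" using c d q A B a T W h by (simp add: blp_wf_def I_def)
  have "w = enc_blp I" using w en c d q A B a T W h al by (simp add: enc_blp_def I_def)
  moreover have "blp_yes I"
  proof -
    have rc: "rcert n m k r (\<lambda>j. of_int (cs ! j)) (\<lambda>j. of_int (ds ! j)) (\<lambda>j. of_int (qs ! j)) (\<lambda>i j. of_int (As ! i ! j))
      (\<lambda>i j. of_int (Bs ! i ! j)) (\<lambda>j. of_int (as ! j)) (\<lambda>i j. of_int (Ts ! i ! j)) (\<lambda>i j. of_int (Ws ! i ! j))
      (\<lambda>i. of_int (hs ! i)) (of_int al)"
      by (rule sVer_rcert[OF ver c(3) d(3) q(3) A(4) B(4) a(3) T(4) W(4) h(3) al(2)])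
        (fact c d q A B a T W h)+
    have "0 < 1 / real_of_int l" using lpos by simp
    from rcert_scale[OF this rc]
    have "rcert n m k r (\<lambda>j. real_of_rat (c ! j)) (\<lambda>j. real_of_rat (d ! j)) (\<lambda>j. real_of_rat (q ! j))
      (\<lambda>i j. real_of_rat (A ! i ! j)) (\<lambda>i j. real_of_rat (B ! i ! j)) (\<lambda>i. real_of_rat (a ! i))
      (\<lambda>i j. real_of_rat (T ! i ! j)) (\<lambda>i j. real_of_rat (W ! i ! j)) (\<lambda>i. real_of_rat (h ! i)) (real_of_rat \<alpha>)"
      by (rule rcert_cong) (use c(5) d(5) q(5) A(7) B(7) a(5) T(7) W(7) h(5) al(3) in blast)+
    then show ?thesis unfolding blp_yes_rcert[OF wf] by (simp add: I_def)
  qed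
  ultimately show ?thesis using wf unfolding BLP_pess_def by blast
qed

section \<open>Short derivations\<close>

definition derl :: "nat \<Rightarrow> nat \<Rightarrow> pr gatom list \<Rightarrow> bool" where
  "derl S N as \<longleftrightarrow> (\<exists>n\<le>N. ders prog S n as)"

abbreviation der :: "nat \<Rightarrow> nat \<Rightarrow> pr gatom \<Rightarrow> bool" where
  "der S N a \<equiv> derl S N [a]"

lemma derl_Nil: "derl S 0 []"
  by (auto simp: derl_def intro: ders_Nil)

lemma derl_Cons: "der S n a \<Longrightarrow> derl S N as \<Longrightarrow> derl S (n + N) (a # as)"
proof -
  assume "der S n a" "derl S N as"
  then obtain i j where "i \<le> n" "ders prog S i [a]" "j \<le> N" "ders prog S j as" by (auto simp: derl_def)
  then show ?thesis using ders_append[of prog S i "[a]" j as] unfolding derl_def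
    by (intro exI[of _ "i + j"]) auto
qed

lemma derl_mono: "derl S n as \<Longrightarrow> n \<le> N \<Longrightarrow> derl S N as"
  unfolding derl_def by (auto intro: le_trans)

definition asg :: "word list \<Rightarrow> nat \<Rightarrow> word" where
  "asg xs v = (if v < length xs then xs ! v else [])"

definition small :: "nat \<Rightarrow> word list \<Rightarrow> bool" where
  "small S xs \<longleftrightarrow> (\<forall>x\<in>set xs. length x \<le> S)"

lemma small_simps: "small S []" "small S (x # xs) \<longleftrightarrow> length x \<le> S \<and> small S xs"
  by (auto simp: small_def)

lemma der_rule:
  assumes "r \<in> set prog" "small S xs" "derl S N (map (inst (asg xs)) (snd r))"
  shows "der S (Suc N) (fst (fst r), map (subst (asg xs)) (snd (fst r)))"
proof -
  obtain n where n: "n \<le> N" "ders prog S n (map (inst (asg xs)) (snd r))" using assms(3) by (auto simp: derl_def)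
  have "length (asg xs v) \<le> S" for v using assms(2) by (auto simp: asg_def small_def)
  then have "ders prog S (Suc n) (inst (asg xs) (fst r) # [])"
    using assms(1) n(2) by (intro ders_Step[of "fst r" "snd r"]) auto
  then show ?thesis using n(1) by (auto simp: derl_def inst_def)
qed

lemma rules_mem: "k < length rules_num \<Longrightarrow> rules_num ! k \<in> set prog" "k < length rules_vec \<Longrightarrow> rules_vec ! k \<in> set prog"
  "k < length rules_parse \<Longrightarrow> rules_parse ! k \<in> set prog" "k < length rules_main \<Longrightarrow> rules_main ! k \<in> set prog"
  by (auto simp: prog_def)

lemmas nrule = der_rule[OF rules_mem(1)]
lemmas vrule = der_rule[OF rules_mem(2)]
lemmas prule = der_rule[OF rules_mem(3)]
lemmas mrule = der_rule[OF rules_mem(4)]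

text \<open>From here on each clause of the program becomes an introduction rule for
  \<open>der\<close>; the list gives the values of the variables 0, 1, ... in order. The eight adder
  clauses are treated together in \<open>d_Add_step\<close>.\<close>

lemmas d_Num0 = nrule[of 0 _ "[]", unfolded rules_num_def inst_def asg_def, simplified]
lemmas d_Num1 = nrule[of 1 _ "[]", unfolded rules_num_def inst_def asg_def, simplified]
lemmas d_Num2 = nrule[of 2 _ "[X]", unfolded rules_num_def inst_def asg_def, simplified] for X
lemmas d_Num3 = nrule[of 3 _ "[X]", unfolded rules_num_def inst_def asg_def, simplified] for X
lemmas d_Shift0 = nrule[of 4 _ "[]", unfolded rules_num_def inst_def asg_def, simplified]
lemmas d_Shift1 = nrule[of 5 _ "[]", unfolded rules_num_def inst_def asg_def, simplified]
lemmas d_Shift2 = nrule[of 6 _ "[X]", unfolded rules_num_def inst_def asg_def, simplified] for X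
lemmas d_Shift3 = nrule[of 7 _ "[X]", unfolded rules_num_def inst_def asg_def, simplified] for X
lemmas d_Add0 = nrule[of 8 _ "[X]", unfolded rules_num_def inst_def asg_def, simplified] for X
lemmas d_Add1 = nrule[of 9 _ "[X]", unfolded rules_num_def inst_def asg_def, simplified] for X
lemmas d_Add2 = nrule[of 10 _ "[X]", unfolded rules_num_def inst_def asg_def, simplified] for X
lemmas d_Add3 = nrule[of 11 _ "[X]", unfolded rules_num_def inst_def asg_def, simplified] for X
lemmas d_Add4 = nrule[of 12 _ "[]", unfolded rules_num_def inst_def asg_def, simplified]
lemmas d_Add5 = nrule[of 13 _ "[]", unfolded rules_num_def inst_def asg_def, simplified]
lemmas d_Mul0 = nrule[of 22 _ "[X]", unfolded rules_num_def inst_def asg_def, simplified] for X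
lemmas d_Mul1 = nrule[of 23 _ "[X, Y]", unfolded rules_num_def inst_def asg_def, simplified] for X Y
lemmas d_Mul2 = nrule[of 24 _ "[X, Y, Z, M]", unfolded rules_num_def inst_def asg_def, simplified] for X Y Z M
lemmas d_Mul3 = nrule[of 25 _ "[X, Y, Z, M, M2]", unfolded rules_num_def inst_def asg_def, simplified] for X Y Z M M2
lemmas d_Neg0 = nrule[of 26 _ "[]", unfolded rules_num_def inst_def asg_def, simplified]
lemmas d_Neg1 = nrule[of 27 _ "[X]", unfolded rules_num_def inst_def asg_def, simplified] for X
lemmas d_Neg2 = nrule[of 28 _ "[X]", unfolded rules_num_def inst_def asg_def, simplified] for X
lemmas d_Nn0 = nrule[of 29 _ "[]", unfolded rules_num_def inst_def asg_def, simplified]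
lemmas d_Nn1 = nrule[of 30 _ "[X]", unfolded rules_num_def inst_def asg_def, simplified] for X
lemmas d_Nn2 = nrule[of 31 _ "[X]", unfolded rules_num_def inst_def asg_def, simplified] for X

lemma d_Add_step:
  assumes "length X \<le> S" "length Y \<le> S" "length Z \<le> S" "length X' \<le> S" "length Y' \<le> S" "length Z' \<le> S"
    and d: "derl S N [(Shift, [[a], X', X]), (Shift, [[b], Y', Y]), (Shift, [[(a \<noteq> b) \<noteq> c], Z', Z]),
      (Add, [[(a \<and> b) \<or> (c \<and> (a \<or> b))], X', Y', Z'])]"
  shows "der S (Suc N) (Add, [[c], X, Y, Z])"
proof -
  have "add_rule a b c \<in> set prog" by (cases a; cases b; cases c; simp add: prog_def rules_num_def)
  from der_rule[OF this, of S "[X, Y, Z, X', Y', Z']" N] assms(1-6) d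
  show ?thesis by (simp add: add_rule_def inst_def asg_def small_simps)
qed

lemmas d_Nnv0 = vrule[of 0 _ "[]", unfolded rules_vec_def inst_def asg_def, simplified]
lemmas d_Nnv1 = vrule[of 1 _ "[X, V]", unfolded rules_vec_def inst_def asg_def, simplified] for X V
lemmas d_Dot0 = vrule[of 2 _ "[]", unfolded rules_vec_def inst_def asg_def, simplified]
lemmas d_Dot1 = vrule[of 3 _ "[X, V, Y, U, Z, M, N']", unfolded rules_vec_def inst_def asg_def, simplified] for X V Y U Z M N'
lemmas d_Zv0 = vrule[of 4 _ "[]", unfolded rules_vec_def inst_def asg_def, simplified]
lemmas d_Zv1 = vrule[of 5 _ "[V]", unfolded rules_vec_def inst_def asg_def, simplified] for V
lemmas d_Ax0 = vrule[of 6 _ "[A]", unfolded rules_vec_def inst_def asg_def, simplified] for A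
lemmas d_Ax1 = vrule[of 7 _ "[A, X, V, Y, U, Z, W, M]", unfolded rules_vec_def inst_def asg_def, simplified] for A X V Y U Z W M
lemmas d_Comb0 = vrule[of 8 _ "[Z]", unfolded rules_vec_def inst_def asg_def, simplified] for Z
lemmas d_Comb1 = vrule[of 9 _ "[A, U, R, M, G, H]", unfolded rules_vec_def inst_def asg_def, simplified] for A U R M G H
lemmas d_Lin = vrule[of 10 _ "[B, W, G, E, U, H]", unfolded rules_vec_def inst_def asg_def, simplified] for B W G E U H
lemmas d_Mv0 = vrule[of 11 _ "[X, Y, E]", unfolded rules_vec_def inst_def asg_def, simplified] for X Y E
lemmas d_Mv1 = vrule[of 12 _ "[T', T, W', W, H', H, X, Y, E, A, B, C, D]", unfolded rules_vec_def inst_def asg_def, simplified]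
  for T' T W' W H' H X Y E A B C D
lemmas d_Chk0 = vrule[of 13 _ "[]", unfolded rules_vec_def inst_def asg_def, simplified]
lemmas d_Chk1 = vrule[of 14 _ "[G, F, Y', Y]", unfolded rules_vec_def inst_def asg_def, simplified] for G F Y' Y
lemmas d_Chk2 = vrule[of 15 _ "[G, F', F, Y]", unfolded rules_vec_def inst_def asg_def, simplified] for G F' F Y
lemmas d_Chk3 = vrule[of 16 _ "[G', G, F', F, Y]", unfolded rules_vec_def inst_def asg_def, simplified] for G' G F' F Y
lemmas d_Eqj0 = vrule[of 17 _ "[]", unfolded rules_vec_def inst_def asg_def, simplified]
lemmas d_Eqj1 = vrule[of 18 _ "[G, H]", unfolded rules_vec_def inst_def asg_def, simplified] for G H
lemmas d_Eqj2 = vrule[of 19 _ "[G', G, H', H]", unfolded rules_vec_def inst_def asg_def, simplified] for G' G H' H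
lemmas d_Eqs0 = vrule[of 20 _ "[W, G]", unfolded rules_vec_def inst_def asg_def, simplified] for W G
lemmas d_Eqs1 = vrule[of 21 _ "[W, B', B, G, H]", unfolded rules_vec_def inst_def asg_def, simplified] for W B' B G H

lemmas d_Nat0 = prule[of 0 _ "[]", unfolded rules_parse_def inst_def asg_def, simplified]
lemmas d_Nat1 = prule[of 1 _ "[]", unfolded rules_parse_def inst_def asg_def, simplified]
lemmas d_Nat2 = prule[of 2 _ "[X]", unfolded rules_parse_def inst_def asg_def, simplified] for X
lemmas d_Nat3 = prule[of 3 _ "[X]", unfolded rules_parse_def inst_def asg_def, simplified] for X
lemmas d_Un0 = prule[of 4 _ "[]", unfolded rules_parse_def inst_def asg_def, simplified]
lemmas d_Un1 = prule[of 5 _ "[X, U]", unfolded rules_parse_def inst_def asg_def, simplified] for X U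
lemmas d_Un2 = prule[of 6 _ "[X, U]", unfolded rules_parse_def inst_def asg_def, simplified] for X U
lemmas d_Cop = prule[of 7 _ "[P, Q, A, X, B, Y]", unfolded rules_parse_def inst_def asg_def, simplified] for P Q A X B Y
lemmas d_Crat0 = prule[of 8 _ "[L, P, Q, Z, M]", unfolded rules_parse_def inst_def asg_def, simplified] for L P Q Z M
lemmas d_Crat1 = prule[of 9 _ "[L, P, Q, Z, M, M']", unfolded rules_parse_def inst_def asg_def, simplified] for L P Q Z M M'
lemmas d_Cv0 = prule[of 10 _ "[L]", unfolded rules_parse_def inst_def asg_def, simplified] for L
lemmas d_Cv1 = prule[of 11 _ "[L, U, R, V, X, Z]", unfolded rules_parse_def inst_def asg_def, simplified] for L U R V X Z
lemmas d_Cm0 = prule[of 12 _ "[L, U]", unfolded rules_parse_def inst_def asg_def, simplified] for L U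
lemmas d_Cm1 = prule[of 13 _ "[L, K, U, R, V, X, Z]", unfolded rules_parse_def inst_def asg_def, simplified] for L K U R V X Z
lemmas d_Ver = mrule[of 0 _ "[c, d, q, A, B, a, T, W, h, al, X, Y, E, t1, t2, t3, t4, t5, t6, G, F]",
  unfolded rules_main_def inst_def asg_def, simplified] for c d q A B a T W h al X Y E t1 t2 t3 t4 t5 t6 G F
lemmas d_Main = mrule[of 1 _ "[en, em, ek, er, uN, uM, uK, uR, Vc, Vd, Vq, VA, VB, Va, VT, VW, Vh, Val, c, d, q, A, B, a, T, W, h, al, L, L']",
  unfolded rules_main_def inst_def asg_def, simplified]
  for en em ek er uN uM uK uR Vc Vd Vq VA VB Va VT VW Vh Val c d q A B a T W h al L L'

section \<open>Canonical numerals\<close>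

lemma half_less: "x \<noteq> 0 \<Longrightarrow> x \<noteq> -1 \<Longrightarrow> nat \<bar>x div 2\<bar> < nat \<bar>x :: int\<bar>"
  by (cases "0 < x") linarith+

lemma bit_div: "of_bool (odd x) + 2 * (x div 2) = (x :: int)"
  by (cases "even x"; simp; presburger)

text \<open>The numeral without redundant leading digits, which agrees with \<open>enc_nat\<close>
  on nonnegative numbers. The derivations constructed below use only these numerals; their digit
  count \<open>bl\<close> is the recursion measure.\<close>

function I :: "int \<Rightarrow> word" where
  "I x = (if x = 0 then [True, True] else if x = -1 then [True, False] else False # odd x # I (x div 2))"
  by auto
termination by (relation "measure (\<lambda>x. nat \<bar>x\<bar>)") (use half_less in auto)

function bl :: "int \<Rightarrow> nat" where
  "bl x = (if x = 0 \<or> x = -1 then 0 else Suc (bl (x div 2)))"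
  by auto
termination by (relation "measure (\<lambda>x. nat \<bar>x\<bar>)") (use half_less in auto)

declare I.simps [simp del] bl.simps [simp del]

lemma I_simps [simp]: "I 0 = [True, True]" "I (-1) = [True, False]"
  by (simp_all add: I.simps)

lemma I_step: "x \<noteq> 0 \<Longrightarrow> x \<noteq> -1 \<Longrightarrow> I x = False # odd x # I (x div 2)"
  by (simp add: I.simps[of x])

lemma bl_simps [simp]: "bl 0 = 0" "bl (-1) = 0"
  by (simp_all add: bl.simps)

lemma bl_step: "x \<noteq> 0 \<Longrightarrow> x \<noteq> -1 \<Longrightarrow> bl x = Suc (bl (x div 2))"
  by (simp add: bl.simps[of x])

lemma bl_div_le: "bl (x div 2) \<le> bl x"
  by (cases "x = 0 \<or> x = -1") (auto simp: bl_step)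

lemma half_induct [case_names zero minus step]:
  assumes "P 0" "P (-1)" "\<And>x :: int. x \<noteq> 0 \<Longrightarrow> x \<noteq> -1 \<Longrightarrow> P (x div 2) \<Longrightarrow> P x"
  shows "P x"
  using assms by (induction x rule: bl.induct) metis

lemma length_I: "length (I x) = 2 * bl x + 2"
  by (induction x rule: half_induct) (simp_all add: I_step bl_step)

lemma enc_nat_I: "enc_nat n = I (int n)"
proof (induction n rule: less_induct)
  case (less n)
  show ?case
  proof (cases "n = 0")
    case False
    then have "enc_nat (n div 2) = I (int (n div 2))" using less by simp
    then show ?thesis using False I_step[of "int n"] by (simp add: enc_nat_pos zdiv_int)
  qed (simp add: enc_nat_0)
qed

lemma bl_bound: "- (2 ^ t) \<le> x \<Longrightarrow> x < 2 ^ t \<Longrightarrow> bl x \<le> t"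
proof (induction t arbitrary: x)
  case 0
  then have "x = 0 \<or> x = -1" by auto
  then show ?case by auto
next
  case (Suc t)
  have "- (2 ^ t) \<le> x div 2" "x div 2 < 2 ^ t" using Suc.prems by auto
  from Suc.IH[OF this] show ?case by (cases "x = 0 \<or> x = -1") (auto simp: bl_step)
qed

lemma bl_less: "x < 2 ^ bl x"
proof (induction x rule: half_induct)
  case (step x)
  then have "x < 2 * 2 ^ bl (x div 2)" by linarith
  then show ?case using step by (simp add: bl_step)
qed simp_all

text \<open>The two exceptions are the sign extensions of 0 and -1, where a further bit does not
  lengthen the canonical numeral. They are covered by the two \<open>Shift\<close> clauses without
  premises.\<close>

lemma I_bit: "I (of_bool b + 2 * x) = False # b # I x \<or> (x = 0 \<and> \<not> b) \<or> (x = -1 \<and> b)"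
proof (cases "(x = 0 \<and> \<not> b) \<or> (x = -1 \<and> b)")
  case False
  then have "of_bool b + 2 * x \<noteq> 0" "of_bool b + 2 * x \<noteq> -1" by (cases b; simp; presburger)+
  then show ?thesis using I_step[of "of_bool b + 2 * x"] by simp
qed blast

definition IV :: "int list \<Rightarrow> word" where
  "IV vs = concat (map I vs)"

lemma IV_simps [simp]: "IV [] = []" "IV (v # vs) = I v @ IV vs" "IV (vs @ us) = IV vs @ IV us"
  by (simp_all add: IV_def)

text \<open>The functions cA, cM, ... bound the number of rule applications in a derivation of an Add, Mul, ...
  atom whose words have length at most S.\<close>
definition cA :: "nat \<Rightarrow> nat" where "cA S = 2 * S * (3 * S + 4)"
definition cM :: "nat \<Rightarrow> nat" where "cM S = S * (cA S + 2 * S + 4)"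

text \<open>2 ^ k bounds the absolute value of the numbers in use. Such a number has at most k + 1
  digits before its terminator, and two bits for each of these make words of length at most 2 * k +
  4.\<close>

locale costs =
  fixes S k :: nat
  assumes Sk: "2 * k + 4 \<le> S"
begin

section \<open>Derivations in integer arithmetic\<close>

definition fit :: "int \<Rightarrow> bool" where "fit x \<longleftrightarrow> \<bar>x\<bar> \<le> 2 ^ k"

lemma fit_bl: "fit x \<Longrightarrow> bl x \<le> k + 1"
proof -
  assume "fit x"
  then have "\<bar>x\<bar> \<le> 2 ^ k" by (simp add: fit_def)
  moreover have "(2::int) ^ (k + 1) = 2 * 2 ^ k" "(0::int) < 2 ^ k" by simp_all
  ultimately have "- (2 ^ (k + 1)) \<le> x" "x < 2 ^ (k + 1)" by linarith+
  then show ?thesis by (rule bl_bound)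
qed

lemma fit_length: "fit x \<Longrightarrow> length (I x) \<le> S"
  using fit_bl[of x] Sk by (simp add: length_I)

lemma fit_bl_S: "fit x \<Longrightarrow> bl x + 1 \<le> S"
  using fit_bl[of x] Sk by simp

lemma small1: "fit x \<Longrightarrow> small S [I x]"
  by (simp add: small_simps fit_length)

lemma fit_div: "fit x \<Longrightarrow> fit (x div 2)"
  unfolding fit_def by linarith

lemma fit_small: "fit 0" "fit (-1)" "fit 1"
  by (simp_all add: fit_def)

lemma dNum_bl: "fit x \<Longrightarrow> der S (bl x + 1) (Num, [I x])"
proof (induction x rule: half_induct)
  case zero
  then show ?case using d_Num0[OF small_simps(1) derl_Nil] by simp
next
  case minus
  then show ?case using d_Num1[OF small_simps(1) derl_Nil] by simp
next
  case (step x)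
  then have "der S (bl (x div 2) + 1) (Num, [I (x div 2)])" using fit_div by blast
  then show ?case
    using step fit_length[OF fit_div[OF step(4)]] d_Num2[of S "I (x div 2)"] d_Num3[of S "I (x div 2)"]
    by (cases "odd x") (simp_all add: I_step bl_step small_simps)
qed

lemma dNum: "fit x \<Longrightarrow> der S S (Num, [I x])"
  using derl_mono[OF dNum_bl] fit_bl_S by blast

lemma dShift: "fit x \<Longrightarrow> der S (S + 1) (Shift, [[b], I x, I (of_bool b + 2 * x)])"
proof -
  assume x: "fit x"
  consider "I (of_bool b + 2 * x) = False # b # I x" | "x = 0" "\<not> b" | "x = -1" b using I_bit[of b x] by blast
  then show ?thesis
  proof cases
    case 1
    then show ?thesis
      using d_Shift2[OF small1[OF x] dNum[OF x]] d_Shift3[OF small1[OF x] dNum[OF x]] by (cases b) simp_all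
  next
    case 2
    then show ?thesis using derl_mono[OF d_Shift0[OF small_simps(1) derl_Nil]] by simp
  next
    case 3
    then show ?thesis using derl_mono[OF d_Shift1[OF small_simps(1) derl_Nil]] by simp
  qed
qed

text \<open>One adder step halves both operands, which lowers the total digit count unless both are
  0 or -1. It costs three \<open>Shift\<close> derivations of S + 1 rules each and one rule of its
  own, together 3 * S + 4.\<close>

lemma dAdd_bl:
  "fit x \<Longrightarrow> fit y \<Longrightarrow> fit (x + y + of_bool c) \<Longrightarrow>
   der S ((bl x + bl y + 1) * (3 * S + 4)) (Add, [[c], I x, I y, I (x + y + of_bool c)])"
proof (induction "bl x + bl y" arbitrary: x y c rule: less_induct)
  case less
  let ?z = "x + y + of_bool c"
  have one: "S + 1 \<le> (bl x + bl y + 1) * (3 * S + 4)" "1 \<le> (bl x + bl y + 1) * (3 * S + 4)" by simp_all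
  have "bl (x div 2) + bl (y div 2) < bl x + bl y \<or> (x = 0 \<or> x = -1) \<and> (y = 0 \<or> y = -1)"
  proof (cases "x = 0 \<or> x = -1")
    case True
    then show ?thesis using bl_div_le[of x] bl_step[of y] by (cases "y = 0 \<or> y = -1") simp_all
  next
    case False
    then show ?thesis using bl_div_le[of y] bl_step[of x] by simp
  qed
  then consider "x = 0" "\<not> c" | "y = 0" "\<not> c" | "x = -1" c | "y = -1" c | "x = 0" "y = 0" c | "x = -1" "y = -1" "\<not> c"
    | "bl (x div 2) + bl (y div 2) < bl x + bl y"
    by (cases c) blast+
  then show ?case
  proof cases
    case 1
    then show ?thesis
      using derl_mono[OF d_Add0[OF small1[OF less.prems(2)] dNum[OF less.prems(2)]], OF one(1)[unfolded Suc_eq_plus1[symmetric]]] by simp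
  next
    case 2
    then show ?thesis
      using derl_mono[OF d_Add1[OF small1[OF less.prems(1)] dNum[OF less.prems(1)]], OF one(1)[unfolded Suc_eq_plus1[symmetric]]] by simp
  next
    case 3
    then show ?thesis
      using derl_mono[OF d_Add2[OF small1[OF less.prems(2)] dNum[OF less.prems(2)]], OF one(1)[unfolded Suc_eq_plus1[symmetric]]] by simp
  next
    case 4
    then show ?thesis
      using derl_mono[OF d_Add3[OF small1[OF less.prems(1)] dNum[OF less.prems(1)]], OF one(1)[unfolded Suc_eq_plus1[symmetric]]] by simp
  next
    case 5
    then show ?thesis using derl_mono[OF d_Add4[OF small_simps(1) derl_Nil], of "(bl x + bl y + 1) * (3 * S + 4)"] I_bit[of True 0] by simp
  next
    case 6
    then show ?thesis using derl_mono[OF d_Add5[OF small_simps(1) derl_Nil], of "(bl x + bl y + 1) * (3 * S + 4)"] I_bit[of False "-1"] by simp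
  next
    case 7
    define a b where "a = odd x" and "b = odd y"
    define x' y' where "x' = x div 2" and "y' = y div 2"
    define z' where "z' = x' + y' + of_bool ((a \<and> b) \<or> (c \<and> (a \<or> b)))"
    have x: "x = of_bool a + 2 * x'" by (simp only: a_def x'_def bit_div)
    have y: "y = of_bool b + 2 * y'" by (simp only: b_def y'_def bit_div)
    have z: "?z = of_bool ((a \<noteq> b) \<noteq> c) + 2 * z'"
      unfolding x y z'_def by (cases a; cases b; cases c) simp_all
    then have z'_div: "z' = ?z div 2" by simp
    have f: "fit x'" "fit y'" "fit z'" using less.prems fit_div by (auto simp: x'_def y'_def z'_div)
    have "der S ((bl x' + bl y' + 1) * (3 * S + 4)) (Add, [[(a \<and> b) \<or> (c \<and> (a \<or> b))], I x', I y', I z'])"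
      unfolding z'_def by (rule less.hyps) (use 7 f in \<open>auto simp: x'_def y'_def z'_def\<close>)
    from d_Add_step[OF fit_length[OF less.prems(1)] fit_length[OF less.prems(2)] fit_length[OF less.prems(3)]
        fit_length[OF f(1)] fit_length[OF f(2)] fit_length[OF f(3)]
        derl_Cons[OF dShift[OF f(1), of a, folded x] derl_Cons[OF dShift[OF f(2), of b, folded y]
          derl_Cons[OF dShift[OF f(3), of "(a \<noteq> b) \<noteq> c", folded z] this]]]]
    have "der S (Suc (S + 1 + (S + 1 + (S + 1 + (bl x' + bl y' + 1) * (3 * S + 4))))) (Add, [[c], I x, I y, I ?z])" .
    moreover have "(bl x' + bl y' + 2) * (3 * S + 4) \<le> (bl x + bl y + 1) * (3 * S + 4)"
      using 7 by (intro mult_le_mono1) (simp add: x'_def y'_def)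
    ultimately show ?thesis by (elim derl_mono) (simp add: algebra_simps)
  qed
qed

lemma dAdd: "fit x \<Longrightarrow> fit y \<Longrightarrow> fit (x + y + of_bool c) \<Longrightarrow> der S (cA S) (Add, [[c], I x, I y, I (x + y + of_bool c)])"
proof -
  assume f: "fit x" "fit y" "fit (x + y + of_bool c)"
  have "(bl x + bl y + 1) * (3 * S + 4) \<le> cA S"
    unfolding cA_def using fit_bl_S[OF f(1)] fit_bl_S[OF f(2)] by (intro mult_le_mono1) simp
  with dAdd_bl[OF f] show ?thesis by (rule derl_mono)
qed

lemma dAdd0: "fit x \<Longrightarrow> fit y \<Longrightarrow> fit (x + y) \<Longrightarrow> der S (cA S) (Add, [[False], I x, I y, I (x + y)])"
  using dAdd[of x y False] by simp

text \<open>The bound on the product covers all intermediate results. The summand 1 pays for 2 * (x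
  div 2), whose absolute value is one more than that of x when x is odd and negative.\<close>

lemma dMul_bl:
  "fit x \<Longrightarrow> fit y \<Longrightarrow> (\<bar>x\<bar> + 1) * \<bar>y\<bar> \<le> 2 ^ k \<Longrightarrow>
   der S ((bl x + 1) * (cA S + 2 * S + 4)) (Mul, [I x, I y, I (x * y)])"
proof (induction x rule: half_induct)
  case zero
  then show ?case using derl_mono[OF d_Mul0[OF small1 dNum], of y "(bl 0 + 1) * (cA S + 2 * S + 4)"] by simp
next
  case minus
  have f: "fit (- y)" using minus(2) by (simp add: fit_def)
  have "der S (cA S) (Add, [[False], I y, I (- y), [True, True]])"
    using dAdd0[OF minus(2) f] fit_small by simp
  from derl_mono[OF d_Mul1[of S "I y" "I (- y)", OF _ this], of "(bl (-1) + 1) * (cA S + 2 * S + 4)"]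
  show ?case using fit_length[OF f] fit_length[OF minus(2)] by (simp add: small_simps)
next
  case (step x)
  define x' where "x' = x div 2"
  have x: "x = of_bool (odd x) + 2 * x'" by (simp only: x'_def bit_div)
  have ax: "\<bar>x'\<bar> \<le> \<bar>x\<bar>" "\<bar>2 * x'\<bar> \<le> \<bar>x\<bar> + 1" by (simp_all add: x'_def)
  have "(\<bar>x'\<bar> + 1) * \<bar>y\<bar> \<le> (\<bar>x\<bar> + 1) * \<bar>y\<bar>" using ax by (intro mult_right_mono) auto
  then have p': "(\<bar>x'\<bar> + 1) * \<bar>y\<bar> \<le> 2 ^ k" using step.prems by linarith
  have le: "fit (c * y)" if "\<bar>c\<bar> \<le> \<bar>x\<bar> + 1" for c
  proof -
    have "\<bar>c * y\<bar> \<le> (\<bar>x\<bar> + 1) * \<bar>y\<bar>" using that unfolding abs_mult by (intro mult_right_mono) auto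
    then show ?thesis using step.prems by (simp add: fit_def)
  qed
  have f: "fit x'" "fit y" "fit (x' * y)" "fit ((2 * x') * y)" "fit (x * y)"
    using fit_div step.prems(1,2) le ax by (auto simp: x'_def)
  have rec: "der S ((bl x' + 1) * (cA S + 2 * S + 4)) (Mul, [I x', I y, I (x' * y)])"
    using step.IH f p' unfolding x'_def by blast
  have sh: "der S (S + 1) (Shift, [[False], I (x' * y), I ((2 * x') * y)])"
    using dShift[OF f(3), of False] by (simp add: mult.assoc)
  have blx: "bl x = Suc (bl x')" using step.hyps by (simp add: bl_step x'_def)
  show ?case
  proof (cases "odd x")
    case False
    have xy: "x * y = (2 * x') * y" by (subst x) (simp add: False)
    have Ix: "I x = False # False # I x'" using step.hyps False by (simp add: I_step x'_def)
    show ?thesis unfolding Ix xy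
      using derl_mono[OF d_Mul2[OF _ derl_Cons[OF rec sh]], of "(bl x + 1) * (cA S + 2 * S + 4)"] f(1-4)[THEN fit_length]
      by (simp add: blx small_simps)
  next
    case True
    then have xy: "x * y = y + (2 * x') * y" using x by (simp add: algebra_simps)
    have ad: "der S (cA S) (Add, [[False], I y, I ((2 * x') * y), I (x * y)])"
      using dAdd0[OF f(2) f(4)] f(5) unfolding xy by simp
    have "I x = False # True # I x'" using step.hyps True by (simp add: I_step x'_def)
    then show ?thesis
      using derl_mono[OF d_Mul3[OF _ derl_Cons[OF rec derl_Cons[OF sh ad]]], of "(bl x + 1) * (cA S + 2 * S + 4)"] f(1-5)[THEN fit_length]
      by (simp add: blx small_simps)
  qed
qed

lemma dMul: "fit x \<Longrightarrow> fit y \<Longrightarrow> (\<bar>x\<bar> + 1) * \<bar>y\<bar> \<le> 2 ^ k \<Longrightarrow> der S (cM S) (Mul, [I x, I y, I (x * y)])"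
proof -
  assume f: "fit x" "fit y" "(\<bar>x\<bar> + 1) * \<bar>y\<bar> \<le> 2 ^ k"
  have "(bl x + 1) * (cA S + 2 * S + 4) \<le> cM S"
    unfolding cM_def using fit_bl_S[OF f(1)] by (intro mult_le_mono1) simp
  with dMul_bl[OF f] show ?thesis by (rule derl_mono)
qed

lemma dNeg: "x < 0 \<Longrightarrow> fit x \<Longrightarrow> der S S (Neg, [I x])"
proof -
  have "x < 0 \<Longrightarrow> fit x \<Longrightarrow> der S (bl x + 1) (Neg, [I x])"
  proof (induction x rule: half_induct)
    case minus
    then show ?case using d_Neg0[OF small_simps(1) derl_Nil] by simp
  next
    case (step x)
    then have "der S (bl (x div 2) + 1) (Neg, [I (x div 2)])" using fit_div by simp
    then show ?case
      using step fit_length[OF fit_div[OF step(5)]] d_Neg1[of S "I (x div 2)"] d_Neg2[of S "I (x div 2)"]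
      by (cases "odd x") (simp_all add: I_step bl_step small_simps)
  qed simp
  then show "x < 0 \<Longrightarrow> fit x \<Longrightarrow> der S S (Neg, [I x])" using derl_mono fit_bl_S by blast
qed

lemma dNn: "0 \<le> x \<Longrightarrow> fit x \<Longrightarrow> der S S (Nn, [I x])"
proof -
  have "0 \<le> x \<Longrightarrow> fit x \<Longrightarrow> der S (bl x + 1) (Nn, [I x])"
  proof (induction x rule: half_induct)
    case zero
    then show ?case using d_Nn0[OF small_simps(1) derl_Nil] by simp
  next
    case (step x)
    then have "der S (bl (x div 2) + 1) (Nn, [I (x div 2)])" using fit_div by simp
    then show ?case
      using step fit_length[OF fit_div[OF step(5)]] d_Nn1[of S "I (x div 2)"] d_Nn2[of S "I (x div 2)"]
      by (cases "odd x") (simp_all add: I_step bl_step small_simps)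
  qed simp
  then show "0 \<le> x \<Longrightarrow> fit x \<Longrightarrow> der S S (Nn, [I x])" using derl_mono fit_bl_S by blast
qed

end

definition cD :: "nat \<Rightarrow> nat" where "cD S = S * (cM S + cA S + 1) + 1"
definition cX :: "nat \<Rightarrow> nat" where "cX S = S * (cM S + cA S + 1) + S + 1"
definition cC :: "nat \<Rightarrow> nat" where "cC S = S * (cX S + 1) + S + 2"
definition cL :: "nat \<Rightarrow> nat" where "cL S = S + cC S + cX S + 1"
definition cMv :: "nat \<Rightarrow> nat" where "cMv S = S * (2 * cD S + 2 * cA S + cM S + 1) + 1"
definition cE :: "nat \<Rightarrow> nat" where "cE S = S * (2 * S + 1) + 1"
definition cEs :: "nat \<Rightarrow> nat" where "cEs S = S * (cL S + cE S + 1) + 1"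

text \<open>d bounds the lengths of vectors and b the absolute values of their entries. The first
  assumption lets a vector of numbers of k bits fit into a word; the last one makes sums of up to 2
  * d + 2 products fit. b + 1 instead of b leaves room for Bezout coefficients.\<close>

locale bnd = costs +
  fixes d :: nat and b :: int
  assumes Sd: "(2 * k + 4) * (d + 1) \<le> S"
    and b0: "0 \<le> b"
    and bk: "(b + 1) * (b + 1) * (2 * int d + 2) \<le> 2 ^ k"
begin

section \<open>Derivations for vectors and matrices\<close>

definition ok :: "int \<Rightarrow> int list \<Rightarrow> bool" where
  "ok c vs \<longleftrightarrow> length vs \<le> d \<and> (\<forall>v\<in>set vs. \<bar>v\<bar> \<le> c)"

lemma ok_Cons: "ok c (v # vs) \<Longrightarrow> \<bar>v\<bar> \<le> c" "ok c (v # vs) \<Longrightarrow> ok c vs"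
  by (auto simp: ok_def)

lemma ok_concat: "ok c (concat (r # rows)) \<Longrightarrow> ok c r" "ok c (concat (r # rows)) \<Longrightarrow> ok c (concat rows)"
  by (auto simp: ok_def)

lemma ok_mono: "ok c vs \<Longrightarrow> c \<le> c' \<Longrightarrow> ok c' vs"
  by (force simp: ok_def)

lemma dS: "d + 1 \<le> S"
proof -
  have "1 * (d + 1) \<le> (2 * k + 4) * (d + 1)" by (intro mult_le_mono1) simp
  from order_trans[OF this Sd] show ?thesis by simp
qed

lemma bk': "0 \<le> c \<Longrightarrow> c \<le> 2 * int d + 2 \<Longrightarrow> c * (b * b) \<le> 2 ^ k"
proof -
  assume "0 \<le> c" "c \<le> 2 * int d + 2"
  then have "c * (b * b) \<le> (2 * int d + 2) * ((b + 1) * (b + 1))"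
    using b0 by (intro mult_mono) auto
  then show ?thesis using bk by (simp add: algebra_simps)
qed

lemma bb: "(b + 1) * (b + 1) \<le> 2 ^ k"
proof -
  have "(b + 1) * (b + 1) * 1 \<le> (b + 1) * (b + 1) * (2 * int d + 2)" using b0 by (intro mult_left_mono) auto
  then show ?thesis using bk by linarith
qed

lemma b_le: "b + 1 \<le> 2 ^ k"
proof -
  have "(b + 1) * 1 \<le> (b + 1) * (b + 1)" using b0 by (intro mult_left_mono) auto
  then show ?thesis unfolding mult_1_right using bb by (rule order_trans)
qed

lemma bfit: "\<bar>x\<bar> \<le> b + 1 \<Longrightarrow> fit x"
  using b_le by (simp add: fit_def)

lemma bfit': "\<bar>x\<bar> \<le> b \<Longrightarrow> fit x"
  using b_le by (simp add: fit_def)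

lemma cfit: "0 \<le> c \<Longrightarrow> c \<le> 2 * int d + 2 \<Longrightarrow> \<bar>x\<bar> \<le> c * (b * b) \<Longrightarrow> fit x"
  using bk'[of c] by (simp add: fit_def)

lemma ok_fit: "ok c vs \<Longrightarrow> c \<le> 2 ^ k \<Longrightarrow> v \<in> set vs \<Longrightarrow> fit v"
  by (force simp: ok_def fit_def)

lemma length_IV: "length vs \<le> d \<Longrightarrow> (\<And>v. v \<in> set vs \<Longrightarrow> fit v) \<Longrightarrow> length (IV vs) \<le> S"
proof -
  assume l: "length vs \<le> d" and f: "\<And>v. v \<in> set vs \<Longrightarrow> fit v"
  have "length (IV vs) \<le> (2 * k + 4) * length vs" using f
  proof (induction vs)
    case (Cons v vs)
    then show ?case using fit_bl[of v] by (simp add: length_I)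
  qed simp
  also have "\<dots> \<le> (2 * k + 4) * (d + 1)" using l by (intro mult_le_mono2) simp
  finally show ?thesis using Sd by simp
qed

lemma ok_IV: "ok c vs \<Longrightarrow> c \<le> 2 ^ k \<Longrightarrow> length (IV vs) \<le> S"
  using length_IV[of vs] ok_fit[of c vs] by (auto simp: ok_def)

lemma okb_IV: "ok b vs \<Longrightarrow> length (IV vs) \<le> S"
  using ok_IV b_le by force

lemma b_I: "\<bar>x\<bar> \<le> b \<Longrightarrow> length (I x) \<le> S"
  using bfit' fit_length by blast

lemma mul_le: "\<bar>x\<bar> \<le> b \<Longrightarrow> \<bar>y\<bar> \<le> b \<Longrightarrow> \<bar>x * y\<bar> \<le> b * b"
  using b0 by (auto simp: abs_mult intro!: mult_mono)

lemma dMulb: "\<bar>x\<bar> \<le> b \<Longrightarrow> \<bar>y\<bar> \<le> b + 1 \<Longrightarrow> der S (cM S) (Mul, [I x, I y, I (x * y)])"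
proof -
  assume xy: "\<bar>x\<bar> \<le> b" "\<bar>y\<bar> \<le> b + 1"
  then have "(\<bar>x\<bar> + 1) * \<bar>y\<bar> \<le> (b + 1) * (b + 1)" using b0 by (intro mult_mono) auto
  then show ?thesis using bb xy by (intro dMul bfit) auto
qed

lemma dNnv: "ok b vs \<Longrightarrow> \<forall>v\<in>set vs. 0 \<le> v \<Longrightarrow> der S (cE S) (Nnv, [IV vs])"
proof -
  have "ok b vs \<Longrightarrow> \<forall>v\<in>set vs. 0 \<le> v \<Longrightarrow> der S (length vs * (2 * S + 1) + 1) (Nnv, [IV vs])"
  proof (induction vs)
    case Nil
    show ?case using derl_mono[OF d_Nnv0[OF small_simps(1) derl_Nil]] by simp
  next
    case (Cons v vs)
    note o = ok_Cons[OF Cons.prems(1)]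
    have n: "der S S (Nn, [I v])" using Cons.prems(2) o by (intro dNn bfit') auto
    have r: "der S (length vs * (2 * S + 1) + 1) (Nnv, [IV vs])" using Cons o by simp
    show ?case unfolding IV_simps
      by (rule derl_mono[OF d_Nnv1[OF _ derl_Cons[OF n r]]])
        (use b_I[OF o(1)] okb_IV[OF o(2)] in \<open>simp_all add: small_simps\<close>)
  qed
  moreover assume "ok b vs" "\<forall>v\<in>set vs. 0 \<le> v"
  moreover have "length vs * (2 * S + 1) + 1 \<le> cE S" if "ok b vs"
    unfolding cE_def using that dS by (intro add_mono mult_le_mono1) (auto simp: ok_def)
  ultimately show ?thesis using derl_mono by blast
qed

lemma idot_le: "length vs = length us \<Longrightarrow> ok b vs \<Longrightarrow> ok b us \<Longrightarrow> \<bar>idot vs us\<bar> \<le> int (length us) * (b * b)"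
proof (induction vs us rule: list_induct2)
  case (Cons v vs u us)
  have "\<bar>v * u\<bar> \<le> b * b" "\<bar>idot vs us\<bar> \<le> int (length us) * (b * b)"
    using Cons ok_Cons mul_le by blast+
  then show ?case by (simp add: distrib_right)
qed simp

lemma idot_fit: "length vs = length us \<Longrightarrow> ok b vs \<Longrightarrow> ok b us \<Longrightarrow> fit (idot vs us)"
  by (rule cfit[OF _ _ idot_le]) (auto simp: ok_def)

lemma dDot: "length vs = length us \<Longrightarrow> ok b vs \<Longrightarrow> ok b us \<Longrightarrow> der S (cD S) (Dot, [IV vs, IV us, I (idot vs us)])"
proof -
  have "length vs = length us \<Longrightarrow> ok b vs \<Longrightarrow> ok b us \<Longrightarrow>
    der S (length us * (cM S + cA S + 1) + 1) (Dot, [IV vs, IV us, I (idot vs us)])"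
  proof (induction vs us rule: list_induct2)
    case Nil
    show ?case using derl_mono[OF d_Dot0[OF small_simps(1) derl_Nil]] by simp
  next
    case (Cons v vs u us)
    note o = ok_Cons[OF Cons.prems(1)] ok_Cons[OF Cons.prems(2)]
    have m: "der S (cM S) (Mul, [I v, I u, I (v * u)])" using o by (intro dMulb) auto
    have r: "der S (length us * (cM S + cA S + 1) + 1) (Dot, [IV vs, IV us, I (idot vs us)])" using Cons.IH o by blast
    have f: "fit (v * u)" "fit (idot vs us)" "fit (v * u + idot vs us)"
      using cfit[of 1] mul_le[OF o(1,3)] idot_fit[OF Cons.hyps o(2,4)] idot_fit[OF _ Cons.prems] Cons.hyps by simp_all
    show ?case unfolding IV_simps idot_simps
      by (rule derl_mono[OF d_Dot1[OF _ derl_Cons[OF m derl_Cons[OF r dAdd0[OF f]]]]])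
        (use b_I[OF o(1)] okb_IV[OF o(2)] b_I[OF o(3)] okb_IV[OF o(4)] f[THEN fit_length] in \<open>simp_all add: small_simps\<close>)
  qed
  moreover assume "length vs = length us" "ok b vs" "ok b us"
  moreover have "length us * (cM S + cA S + 1) + 1 \<le> cD S" if "ok b us"
    unfolding cD_def using that dS by (intro add_mono mult_le_mono1) (auto simp: ok_def)
  ultimately show ?thesis using derl_mono by blast
qed

lemma dZv: "m \<le> d \<Longrightarrow> der S (S + 1) (Zv, [IV (replicate m 0)])"
proof -
  have "m \<le> d \<Longrightarrow> der S (m + 1) (Zv, [IV (replicate m 0)])"
  proof (induction m)
    case 0
    show ?case using derl_mono[OF d_Zv0[OF small_simps(1) derl_Nil]] by simp
  next
    case (Suc m)
    have "ok b (replicate m 0)" using Suc.prems b0 by (simp add: ok_def)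
    from okb_IV[OF this] show ?case
      using d_Zv1[OF _ Suc.IH] Suc.prems by (simp add: small_simps)
  qed
  then show "m \<le> d \<Longrightarrow> ?thesis" using derl_mono[of S "m + 1"] dS by simp
qed

lemma ok_axpy: "length vs = length us \<Longrightarrow> \<bar>a\<bar> \<le> b \<Longrightarrow> ok b vs \<Longrightarrow> ok c us \<Longrightarrow> ok (b * b + c) (axpy a vs us)"
proof (induction vs us rule: list_induct2)
  case (Cons v vs u us)
  note o = ok_Cons[OF Cons.prems(2)] ok_Cons[OF Cons.prems(3)]
  have "\<bar>a * v\<bar> \<le> b * b" using o Cons.prems(1) by (intro mul_le)
  then have "\<bar>a * v + u\<bar> \<le> b * b + c" using o(3) by linarith
  then show ?case using Cons.IH[OF Cons.prems(1) o(2,4)] Cons.prems by (auto simp: ok_def)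
qed (simp add: ok_def)

text \<open>The vector us is usually a partial linear combination; c counts the products that are
  already summed in each of its entries.\<close>

lemma dAx:
  assumes "length vs = length us" "\<bar>a\<bar> \<le> b" "ok b vs" "ok (c * (b * b)) us" "0 \<le> c" "c \<le> int d"
  shows "der S (cX S) (Ax, [I a, IV vs, IV us, IV (axpy a vs us)])"
proof -
  have le: "b * b \<le> 2 ^ k" "c * (b * b) \<le> 2 ^ k" "b * b + c * (b * b) \<le> 2 ^ k"
    using bk'[of 1] bk'[of c] bk'[of "1 + c"] assms(5,6) by (simp_all add: algebra_simps)
  have "length vs = length us \<Longrightarrow> ok b vs \<Longrightarrow> ok (c * (b * b)) us \<Longrightarrow>
    der S (length us * (cM S + cA S + 1) + S + 1) (Ax, [I a, IV vs, IV us, IV (axpy a vs us)])"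
  proof (induction vs us rule: list_induct2)
    case Nil
    show ?case using derl_mono[OF d_Ax0[OF small1 dNum]] bfit'[OF assms(2)] by simp
  next
    case (Cons v vs u us)
    note o = ok_Cons[OF Cons.prems(1)] ok_Cons[OF Cons.prems(2)]
    have m: "der S (cM S) (Mul, [I a, I v, I (a * v)])" using o assms(2) by (intro dMulb) auto
    have r: "der S (length us * (cM S + cA S + 1) + S + 1) (Ax, [I a, IV vs, IV us, IV (axpy a vs us)])"
      using Cons.IH o by blast
    have x: "ok (b * b + c * (b * b)) (axpy a (v # vs) (u # us))"
      using ok_axpy[of "v # vs" "u # us"] Cons.hyps Cons.prems assms(2) by simp
    then have x': "ok (b * b + c * (b * b)) (axpy a vs us)" "\<bar>a * v + u\<bar> \<le> b * b + c * (b * b)" by (auto simp: ok_def)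
    have f: "fit (a * v)" "fit u" "fit (a * v + u)"
      using mul_le[OF assms(2) o(1)] o(3) le x'(2) by (simp_all add: fit_def)
    show ?case unfolding IV_simps axpy_simps
      by (rule derl_mono[OF d_Ax1[OF _ derl_Cons[OF m derl_Cons[OF dAdd0[OF f] r]]]])
        (use b_I[OF assms(2)] b_I[OF o(1)] okb_IV[OF o(2)] ok_IV[OF o(4) le(2)] ok_IV[OF x'(1) le(3)] f[THEN fit_length]
         in \<open>simp_all add: small_simps\<close>)
  qed
  from this[OF assms(1,3,4)] show ?thesis
  proof (rule derl_mono)
    show "length us * (cM S + cA S + 1) + S + 1 \<le> cX S"
      unfolding cX_def using assms(4) dS by (intro add_mono mult_le_mono1) (auto simp: ok_def)
  qed
qed

lemma ok_icomb: "length us = length rows \<Longrightarrow> \<forall>r\<in>set rows. length r = m \<Longrightarrow> m \<le> d \<Longrightarrow> ok b us \<Longrightarrow> ok b (concat rows) \<Longrightarrow>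
  ok (int (length us) * (b * b)) (icomb m us rows)"
proof (induction us rows rule: list_induct2)
  case (Cons u us r rows)
  note o = ok_Cons[OF Cons.prems(3)]
  have "ok b r" "ok b (concat rows)" using ok_concat[OF Cons.prems(4)] .
  then show ?case
    using ok_axpy[of r "icomb m us rows" u "int (length us) * (b * b)"] Cons.IH Cons.prems o length_icomb[of rows m us]
    by (simp add: algebra_simps)
qed (simp add: ok_def)

lemma dComb:
  assumes "length us = length rows" "\<forall>r\<in>set rows. length r = m" "m \<le> d" "ok b us" "ok b (concat rows)"
  shows "der S (cC S) (Comb, [IV us, IV (concat rows), IV (icomb m us rows)])"
proof -
  have "length us = length rows \<Longrightarrow> \<forall>r\<in>set rows. length r = m \<Longrightarrow> ok b us \<Longrightarrow> ok b (concat rows) \<Longrightarrow>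
    der S (length us * (cX S + 1) + S + 2) (Comb, [IV us, IV (concat rows), IV (icomb m us rows)])"
  proof (induction us rows rule: list_induct2)
    case Nil
    have "ok b (replicate m 0)" using assms(3) b0 by (simp add: ok_def)
    from okb_IV[OF this] show ?case using derl_mono[OF d_Comb0[OF _ dZv[OF assms(3)]]] by (simp add: small_simps)
  next
    case (Cons u us r rows)
    note o = ok_Cons[OF Cons.prems(2)]
    have r: "ok b r" "ok b (concat rows)" using ok_concat[OF Cons.prems(3)] .
    have l: "length r = m" "\<forall>r\<in>set rows. length r = m" using Cons.prems(1) by auto
    have i: "ok (int (length us) * (b * b)) (icomb m us rows)"
      using ok_icomb[OF Cons.hyps l(2) assms(3) o(2) r(2)] .
    have i': "ok (int (length (u # us)) * (b * b)) (icomb m (u # us) (r # rows))"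
      by (rule ok_icomb) (use Cons.hyps Cons.prems assms(3) in auto)
    have lu: "length us + 1 \<le> d" using Cons.prems(2) by (simp add: ok_def)
    have x: "der S (cX S) (Ax, [I u, IV r, IV (icomb m us rows), IV (axpy u r (icomb m us rows))])"
      using o r i lu by (intro dAx[where c = "int (length us)"]) (auto simp: l(1) length_icomb[OF l(2)])
    have c: "der S (length us * (cX S + 1) + S + 2) (Comb, [IV us, IV (concat rows), IV (icomb m us rows)])"
      using Cons.IH o r l by blast
    have le: "length (IV (icomb m us rows)) \<le> S" "length (IV (axpy u r (icomb m us rows))) \<le> S"
      using ok_IV[OF i] ok_IV[OF i'] bk'[of "int (length us)"] bk'[of "int (length us) + 1"] lu by (simp_all add: add.commute)
    show ?case unfolding IV_simps concat.simps icomb.simps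
      by (rule derl_mono[OF d_Comb1[OF _ derl_Cons[OF c x]]])
        (use b_I[OF o(1)] okb_IV[OF o(2)] okb_IV[OF r(1)] okb_IV[OF r(2)] le in \<open>simp_all add: small_simps\<close>)
  qed
  from this[OF assms(1,2,4,5)] show ?thesis
  proof (rule derl_mono)
    show "length us * (cX S + 1) + S + 2 \<le> cC S"
      unfolding cC_def using assms(4) dS by (intro add_mono mult_le_mono1) (auto simp: ok_def)
  qed
qed

lemma ok_lin:
  assumes "length us = length rows" "\<forall>r\<in>set rows. length r = length bs" "ok b us" "ok b (concat rows)" "\<bar>e\<bar> \<le> b" "ok b bs"
  shows "ok (2 ^ k) (axpy e bs (icomb (length bs) us rows))"
proof -
  have d: "length bs \<le> d" "length us \<le> d" using assms by (auto simp: ok_def)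
  have "ok (b * b + int (length us) * (b * b)) (axpy e bs (icomb (length bs) us rows))"
    using length_icomb[OF assms(2)] assms ok_icomb[OF assms(1,2) d(1) assms(3,4)] by (intro ok_axpy) auto
  then show ?thesis by (rule ok_mono) (use bk'[of "1 + int (length us)"] d in \<open>simp add: algebra_simps\<close>)
qed

lemma dLin:
  assumes "length us = length rows" "\<forall>r\<in>set rows. length r = length bs" "ok b us" "ok b (concat rows)"
    "e < 0" "\<bar>e\<bar> \<le> b" "ok b bs"
  shows "der S (cL S) (Lin, [IV bs, IV (concat rows), IV (axpy e bs (icomb (length bs) us rows))])"
proof -
  have d: "length bs \<le> d" "length us \<le> d" using assms by (auto simp: ok_def)
  note i = ok_icomb[OF assms(1,2) d(1) assms(3,4)]
  have x: "der S (cX S) (Ax, [I e, IV bs, IV (icomb (length bs) us rows), IV (axpy e bs (icomb (length bs) us rows))])"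
    using assms d i by (intro dAx[where c = "int (length us)"]) (auto simp: length_icomb[OF assms(2)])
  have le: "length (IV (icomb (length bs) us rows)) \<le> S" "length (IV (axpy e bs (icomb (length bs) us rows))) \<le> S"
    using ok_IV[OF i] ok_IV[OF ok_lin[OF assms(1-4,6,7)]] bk'[of "int (length us)"] d by simp_all
  show ?thesis
    by (rule derl_mono[OF d_Lin[OF _ derl_Cons[OF dNeg[OF assms(5) bfit'[OF assms(6)]] derl_Cons[OF dComb[OF assms(1,2) d(1) assms(3,4)] x]]]])
      (use assms(3,4,6,7) le b_I okb_IV in \<open>simp_all add: small_simps cL_def\<close>)
qed

lemma dMv:
  assumes "ok b xs" "ok b ys" "\<bar>e\<bar> \<le> b" "length Ts = length hs" "length Ws = length hs"
    "\<forall>r\<in>set Ts. length r = length xs" "\<forall>r\<in>set Ws. length r = length ys" "ok b (concat Ts)" "ok b (concat Ws)" "ok b hs"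
    "\<forall>i<length hs. idot (Ts ! i) xs + idot (Ws ! i) ys + hs ! i * e = 0"
  shows "der S (cMv S) (Mv, [IV (concat Ts), IV (concat Ws), IV hs, IV xs, IV ys, I e])"
proof -
  let ?C = "2 * cD S + 2 * cA S + cM S + 1"
  note l = okb_IV[OF assms(1)] okb_IV[OF assms(2)] b_I[OF assms(3)]
  have "length Ts = length Ws \<Longrightarrow> length Ws = length hs \<Longrightarrow> \<forall>r\<in>set Ts. length r = length xs \<Longrightarrow>
    \<forall>r\<in>set Ws. length r = length ys \<Longrightarrow> ok b (concat Ts) \<Longrightarrow> ok b (concat Ws) \<Longrightarrow> ok b hs \<Longrightarrow>
    \<forall>i<length hs. idot (Ts ! i) xs + idot (Ws ! i) ys + hs ! i * e = 0 \<Longrightarrow>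
    der S (length hs * ?C + 1) (Mv, [IV (concat Ts), IV (concat Ws), IV hs, IV xs, IV ys, I e])"
  proof (induction Ts Ws hs rule: list_induct3)
    case Nil
    show ?case using derl_mono[OF d_Mv0[OF _ derl_Nil]] l by (simp add: small_simps)
  next
    case (Cons t Ts w Ws h hs)
    note o = ok_Cons[OF Cons.prems(5)]
    have r: "ok b t" "ok b (concat Ts)" "ok b w" "ok b (concat Ws)" using ok_concat[OF Cons.prems(3)] ok_concat[OF Cons.prems(4)] .
    have q: "length t = length xs" "length w = length ys" using Cons.prems(1,2) by auto
    have z: "idot t xs + idot w ys + h * e = 0" using Cons.prems(6) by force
    have z': "\<forall>i<length hs. idot (Ts ! i) xs + idot (Ws ! i) ys + hs ! i * e = 0" using Cons.prems(6) by force
    have rec: "der S (length hs * ?C + 1) (Mv, [IV (concat Ts), IV (concat Ws), IV hs, IV xs, IV ys, I e])"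
      using Cons.IH[OF _ _ r(2,4) o(2) z'] Cons.prems(1,2) by simp
    have f: "fit (idot t xs)" "fit (idot w ys)" using idot_fit q r assms by blast+
    have he: "\<bar>h * e\<bar> \<le> b * b" using mul_le o assms by blast
    then have f2: "fit (h * e)" using cfit[of 1] by simp
    \<comment> \<open>Instead of estimating the sum, the equation being checked is used: the sum
      equals - h * e.\<close>
    have f1: "fit (idot t xs + idot w ys)" using f2 z by (simp add: fit_def abs_if split: if_splits)
    have m: "der S (cM S) (Mul, [I h, I e, I (h * e)])" using o assms(3) by (intro dMulb) auto
    have a: "der S (cA S) (Add, [[False], I (idot t xs + idot w ys), I (h * e), [True, True]])"
      using dAdd0[OF f1 f2] z fit_small by simp
    show ?case unfolding IV_simps concat.simps
      by (rule derl_mono[OF d_Mv1[OF _ derl_Cons[OF dDot[OF q(1) r(1) assms(1)] derl_Cons[OF dDot[OF q(2) r(3) assms(2)]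
          derl_Cons[OF dAdd0[OF f f1] derl_Cons[OF m derl_Cons[OF a rec]]]]]]])
        (use l b_I[OF o(1)] okb_IV[OF o(2)] r[THEN okb_IV] f1[THEN fit_length] f2[THEN fit_length] f[THEN fit_length]
         in \<open>simp_all add: small_simps\<close>)
  qed
  from this[OF _ assms(5-11)] assms(4,5) have "der S (length hs * ?C + 1) (Mv, [IV (concat Ts), IV (concat Ws), IV hs, IV xs, IV ys, I e])"
    by simp
  then show ?thesis
  proof (rule derl_mono)
    show "length hs * ?C + 1 \<le> cMv S"
      unfolding cMv_def using assms(10) dS by (intro add_mono mult_le_mono1) (auto simp: ok_def)
  qed
qed

lemma dChk:
  assumes "length gs = length fs" "length fs = length ys" "ok (2 ^ k) gs" "ok (2 ^ k) fs" "ok (2 ^ k) ys"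
    "\<forall>j<length ys. 0 \<le> ys ! j \<and> gs ! j \<le> 0 \<and> (gs ! j < 0 \<longrightarrow> ys ! j = 0) \<and>
       (gs ! j = 0 \<longrightarrow> 0 \<le> fs ! j \<and> (ys ! j = 0 \<or> fs ! j = 0))"
  shows "der S (cE S) (Chk, [IV gs, IV fs, IV ys])"
proof -
  let ?C = "2 * S + 1"
  have "length gs = length fs \<Longrightarrow> length fs = length ys \<Longrightarrow> ok (2 ^ k) gs \<Longrightarrow> ok (2 ^ k) fs \<Longrightarrow> ok (2 ^ k) ys \<Longrightarrow>
    \<forall>j<length ys. 0 \<le> ys ! j \<and> gs ! j \<le> 0 \<and> (gs ! j < 0 \<longrightarrow> ys ! j = 0) \<and>
       (gs ! j = 0 \<longrightarrow> 0 \<le> fs ! j \<and> (ys ! j = 0 \<or> fs ! j = 0)) \<Longrightarrow>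
    der S (length ys * ?C + 1) (Chk, [IV gs, IV fs, IV ys])"
  proof (induction gs fs ys rule: list_induct3)
    case Nil
    show ?case using derl_mono[OF d_Chk0[OF small_simps(1) derl_Nil]] by simp
  next
    case (Cons g gs f fs y ys)
    note o = ok_Cons[OF Cons.prems(1)] ok_Cons[OF Cons.prems(2)] ok_Cons[OF Cons.prems(3)]
    note l = ok_IV[OF o(2) order_refl] ok_IV[OF o(4) order_refl] ok_IV[OF o(6) order_refl]
    have fit: "fit g" "fit f" "fit y" using o by (simp_all add: fit_def)
    have "\<forall>j<length ys. 0 \<le> ys ! j \<and> gs ! j \<le> 0 \<and> (gs ! j < 0 \<longrightarrow> ys ! j = 0) \<and>
       (gs ! j = 0 \<longrightarrow> 0 \<le> fs ! j \<and> (ys ! j = 0 \<or> fs ! j = 0))" using Cons.prems(4) by force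
    then have rec: "der S (length ys * ?C + 1) (Chk, [IV gs, IV fs, IV ys])" using Cons.IH o by blast
    have z: "0 \<le> y" "g \<le> 0" "g < 0 \<longrightarrow> y = 0" "g = 0 \<longrightarrow> 0 \<le> f \<and> (y = 0 \<or> f = 0)" using Cons.prems(4) by force+
    \<comment> \<open>One case for each recursive clause of \<open>Chk\<close>. A nonzero y is
      possible only in the first, where column and multiplier are both tight.\<close>
    then consider "g = 0" "f = 0" | "g = 0" "0 \<le> f" "y = 0" | "g < 0" "y = 0" by linarith
    then show ?case
    proof cases
      case 1
      show ?thesis unfolding IV_simps 1 I_simps append_Cons append_Nil
        by (rule derl_mono[OF d_Chk1[OF _ derl_Cons[OF dNn[OF z(1) fit(3)] rec], unfolded append_Cons append_Nil]])
          (use l fit[THEN fit_length] in \<open>simp_all add: small_simps\<close>)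
    next
      case 2
      show ?thesis unfolding IV_simps 2(1,3) I_simps append_Cons append_Nil
        by (rule derl_mono[OF d_Chk2[OF _ derl_Cons[OF dNn[OF 2(2) fit(2)] rec], unfolded append_Cons append_Nil]])
          (use l fit[THEN fit_length] in \<open>simp_all add: small_simps\<close>)
    next
      case 3
      show ?thesis unfolding IV_simps 3(2) I_simps append_Cons append_Nil
        by (rule derl_mono[OF d_Chk3[OF _ derl_Cons[OF dNeg[OF 3(1) fit(1)] derl_Cons[OF dNum[OF fit(2)] rec]], unfolded append_Cons append_Nil]])
          (use l fit[THEN fit_length] in \<open>simp_all add: small_simps\<close>)
    qed
  qed
  from this[OF assms] show ?thesis
  proof (rule derl_mono)
    show "length ys * ?C + 1 \<le> cE S"
      unfolding cE_def using assms(5) dS by (intro add_mono mult_le_mono1) (auto simp: ok_def)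
  qed
qed

lemma dEqj:
  assumes "length gs = length hs" "ok (2 ^ k) gs" "ok (2 ^ k) hs"
    "\<forall>j<length hs. gs ! j \<le> 0 \<and> (gs ! j = 0 \<longrightarrow> hs ! j = 0)"
  shows "der S (cE S) (Eqj, [IV gs, IV hs])"
proof -
  let ?C = "2 * S + 1"
  have "length gs = length hs \<Longrightarrow> ok (2 ^ k) gs \<Longrightarrow> ok (2 ^ k) hs \<Longrightarrow>
    \<forall>j<length hs. gs ! j \<le> 0 \<and> (gs ! j = 0 \<longrightarrow> hs ! j = 0) \<Longrightarrow>
    der S (length hs * ?C + 1) (Eqj, [IV gs, IV hs])"
  proof (induction gs hs rule: list_induct2)
    case Nil
    show ?case using derl_mono[OF d_Eqj0[OF small_simps(1) derl_Nil]] by simp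
  next
    case (Cons g gs h hs)
    note o = ok_Cons[OF Cons.prems(1)] ok_Cons[OF Cons.prems(2)]
    note l = ok_IV[OF o(2) order_refl] ok_IV[OF o(4) order_refl]
    have fit: "fit g" "fit h" using o by (simp_all add: fit_def)
    have "\<forall>j<length hs. gs ! j \<le> 0 \<and> (gs ! j = 0 \<longrightarrow> hs ! j = 0)" using Cons.prems(3) by force
    then have rec: "der S (length hs * ?C + 1) (Eqj, [IV gs, IV hs])" using Cons.IH o by blast
    have "g \<le> 0" "g = 0 \<longrightarrow> h = 0" using Cons.prems(3) by force+
    then consider "g = 0" "h = 0" | "g < 0" by linarith
    then show ?case
    proof cases
      case 1
      show ?thesis unfolding IV_simps 1 I_simps append_Cons append_Nil
        by (rule derl_mono[OF d_Eqj1[OF _ rec, unfolded append_Cons append_Nil]])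
          (use l in \<open>simp_all add: small_simps\<close>)
    next
      case 2
      show ?thesis unfolding IV_simps
        by (rule derl_mono[OF d_Eqj2[OF _ derl_Cons[OF dNeg[OF 2 fit(1)] derl_Cons[OF dNum[OF fit(2)] rec]]]])
          (use l fit[THEN fit_length] in \<open>simp_all add: small_simps\<close>)
    qed
  qed
  from this[OF assms] show ?thesis
  proof (rule derl_mono)
    show "length hs * ?C + 1 \<le> cE S"
      unfolding cE_def using assms(3) dS by (intro add_mono mult_le_mono1) (auto simp: ok_def)
  qed
qed

lemma dEqs:
  assumes "\<forall>r\<in>set Ws. length r = m" "ok b (concat Ws)" "ok (2 ^ k) gs" "length gs = m" "\<forall>j<m. gs ! j \<le> 0"
    "length Bs \<le> d" "ok b (concat Bs)" "\<forall>bs\<in>set Bs. length bs = m"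
    "\<forall>bs\<in>set Bs. \<exists>e us. e < 0 \<and> \<bar>e\<bar> \<le> b \<and> ok b us \<and> length us = length Ws \<and>
       (\<forall>j<m. gs ! j = 0 \<longrightarrow> axpy e bs (icomb m us Ws) ! j = 0)"
  shows "der S (cEs S) (Eqs, [IV (concat Ws), IV (concat Bs), IV gs])"
proof -
  let ?C = "cL S + cE S + 1"
  note l = okb_IV[OF assms(2)] ok_IV[OF assms(3) order_refl]
  have "ok b (concat Bs) \<Longrightarrow> \<forall>bs\<in>set Bs. length bs = m \<Longrightarrow>
     \<forall>bs\<in>set Bs. \<exists>e us. e < 0 \<and> \<bar>e\<bar> \<le> b \<and> ok b us \<and> length us = length Ws \<and>
       (\<forall>j<m. gs ! j = 0 \<longrightarrow> axpy e bs (icomb m us Ws) ! j = 0) \<Longrightarrow>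
     der S (length Bs * ?C + 1) (Eqs, [IV (concat Ws), IV (concat Bs), IV gs])"
  proof (induction Bs)
    case Nil
    show ?case using derl_mono[OF d_Eqs0[OF _ derl_Nil]] l by (simp add: small_simps)
  next
    case (Cons bs Bs)
    have o: "ok b bs" "ok b (concat Bs)" using ok_concat[OF Cons.prems(1)] .
    have lb: "length bs = m" using Cons.prems(2) by simp
    obtain e us where e: "e < 0" "\<bar>e\<bar> \<le> b" "ok b us" "length us = length Ws"
      "\<forall>j<m. gs ! j = 0 \<longrightarrow> axpy e bs (icomb m us Ws) ! j = 0" using Cons.prems(3) by auto
    let ?h = "axpy e bs (icomb m us Ws)"
    have Wl: "\<forall>r\<in>set Ws. length r = length bs" using assms(1) lb by simp
    have h: "ok (2 ^ k) ?h" using ok_lin[OF e(4) Wl e(3) assms(2) e(2) o(1)] unfolding lb .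
    have lin: "der S (cL S) (Lin, [IV bs, IV (concat Ws), IV ?h])"
      using dLin[OF e(4) Wl e(3) assms(2) e(1,2) o(1)] unfolding lb .
    have lh: "length ?h = m" using lb length_icomb[OF assms(1)] by simp
    have eq: "der S (cE S) (Eqj, [IV gs, IV ?h])"
      by (rule dEqj) (use assms(3-5) h lh e(5) in auto)
    have rec: "der S (length Bs * ?C + 1) (Eqs, [IV (concat Ws), IV (concat Bs), IV gs])" using Cons.IH o Cons.prems by simp
    show ?case unfolding IV_simps concat.simps
      by (rule derl_mono[OF d_Eqs1[OF _ derl_Cons[OF lin derl_Cons[OF eq rec]]]])
        (use l okb_IV[OF o(1)] okb_IV[OF o(2)] ok_IV[OF h order_refl] in \<open>simp_all add: small_simps\<close>)
  qed
  from this[OF assms(7-9)] show ?thesis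
  proof (rule derl_mono)
    show "length Bs * ?C + 1 \<le> cEs S"
      unfolding cEs_def using assms(6) dS by (intro add_mono mult_le_mono1) auto
  qed
qed

end

text \<open>Reducing one coefficient modulo q bounds it by q, and the equation then forces the other
  one into the range of p. Short coefficients keep the derivation of coprimality short.\<close>

lemma bezout_small:
  fixes p q :: int
  assumes "coprime p q" "0 \<le> p" "0 < q"
  shows "\<exists>a c. p * a + q * c = 1 \<and> 0 \<le> a \<and> a < q \<and> \<bar>c\<bar> \<le> p + 1"
proof -
  obtain u v where uv: "u * p + v * q = 1" using bezout_int[of p q] assms(1) by auto
  define a c where "a = u mod q" and "c = v + p * (u div q)"
  have a: "0 \<le> a" "a < q" using assms(3) by (auto simp: a_def)
  have "p * a + q * c = p * (u div q * q + u mod q) + q * v" unfolding a_def c_def by algebra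
  then have 1: "p * a + q * c = 1" using uv by (simp add: mult.commute)
  have pa: "0 \<le> p * a" "p * a \<le> p * q" using a assms by (auto intro!: mult_left_mono)
  have "c \<le> 1"
  proof (rule ccontr)
    assume "\<not> ?thesis"
    then have "q * 2 \<le> q * c" using assms(3) by (intro mult_left_mono) auto
    then show False using 1 pa assms(3) by linarith
  qed
  moreover have "- p \<le> c"
  proof (rule ccontr)
    assume "\<not> ?thesis"
    then have "q * c \<le> q * (- p - 1)" using assms(3) by (intro mult_left_mono) auto
    then show False using 1 pa assms(3) by (simp add: algebra_simps)
  qed
  ultimately show ?thesis using 1 a assms(2) by (intro exI[of _ a] exI[of _ c]) auto
qed

section \<open>Derivations for parsing the instance\<close>

lemma I_pos: "0 < x \<Longrightarrow> I x = False # tl (I x)"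
  by (simp add: I_step)

text \<open>The floor serves to obtain an integer. The predicate \<open>good\<close> requires l to
  clear the denominator of v, and then no rounding takes place.\<close>

definition scl :: "int \<Rightarrow> rat \<Rightarrow> int" where
  "scl l v = \<lfloor>of_int l * v\<rfloor>"

definition cP :: "nat \<Rightarrow> nat" where "cP S = 2 * S + 2 * cM S + cA S + 1"
definition cR :: "nat \<Rightarrow> nat" where "cR S = cP S + 2 * cM S + cA S + 1"
definition cv :: "nat \<Rightarrow> nat" where "cv S = S * (cR S + 1) + 1"
definition cm :: "nat \<Rightarrow> nat" where "cm S = S * (cv S + 1) + 1"
definition cVer :: "nat \<Rightarrow> nat" where
  "cVer S = 2 * cE S + 2 * S + 2 * cMv S + 2 * cD S + 3 * cA S + cM S + 2 * cL S + cEs S + 1"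
definition cMain :: "nat \<Rightarrow> nat" where
  "cMain S = 9 * S + cA S + 5 * cv S + 4 * cm S + cR S + cVer S + 1"

context bnd
begin

lemma dNat: "0 \<le> x \<Longrightarrow> fit x \<Longrightarrow> der S S (Nat, [I x])"
proof -
  have "0 \<le> x \<Longrightarrow> fit x \<Longrightarrow> der S (bl x + 1) (Nat, [I x])"
  proof (induction x rule: half_induct)
    case zero
    then show ?case using d_Nat0[OF small_simps(1) derl_Nil] by simp
  next
    case (step x)
    show ?case
    proof (cases "x div 2 = 0")
      case True
      then have x: "x = 1" using step by presburger
      show ?thesis using derl_mono[OF d_Nat1[OF small_simps(1) derl_Nil]] by (simp add: x I_step)
    next
      case False
      then have I: "I (x div 2) = False # tl (I (x div 2))" using step by (intro I_pos) auto
      have r: "der S (bl (x div 2) + 1) (Nat, [False # tl (I (x div 2))])" using step fit_div I by simp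
      have le: "length (tl (I (x div 2))) \<le> S" using fit_length[OF fit_div[OF step(5)]] by simp
      show ?thesis unfolding I_step[OF step(1,2)] bl_step[OF step(1,2)]
        using d_Nat2[OF _ r] d_Nat3[OF _ r] le I by (cases "odd x") (simp_all add: small_simps)
    qed
  qed simp
  then show "0 \<le> x \<Longrightarrow> fit x \<Longrightarrow> der S S (Nat, [I x])" using derl_mono fit_bl_S by blast
qed

lemma dUn: "nat x \<le> S \<Longrightarrow> 0 \<le> x \<Longrightarrow> fit x \<Longrightarrow> der S S (Unary, [I x, replicate (nat x) True])"
proof -
  have "0 \<le> x \<Longrightarrow> nat x \<le> S \<Longrightarrow> fit x \<Longrightarrow> der S (bl x + 1) (Unary, [I x, replicate (nat x) True])"
  proof (induction x rule: half_induct)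
    case zero
    then show ?case using d_Un0[OF small_simps(1) derl_Nil] by simp
  next
    case (step x)
    let ?u = "replicate (nat (x div 2)) True"
    have "nat (x div 2) \<le> S" using step.prems by linarith
    then have r: "der S (bl (x div 2) + 1) (Unary, [I (x div 2), ?u])" and le: "small S [I (x div 2), ?u]"
      using step fit_div fit_length by (simp_all add: small_simps)
    have "nat x = of_bool (odd x) + (nat (x div 2) + nat (x div 2))" 
      using step.prems(1) bit_div[of x] by (cases "odd x"; simp only: of_bool_eq not_True_eq_False simp_thms; linarith)
    then have u: "replicate (nat x) True = (if odd x then [True] else []) @ ?u @ ?u"
      by (simp add: replicate_add)
    show ?case unfolding I_step[OF step(1,2)] bl_step[OF step(1,2)] u
      using d_Un1[OF le r] d_Un2[OF le r] by (cases "odd x") simp_all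
  qed simp
  then show "nat x \<le> S \<Longrightarrow> 0 \<le> x \<Longrightarrow> fit x \<Longrightarrow> der S S (Unary, [I x, replicate (nat x) True])"
    using derl_mono fit_bl_S by blast
qed

lemma dCop:
  assumes "coprime p q" "0 \<le> p" "0 < q" "p \<le> b" "q \<le> b"
  shows "der S (cP S) (Cop, [I p, I q])"
proof -
  obtain a c where ac: "p * a + q * c = 1" "0 \<le> a" "a < q" "\<bar>c\<bar> \<le> p + 1" using bezout_small[OF assms(1-3)] by blast
  have abs: "\<bar>p\<bar> \<le> b" "\<bar>q\<bar> \<le> b" "\<bar>a\<bar> \<le> b" "\<bar>c\<bar> \<le> b + 1" using assms ac by auto
  have "\<bar>p * a\<bar> \<le> b * b" using mul_le abs by blast
  then have fa: "fit (p * a)" using cfit[of 1] by simp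
  have "\<bar>q * c\<bar> \<le> (b + 1) * (b + 1)" unfolding abs_mult using abs b0 by (intro mult_mono) auto
  then have fc: "fit (q * c)" using bb by (simp add: fit_def)
  have ad: "der S (cA S) (Add, [[False], I (p * a), I (q * c), [False, True, True, True]])"
    using dAdd0[OF fa fc] ac(1) fit_small by (simp add: I_step)
  obtain Q where Q: "I q = False # Q" using I_pos assms(3) by blast
  have m: "der S (cM S) (Mul, [I p, I a, I (p * a)])" "der S (cM S) (Mul, [I q, I c, I (q * c)])"
    using dMulb abs by auto
  have n: "der S S (Nat, [I p])" "der S S (Nat, [I q])" using dNat bfit' abs assms by auto
  have le: "length (I p) \<le> S" "length Q \<le> S" "length (I a) \<le> S" "length (I c) \<le> S"
    "length (I (p * a)) \<le> S" "length (I (q * c)) \<le> S"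
    using b_I[OF abs(1)] b_I[OF abs(2)] b_I[OF abs(3)] fit_length[OF bfit[OF abs(4)]] fit_length[OF fa] fit_length[OF fc] by (simp_all add: Q)
  from derl_mono[OF d_Cop[OF _ derl_Cons[OF n(1) derl_Cons[OF n(2)[unfolded Q] derl_Cons[OF m(1) derl_Cons[OF m(2)[unfolded Q] ad]]]]], of "cP S"]
  show ?thesis unfolding Q using le by (simp add: small_simps cP_def)
qed

definition good :: "int \<Rightarrow> rat \<Rightarrow> bool" where
  "good l v \<longleftrightarrow> \<bar>fst (quotient_of v)\<bar> \<le> b \<and> snd (quotient_of v) \<le> b \<and> \<bar>scl l v\<bar> \<le> b \<and> of_int (scl l v) = of_int l * v"

lemma dCrat:
  assumes "good l v" "\<bar>l\<bar> \<le> b"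
  shows "der S (cR S) (Crat, [I l, enc_rat v, I (scl l v)])"
proof -
  obtain p q where pq: "quotient_of v = (p, q)" by fastforce
  define z where "z = scl l v"
  have g: "\<bar>p\<bar> \<le> b" "q \<le> b" "\<bar>z\<bar> \<le> b" "of_int z = of_int l * v"
    using assms(1) by (auto simp: good_def pq z_def)
  have q0: "0 < q" and cop: "coprime p q" using quotient_of_denom_pos[OF pq] quotient_of_coprime[OF pq] by auto
  have "v = of_int p / of_int q" using quotient_of_div[OF pq] .
  then have "rat_of_int (z * q) = rat_of_int (p * l)" using g(4) q0 by simp
  then have zq: "z * q = p * l" unfolding of_int_eq_iff .
  have R: "enc_rat v = (p < 0) # I \<bar>p\<bar> @ I q"
    using q0 by (simp add: enc_rat_def pq enc_int_def enc_nat_I)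
  have aq: "\<bar>q\<bar> \<le> b" using q0 g by simp
  have fm: "fit (p * l)" "fit (- p * l)" using cfit[of 1] mul_le[OF g(1) assms(2)] by auto
  have m2: "der S (cM S) (Mul, [I z, I q, I (z * q)])" using aq g by (intro dMulb) auto
  note le = b_I[OF assms(2)] b_I[OF aq] b_I[OF g(3)] fm[THEN fit_length]
  show ?thesis
  proof (cases "p < 0")
    case False
    then have c: "der S (cP S) (Cop, [I p, I q])" using dCop cop q0 g aq by auto
    have m1: "der S (cM S) (Mul, [I p, I l, I (p * l)])" using g assms by (intro dMulb) auto
    have R': "enc_rat v = False # I p @ I q" using R False by simp
    show ?thesis unfolding R' z_def[symmetric]
      by (rule derl_mono[OF d_Crat0[OF _ derl_Cons[OF c derl_Cons[OF m1 m2[unfolded zq]]]]])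
        (use le b_I[OF g(1)] in \<open>simp_all add: small_simps cR_def\<close>)
  next
    case True
    define p' where "p' = - p"
    obtain P where P: "I p' = False # P" using True I_pos[of p'] by (auto simp: p'_def)
    have gp: "\<bar>p'\<bar> \<le> b" using g(1) by (simp add: p'_def)
    have c: "der S (cP S) (Cop, [I p', I q])" using dCop[of p' q] cop q0 g aq True by (simp add: p'_def)
    have m1: "der S (cM S) (Mul, [I p', I l, I (p' * l)])" using gp assms by (intro dMulb) auto
    have ad: "der S (cA S) (Add, [[False], I (p' * l), I (z * q), [True, True]])"
      using dAdd0[of "p' * l" "z * q"] fm fit_small by (simp add: p'_def zq)
    have R': "enc_rat v = True # False # P @ I q" using R True P[unfolded p'_def] by simp
    have le': "length P \<le> S" "length (I (p' * l)) \<le> S" "length (I (z * q)) \<le> S"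
      using b_I[OF gp] le P by (simp_all add: zq p'_def)
    show ?thesis unfolding R' z_def[symmetric]
      by (rule derl_mono[OF d_Crat1[OF _ derl_Cons[OF c[unfolded P] derl_Cons[OF m1[unfolded P] derl_Cons[OF m2 ad]]]]])
        (use le le' in \<open>simp_all add: small_simps cR_def\<close>)
  qed
qed

lemma scl_fit: "good l v \<Longrightarrow> fit (scl l v)"
  by (simp add: good_def bfit')

lemma dCv:
  assumes "\<bar>l\<bar> \<le> b" "\<forall>v\<in>set vs. good l v" "length vs \<le> d" "length (enc_vec vs) \<le> S"
  shows "der S (cv S) (Cv, [I l, replicate (length vs) True, enc_vec vs, IV (map (scl l) vs)])"
proof -
  have "\<forall>v\<in>set vs. good l v \<Longrightarrow> length vs \<le> d \<Longrightarrow> length (enc_vec vs) \<le> S \<Longrightarrow>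
    der S (length vs * (cR S + 1) + 1) (Cv, [I l, replicate (length vs) True, enc_vec vs, IV (map (scl l) vs)])"
  proof (induction vs)
    case Nil
    show ?case using derl_mono[OF d_Cv0[OF _ derl_Nil]] b_I[OF assms(1)] by (simp add: small_simps)
  next
    case (Cons v vs)
    have "ok b (map (scl l) vs)" using Cons.prems by (auto simp: ok_def good_def)
    note le = b_I[OF assms(1)] okb_IV[OF this]
    have r: "der S (length vs * (cR S + 1) + 1) (Cv, [I l, replicate (length vs) True, enc_vec vs, IV (map (scl l) vs)])"
      using Cons by simp
    have g: "good l v" using Cons.prems by simp
    show ?case unfolding enc_vec_simps list.map IV_simps list.size replicate_Suc add_0_right add_Suc_right
      by (rule derl_mono[OF d_Cv1[OF _ derl_Cons[OF dCrat[OF g assms(1)] r]]])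
        (use le fit_length[OF scl_fit[OF g]] Cons.prems dS in \<open>simp_all add: small_simps\<close>)
  qed
  from this[OF assms(2-4)] show ?thesis
  proof (rule derl_mono)
    show "length vs * (cR S + 1) + 1 \<le> cv S"
      unfolding cv_def using assms(3) dS by (intro add_mono mult_le_mono1) auto
  qed
qed

lemma dCm:
  assumes "\<bar>l\<bar> \<le> b" "\<forall>row\<in>set M. length row = n" "\<forall>v\<in>set (concat M). good l v" "length M \<le> d" "n \<le> d" "length (concat M) \<le> d"
    "length (enc_mat M) \<le> S"
  shows "der S (cm S) (Cm, [I l, replicate (length M) True, replicate n True, enc_mat M, IV (map (scl l) (concat M))])"
proof -
  have "\<forall>row\<in>set M. length row = n \<Longrightarrow> \<forall>v\<in>set (concat M). good l v \<Longrightarrow> length M \<le> d \<Longrightarrow> length (concat M) \<le> d \<Longrightarrow>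
    length (enc_mat M) \<le> S \<Longrightarrow>
    der S (length M * (cv S + 1) + 1) (Cm, [I l, replicate (length M) True, replicate n True, enc_mat M, IV (map (scl l) (concat M))])"
  proof (induction M)
    case Nil
    show ?case using derl_mono[OF d_Cm0[OF _ derl_Nil]] b_I[OF assms(1)] assms(5) dS by (simp add: small_simps)
  next
    case (Cons v M)
    have "ok b (map (scl l) (concat M))" "ok b (map (scl l) v)" using Cons.prems by (auto simp: ok_def good_def)
    note le = b_I[OF assms(1)] this[THEN okb_IV]
    have r: "der S (length M * (cv S + 1) + 1) (Cm, [I l, replicate (length M) True, replicate n True, enc_mat M, IV (map (scl l) (concat M))])"
      using Cons by simp
    have n: "length v = n" using Cons.prems by simp
    have c: "der S (cv S) (Cv, [I l, replicate n True, enc_vec v, IV (map (scl l) v)])"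
      using dCv[OF assms(1), of v] Cons.prems n assms(5) by simp
    show ?case unfolding enc_mat_simps concat.simps map_append IV_simps list.size replicate_Suc add_0_right add_Suc_right
      by (rule derl_mono[OF d_Cm1[OF _ derl_Cons[OF c r]]])
        (use le Cons.prems assms(5) dS in \<open>simp_all add: small_simps\<close>)
  qed
  from this[OF assms(2-4,6,7)] show ?thesis
  proof (rule derl_mono)
    show "length M * (cv S + 1) + 1 \<le> cm S"
      unfolding cm_def using assms(4) dS by (intro add_mono mult_le_mono1) auto
  qed
qed

lemma dVer:
  assumes data: "ok b cs" "ok b ds" "ok b qs" "ok b (concat As)" "ok b (concat Bs)" "ok b as"
      "ok b (concat Ts)" "ok b (concat Ws)" "ok b hs" "\<bar>al\<bar> \<le> b"
    and len: "length cs = n" "length ds = m" "length qs = m" "length As = length as" "length Bs = length as"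
      "\<forall>row\<in>set As. length row = n" "\<forall>row\<in>set Bs. length row = m"
      "length Ts = length hs" "length Ws = length hs" "\<forall>row\<in>set Ts. length row = n" "\<forall>row\<in>set Ws. length row = m"
    and xy: "ok b xs" "ok b ys" "length xs = n" "length ys = m" "\<forall>x\<in>set xs. 0 \<le> x" "e < 0" "\<bar>e\<bar> \<le> b"
    and feas: "\<forall>i<length hs. idot (Ts ! i) xs + idot (Ws ! i) ys + hs ! i * e = 0"
      "\<forall>i<length as. idot (As ! i) xs + idot (Bs ! i) ys + as ! i * e = 0"
      "idot cs xs + idot ds ys + al * e \<le> 0"
    and dual: "ok b us" "length us = length hs" "eu < 0" "\<bar>eu\<bar> \<le> b" "ok b ls" "length ls = length hs" "el < 0" "\<bar>el\<bar> \<le> b"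
    and gs: "gs = axpy eu qs (icomb m us Ws)" and fs: "fs = axpy el ds (icomb m ls Ws)"
    and chk: "\<forall>j<m. 0 \<le> ys ! j \<and> gs ! j \<le> 0 \<and> (gs ! j < 0 \<longrightarrow> ys ! j = 0) \<and>
       (gs ! j = 0 \<longrightarrow> 0 \<le> fs ! j \<and> (ys ! j = 0 \<or> fs ! j = 0))"
    and eqs: "\<forall>bs\<in>set Bs. \<exists>e us. e < 0 \<and> \<bar>e\<bar> \<le> b \<and> ok b us \<and> length us = length Ws \<and>
       (\<forall>j<m. gs ! j = 0 \<longrightarrow> axpy e bs (icomb m us Ws) ! j = 0)"
  shows "der S (cVer S) (Ver, [IV cs, IV ds, IV qs, IV (concat As), IV (concat Bs), IV as, IV (concat Ts), IV (concat Ws), IV hs, I al])"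
proof -
  define t1 t2 t4 where "t1 = idot cs xs" and "t2 = idot ds ys" and "t4 = al * e"
  have b: "\<bar>t1\<bar> \<le> int d * (b * b)" "\<bar>t2\<bar> \<le> int d * (b * b)" "\<bar>t4\<bar> \<le> b * b"
  proof -
    have le: "\<bar>idot vs us\<bar> \<le> int d * (b * b)" if "length vs = length us" "ok b vs" "ok b us" for vs us
    proof -
      have "int (length us) * (b * b) \<le> int d * (b * b)" using that b0 by (intro mult_right_mono) (auto simp: ok_def)
      with idot_le[OF that] show ?thesis by linarith
    qed
    show "\<bar>t1\<bar> \<le> int d * (b * b)" unfolding t1_def by (rule le) (use data xy len in simp_all)
    show "\<bar>t2\<bar> \<le> int d * (b * b)" unfolding t2_def by (rule le) (use data xy len in simp_all)
    show "\<bar>t4\<bar> \<le> b * b" unfolding t4_def using mul_le data xy by blast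
  qed
  \<comment> \<open>The largest sum in a derivation: up to d products from each of the two scalar
    products and one more for the right-hand side, within the 2 * d + 2 products allowed by
    \<open>bk\<close>.\<close>
  have "\<bar>t1 + t2\<bar> \<le> (2 * int d) * (b * b)" "\<bar>t1 + t2 + t4\<bar> \<le> (2 * int d + 1) * (b * b)"
    using b by (simp_all add: distrib_right)
  then have f: "fit t1" "fit t2" "fit (t1 + t2)" "fit t4" "fit (t1 + t2 + t4)" "fit (- (t1 + t2 + t4))"
    using cfit[of "2 * int d" "t1 + t2"] cfit[of "2 * int d + 1" "t1 + t2 + t4"] cfit[of "2 * int d + 1" "- (t1 + t2 + t4)"]
      cfit[OF _ _ b(1)] cfit[OF _ _ b(2)] cfit[of 1 t4] b(3) by (simp_all only: abs_minus_cancel mult_1)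
  have fs_len: "length gs = m" "length fs = m" using len length_icomb[OF len(11)] by (simp_all add: gs fs)
  have Wl: "\<forall>r\<in>set Ws. length r = length qs" "\<forall>r\<in>set Ws. length r = length ds" using len by auto
  have lw: "length us = length Ws" "length ls = length Ws" using dual len by auto
  have okg: "ok (2 ^ k) gs" "ok (2 ^ k) fs"
    using ok_lin[OF lw(1) Wl(1) dual(1) data(8) dual(4) data(3)] ok_lin[OF lw(2) Wl(2) dual(5) data(8) dual(8) data(2)]
    by (simp_all add: gs fs len)
  have oky: "ok (2 ^ k) ys" using ok_mono[OF xy(2)] b_le by simp
  have lB: "length Bs \<le> d" using data(6) len(5) by (simp add: ok_def)
  have 1: "der S (cE S) (Nnv, [IV xs])" using dNnv xy by blast
  have 2: "der S S (Neg, [I e])" using dNeg xy bfit' by blast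
  have 3: "der S (cMv S) (Mv, [IV (concat Ts), IV (concat Ws), IV hs, IV xs, IV ys, I e])"
    by (rule dMv) (use data len xy feas in simp_all)
  have 4: "der S (cMv S) (Mv, [IV (concat As), IV (concat Bs), IV as, IV xs, IV ys, I e])"
    by (rule dMv) (use data len xy feas in simp_all)
  have 5: "der S (cD S) (Dot, [IV cs, IV xs, I t1])" "der S (cD S) (Dot, [IV ds, IV ys, I t2])"
    unfolding t1_def t2_def by (rule dDot; use data len xy in simp)+
  have 6: "der S (cM S) (Mul, [I al, I e, I t4])" unfolding t4_def using data xy by (intro dMulb) auto
  have 7: "der S (cA S) (Add, [[False], I (t1 + t2 + t4), I (- (t1 + t2 + t4)), [True, True]])"
    using dAdd0[OF f(5,6)] fit_small by simp
  have 8: "der S S (Nn, [I (- (t1 + t2 + t4))])" using f feas(3) by (intro dNn) (auto simp: t1_def t2_def t4_def)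
  have 9: "der S (cL S) (Lin, [IV qs, IV (concat Ws), IV gs])" "der S (cL S) (Lin, [IV ds, IV (concat Ws), IV fs])"
    using dLin[OF lw(1) Wl(1) dual(1) data(8) dual(3,4) data(3)] dLin[OF lw(2) Wl(2) dual(5) data(8) dual(7,8) data(2)]
    by (simp_all add: gs fs len)
  have 10: "der S (cE S) (Chk, [IV gs, IV fs, IV ys])"
    by (rule dChk) (use okg oky fs_len xy chk in simp_all)
  have 11: "der S (cEs S) (Eqs, [IV (concat Ws), IV (concat Bs), IV gs])"
    by (rule dEqs[OF len(11) data(8) okg(1) fs_len(1) _ lB data(5) len(7) eqs]) (use chk in auto)
  show ?thesis
    by (rule derl_mono[OF d_Ver[OF _ derl_Cons[OF 1 derl_Cons[OF 2 derl_Cons[OF 3 derl_Cons[OF 4 derl_Cons[OF 5(1)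
      derl_Cons[OF 5(2) derl_Cons[OF dAdd0[OF f(1-3)] derl_Cons[OF 6 derl_Cons[OF dAdd0[OF f(3-5)] derl_Cons[OF 7 derl_Cons[OF 8
        derl_Cons[OF 9(1) derl_Cons[OF 9(2) derl_Cons[OF 10 11]]]]]]]]]]]]]]]])
      (use data xy okb_IV b_I f[THEN fit_length] okg[THEN ok_IV] in \<open>simp_all add: small_simps cVer_def\<close>)
qed

end

section \<open>Clearing denominators and size estimates\<close>

lemma enc_vec_append: "enc_vec (vs @ us) = enc_vec vs @ enc_vec us"
  by (simp add: enc_vec_def)

lemma enc_mat_concat: "enc_mat M = enc_vec (concat M)"
  by (induction M) (simp_all add: enc_vec_append)

lemma enc_rat_I: "quotient_of v = (p, q) \<Longrightarrow> enc_rat v = (p < 0) # I \<bar>p\<bar> @ I q"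
  using quotient_of_denom_pos[of v p q] by (simp add: enc_rat_def enc_int_def enc_nat_I)

lemma length_enc_vec: "length vs \<le> length (enc_vec vs)"
  by (induction vs) (auto simp: enc_rat_def enc_int_def split: prod.splits)

lemma enc_rat_bound: "\<bar>fst (quotient_of v)\<bar> \<le> 2 ^ length (enc_rat v)" "snd (quotient_of v) \<le> 2 ^ length (enc_rat v)"
proof -
  obtain p q where pq: "quotient_of v = (p, q)" by fastforce
  have "bl \<bar>p\<bar> \<le> length (enc_rat v)" "bl q \<le> length (enc_rat v)" by (simp_all add: enc_rat_I[OF pq] length_I)
  then have "(2::int) ^ bl \<bar>p\<bar> \<le> 2 ^ length (enc_rat v)" "(2::int) ^ bl q \<le> 2 ^ length (enc_rat v)"
    by (simp_all add: power_increasing)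
  then show "\<bar>fst (quotient_of v)\<bar> \<le> 2 ^ length (enc_rat v)" "snd (quotient_of v) \<le> 2 ^ length (enc_rat v)"
    using bl_less[of "\<bar>p\<bar>"] bl_less[of q] unfolding pq fst_conv snd_conv by linarith+
qed

text \<open>The plain product is taken as common denominator: the number of its digits is at most
  the sum of those of the factors, hence at most the encoding length.\<close>

definition denom :: "rat list \<Rightarrow> int" where
  "denom vs = prod_list (map (\<lambda>v. snd (quotient_of v)) vs)"

lemma denom_pos: "0 < denom vs"
  by (induction vs) (auto simp: denom_def quotient_of_denom_pos')

lemma denom_le: "denom vs \<le> 2 ^ length (enc_vec vs)"
proof (induction vs)
  case (Cons v vs)
  have "snd (quotient_of v) * denom vs \<le> 2 ^ length (enc_rat v) * 2 ^ length (enc_vec vs)"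
    using Cons enc_rat_bound(2)[of v] denom_pos[of vs] by (intro mult_mono) auto
  then show ?case by (simp add: denom_def power_add)
qed (simp add: denom_def)

lemma denom_dvd: "v \<in> set vs \<Longrightarrow> snd (quotient_of v) dvd denom vs"
  by (induction vs) (auto simp: denom_def)

lemma length_enc_mem: "v \<in> set vs \<Longrightarrow> length (enc_rat v) \<le> length (enc_vec vs)"
  by (induction vs) auto

text \<open>With v = p / q and the common denominator q * t, the scaled entry is p * t. Both factors
  are at most 2 ^ s in absolute value, which gives the exponent 2 * s.\<close>

lemma scl_denom:
  assumes "v \<in> set vs" "length (enc_vec vs) \<le> s"
  shows "of_int (scl (denom vs) v) = of_int (denom vs) * v" "\<bar>scl (denom vs) v\<bar> \<le> 2 ^ (2 * s)"
    "\<bar>fst (quotient_of v)\<bar> \<le> 2 ^ s" "snd (quotient_of v) \<le> 2 ^ s"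
proof -
  obtain p q where pq: "quotient_of v = (p, q)" by fastforce
  have q0: "0 < q" and v: "v = of_int p / of_int q" using quotient_of_denom_pos[OF pq] quotient_of_div[OF pq] by auto
  obtain t where t: "denom vs = q * t" using denom_dvd[OF assms(1)] pq by auto
  have "of_int (denom vs) * v = of_int (p * t)" using q0 by (simp add: t v)
  then have s: "scl (denom vs) v = p * t" by (simp only: scl_def floor_of_int)
  then show "of_int (scl (denom vs) v) = of_int (denom vs) * v" using \<open>of_int (denom vs) * v = of_int (p * t)\<close> by simp
  have "length (enc_rat v) \<le> s" using length_enc_mem[OF assms(1)] assms(2) by simp
  then have "(2::int) ^ length (enc_rat v) \<le> 2 ^ s" by (simp add: power_increasing)
  then show le: "\<bar>fst (quotient_of v)\<bar> \<le> 2 ^ s" "snd (quotient_of v) \<le> 2 ^ s"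
    using enc_rat_bound[of v] by linarith+
  have t0: "0 < t" using denom_pos[of vs] q0 unfolding t by (simp add: zero_less_mult_iff)
  have "1 * t \<le> q * t" using t0 q0 by (intro mult_right_mono) auto
  moreover have "(2::int) ^ length (enc_vec vs) \<le> 2 ^ s" using assms(2) by (simp add: power_increasing)
  ultimately have "t \<le> 2 ^ s" using denom_le[of vs] t by linarith
  then have "\<bar>p\<bar> * \<bar>t\<bar> \<le> 2 ^ s * 2 ^ s" using le(1) t0 by (intro mult_mono) (auto simp: pq)
  then show "\<bar>scl (denom vs) v\<bar> \<le> 2 ^ (2 * s)" by (simp add: s abs_mult mult_2 power_add)
qed

definition entries :: "blp_inst \<Rightarrow> rat list" where
  "entries J = vec_c J @ vec_d J @ vec_q J @ concat (mat_A J) @ concat (mat_B J) @ vec_a J @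
     concat (mat_T J) @ concat (mat_W J) @ vec_h J @ [val_alpha J]"

lemma entries_length: "length (enc_vec (entries J)) \<le> length (enc_blp J)"
  by (simp add: entries_def enc_blp_def enc_vec_append enc_mat_concat)

context bnd
begin

lemma d_fit: "n \<le> d \<Longrightarrow> fit (int n)"
proof -
  assume n: "n \<le> d"
  have "1 * 1 * (2 * int d + 2) \<le> (b + 1) * (b + 1) * (2 * int d + 2)" using b0 by (intro mult_right_mono mult_mono) auto
  from order_trans[OF this bk] show ?thesis using of_nat_mono[OF n, where 'a = int] of_nat_0_le_iff[of d, where 'a = int] unfolding fit_def abs_of_nat mult_1 by linarith
qed

lemma dMain:
  assumes wf: "blp_wf J" and len: "length (enc_blp J) \<le> d" and good: "\<forall>v\<in>set (entries J). good l v" and l: "0 < l" "l \<le> b"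
    and ver: "der S (cVer S) (Ver, [IV (map (scl l) (vec_c J)), IV (map (scl l) (vec_d J)), IV (map (scl l) (vec_q J)),
      IV (map (scl l) (concat (mat_A J))), IV (map (scl l) (concat (mat_B J))), IV (map (scl l) (vec_a J)),
      IV (map (scl l) (concat (mat_T J))), IV (map (scl l) (concat (mat_W J))), IV (map (scl l) (vec_h J)), I (scl l (val_alpha J))])"
  shows "der S (cMain S) (Main, [enc_blp J])"
proof -
  let ?n = "dim_n J" and ?m = "dim_m J" and ?k = "dim_k J" and ?r = "dim_r J"
  have lv: "length (vec_c J) = ?n" "length (vec_d J) = ?m" "length (vec_q J) = ?m" "length (vec_a J) = ?k" "length (vec_h J) = ?r"
    "length (mat_A J) = ?k" "length (mat_B J) = ?k" "length (mat_T J) = ?r" "length (mat_W J) = ?r"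
    and lr: "\<forall>row\<in>set (mat_A J). length row = ?n" "\<forall>row\<in>set (mat_B J). length row = ?m"
      "\<forall>row\<in>set (mat_T J). length row = ?n" "\<forall>row\<in>set (mat_W J). length row = ?m"
    using wf by (auto simp: blp_wf_def)
  have el: "length (enc_vec (vec_c J)) \<le> d" "length (enc_vec (vec_d J)) \<le> d" "length (enc_vec (vec_q J)) \<le> d"
    "length (enc_mat (mat_A J)) \<le> d" "length (enc_mat (mat_B J)) \<le> d" "length (enc_vec (vec_a J)) \<le> d"
    "length (enc_mat (mat_T J)) \<le> d" "length (enc_mat (mat_W J)) \<le> d" "length (enc_vec (vec_h J)) \<le> d"
    "length (enc_rat (val_alpha J)) \<le> d"
    using len by (simp_all add: enc_blp_def)
  note elS = el[THEN order_trans[OF _ order_trans[OF le_add1 dS]]]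
  note vl = order_trans[OF length_enc_vec el(1)] order_trans[OF length_enc_vec el(2)] order_trans[OF length_enc_vec el(3)]
    order_trans[OF length_enc_vec el(4)[unfolded enc_mat_concat]] order_trans[OF length_enc_vec el(5)[unfolded enc_mat_concat]]
    order_trans[OF length_enc_vec el(6)]
    order_trans[OF length_enc_vec el(7)[unfolded enc_mat_concat]] order_trans[OF length_enc_vec el(8)[unfolded enc_mat_concat]]
    order_trans[OF length_enc_vec el(9)]
  \<comment> \<open>Each dimension is the length of a vector of the instance and every entry takes
    at least one bit; so the dimensions are small enough to be written in unary.\<close>
  have dim: "?n \<le> d" "?m \<le> d" "?k \<le> d" "?r \<le> d" using vl(1,2,6,9) unfolding lv by auto
  have dimS: "?n \<le> S" "?m \<le> S" "?k \<le> S" "?r \<le> S" using dim dS by auto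
  have g: "\<forall>v\<in>set (vec_c J). good l v" "\<forall>v\<in>set (vec_d J). good l v" "\<forall>v\<in>set (vec_q J). good l v"
    "\<forall>v\<in>set (concat (mat_A J)). good l v" "\<forall>v\<in>set (concat (mat_B J)). good l v" "\<forall>v\<in>set (vec_a J). good l v"
    "\<forall>v\<in>set (concat (mat_T J)). good l v" "\<forall>v\<in>set (concat (mat_W J)). good l v" "\<forall>v\<in>set (vec_h J). good l v"
    "good l (val_alpha J)"
    using good unfolding entries_def set_append ball_Un by simp_all
  have al: "\<bar>l\<bar> \<le> b" using l by simp
  have nat: "der S S (Nat, [enc_nat i])" "der S S (Unary, [enc_nat i, replicate i True])" "length (enc_nat i) \<le> S" if "i \<le> d" for i
    using dNat[OF _ d_fit[OF that]] dUn[OF _ _ d_fit[OF that]] fit_length[OF d_fit[OF that]] that dS by (simp_all add: enc_nat_I)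
  have cvs: "der S (cv S) (Cv, [I l, replicate i True, enc_vec vs, IV (map (scl l) vs)])"
    if "\<forall>v\<in>set vs. good l v" "length vs = i" "length vs \<le> d" "length (enc_vec vs) \<le> S" for vs i
    using dCv[OF al that(1,3,4)] that(2) by simp
  have cms: "der S (cm S) (Cm, [I l, replicate i True, replicate j True, enc_mat M, IV (map (scl l) (concat M))])"
    if "\<forall>v\<in>set (concat M). good l v" "length M = i" "\<forall>row\<in>set M. length row = j" "length (concat M) \<le> d" "i \<le> d" "j \<le> d"
      "length (enc_mat M) \<le> S" for M i j
    using dCm[OF al that(3,1) _ that(6,4,7)] that(2,5) by simp
  have okl: "length (IV (map (scl l) vs)) \<le> S" if "\<forall>v\<in>set vs. good l v" "length vs \<le> d" for vs
    by (rule okb_IV) (use that in \<open>auto simp: ok_def good_def\<close>)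
  have f: "fit l" "fit (- l)" using al bfit' by auto
  have neg: "der S S (Neg, [I (- l)])" using f l by (intro dNeg) auto
  have ad: "der S (cA S) (Add, [[False], I l, I (- l), [True, True]])" using dAdd0[OF f] fit_small by simp
  show ?thesis unfolding enc_blp_def
    by (rule derl_mono[OF d_Main[OF _ derl_Cons[OF nat(1)[OF dim(1)] derl_Cons[OF nat(1)[OF dim(2)] derl_Cons[OF nat(1)[OF dim(3)]
      derl_Cons[OF nat(1)[OF dim(4)] derl_Cons[OF nat(2)[OF dim(1)] derl_Cons[OF nat(2)[OF dim(2)] derl_Cons[OF nat(2)[OF dim(3)]
      derl_Cons[OF nat(2)[OF dim(4)] derl_Cons[OF neg derl_Cons[OF ad
      derl_Cons[OF cvs[OF g(1) lv(1) vl(1) elS(1)] derl_Cons[OF cvs[OF g(2) lv(2) vl(2) elS(2)] derl_Cons[OF cvs[OF g(3) lv(3) vl(3) elS(3)]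
      derl_Cons[OF cms[OF g(4) lv(6) lr(1) vl(4) dim(3,1) elS(4)] derl_Cons[OF cms[OF g(5) lv(7) lr(2) vl(5) dim(3,2) elS(5)]
      derl_Cons[OF cvs[OF g(6) lv(4) vl(6) elS(6)]
      derl_Cons[OF cms[OF g(7) lv(8) lr(3) vl(7) dim(4,1) elS(7)] derl_Cons[OF cms[OF g(8) lv(9) lr(4) vl(8) dim(4,2) elS(8)]
      derl_Cons[OF cvs[OF g(9) lv(5) vl(9) elS(9)] derl_Cons[OF dCrat[OF g(10) al] ver]]]]]]]]]]]]]]]]]]]]]])
      (use nat(3) dim dimS elS okl[OF g(1) vl(1)] okl[OF g(2) vl(2)] okl[OF g(3) vl(3)] okl[OF g(4) vl(4)] okl[OF g(5) vl(5)]
        okl[OF g(6) vl(6)] okl[OF g(7) vl(7)] okl[OF g(8) vl(8)] okl[OF g(9) vl(9)] fit_length[OF f(1)] fit_length[OF f(2)]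
        fit_length[OF scl_fit[OF g(10)]]
       in \<open>simp_all add: small_simps cMain_def\<close>)
qed

text \<open>The denominators enter with a minus sign, because the rules add e times the right-hand
  side and compare the sum with 0.\<close>

lemma icert_dVer:
  assumes data: "ok b cs" "ok b ds" "ok b qs" "ok b (concat As)" "ok b (concat Bs)" "ok b as"
      "ok b (concat Ts)" "ok b (concat Ws)" "ok b hs" "\<bar>al\<bar> \<le> b"
    and len: "length cs = n" "length ds = m" "length qs = m" "length As = length as" "length Bs = length as"
      "\<forall>row\<in>set As. length row = n" "\<forall>row\<in>set Bs. length row = m"
      "length Ts = length hs" "length Ws = length hs" "\<forall>row\<in>set Ts. length row = n" "\<forall>row\<in>set Ws. length row = m"
    and ic: "icert n m (length as) (length hs) (\<lambda>j. cs ! j) (\<lambda>j. ds ! j) (\<lambda>j. qs ! j) (\<lambda>i j. As ! i ! j) (\<lambda>i j. Bs ! i ! j) (\<lambda>i. as ! i)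
       (\<lambda>i j. Ts ! i ! j) (\<lambda>i j. Ws ! i ! j) (\<lambda>i. hs ! i) al x y D u Du v Dv \<mu> D\<mu>"
    and bd: "\<forall>j<n. x j \<le> b" "\<forall>j<m. y j \<le> b" "D \<le> b" "\<forall>i<length hs. \<bar>u i\<bar> \<le> b \<and> \<bar>v i\<bar> \<le> b" "Du \<le> b" "Dv \<le> b"
      "\<forall>i'<length as. D\<mu> i' \<le> b \<and> (\<forall>i<length hs. \<bar>\<mu> i' i\<bar> \<le> b)"
  shows "der S (cVer S) (Ver, [IV cs, IV ds, IV qs, IV (concat As), IV (concat Bs), IV as, IV (concat Ts), IV (concat Ws), IV hs, I al])"
proof -
  let ?k = "length as" and ?r = "length hs"
  note ic' = ic[unfolded icert_def]
  have c: "\<forall>j<n. 0 \<le> x j" "\<forall>j<m. 0 \<le> y j" "0 < D" "0 < Du" "0 < Dv" "\<forall>i'<?k. 0 < D\<mu> i'"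
     "\<forall>i<?r. (\<Sum>j<n. x j * Ts ! i ! j) + (\<Sum>j<m. y j * Ws ! i ! j) = D * hs ! i"
     "\<forall>i<?k. (\<Sum>j<n. x j * As ! i ! j) + (\<Sum>j<m. y j * Bs ! i ! j) = D * as ! i"
     "(\<Sum>j<n. x j * cs ! j) + (\<Sum>j<m. y j * ds ! j) \<le> D * al"
     "\<forall>j<m. (\<Sum>i<?r. u i * Ws ! i ! j) \<le> Du * qs ! j"
     "\<forall>j<m. (\<Sum>i<?r. u i * Ws ! i ! j) < Du * qs ! j \<longrightarrow> y j = 0"
     "\<forall>j<m. (\<Sum>i<?r. u i * Ws ! i ! j) = Du * qs ! j \<longrightarrow> Dv * ds ! j \<le> (\<Sum>i<?r. v i * Ws ! i ! j) \<and> (y j = 0 \<or> (\<Sum>i<?r. v i * Ws ! i ! j) = Dv * ds ! j)"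
     "\<forall>i'<?k. \<forall>j<m. (\<Sum>i<?r. u i * Ws ! i ! j) = Du * qs ! j \<longrightarrow> (\<Sum>i<?r. \<mu> i' i * Ws ! i ! j) = D\<mu> i' * Bs ! i' ! j"
    using ic' by - (elim conjE, assumption)+
  define xs ys us ls where "xs = map x [0..<n]" and "ys = map y [0..<m]" and "us = map u [0..<?r]" and "ls = map v [0..<?r]"
  have dims: "n \<le> d" "m \<le> d" "?r \<le> d" using data len by (auto simp: ok_def)
  have ok: "ok b xs" "ok b ys" "ok b us" "ok b ls"
    using bd c(1,2) dims by (auto simp: ok_def xs_def ys_def us_def ls_def)
  have dx: "idot w xs = (\<Sum>j<n. x j * w ! j)" if "length w = n" for w
    using that by (subst idot_sum) (auto simp: xs_def)
  have dy: "idot w ys = (\<Sum>j<m. y j * w ! j)" if "length w = m" for w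
    using that by (subst idot_sum) (auto simp: ys_def)
  have comb: "axpy e bs (icomb m (map f [0..<?r]) Ws) ! j = (\<Sum>i<?r. f i * Ws ! i ! j) + e * bs ! j"
    if "j < m" "length bs = m" for e bs f j
  proof -
    have "icomb m (map f [0..<?r]) Ws ! j = (\<Sum>i<?r. f i * Ws ! i ! j)"
      using that len by (subst icomb_nth) auto
    then show ?thesis using that length_icomb[OF len(11)] by (subst axpy_nth) auto
  qed
  show ?thesis
  proof (rule dVer[OF data len ok(1,2) _ _ _ _ _ _ _ _ ok(3) _ _ _ ok(4) _ _ _ refl refl])
    show "length xs = n" "length ys = m" "length us = ?r" "length ls = ?r" by (simp_all add: xs_def ys_def us_def ls_def)
    show "\<forall>x\<in>set xs. 0 \<le> x" using c(1) by (auto simp: xs_def)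
    show "- D < 0" "\<bar>- D\<bar> \<le> b" "- Du < 0" "\<bar>- Du\<bar> \<le> b" "- Dv < 0" "\<bar>- Dv\<bar> \<le> b" using c bd by auto
    show "\<forall>i<?r. idot (Ts ! i) xs + idot (Ws ! i) ys + hs ! i * - D = 0"
      using c(7) len by (simp add: dx dy mult.commute)
    show "\<forall>i<?k. idot (As ! i) xs + idot (Bs ! i) ys + as ! i * - D = 0"
      using c(8) len by (simp add: dx dy mult.commute)
    show "idot cs xs + idot ds ys + al * - D \<le> 0"
      using c(9) len by (simp add: dx dy mult.commute)
    show "\<forall>j<m. 0 \<le> ys ! j \<and> axpy (- Du) qs (icomb m us Ws) ! j \<le> 0 \<and>
      (axpy (- Du) qs (icomb m us Ws) ! j < 0 \<longrightarrow> ys ! j = 0) \<and>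
      (axpy (- Du) qs (icomb m us Ws) ! j = 0 \<longrightarrow>
        0 \<le> axpy (- Dv) ds (icomb m ls Ws) ! j \<and> (ys ! j = 0 \<or> axpy (- Dv) ds (icomb m ls Ws) ! j = 0))"
      using c(2,10,11,12) len by (auto simp: us_def ls_def ys_def comb)
    show "\<forall>bs\<in>set Bs. \<exists>e us'. e < 0 \<and> \<bar>e\<bar> \<le> b \<and> ok b us' \<and> length us' = length Ws \<and>
      (\<forall>j<m. axpy (- Du) qs (icomb m us Ws) ! j = 0 \<longrightarrow> axpy e bs (icomb m us' Ws) ! j = 0)"
    proof
      fix bs assume "bs \<in> set Bs"
      then obtain i where i: "i < ?k" "bs = Bs ! i" "length bs = m" using len(5,7) by (metis in_set_conv_nth)
      show "\<exists>e us'. e < 0 \<and> \<bar>e\<bar> \<le> b \<and> ok b us' \<and> length us' = length Ws \<and>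
        (\<forall>j<m. axpy (- Du) qs (icomb m us Ws) ! j = 0 \<longrightarrow> axpy e bs (icomb m us' Ws) ! j = 0)"
      proof (intro exI conjI)
        show "- D\<mu> i < 0" "\<bar>- D\<mu> i\<bar> \<le> b" using c(6) bd(7) i by auto
        show "ok b (map (\<mu> i) [0..<?r])" using bd(7) i dims by (auto simp: ok_def)
        show "length (map (\<mu> i) [0..<?r]) = length Ws" using len by simp
        show "\<forall>j<m. axpy (- Du) qs (icomb m us Ws) ! j = 0 \<longrightarrow> axpy (- D\<mu> i) bs (icomb m (map (\<mu> i) [0..<?r]) Ws) ! j = 0"
          using c(13) i len by (simp add: us_def comb)
      qed
    qed
  qed
qed

end

text \<open>For instances of encoding length s, 2 ^ value_exp s bounds the scaled data and the certificate,
  2 ^ product_exp s the sums of products formed from them.\<close>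
definition value_exp :: "nat \<Rightarrow> nat" where "value_exp s = (3 * s + 3) * (3 * s + 1)"
definition product_exp :: "nat \<Rightarrow> nat" where "product_exp s = 2 * value_exp s + s + 3"
definition word_bound :: "nat \<Rightarrow> nat" where "word_bound s = (2 * product_exp s + 4) * (s + 1)"

text \<open>The exponent \<open>product_exp\<close> comes from 2 ^ v + 1 <= 2 ^ (v + 1), used twice,
  and from 2 * s + 2 <= 2 ^ (s + 1), which add up to 2 * v + s + 3.\<close>

lemma bnd: "bnd (word_bound s) (product_exp s) s (2 ^ value_exp s)"
proof unfold_locales
  show "2 * product_exp s + 4 \<le> word_bound s" by (simp add: word_bound_def)
  show "(2 * product_exp s + 4) * (s + 1) \<le> word_bound s" by (simp add: word_bound_def)
  show "(0::int) \<le> 2 ^ value_exp s" by simp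
  have 1: "(2::int) ^ value_exp s + 1 \<le> 2 ^ (value_exp s + 1)" by simp
  have "s + 1 \<le> 2 ^ s" by (rule Suc_leI[OF less_exp, unfolded Suc_eq_plus1])
  then have "2 * s + 2 \<le> 2 ^ (s + 1)" by simp
  then have 2: "2 * int s + 2 \<le> 2 ^ (s + 1)" using zle_int[of "2 * s + 2" "2 ^ (s + 1)"] by simp
  have "((2::int) ^ value_exp s + 1) * (2 ^ value_exp s + 1) * (2 * int s + 2) \<le> 2 ^ (value_exp s + 1) * 2 ^ (value_exp s + 1) * 2 ^ (s + 1)"
    using 1 2 by (intro mult_mono) auto
  also have "\<dots> = 2 ^ product_exp s" unfolding product_exp_def power_add[symmetric] by (rule arg_cong[of _ _ "(^) 2"]) simp
  finally show "((2::int) ^ value_exp s + 1) * (2 ^ value_exp s + 1) * (2 * int s + 2) \<le> 2 ^ product_exp s" .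
qed

text \<open>The source of \<open>value_exp\<close>. The systems solved have at most n + m + r + 1 <=
  3 * s + 1 unknowns and scaled entries up to 2 ^ (2 * s), so the base of \<open>bound\<close> is at
  most 2 ^ (3 * s + 3).\<close>

lemma bound_le: "N \<le> 3 * s + 1 \<Longrightarrow> bound N (2 ^ (2 * s)) \<le> 2 ^ value_exp s"
proof -
  assume N: "N \<le> 3 * s + 1"
  have s: "s + 1 \<le> 2 ^ s" by (rule Suc_leI[OF less_exp, unfolded Suc_eq_plus1])
  have e: "(2::nat) ^ (3 * s + 3) = 8 * (2 ^ s * 2 ^ (2 * s))" by (simp add: power_add mult_2 numeral_3_eq_3)
  have "2 * (3 * s + 1 + 1) * 2 ^ (2 * s) + 1 \<le> 2 * (3 * 2 ^ s) * 2 ^ (2 * s) + 1 * (1::nat)"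
    using s by (intro add_mono mult_le_mono) auto
  also have "\<dots> \<le> 6 * (2 ^ s * 2 ^ (2 * s)) + 2 ^ s * 2 ^ (2 * s)" by simp
  also have "\<dots> \<le> 2 ^ (3 * s + 3)" unfolding e by simp
  finally have "bound (3 * s + 1) (2 ^ (2 * s)) \<le> (2 ^ (3 * s + 3)) ^ (3 * s + 1)"
    unfolding bound_def by (intro power_mono) auto
  also have "\<dots> = 2 ^ value_exp s" by (simp only: value_exp_def power_mult)
  finally show ?thesis using bound_mono[OF N] le_trans by blast
qed

text \<open>The whole instance is scaled by the product of all its denominators. Its real
  certificate is replaced by a short integral one, and the numbers of the latter dictate the
  derivation of \<open>Main\<close>.\<close>

lemma blp_complete:
  assumes "w \<in> BLP_pess"
  shows "der (word_bound (length w)) (cMain (word_bound (length w))) (Main, [w])"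
proof -
  obtain J where J: "w = enc_blp J" "blp_wf J" "blp_yes J" using assms by (auto simp: BLP_pess_def)
  define s where "s = length w"
  interpret bnd "word_bound s" "product_exp s" s "2 ^ value_exp s" by (rule bnd)
  let ?n = "dim_n J" and ?m = "dim_m J" and ?k = "dim_k J" and ?r = "dim_r J"
  define l where "l = denom (entries J)"
  have es: "length (enc_vec (entries J)) \<le> s" using entries_length by (simp add: s_def J(1))
  have l0: "0 < l" by (simp add: l_def denom_pos)
  have "(2::int) ^ s \<le> 2 ^ (2 * s)" "(2::int) ^ (2 * s) \<le> 2 ^ value_exp s" "(2::int) ^ length (enc_vec (entries J)) \<le> 2 ^ s"
    using es by (auto intro!: power_increasing simp: value_exp_def)
  then have lb: "l \<le> 2 ^ value_exp s" and le: "\<And>z. z \<le> 2 ^ s \<Longrightarrow> z \<le> (2::int) ^ value_exp s" "\<And>z. z \<le> 2 ^ (2 * s) \<Longrightarrow> z \<le> (2::int) ^ value_exp s"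
    using denom_le[of "entries J"] unfolding l_def by linarith+
  have sc: "of_int (scl l v) = of_int l * v" "\<bar>scl l v\<bar> \<le> 2 ^ (2 * s)" "good l v" if "v \<in> set (entries J)" for v
    using scl_denom[OF that es] le by (auto simp: l_def good_def)
  have real: "real_of_int l * real_of_rat v = real_of_int (scl l v)" if "v \<in> set (entries J)" for v
  proof -
    have "real_of_rat (of_int (scl l v)) = real_of_rat (of_int l * v)" using sc(1)[OF that] by simp
    then show ?thesis by (simp add: of_rat_mult)
  qed
  have lv: "length (vec_c J) = ?n" "length (vec_d J) = ?m" "length (vec_q J) = ?m" "length (vec_a J) = ?k" "length (vec_h J) = ?r"
    "length (mat_A J) = ?k" "length (mat_B J) = ?k" "length (mat_T J) = ?r" "length (mat_W J) = ?r"
    and lr: "\<forall>row\<in>set (mat_A J). length row = ?n" "\<forall>row\<in>set (mat_B J). length row = ?m"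
      "\<forall>row\<in>set (mat_T J). length row = ?n" "\<forall>row\<in>set (mat_W J). length row = ?m"
    using J(2) by (auto simp: blp_wf_def)
  define cs ds qs As Bs as Ts Ws hs al where lists: "cs = map (scl l) (vec_c J)" "ds = map (scl l) (vec_d J)" "qs = map (scl l) (vec_q J)"
    "As = map (map (scl l)) (mat_A J)" "Bs = map (map (scl l)) (mat_B J)" "as = map (scl l) (vec_a J)"
    "Ts = map (map (scl l)) (mat_T J)" "Ws = map (map (scl l)) (mat_W J)" "hs = map (scl l) (vec_h J)" "al = scl l (val_alpha J)"
  have ent: "j < ?n \<Longrightarrow> vec_c J ! j \<in> set (entries J)" "j < ?m \<Longrightarrow> vec_d J ! j \<in> set (entries J)"
    "j < ?m \<Longrightarrow> vec_q J ! j \<in> set (entries J)" "j < ?k \<Longrightarrow> vec_a J ! j \<in> set (entries J)" "j < ?r \<Longrightarrow> vec_h J ! j \<in> set (entries J)"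
    "val_alpha J \<in> set (entries J)" for j
    using lv nth_mem[of j "vec_c J"] nth_mem[of j "vec_d J"] nth_mem[of j "vec_q J"] nth_mem[of j "vec_a J"] nth_mem[of j "vec_h J"]
    by (auto simp: entries_def)
  have mem: "M ! i ! j \<in> set (concat M)" if "i < length M" "\<forall>row\<in>set M. length row = p" "j < p" for M :: "rat list list" and i j p
    using that nth_mem[of i M] nth_mem[of j "M ! i"] by (auto intro!: bexI[of _ "M ! i"])
  have entm: "i < ?k \<Longrightarrow> j < ?n \<Longrightarrow> mat_A J ! i ! j \<in> set (entries J)" "i < ?k \<Longrightarrow> j < ?m \<Longrightarrow> mat_B J ! i ! j \<in> set (entries J)"
    "i < ?r \<Longrightarrow> j < ?n \<Longrightarrow> mat_T J ! i ! j \<in> set (entries J)" "i < ?r \<Longrightarrow> j < ?m \<Longrightarrow> mat_W J ! i ! j \<in> set (entries J)" for i j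
    using mem[OF _ lr(1), of i j] mem[OF _ lr(2), of i j] mem[OF _ lr(3), of i j] mem[OF _ lr(4), of i j]
    unfolding entries_def set_append lv Un_iff by simp_all
  have nth: "j < ?n \<Longrightarrow> cs ! j = scl l (vec_c J ! j)" "j < ?m \<Longrightarrow> ds ! j = scl l (vec_d J ! j)" "j < ?m \<Longrightarrow> qs ! j = scl l (vec_q J ! j)"
    "j < ?k \<Longrightarrow> as ! j = scl l (vec_a J ! j)" "j < ?r \<Longrightarrow> hs ! j = scl l (vec_h J ! j)"
    "i < ?k \<Longrightarrow> j < ?n \<Longrightarrow> As ! i ! j = scl l (mat_A J ! i ! j)" "i < ?k \<Longrightarrow> j < ?m \<Longrightarrow> Bs ! i ! j = scl l (mat_B J ! i ! j)"
    "i < ?r \<Longrightarrow> j < ?n \<Longrightarrow> Ts ! i ! j = scl l (mat_T J ! i ! j)" "i < ?r \<Longrightarrow> j < ?m \<Longrightarrow> Ws ! i ! j = scl l (mat_W J ! i ! j)" for i j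
    using lv lr by (simp_all add: lists)
  have "rcert ?n ?m ?k ?r (\<lambda>j. of_int (cs ! j)) (\<lambda>j. of_int (ds ! j)) (\<lambda>j. of_int (qs ! j)) (\<lambda>i j. of_int (As ! i ! j)) (\<lambda>i j. of_int (Bs ! i ! j))
    (\<lambda>j. of_int (as ! j)) (\<lambda>i j. of_int (Ts ! i ! j)) (\<lambda>i j. of_int (Ws ! i ! j)) (\<lambda>i. of_int (hs ! i)) (of_int al)"
    by (rule rcert_cong[OF rcert_scale[of "of_int l", OF _ blp_yes_rcert[OF J(2), THEN iffD1, OF J(3)]]])
      (use l0 in \<open>simp_all add: real ent entm nth lists(10)\<close>)
  note rc = this
  define Hb where "Hb = int (bound (?n + ?m + ?r + 1) (2 ^ (2 * s)))"
  have ex: "\<exists>x y D u Du v Dv \<mu> D\<mu>. icert ?n ?m ?k ?r (\<lambda>j. cs ! j) (\<lambda>j. ds ! j) (\<lambda>j. qs ! j) (\<lambda>i j. As ! i ! j) (\<lambda>i j. Bs ! i ! j) (\<lambda>i. as ! i)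
       (\<lambda>i j. Ts ! i ! j) (\<lambda>i j. Ws ! i ! j) (\<lambda>i. hs ! i) al x y D u Du v Dv \<mu> D\<mu> \<and>
     (\<forall>j<?n. x j \<le> Hb) \<and> (\<forall>j<?m. y j \<le> Hb) \<and>
     D \<le> Hb \<and>
     (\<forall>i<?r. \<bar>u i\<bar> \<le> Hb \<and> \<bar>v i\<bar> \<le> Hb) \<and>
     Du \<le> Hb \<and> Dv \<le> Hb \<and>
     (\<forall>i'<?k. D\<mu> i' \<le> Hb \<and> (\<forall>i<?r. \<bar>\<mu> i' i\<bar> \<le> Hb))"
    unfolding Hb_def by (rule rcert_icert[OF rc]) (simp_all add: nth ent entm sc(2) lists(10))
  have cnt: "length (entries J) \<le> s" using length_enc_vec[of "entries J"] es by simp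
  have dim: "?n \<le> s" "?m \<le> s" "?r \<le> s" using cnt lv by (simp_all add: entries_def)
  have "int (bound (?n + ?m + ?r + 1) (2 ^ (2 * s))) \<le> int (2 ^ value_exp s)" using dim by (intro of_nat_mono bound_le) simp
  then have H: "Hb \<le> 2 ^ value_exp s" by (simp add: Hb_def)
  have oke: "ok (2 ^ value_exp s) (map (scl l) vs)" if "set vs \<subseteq> set (entries J)" "length vs \<le> s" for vs
    using that sc(2) le(2) by (fastforce simp: ok_def)
  have okd: "ok (2 ^ value_exp s) cs" "ok (2 ^ value_exp s) ds" "ok (2 ^ value_exp s) qs" "ok (2 ^ value_exp s) (concat As)" "ok (2 ^ value_exp s) (concat Bs)"
    "ok (2 ^ value_exp s) as" "ok (2 ^ value_exp s) (concat Ts)" "ok (2 ^ value_exp s) (concat Ws)" "ok (2 ^ value_exp s) hs"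
    using cnt unfolding lists map_concat[symmetric] by (auto intro!: oke simp: entries_def)
  have alb: "\<bar>al\<bar> \<le> 2 ^ value_exp s" using sc(2)[OF ent(6)] le(2) by (simp add: lists)
  have len: "length cs = ?n" "length ds = ?m" "length qs = ?m" "length As = length as" "length Bs = length as"
      "\<forall>row\<in>set As. length row = ?n" "\<forall>row\<in>set Bs. length row = ?m"
      "length Ts = length hs" "length Ws = length hs" "\<forall>row\<in>set Ts. length row = ?n" "\<forall>row\<in>set Ws. length row = ?m"
    using lv lr by (auto simp: lists)
  have kr: "?k = length as" "?r = length hs" using lv by (simp_all add: lists)
  have ver: "der (word_bound s) (cVer (word_bound s)) (Ver, [IV cs, IV ds, IV qs, IV (concat As), IV (concat Bs), IV as, IV (concat Ts), IV (concat Ws), IV hs, I al])"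
    using ex
  proof (elim exE conjE, goal_cases)
    case (1 x y D u Du v Dv \<mu> D\<mu>)
    note le = order_trans[OF _ H]
    show ?case
      by (rule icert_dVer[OF okd alb len 1(1)[unfolded kr]])
        (use 1(2-)[unfolded kr] in \<open>auto intro: le\<close>)
  qed
  have "der (word_bound s) (cMain (word_bound s)) (Main, [enc_blp J])"
    by (rule dMain[OF J(2) _ _ l0 lb ver[unfolded lists map_concat[symmetric]]]) (use sc(3) in \<open>simp_all add: s_def J(1)\<close>)
  then show ?thesis by (simp add: s_def J(1))
qed

theorem theorem2:
  shows "in_NP BLP_pess"
proof (rule rewriting_in_NP[where P = "map flat_rule prog" and V = 30 and pw = "pword Main 1" and N = "\<lambda>s. cMain (word_bound s)" and S = word_bound])
  show "\<forall>p\<in>set hs \<union> set bs. pat_ok 30 p" if hb: "(hs, bs) \<in> set (map flat_rule prog)" for hs bs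
  proof -
    obtain r where "(hs, bs) = flat_rule r" "r \<in> set prog" using hb unfolding set_map by (rule imageE)
    then show ?thesis using flat_rule_ok[OF prog_ok] by metis
  qed
  have g: "concat (map gflat [(Main, [w])]) = [pword Main 1, w]" for w by (simp add: gflat_def)
  show "w \<in> BLP_pess" if "rws (map flat_rule prog) S n [pword Main 1, w]" for w S n
    using rws_sound[of prog S n "[(Main, [w])]", unfolded g, OF that prog_valid] sMain_sound by simp
  show "\<exists>n\<le>cMain (word_bound (length w)). rws (map flat_rule prog) (word_bound (length w)) n [pword Main 1, w]" if w: "w \<in> BLP_pess" for w
  proof -
    obtain n where "n \<le> cMain (word_bound (length w))" "ders prog (word_bound (length w)) n [(Main, [w])]"
      using blp_complete[OF w] unfolding derl_def by blast
    then show ?thesis using ders_rws[of prog "word_bound (length w)" n "[(Main, [w])]"] unfolding g by blast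
  qed
  show word_bound: "poly_bounded word_bound" unfolding word_bound_def product_exp_def value_exp_def by (intro poly_bounded_mult poly_bounded_add poly_bounded_id poly_bounded_const)
  show "poly_bounded (\<lambda>s. cMain (word_bound s))"
    unfolding cMain_def cVer_def cm_def cv_def cR_def cP_def cEs_def cE_def cMv_def cL_def cC_def cX_def cD_def cM_def cA_def
    by (intro poly_bounded_mult poly_bounded_add word_bound poly_bounded_const)
qed

end
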